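(* Let $\Omega$ be a domain in $\mathbf{R}^n$ and let $n<q<p<\infty$, $\beta=(q-n)/(q-1)$ and $\alpha=(p-n)/(p-1)$. (i) A function $f:(\partial\Omega)_\alpha\to\mathbf{R}$ belongs to $\operatorname{tr}_{(\partial\Omega)_\alpha}(L^1_p(\Omega))$ if and only if $f$ is continuous on $(\partial\Omega)_\alpha$ with respect to $d_{\alpha,\overline\Omega}$ and $f^\sharp_{\infty,\beta,\Omega}\in L_p(\Omega)$. Moreover, $$\|f\|_{\operatorname{tr}(L^1_p(\Omega))}\sim\|f^\sharp_{\infty,\beta,\Omega}\|_{L_p(\Omega)}$$ with constants of equivalence depending only on $n,p$ and $q$. (ii) Fix $\varepsilon>0$, $\theta>1$ and a covering $\mathcal Q$ of $\Omega$ consisting of non-overlapping cubes $Q\subset\Omega$ satisfying $\frac1\theta\operatorname{diam}Q\le\operatorname{dist}(Q,\partial\Omega)\le\theta\operatorname{diam}Q$. A function $f:(\partial\Omega)_\alpha\to\mathbf{R}$ is an element of $\operatorname{tr}_{(\partial\Omega)_\alpha}(W^1_p(\Omega))$ if and only if $f$ is continuous on $(\partial\Omega)_\alpha$ with respect to $d_{\alpha,\overline\Omega}$, and $f\circ T_{\mathcal Q}$ and $f^\sharp_{\infty,\beta,\Omega}$ are both in $L_p(\mathcal{O}_\varepsilon(\partial\Omega))$. Furthermore, $$\|f\|_{\operatorname{tr}(W^1_p(\Omega))}\sim\|f\circ T_{\mathcal Q}\|_{L_p(\mathcal{O}_\varepsilon(\partial\Omega))}+\|f^\sharp_{\infty,\beta,\Omega}\|_{L_p(\mathcal{O}_\varepsilon(\partial\Omega))}$$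 with constants of equivalence depending only on $n,p,q,\varepsilon$ and $\theta$.
   Context: Conventions. $\mathbf{R}^n$ carries the uniform norm $\|x\|=\max_i|x_i|$; distances, diameters, nearest points and arc length are taken with respect to it. A cube is a closed cube $Q=Q(x_Q,r_Q)=\{y:\|y-x_Q\|\le r_Q\}$, $r_Q>0$. Cubes are non-overlapping if their interiors are disjoint. $\Omega\subset\mathbf{R}^n$ is a domain (nonempty open connected set) with $\Omega\ne\mathbf{R}^n$. $X\sim Y$ means $X/C\le Y\le CX$ for a constant $C\ge1$. $\mathcal{O}_\varepsilon(\partial\Omega)=\{x\in\Omega:\operatorname{dist}(x,\partial\Omega)<\varepsilon\}$. Metrics. For $\alpha\in(0,1]$ (and likewise for $\beta$) and $x,y\in\Omega$, $d_{\alpha,\Omega}(x,y)=\inf_\gamma\int_\gamma\operatorname{dist}(z,\partial\Omega)^{\alpha-1}ds(z)$, the infimum being over rectifiable curves $\gamma\subset\Omega$ joining $x$ to $y$; $\rho_{\alpha,\Omega}(x,y)=d_{\alpha,\Omega}(x,y)+\|x-y\|^\alpha$. Completion. $\Omega^{*,\alpha}$ is the Cauchy completion of $(\Omega,\rho_{\alpha,\Omega})$, i.e. the set of equivalence classes $\omega=[(x_i)]_\alpha$ of $\rho_{\alpha,\Omega}$-Cauchy sequences in $\Omega$, where $(x_i)\stackrel{\alpha}{\sim}(y_i)$ iff $\rho_{\alpha,\Omega}(x_i,y_i)\to0$; $\Omega$ is viewed as a subset via constant sequences. $\rho_{\alpha,\overline\Omega}$ is the completion metric, and $d_{\alpha,\overline\Omega}(\omega_1,\omega_2)=\lim_i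 d_{\alpha,\Omega}(x_i,y_i)$ for $(x_i)\in\omega_1$, $(y_i)\in\omega_2$. The $\alpha$-boundary is $(\partial\Omega)_\alpha=\Omega^{*,\alpha}\setminus\Omega$. The same definitions apply with $\beta$ in place of $\alpha$. Sharp maximal function. Since $\beta<\alpha$, every $\rho_{\beta,\Omega}$-Cauchy sequence is $\rho_{\alpha,\Omega}$-Cauchy and $\beta$-equivalent sequences are $\alpha$-equivalent; for $\omega\in\Omega^{*,\beta}$ let $\omega^{[\alpha]}=[(x_i)]_\alpha\in\Omega^{*,\alpha}$ for any $(x_i)\in\omega$ (if $\omega\in(\partial\Omega)_\beta$ then $\omega^{[\alpha]}\in(\partial\Omega)_\alpha$). On $\Omega^{*,\beta}$ put $\delta_{\beta,\overline\Omega}(\omega_1,\omega_2)=d_{\beta,\overline\Omega}(\omega_1,\omega_2)^{1/\beta}$, and for $x\in\Omega$, $r>0$ let $B(x,r:\delta_{\beta,\overline\Omega})=\{\omega\in\Omega^{*,\beta}:\delta_{\beta,\overline\Omega}(x,\omega)\le r\}$. For $f:(\partial\Omega)_\alpha\to\mathbf{R}$ and $x\in\Omega$, $$f^\sharp_{\infty,\beta,\Omega}(x)=\sup\left\{\frac{|f(\omega_1^{[\alpha]})-f(\omega_2^{[\alpha]})|}{r}:\ r>0,\ \omega_1,\omega_2\in B(x,r:\delta_{\beta,\overline\Omega})\cap(\partial\Omega)_\beta\right\}.$$ The map $T_{\mathcal Q}$. For each cube $Q\subset\Omega$, $a_Q$ denotes a (fixed) point of $\partial\Omega$ nearest to $Q$.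 The sequence $x_i=a_Q+\frac1i(x_Q-a_Q)$, $i=1,2,\dots$, is $\rho_{\alpha,\Omega}$-Cauchy in $\Omega$, and $\omega_{Q,\alpha}=[(x_i)]_\alpha\in(\partial\Omega)_\alpha$ denotes its class. $T_{\mathcal Q}:\Omega\to(\partial\Omega)_\alpha$ is defined a.e. by $T_{\mathcal Q}|_Q=\omega_{Q,\alpha}$, $Q\in\mathcal Q$. Sobolev spaces and traces. $L^1_p(\Omega)$ is the homogeneous Sobolev space with seminorm $\|F\|_{L^1_p(\Omega)}=\|\nabla F\|_{L_p(\Omega)}$; $W^1_p(\Omega)$ is normed by $\|F\|_{L_p(\Omega)}+\|\nabla F\|_{L_p(\Omega)}$. For $p>n$ each element is identified with its continuous representative; with $\alpha=(p-n)/(p-1)$ this representative is uniformly continuous with respect to $\rho_{\alpha,\Omega}$, so it extends uniquely to a continuous function on $\Omega^{*,\alpha}$, and its trace $\operatorname{tr}_{(\partial\Omega)_\alpha}F$ is the restriction of this extension to $(\partial\Omega)_\alpha$; i.e. $\operatorname{tr}_{(\partial\Omega)_\alpha}F(\omega)=\lim_iF(y_i)$ for any $(y_i)\in\omega$. For $X=L^1_p(\Omega)$ or $W^1_p(\Omega)$, $\operatorname{tr}_{(\partial\Omega)_\alpha}(X)$ is the space of all traces of continuous $F\in X$, with $\|f\|_{\operatorname{tr}(X)}=\inf\{\|F\|_X:F\in X\text{ continuous},\ \operatorname{tr}_{(\partial\Omega)_\alpha}F=f\}$. *)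

theory Defs
  imports "HOL-Analysis.Analysis"
begin

section \<open>The uniform norm\<close>

text \<open>
  The space \<^typ>\<open>real^'n\<close> carries its Euclidean norm in the library.  Distances, diameters, nearest
  points, arc length and the size of gradients are taken here with respect to the uniform norm,
  which is the library's \<^const>\<open>infnorm\<close>.  On \<^typ>\<open>real\<close>, \<^const>\<open>infnorm\<close> is the absolute value.
\<close>

definition udist_set :: "(real^'n) set \<Rightarrow> (real^'n) set \<Rightarrow> real" where
  "udist_set A B = Inf {infnorm (a - b) |a b. a \<in> A \<and> b \<in> B}"

abbreviation udist :: "real^'n \<Rightarrow> (real^'n) set \<Rightarrow> real" where
  "udist x A \<equiv> udist_set {x} A"

definition udiam :: "(real^'n) set \<Rightarrow> real" where
  "udiam A = Sup {infnorm (a - b) |a b. a \<in> A \<and> b \<in> A}"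

definition bdry_nbhd :: "real \<Rightarrow> (real^'n) set \<Rightarrow> (real^'n) set" where
  "bdry_nbhd \<epsilon> \<Omega> = {x \<in> \<Omega>. udist x (frontier \<Omega>) < \<epsilon>}"


section \<open>Arc length and the intrinsic metrics\<close>

text \<open>
  Length of \<open>\<gamma>\<close> restricted to \<open>[a,b]\<close>: supremum over all \<open>t\<^sub>0 \<le> t\<^sub>1 \<le> \<dots> \<le> t\<^sub>k\<close> in \<open>[a,b]\<close>.
  For \<open>b < a\<close> the index set is empty and the length is 0.
\<close>
definition curve_length :: "(real \<Rightarrow> real^'n) \<Rightarrow> real \<Rightarrow> real \<Rightarrow> ennreal" where
  "curve_length \<gamma> a b =
     (SUP (t, k) \<in> {(t :: nat \<Rightarrow> real, k :: nat). mono t \<and> range t \<subseteq> {a..b}}.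
        ennreal (\<Sum>i<k. infnorm (\<gamma> (t (Suc i)) - \<gamma> (t i))))"

definition rectifiable :: "(real \<Rightarrow> real^'n) \<Rightarrow> bool" where
  "rectifiable \<gamma> \<longleftrightarrow> path \<gamma> \<and> curve_length \<gamma> 0 1 < \<infinity>"

text \<open>
  The integral of \<open>g\<close> along \<open>\<gamma>\<close> against arc length is the Stieltjes integral of \<open>g \<circ> \<gamma>\<close> against
  \<open>s(t)\<close>, the length of \<open>\<gamma>\<close> on \<open>[0,t]\<close>, extended to a monotone function on the line by
  \<open>s(t) = 0\<close> for \<open>t < 0\<close> and \<open>s(t) = s(1)\<close> for \<open>t > 1\<close>.
\<close>
definition arc_length_measure :: "(real \<Rightarrow> real^'n) \<Rightarrow> real measure" where
  "arc_length_measure \<gamma> = interval_measure (\<lambda>t. enn2real (curve_length \<gamma> 0 (min t 1)))"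

definition curve_integral :: "(real \<Rightarrow> real^'n) \<Rightarrow> (real^'n \<Rightarrow> real) \<Rightarrow> real" where
  "curve_integral \<gamma> g = (LINT t:{0..1}|arc_length_measure \<gamma>. g (\<gamma> t))"

definition d_met :: "real \<Rightarrow> (real^'n) set \<Rightarrow> real^'n \<Rightarrow> real^'n \<Rightarrow> real" where
  "d_met \<alpha> \<Omega> x y =
     Inf {curve_integral \<gamma> (\<lambda>z. udist z (frontier \<Omega>) powr (\<alpha> - 1)) |\<gamma>.
            rectifiable \<gamma> \<and> path_image \<gamma> \<subseteq> \<Omega> \<and> pathstart \<gamma> = x \<and> pathfinish \<gamma> = y}"

definition rho_met :: "real \<Rightarrow> (real^'n) set \<Rightarrow> real^'n \<Rightarrow> real^'n \<Rightarrow> real" where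
  "rho_met \<alpha> \<Omega> x y = d_met \<alpha> \<Omega> x y + infnorm (x - y) powr \<alpha>"


section \<open>The Cauchy completion and the boundary\<close>

text \<open>Points of the completion are equivalence classes, i.e. sets of sequences in \<open>\<Omega>\<close>.\<close>
type_synonym 'n cpoint = "(nat \<Rightarrow> real^'n) set"

text \<open>
  The library's notion \<^const>\<open>Metric_space.MCauchy\<close> is written out here: its locale asks for symmetry
  and nonnegativity at all points of the type, and \<^const>\<open>rho_met\<close> is meaningful on \<open>\<Omega>\<close> only.
\<close>
definition rho_Cauchy :: "real \<Rightarrow> (real^'n) set \<Rightarrow> (nat \<Rightarrow> real^'n) \<Rightarrow> bool" where
  "rho_Cauchy \<alpha> \<Omega> x \<longleftrightarrow>
     range x \<subseteq> \<Omega> \<and> (\<forall>e>0. \<exists>N. \<forall>i\<ge>N. \<forall>j\<ge>N. rho_met \<alpha> \<Omega> (x i) (x j) < e)"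

definition cauchy_equiv :: "real \<Rightarrow> (real^'n) set \<Rightarrow> ((nat \<Rightarrow> real^'n) \<times> (nat \<Rightarrow> real^'n)) set" where
  "cauchy_equiv \<alpha> \<Omega> =
     {(x, y). rho_Cauchy \<alpha> \<Omega> x \<and> rho_Cauchy \<alpha> \<Omega> y \<and> (\<lambda>i. rho_met \<alpha> \<Omega> (x i) (y i)) \<longlonglongrightarrow> 0}"

definition cclass :: "real \<Rightarrow> (real^'n) set \<Rightarrow> (nat \<Rightarrow> real^'n) \<Rightarrow> 'n cpoint" where
  "cclass \<alpha> \<Omega> x = cauchy_equiv \<alpha> \<Omega> `` {x}"

definition completed :: "real \<Rightarrow> (real^'n) set \<Rightarrow> 'n cpoint set" where
  "completed \<alpha> \<Omega> = {x. rho_Cauchy \<alpha> \<Omega> x} // cauchy_equiv \<alpha> \<Omega>"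

definition embed :: "real \<Rightarrow> (real^'n) set \<Rightarrow> real^'n \<Rightarrow> 'n cpoint" where
  "embed \<alpha> \<Omega> x = cclass \<alpha> \<Omega> (\<lambda>_. x)"

definition alpha_bdry :: "real \<Rightarrow> (real^'n) set \<Rightarrow> 'n cpoint set" where
  "alpha_bdry \<alpha> \<Omega> = completed \<alpha> \<Omega> - embed \<alpha> \<Omega> ` \<Omega>"

definition d_bar :: "real \<Rightarrow> (real^'n) set \<Rightarrow> 'n cpoint \<Rightarrow> 'n cpoint \<Rightarrow> real" where
  "d_bar \<alpha> \<Omega> \<omega>\<^sub>1 \<omega>\<^sub>2 =
     (THE l. \<forall>x\<in>\<omega>\<^sub>1. \<forall>y\<in>\<omega>\<^sub>2. (\<lambda>i. d_met \<alpha> \<Omega> (x i) (y i)) \<longlonglongrightarrow> l)"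

definition d_continuous :: "real \<Rightarrow> (real^'n) set \<Rightarrow> ('n cpoint \<Rightarrow> real) \<Rightarrow> bool" where
  "d_continuous \<alpha> \<Omega> f \<longleftrightarrow>
     (\<forall>\<omega>\<in>alpha_bdry \<alpha> \<Omega>. \<forall>e>0. \<exists>\<delta>>0. \<forall>\<omega>'\<in>alpha_bdry \<alpha> \<Omega>.
        d_bar \<alpha> \<Omega> \<omega> \<omega>' < \<delta> \<longrightarrow> \<bar>f \<omega>' - f \<omega>\<bar> < e)"


section \<open>The sharp maximal function\<close>

definition change_exponent :: "real \<Rightarrow> (real^'n) set \<Rightarrow> 'n cpoint \<Rightarrow> 'n cpoint" where
  "change_exponent \<alpha> \<Omega> \<omega> = cclass \<alpha> \<Omega> (SOME x. x \<in> \<omega>)"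

definition delta_bar :: "real \<Rightarrow> (real^'n) set \<Rightarrow> 'n cpoint \<Rightarrow> 'n cpoint \<Rightarrow> real" where
  "delta_bar \<beta> \<Omega> \<omega>\<^sub>1 \<omega>\<^sub>2 = d_bar \<beta> \<Omega> \<omega>\<^sub>1 \<omega>\<^sub>2 powr (1 / \<beta>)"

definition delta_ball :: "real \<Rightarrow> (real^'n) set \<Rightarrow> real^'n \<Rightarrow> real \<Rightarrow> 'n cpoint set" where
  "delta_ball \<beta> \<Omega> x r = {\<omega> \<in> completed \<beta> \<Omega>. delta_bar \<beta> \<Omega> (embed \<beta> \<Omega> x) \<omega> \<le> r}"

definition fsharp :: "real \<Rightarrow> real \<Rightarrow> (real^'n) set \<Rightarrow> ('n cpoint \<Rightarrow> real) \<Rightarrow> real^'n \<Rightarrow> ennreal" where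
  "fsharp \<alpha> \<beta> \<Omega> f x =
     Sup {ennreal (\<bar>f (change_exponent \<alpha> \<Omega> \<omega>\<^sub>1) - f (change_exponent \<alpha> \<Omega> \<omega>\<^sub>2)\<bar> / r) |r \<omega>\<^sub>1 \<omega>\<^sub>2.
            r > 0 \<and> \<omega>\<^sub>1 \<in> delta_ball \<beta> \<Omega> x r \<inter> alpha_bdry \<beta> \<Omega>
                  \<and> \<omega>\<^sub>2 \<in> delta_ball \<beta> \<Omega> x r \<inter> alpha_bdry \<beta> \<Omega>}"


section \<open>Cubes and the map \<open>T\<close>\<close>

text \<open>A cube is represented by its centre and radius, which it determines when the radius is positive.\<close>
type_synonym 'n cube = "(real^'n) \<times> real"

definition cube_set :: "'n cube \<Rightarrow> (real^'n) set" where
  "cube_set Q = {y. infnorm (y - fst Q) \<le> snd Q}"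

definition is_cube_in :: "(real^'n) set \<Rightarrow> 'n cube \<Rightarrow> bool" where
  "is_cube_in \<Omega> Q \<longleftrightarrow> snd Q > 0 \<and> cube_set Q \<subseteq> \<Omega>"

definition whitney_covering :: "real \<Rightarrow> (real^'n) set \<Rightarrow> 'n cube set \<Rightarrow> bool" where
  "whitney_covering \<theta> \<Omega> \<Q> \<longleftrightarrow>
     (\<forall>Q\<in>\<Q>. is_cube_in \<Omega> Q) \<and> (\<Union>Q\<in>\<Q>. cube_set Q) = \<Omega> \<and>
     (\<forall>Q\<in>\<Q>. \<forall>Q'\<in>\<Q>. Q \<noteq> Q' \<longrightarrow> interior (cube_set Q) \<inter> interior (cube_set Q') = {}) \<and>
     (\<forall>Q\<in>\<Q>. udiam (cube_set Q) / \<theta> \<le> udist_set (cube_set Q) (frontier \<Omega>) \<and>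
             udist_set (cube_set Q) (frontier \<Omega>) \<le> \<theta> * udiam (cube_set Q))"

definition nearest_choice :: "(real^'n) set \<Rightarrow> ('n cube \<Rightarrow> real^'n) \<Rightarrow> bool" where
  "nearest_choice \<Omega> a \<longleftrightarrow>
     (\<forall>Q. is_cube_in \<Omega> Q \<longrightarrow>
        a Q \<in> frontier \<Omega> \<and> udist (a Q) (cube_set Q) = udist_set (cube_set Q) (frontier \<Omega>))"

definition omega_cube :: "real \<Rightarrow> (real^'n) set \<Rightarrow> ('n cube \<Rightarrow> real^'n) \<Rightarrow> 'n cube \<Rightarrow> 'n cpoint" where
  "omega_cube \<alpha> \<Omega> a Q = cclass \<alpha> \<Omega> (\<lambda>i. a Q + (1 / real (Suc i)) *\<^sub>R (fst Q - a Q))"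

text \<open>
  A point lying on several cubes of the covering gets the value of one of them; such points form a
  null set, and all \<open>L\<^sub>p\<close> conditions below are with respect to the complete Lebesgue measure.
\<close>
definition T_map ::
    "real \<Rightarrow> (real^'n) set \<Rightarrow> ('n cube \<Rightarrow> real^'n) \<Rightarrow> 'n cube set \<Rightarrow> real^'n \<Rightarrow> 'n cpoint" where
  "T_map \<alpha> \<Omega> a \<Q> x = omega_cube \<alpha> \<Omega> a (SOME Q. Q \<in> \<Q> \<and> x \<in> cube_set Q)"


section \<open>Lebesgue and Sobolev spaces\<close>

definition ennreal_powr :: "ennreal \<Rightarrow> real \<Rightarrow> ennreal" where
  "ennreal_powr u p = (if u = \<infinity> then \<infinity> else ennreal (enn2real u powr p))"

text \<open>The \<open>L\<^sub>p(S)\<close> norm and space for functions with values in \<open>[0,\<infinity>]\<close>.\<close>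
definition enn_Lp_norm :: "real \<Rightarrow> (real^'n) set \<Rightarrow> (real^'n \<Rightarrow> ennreal) \<Rightarrow> ennreal" where
  "enn_Lp_norm p S h = ennreal_powr (\<integral>\<^sup>+x. ennreal_powr (h x) p \<partial>lebesgue_on S) (1 / p)"

definition enn_Lp :: "real \<Rightarrow> (real^'n) set \<Rightarrow> (real^'n \<Rightarrow> ennreal) set" where
  "enn_Lp p S = {h \<in> borel_measurable (lebesgue_on S). enn_Lp_norm p S h < \<infinity>}"

text \<open>The same for functions with values in \<open>\<real>\<close> or in \<open>\<real>\<^sup>n\<close>.\<close>
definition Lp_norm :: "real \<Rightarrow> (real^'n) set \<Rightarrow> (real^'n \<Rightarrow> 'b::euclidean_space) \<Rightarrow> ennreal" where
  "Lp_norm p S h = enn_Lp_norm p S (\<lambda>x. ennreal (infnorm (h x)))"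

definition Lp :: "real \<Rightarrow> (real^'n) set \<Rightarrow> (real^'n \<Rightarrow> 'b::euclidean_space) set" where
  "Lp p S = {h \<in> borel_measurable (lebesgue_on S). Lp_norm p S h < \<infinity>}"

definition partial_deriv :: "'n \<Rightarrow> (real^'n \<Rightarrow> real) \<Rightarrow> real^'n \<Rightarrow> real" where
  "partial_deriv i \<phi> x = frechet_derivative \<phi> (at x) (axis i 1)"

primrec k_smooth :: "nat \<Rightarrow> (real^'n \<Rightarrow> real) \<Rightarrow> bool" where
  "k_smooth 0 \<phi> \<longleftrightarrow> continuous_on UNIV \<phi>"
| "k_smooth (Suc k) \<phi> \<longleftrightarrow> (\<forall>x. \<phi> differentiable (at x)) \<and> (\<forall>i. k_smooth k (partial_deriv i \<phi>))"

definition test_function :: "(real^'n) set \<Rightarrow> (real^'n \<Rightarrow> real) \<Rightarrow> bool" where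
  "test_function \<Omega> \<phi> \<longleftrightarrow>
     (\<forall>k. k_smooth k \<phi>) \<and> (\<exists>K. compact K \<and> K \<subseteq> \<Omega> \<and> (\<forall>x. x \<notin> K \<longrightarrow> \<phi> x = 0))"

definition locally_integrable :: "(real^'n) set \<Rightarrow> (real^'n \<Rightarrow> 'b::euclidean_space) \<Rightarrow> bool" where
  "locally_integrable \<Omega> F \<longleftrightarrow> (\<forall>K. compact K \<and> K \<subseteq> \<Omega> \<longrightarrow> F absolutely_integrable_on K)"

definition weak_gradient :: "(real^'n) set \<Rightarrow> (real^'n \<Rightarrow> real) \<Rightarrow> (real^'n \<Rightarrow> real^'n) \<Rightarrow> bool" where
  "weak_gradient \<Omega> F G \<longleftrightarrow>
     locally_integrable \<Omega> F \<and> locally_integrable \<Omega> G \<and>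
     (\<forall>\<phi> i. test_function \<Omega> \<phi> \<longrightarrow>
        (LINT x:\<Omega>|lebesgue. F x * partial_deriv i \<phi> x) = - (LINT x:\<Omega>|lebesgue. G x $ i * \<phi> x))"

text \<open>A weak gradient is unique up to null sets; this picks a representative.\<close>
definition grad :: "(real^'n) set \<Rightarrow> (real^'n \<Rightarrow> real) \<Rightarrow> real^'n \<Rightarrow> real^'n" where
  "grad \<Omega> F = (SOME G. weak_gradient \<Omega> F G)"

definition L1p :: "real \<Rightarrow> (real^'n) set \<Rightarrow> (real^'n \<Rightarrow> real) set" where
  "L1p p \<Omega> = {F. (\<exists>G. weak_gradient \<Omega> F G) \<and> grad \<Omega> F \<in> Lp p \<Omega>}"

definition L1p_norm :: "real \<Rightarrow> (real^'n) set \<Rightarrow> (real^'n \<Rightarrow> real) \<Rightarrow> ennreal" where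
  "L1p_norm p \<Omega> F = Lp_norm p \<Omega> (grad \<Omega> F)"

definition W1p :: "real \<Rightarrow> (real^'n) set \<Rightarrow> (real^'n \<Rightarrow> real) set" where
  "W1p p \<Omega> = L1p p \<Omega> \<inter> Lp p \<Omega>"

definition W1p_norm :: "real \<Rightarrow> (real^'n) set \<Rightarrow> (real^'n \<Rightarrow> real) \<Rightarrow> ennreal" where
  "W1p_norm p \<Omega> F = Lp_norm p \<Omega> F + Lp_norm p \<Omega> (grad \<Omega> F)"


section \<open>Traces\<close>

text \<open>
  \<open>f\<close> is the trace of \<open>F\<close>.  Only the values of \<open>f\<close> on the boundary matter; functions on the
  boundary are represented by total functions throughout.
\<close>
definition is_trace :: "real \<Rightarrow> (real^'n) set \<Rightarrow> (real^'n \<Rightarrow> real) \<Rightarrow> ('n cpoint \<Rightarrow> real) \<Rightarrow> bool" where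
  "is_trace \<alpha> \<Omega> F f \<longleftrightarrow> (\<forall>\<omega>\<in>alpha_bdry \<alpha> \<Omega>. \<forall>y\<in>\<omega>. (\<lambda>i. F (y i)) \<longlonglongrightarrow> f \<omega>)"

definition trace_space ::
    "real \<Rightarrow> (real^'n) set \<Rightarrow> (real^'n \<Rightarrow> real) set \<Rightarrow> ('n cpoint \<Rightarrow> real) set" where
  "trace_space \<alpha> \<Omega> X = {f. \<exists>F\<in>X. continuous_on \<Omega> F \<and> is_trace \<alpha> \<Omega> F f}"

definition trace_norm ::
    "real \<Rightarrow> (real^'n) set \<Rightarrow> (real^'n \<Rightarrow> real) set \<Rightarrow> ((real^'n \<Rightarrow> real) \<Rightarrow> ennreal) \<Rightarrow>
     ('n cpoint \<Rightarrow> real) \<Rightarrow> ennreal" where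
  "trace_norm \<alpha> \<Omega> X N f = Inf {N F |F. F \<in> X \<and> continuous_on \<Omega> F \<and> is_trace \<alpha> \<Omega> F f}"

definition comparable :: "real \<Rightarrow> ennreal \<Rightarrow> ennreal \<Rightarrow> bool" where
  "comparable C X Y \<longleftrightarrow> X / ennreal C \<le> Y \<and> Y \<le> ennreal C * X"

end

theory Submission
 imports Defs
begin

text \<open>
 Write \<open>bd x\<close> for the distance of \<open>x\<close> to the boundary.  Both norm equivalences rest on two pointwise
 estimates which relate an extension \<open>F\<close> to its trace \<open>f\<close>.

 For the trace of a Sobolev function, fix \<open>x\<close> in the domain and a boundary point at intrinsic distance \<open>r\<close>
 (with exponent \<open>\<beta>\<close>).  Cubes of size \<open>bd z\<close> along an almost shortest curve form a chain from \<open>x\<close> to that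
 point (\<open>chain_exists\<close>).  Morrey's inequality with the exponent \<open>q > n\<close> bounds the increment of \<open>F\<close> on every cube
 (\<open>morrey_cube\<close>), and Hoelder's inequality adds the increments: \<open>\<beta> = (q - n)/(q - 1)\<close> is exactly the exponent for
 which the \<open>\<beta>\<close>-th powers of the sizes of the cubes are controlled by the weighted length of the curve (\<open>chain_estimate\<close>).  The outcome is
 \<open>\<bar>F x - f \<omega>\<bar> <= C r V x\<close>, where \<open>V\<close> is the \<open>q\<close>-th root of an iterated maximal function of \<open>\<bar>\<nabla>F\<bar>\<^sup>q\<close>
 (\<open>trace_approach\<close>).  Hence \<open>f\<^sup>\<sharp> <= C V\<close>, and since \<open>p/q > 1\<close> the maximal theorem (\<open>maxfun_strong_type\<close>) bounds the
 \<open>L\<^sub>p\<close> norm of \<open>V\<close> by that of \<open>\<nabla>F\<close> (\<open>necessity\<close>).  The same chains with \<open>p\<close> in place of \<open>q\<close> give the continuity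
 of the trace (\<open>trace_d_continuous\<close>).

 Conversely, let \<open>g x\<close> be the value of \<open>f\<close> at a boundary point whose intrinsic distance to \<open>x\<close> is comparable to
 \<open>bd x\<close>.  On a cube of size \<open>bd x / 2\<close> around \<open>x\<close> all these values belong to one intrinsic ball of radius comparable to
 \<open>bd x\<close>, so they differ by at most \<open>C bd x f\<^sup>\<sharp> x\<close>.  Averaging \<open>g\<close> at the scale of the distance to the boundary
 gives a locally Lipschitz function \<open>F\<close> with \<open>\<bar>\<nabla>F\<bar> <= C f\<^sup>\<sharp>\<close>; it has trace \<open>f\<close> because \<open>f\<close> is continuous and points
 that are near with exponent \<open>\<beta>\<close> are near with exponent \<open>\<alpha>\<close> (\<open>extension\<close>).  For the inhomogeneous space \<open>g\<close> is
 multiplied by a cutoff at distance comparable to \<open>\<epsilon>\<close>; the value \<open>f (T x)\<close> differs from \<open>g x\<close> by at most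
 \<open>C bd x f\<^sup>\<sharp> x\<close> and so controls the size of \<open>F\<close> and the contribution of the cutoff to the gradient.

 No constant depends on the domain, except through its dimension.
\<close>

section \<open>The uniform norm and the distance to the boundary\<close>

lemma infnorm_triangle_diff: "infnorm (a - c) <= infnorm (a - b) + infnorm (b - (c::'a::euclidean_space))"
 using infnorm_triangle[of "a - b" "b - c"] by simp

lemma infnorm_le_cart: "infnorm (x::real^'n) <= r \<longleftrightarrow> (\<forall>i. \<bar>x $ i\<bar> <= r)"
proof
 assume "infnorm x <= r" then show "\<forall>i. \<bar>x $ i\<bar> <= r"
  using component_le_infnorm_cart order_trans by blast
next
 assume r: "\<forall>i. \<bar>x $ i\<bar> <= r"
 show "infnorm x <= r" unfolding infnorm_cart by (rule cSup_least) (use r in auto)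
qed

lemma infnorm_ball_eq_cbox: "{z::real^'n. infnorm (z - c) <= r} = cbox (\<chi> i. c $ i - r) (\<chi> i. c $ i + r)"
proof -
 have "infnorm (z - c) <= r \<longleftrightarrow> z \<in> cbox (\<chi> i. c $ i - r) (\<chi> i. c $ i + r)" for z
  unfolding infnorm_le_cart mem_box_cart by (auto simp: abs_le_iff algebra_simps)
 then show ?thesis by blast
qed

lemma udist_bdd_below: "bdd_below {infnorm (a - b) |a b. a \<in> A \<and> b \<in> B}"
 by (rule bdd_belowI[of _ 0]) (auto simp: infnorm_pos_le)

lemma udist_le: "a \<in> A ==> udist x A <= infnorm (x - a)"
 unfolding udist_set_def by (rule cInf_lower[OF _ udist_bdd_below]) auto

lemma udist_greatest: "A \<noteq> {} ==> (\<And>a. a \<in> A ==> r <= infnorm (x - a)) ==> r <= udist x A"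
 unfolding udist_set_def by (rule cInf_greatest) auto

lemma udist_nonneg: "A \<noteq> {} ==> 0 <= udist x A"
 by (rule udist_greatest) (auto simp: infnorm_pos_le)

lemma udist_attained:
 assumes "closed A" "A \<noteq> {}"
 obtains a where "a \<in> A" "udist x A = infnorm (x - a)"
proof -
 obtain a0 where a0: "a0 \<in> A" using assms by auto
 define K where "K = A \<inter> {z. infnorm (z - x) <= infnorm (x - a0)}"
 have "compact K" unfolding K_def infnorm_ball_eq_cbox
  using assms(1) by (simp add: closed_Int_compact)
 moreover have "a0 \<in> K" using a0 by (simp add: K_def infnorm_sub)
 moreover have "continuous_on K (\<lambda>a. infnorm (x - a))" by (intro continuous_intros)
 ultimately obtain a where a: "a \<in> K" "\<And>b. b \<in> K ==> infnorm (x - a) <= infnorm (x - b)"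
  using continuous_attains_inf[of K "\<lambda>a. infnorm (x - a)"] by blast
 have "infnorm (x - a) <= infnorm (x - b)" if "b \<in> A" for b
 proof (cases "b \<in> K")
  case False
  then have "infnorm (x - a0) < infnorm (x - b)" using that by (auto simp: K_def infnorm_sub)
  then show ?thesis using a(2)[OF \<open>a0 \<in> K\<close>] by linarith
 qed (use a in auto)
 then have "udist x A = infnorm (x - a)"
  using udist_le[of a A x] a(1) udist_greatest[OF assms(2), of "infnorm (x - a)" x]
  by (simp add: K_def antisym)
 with a(1) that show ?thesis by (auto simp: K_def)
qed

lemma udist_lipschitz:
 assumes "A \<noteq> {}" shows "udist x A <= udist y A + infnorm (x - y)"
proof -
 have "udist x A - infnorm (x - y) <= udist y A"
 proof (rule udist_greatest[OF assms])
  fix a assume "a \<in> A"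
  then show "udist x A - infnorm (x - y) <= infnorm (y - a)"
   using udist_le[of a A x] infnorm_triangle_diff[of x a y] by linarith
 qed
 then show ?thesis by linarith
qed

lemma continuous_udist:
 assumes "A \<noteq> {}" shows "continuous_on S (\<lambda>x. udist x A)"
proof -
 have "dist (udist x A) (udist y A) <= dist x y" for x y
  using udist_lipschitz[OF assms, of x y] udist_lipschitz[OF assms, of y x]
   infnorm_le_norm[of "x - y"] infnorm_sub[of x y] by (auto simp: dist_norm abs_if)
 then have "1-lipschitz_on S (\<lambda>x. udist x A)" by (intro lipschitz_onI) auto
 then show ?thesis by (rule lipschitz_on_continuous_on)
qed

locale proper_domain =
 fixes \<Omega> :: "(real^'n::finite) set"
 assumes op: "open \<Omega>" and conn: "connected \<Omega>" and ne: "\<Omega> \<noteq> {}" and proper: "\<Omega> \<noteq> UNIV"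
begin

abbreviation bd :: "real^'n => real" where "bd x \<equiv> udist x (frontier \<Omega>)"
abbreviation dmet :: "real => real^'n => real^'n => real" where "dmet \<sigma> \<equiv> d_met \<sigma> \<Omega>"
abbreviation dbar :: "real => 'n cpoint => 'n cpoint => real" where "dbar \<sigma> \<equiv> d_bar \<sigma> \<Omega>"
abbreviation d_to :: "real => real^'n => 'n cpoint => real" where "d_to \<sigma> x \<equiv> d_bar \<sigma> \<Omega> (embed \<sigma> \<Omega> x)"
abbreviation bdry :: "real => 'n cpoint set" where "bdry \<sigma> \<equiv> alpha_bdry \<sigma> \<Omega>"

lemma frontier_ne: "frontier \<Omega> \<noteq> {}"
 using frontier_eq_empty ne proper by blast

lemmas bd_lipschitz = udist_lipschitz[OF frontier_ne]
lemmas continuous_bd = continuous_udist[OF frontier_ne]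
lemmas bd_nonneg = udist_nonneg[OF frontier_ne]

lemma bd_pos: assumes "x \<in> \<Omega>" shows "0 < bd x"
proof -
 obtain a where a: "a \<in> frontier \<Omega>" "bd x = infnorm (x - a)"
  using udist_attained[OF frontier_closed frontier_ne, of x] by blast
 then have "a \<notin> \<Omega>" using op by (simp add: frontier_def interior_open)
 then show ?thesis using a assms by (metis infnorm_pos_lt right_minus_eq)
qed

lemma ball_bd_subset:
 assumes "x \<in> \<Omega>" "infnorm (y - x) < bd x" shows "y \<in> \<Omega>"
proof (rule ccontr)
 assume "y \<notin> \<Omega>"
 then have "closed_segment x y \<inter> frontier \<Omega> \<noteq> {}"
  using connected_Int_frontier[of "closed_segment x y" \<Omega>] assms(1) by auto
 then obtain a u where a: "a \<in> frontier \<Omega>" "0 <= u" "u <= 1" "a = (1 - u) *\<^sub>R x + u *\<^sub>R y"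
  by (auto simp: closed_segment_def)
 have "x - a = u *\<^sub>R (x - y)" unfolding a(4) by (simp add: algebra_simps)
 then have "infnorm (x - a) = infnorm (u *\<^sub>R (x - y))" by simp
 also have "... <= infnorm (x - y)" using a(2,3) by (simp add: infnorm_mul infnorm_pos_le mult_left_le_one_le)
 finally show False using udist_le[OF a(1), of x] assms(2) by (simp add: infnorm_sub)
qed

lemma bd_half:
 assumes "x \<in> \<Omega>" "infnorm (y - x) <= c * bd x" "c < 1"
 shows "y \<in> \<Omega>" "(1 - c) * bd x <= bd y" "bd y <= (1 + c) * bd x"
proof -
 have "c * bd x < bd x" using bd_pos[OF assms(1)] assms(3) by simp
 then show "y \<in> \<Omega>" using ball_bd_subset[OF assms(1), of y] assms(2) by linarith
 show "(1 - c) * bd x <= bd y" using bd_lipschitz[of x y] assms(2) by (simp add: algebra_simps infnorm_sub)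
 show "bd y <= (1 + c) * bd x" using bd_lipschitz[of y x] assms(2) by (simp add: algebra_simps)
qed

end

section \<open>Arc length and integrals along curves\<close>

lemma curve_length_upper:
 "mono t ==> range t \<subseteq> {a..b} ==>
   ennreal (\<Sum>i<k. infnorm (\<gamma> (t (Suc i)) - \<gamma> (t i))) <= curve_length \<gamma> a b"
 unfolding curve_length_def by (rule SUP_upper2[where i="(t,k)"]) auto

lemma curve_length_least:
 "(\<And>t k. mono t ==> range t \<subseteq> {a..b} ==>
   ennreal (\<Sum>i<k. infnorm (\<gamma> (t (Suc i)) - \<gamma> (t i))) <= L) ==> curve_length \<gamma> a b <= L"
 unfolding curve_length_def by (rule SUP_least) auto

lemma curve_length_ge_chord:
 assumes "a <= u" "u <= v" "v <= b" shows "ennreal (infnorm (\<gamma> v - \<gamma> u)) <= curve_length \<gamma> a b"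
proof -
 have "mono (\<lambda>i::nat. if i = 0 then u else v)" using assms by (intro monoI) auto
 moreover have "range (\<lambda>i::nat. if i = 0 then u else v) \<subseteq> {a..b}" using assms by auto
 ultimately show ?thesis using curve_length_upper[of "\<lambda>i::nat. if i = 0 then u else v" a b \<gamma> 1] by simp
qed

lemma curve_length_add_le:
 assumes "a <= b" "b <= c"
 shows "curve_length \<gamma> a b + curve_length \<gamma> b c <= curve_length \<gamma> a c"
proof -
 have key: "ennreal (\<Sum>i<k. infnorm (\<gamma> (t (Suc i)) - \<gamma> (t i))) +
    ennreal (\<Sum>i<l. infnorm (\<gamma> (u (Suc i)) - \<gamma> (u i))) <= curve_length \<gamma> a c"
  if t: "mono t" "range t \<subseteq> {a..b}" and u: "mono u" "range u \<subseteq> {b..c}" for t u :: "nat => real" and k l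
 proof -
  define v where "v i = (if i <= k then t i else u (i - Suc k))" for i
  have tb: "t i \<in> {a..b}" "u i \<in> {b..c}" for i using t(2) u(2) by (auto simp: image_subset_iff)
  have v: "mono v"
  proof (rule monoI)
   fix i j :: nat assume "i <= j"
   then show "v i <= v j" using monoD[OF t(1), of i j] monoD[OF u(1), of "i - Suc k" "j - Suc k"]
     tb(1)[of i] tb(2)[of "j - Suc k"] by (auto simp: v_def)
  qed
  have rv: "range v \<subseteq> {a..c}"
  proof
   fix s assume "s \<in> range v"
   then obtain i where "s = v i" by auto
   then show "s \<in> {a..c}" using tb(1)[of i] tb(2)[of "i - Suc k"] assms by (auto simp: v_def)
  qed
  let ?D = "\<lambda>w i. infnorm (\<gamma> (w (Suc i)) - \<gamma> (w i))"
  have "(\<Sum>i<k. ?D t i) + (\<Sum>i<l. ?D u i) <= (\<Sum>i<k. ?D v i) + (\<Sum>i<l. ?D v (Suc k + i))"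
   by (intro add_mono sum_mono) (auto simp: v_def)
  also have "... <= (\<Sum>i<Suc k + l. ?D v i)"
  proof -
   have "(\<Sum>i<Suc k + l. ?D v i) = (\<Sum>i<Suc k. ?D v i) + (\<Sum>i<l. ?D v (Suc k + i))" for l
    by (induction l) auto
   then show ?thesis by (simp add: infnorm_pos_le)
  qed
  finally have "ennreal ((\<Sum>i<k. ?D t i) + (\<Sum>i<l. ?D u i)) <= curve_length \<gamma> a c"
   using curve_length_upper[OF v rv, where k="Suc k + l" and \<gamma>=\<gamma>] by (meson ennreal_leI order_trans)
  then show ?thesis by (subst (asm) ennreal_plus) (auto intro!: sum_nonneg simp: infnorm_pos_le)
 qed
 have const: "(\<lambda>_. a, 0) \<in> {(t :: nat => real, k :: nat). mono t \<and> range t \<subseteq> {a..b}}"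
  "(\<lambda>_. b, 0) \<in> {(t :: nat => real, k :: nat). mono t \<and> range t \<subseteq> {b..c}}"
  using assms by (auto simp: mono_def)
 have "curve_length \<gamma> a b + curve_length \<gamma> b c =
   (SUP x\<in>{(t :: nat => real, k :: nat). mono t \<and> range t \<subseteq> {b..c}}. curve_length \<gamma> a b +
    (case x of (t,k) => ennreal (\<Sum>i<k. infnorm (\<gamma> (t (Suc i)) - \<gamma> (t i)))))"
  unfolding curve_length_def[of \<gamma> b c] using const by (subst ennreal_SUP_add_right) auto
 also have "... <= curve_length \<gamma> a c"
 proof (rule SUP_least, clarify)
  fix t :: "nat => real" and k :: nat assume t: "mono t" "range t \<subseteq> {b..c}"
  have "curve_length \<gamma> a b + ennreal (\<Sum>i<k. infnorm (\<gamma> (t (Suc i)) - \<gamma> (t i))) =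
   (SUP x\<in>{(t :: nat => real, k :: nat). mono t \<and> range t \<subseteq> {a..b}}. 
    (case x of (t,k) => ennreal (\<Sum>i<k. infnorm (\<gamma> (t (Suc i)) - \<gamma> (t i)))) + 
     ennreal (\<Sum>i<k. infnorm (\<gamma> (t (Suc i)) - \<gamma> (t i))))"
   unfolding curve_length_def[of \<gamma> a b] using const by (subst ennreal_SUP_add_left) auto
  also have "... <= curve_length \<gamma> a c" by (rule SUP_least) (use key t in auto)
  finally show "curve_length \<gamma> a b + ennreal (\<Sum>i<k. infnorm (\<gamma> (t (Suc i)) - \<gamma> (t i))) <= curve_length \<gamma> a c" .
 qed
 finally show ?thesis .
qed

text \<open>Inserting the point \<open>b\<close> into a partition does not decrease its sum; truncating the
 partition by \<^const>\<open>min\<close> and \<^const>\<open>max\<close> at \<open>b\<close> does this without re-indexing.\<close>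
lemma curve_length_add:
 assumes "a <= b" "b <= c"
 shows "curve_length \<gamma> a c = curve_length \<gamma> a b + curve_length \<gamma> b c"
proof (rule antisym)
 show "curve_length \<gamma> a c <= curve_length \<gamma> a b + curve_length \<gamma> b c"
 proof (rule curve_length_least)
  fix t :: "nat => real" and k assume t: "mono t" "range t \<subseteq> {a..c}"
  let ?D = "\<lambda>w i. infnorm (\<gamma> (w (Suc i)) - \<gamma> (w i))"
  let ?u = "\<lambda>i. min (t i) b" and ?v = "\<lambda>i. max (t i) b"
  have "?D t i <= ?D ?u i + ?D ?v i" for i
   using monoD[OF t(1), of i "Suc i"] infnorm_triangle_diff[of "\<gamma> (t (Suc i))" "\<gamma> (t i)" "\<gamma> b"]
   by (auto simp: min_def max_def infnorm_0 infnorm_pos_le)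
  then have "ennreal (\<Sum>i<k. ?D t i) <= ennreal (\<Sum>i<k. ?D ?u i) + ennreal (\<Sum>i<k. ?D ?v i)"
   by (subst ennreal_plus[symmetric])
    (auto intro!: sum_nonneg ennreal_leI sum_mono simp: infnorm_pos_le sum.distrib[symmetric])
  also have "... <= curve_length \<gamma> a b + curve_length \<gamma> b c"
   by (intro add_mono curve_length_upper monoI min.mono max.mono order_refl monoD[OF t(1)])
    (use t(2) assms in \<open>auto simp: image_subset_iff\<close>)
  finally show "ennreal (\<Sum>i<k. ?D t i) <= curve_length \<gamma> a b + curve_length \<gamma> b c" .
 qed
qed (rule curve_length_add_le[OF assms])

lemma curve_length_refl [simp]: "curve_length \<gamma> a a = 0"
proof -
 have "curve_length \<gamma> a a <= 0"
 proof (rule curve_length_least)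
  fix t :: "nat => real" and k assume t: "range t \<subseteq> {a..a}"
  then have "t i = a" for i by auto
  then show "ennreal (\<Sum>i<k. infnorm (\<gamma> (t (Suc i)) - \<gamma> (t i))) <= 0" by (simp add: infnorm_0)
 qed
 then show ?thesis by simp
qed

lemma curve_length_negative: "b < a ==> curve_length \<gamma> a b = 0"
 unfolding curve_length_def by (auto simp: bot_ennreal)

lemma curve_length_affine_le:
 assumes "c > 0" and eq: "\<And>s. a <= s ==> s <= b ==> \<eta> s = \<gamma> (c * s + d)"
 shows "curve_length \<eta> a b <= curve_length \<gamma> (c * a + d) (c * b + d)"
proof (rule curve_length_least)
 fix t :: "nat => real" and k assume t: "mono t" "range t \<subseteq> {a..b}"
 have tb: "a <= t i" "t i <= b" for i using t(2) by (auto simp: image_subset_iff)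
 have "ennreal (\<Sum>i<k. infnorm (\<gamma> (c * t (Suc i) + d) - \<gamma> (c * t i + d))) <= curve_length \<gamma> (c * a + d) (c * b + d)"
  by (rule curve_length_upper[of "\<lambda>i. c * t i + d"])
   (use t assms tb in \<open>auto simp: mono_def mult_left_mono\<close>)
 then show "ennreal (\<Sum>i<k. infnorm (\<eta> (t (Suc i)) - \<eta> (t i))) <= curve_length \<gamma> (c * a + d) (c * b + d)"
  using tb by (simp add: eq)
qed

lemma curve_length_affine:
 assumes "c > 0" and eq: "\<And>s. a <= s ==> s <= b ==> \<eta> s = \<gamma> (c * s + d)"
 shows "curve_length \<eta> a b = curve_length \<gamma> (c * a + d) (c * b + d)"
proof (rule antisym)
 show "curve_length \<eta> a b <= curve_length \<gamma> (c * a + d) (c * b + d)"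
  by (rule curve_length_affine_le) (use assms in auto)
 have "curve_length \<gamma> (c * a + d) (c * b + d) <= curve_length \<eta> ((1/c) * (c * a + d) + (- d/c)) ((1/c) * (c * b + d) + (-d/c))"
 proof (rule curve_length_affine_le)
  fix s assume "c * a + d <= s" "s <= c * b + d"
  then have "a <= (s - d)/c" "(s - d)/c <= b" using \<open>c > 0\<close> by (auto simp: field_simps)
  then show "\<gamma> s = \<eta> (1 / c * s + - d / c)" using eq[of "(s - d)/c"] \<open>c > 0\<close> by (simp add: field_simps)
 qed (use \<open>c > 0\<close> in auto)
 then show "curve_length \<gamma> (c * a + d) (c * b + d) <= curve_length \<eta> a b"
  using \<open>c > 0\<close> by (simp add: field_simps)
qed

lemma curve_length_reverse_le: "curve_length (\<lambda>s. \<gamma> (1 - s)) a b <= curve_length \<gamma> (1 - b) (1 - a)"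
proof (rule curve_length_least)
 fix t :: "nat => real" and k assume t: "mono t" "range t \<subseteq> {a..b}"
 define u where "u i = 1 - t (k - i)" for i
 have "(\<Sum>i<k. infnorm (\<gamma> (1 - t (Suc i)) - \<gamma> (1 - t i))) = (\<Sum>i<k. infnorm (\<gamma> (u (Suc i)) - \<gamma> (u i)))"
  by (rule sum.reindex_bij_witness[where i="\<lambda>i. k - Suc i" and j="\<lambda>i. k - Suc i"])
   (auto simp: u_def Suc_diff_Suc infnorm_sub)
 also have "ennreal ... <= curve_length \<gamma> (1 - b) (1 - a)"
  by (rule curve_length_upper) (use t in \<open>auto simp: u_def mono_def image_subset_iff\<close>)
 finally show "ennreal (\<Sum>i<k. infnorm (\<gamma> (1 - t (Suc i)) - \<gamma> (1 - t i))) <= curve_length \<gamma> (1 - b) (1 - a)" .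
qed

lemma curve_length_reverse: "curve_length (\<lambda>s. \<gamma> (1 - s)) a b = curve_length \<gamma> (1 - b) (1 - a)"
 using curve_length_reverse_le[of \<gamma> a b] curve_length_reverse_le[of "\<lambda>s. \<gamma> (1 - s)" "1 - b" "1 - a"]
 by (simp add: antisym)

lemma curve_length_lipschitz:
 assumes "a <= b" "0 <= L" and L: "\<And>s t. a <= s ==> s <= t ==> t <= b ==> infnorm (\<gamma> t - \<gamma> s) <= L * (t - s)"
 shows "curve_length \<gamma> a b <= ennreal (L * (b - a))"
proof (rule curve_length_least)
 fix t :: "nat => real" and k assume t: "mono t" "range t \<subseteq> {a..b}"
 have tb: "a <= t i" "t i <= b" for i using t(2) by (auto simp: image_subset_iff)
 have "(\<Sum>i<k. infnorm (\<gamma> (t (Suc i)) - \<gamma> (t i))) <= (\<Sum>i<k. L * t (Suc i) - L * t i)"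
  by (intro sum_mono) (use L[OF tb(1) monoD[OF t(1)] tb(2), of _ "Suc _"] in \<open>auto simp: algebra_simps\<close>)
 also have "... = L * (t k - t 0)" by (induction k) (auto simp: algebra_simps)
 also have "... <= L * (b - a)" using tb[of k] tb[of 0] assms(2) by (intro mult_left_mono) auto
 finally show "ennreal (\<Sum>i<k. infnorm (\<gamma> (t (Suc i)) - \<gamma> (t i))) <= ennreal (L * (b - a))" by (rule ennreal_leI)
qed

text \<open>For a fixed partition the sum over its truncation at \<open>v\<close> is continuous in \<open>v\<close>, so the
 supremum is lower semicontinuous.\<close>
lemma curve_length_lower_semicontinuous:
 assumes \<gamma>: "continuous_on {0..1} \<gamma>" and u: "0 <= u" "u <= 1" and c: "ennreal c < curve_length \<gamma> 0 u" "0 <= c"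
 shows "\<exists>\<delta>>0. \<forall>v\<in>{0..1}. \<bar>v - u\<bar> < \<delta> \<longrightarrow> ennreal c < curve_length \<gamma> 0 v"
proof -
 obtain t k where t: "mono t" "range t \<subseteq> {0..u}"
  and tk: "ennreal c < ennreal (\<Sum>i<k. infnorm (\<gamma> (t (Suc i)) - \<gamma> (t i)))"
  using c unfolding curve_length_def less_SUP_iff by auto
 have tb: "0 <= t i" "t i <= u" for i using t(2) by (auto simp: image_subset_iff)
 define S where "S v = (\<Sum>i<k. infnorm (\<gamma> (min (t (Suc i)) v) - \<gamma> (min (t i) v)))" for v
 have "continuous_on {0..1} (\<lambda>v. min (t i) v)" for i
  by (intro continuous_intros)
 then have "continuous_on {0..1} (\<lambda>v. \<gamma> (min (t i) v))" for i
  by (rule continuous_on_compose2[OF \<gamma>]) (use tb u in auto)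
 then have cont: "continuous_on {0..1} S" unfolding S_def by (intro continuous_intros)
 have "c < S u" using tk tb c(2) by (simp add: S_def min_def ennreal_less_iff)
 then obtain \<delta> where \<delta>: "\<delta> > 0" "\<And>v. v \<in> {0..1} ==> dist v u < \<delta> ==> dist (S v) (S u) < S u - c"
  using cont[unfolded continuous_on_iff, rule_format, of u "S u - c"] u by auto
 have "ennreal c < curve_length \<gamma> 0 v" if "v \<in> {0..1}" "\<bar>v - u\<bar> < \<delta>" for v
 proof -
  have "c < S v" using \<delta>(2)[of v] that by (auto simp: dist_real_def)
  then have "ennreal c < ennreal (S v)" using c(2) by (simp add: ennreal_less_iff)
  also have "... <= curve_length \<gamma> 0 v" unfolding S_def
   by (intro curve_length_upper monoI min.mono order_refl monoD[OF t(1)])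
    (use tb that in \<open>auto simp: image_subset_iff min_le_iff_disj\<close>)
  finally show ?thesis .
 qed
 then show ?thesis using \<delta>(1) by blast
qed

definition arc_length :: "(real => real^'n) => real => real" where
 "arc_length \<gamma> t = enn2real (curve_length \<gamma> 0 (min t 1))"

lemma curve_length_le_total: "0 <= s ==> s <= t ==> t <= 1 ==> curve_length \<gamma> s t <= curve_length \<gamma> 0 1"
 using curve_length_add[of 0 s 1 \<gamma>] curve_length_add[of s t 1 \<gamma>]
 by (metis add_increasing add_increasing2 le_iff_add order_trans zero_le)

context
 fixes \<gamma> :: "real => real^'n" assumes rect: "rectifiable \<gamma>"
begin

lemma rectifiable_continuous: "continuous_on {0..1} \<gamma>" using rect by (simp add: rectifiable_def path_def)

lemma curve_length_finite: "0 <= s ==> s <= t ==> t <= 1 ==> curve_length \<gamma> s t < \<infinity>"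
 using curve_length_le_total[of s t \<gamma>] rect unfolding rectifiable_def by (meson order_le_less_trans)

lemma arc_length_diff:
 assumes "0 <= s" "s <= t" "t <= 1" shows "ennreal (arc_length \<gamma> t - arc_length \<gamma> s) = curve_length \<gamma> s t"
  and "arc_length \<gamma> s <= arc_length \<gamma> t"
proof -
 have eq: "curve_length \<gamma> 0 t = curve_length \<gamma> 0 s + curve_length \<gamma> s t" using assms by (intro curve_length_add)
 obtain x y where xy: "curve_length \<gamma> 0 s = ennreal x" "curve_length \<gamma> s t = ennreal y" "0 <= x" "0 <= y"
  using curve_length_finite[of 0 s] curve_length_finite[of s t] assms by (auto simp: less_top_ennreal)
 have "arc_length \<gamma> s = x" using assms xy by (simp add: arc_length_def)
 moreover have "arc_length \<gamma> t = x + y" using assms xy eq 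
  by (simp add: arc_length_def flip: ennreal_plus)
 ultimately show "ennreal (arc_length \<gamma> t - arc_length \<gamma> s) = curve_length \<gamma> s t" 
  "arc_length \<gamma> s <= arc_length \<gamma> t" using xy by auto
qed

lemma arc_length_chord:
 "0 <= s ==> s <= t ==> t <= 1 ==> infnorm (\<gamma> t - \<gamma> s) <= arc_length \<gamma> t - arc_length \<gamma> s"
 using curve_length_ge_chord[of s s t t \<gamma>] arc_length_diff[of s t]
 by (metis diff_ge_0_iff_ge ennreal_le_iff order_refl)

lemma arc_length_0: "t <= 0 ==> arc_length \<gamma> t = 0"
 by (cases "t = 0") (auto simp: arc_length_def curve_length_negative)

end

lemma rectifiable_reverse:
 assumes "rectifiable \<gamma>" shows "rectifiable (\<lambda>s. \<gamma> (1 - s))"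
proof -
 have "path (reversepath \<gamma>)" using assms by (simp add: rectifiable_def)
 then show ?thesis using assms by (simp add: rectifiable_def curve_length_reverse reversepath_def)
qed

lemma arc_length_lower_semicontinuous:
 assumes rect: "rectifiable \<gamma>" and u: "0 <= u" "u <= 1" and e: "e > 0"
 shows "\<exists>\<delta>>0. \<forall>v\<in>{0..1}. \<bar>v - u\<bar> < \<delta> \<longrightarrow> arc_length \<gamma> u - e < arc_length \<gamma> v"
proof (cases "arc_length \<gamma> u - e < 0")
 case True
 then have "arc_length \<gamma> u - e < arc_length \<gamma> v" for v
  using enn2real_nonneg[of "curve_length \<gamma> 0 (min v 1)"] unfolding arc_length_def by linarith
 then show ?thesis by (intro exI[of _ 1]) auto
next
 case False
 have *: "ennreal (arc_length \<gamma> v) = curve_length \<gamma> 0 v" if "v \<in> {0..1}" for v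
  using arc_length_diff(1)[OF rect, of 0 v] that arc_length_0[OF rect, of 0] by auto
 have "ennreal (arc_length \<gamma> u - e) < curve_length \<gamma> 0 u"
  using *[of u] u e False by (auto simp: ennreal_less_iff simp flip: *[of u])
 from curve_length_lower_semicontinuous[OF rectifiable_continuous[OF rect] u this] False
 obtain \<delta> where "\<delta> > 0" "\<forall>v\<in>{0..1}. \<bar>v - u\<bar> < \<delta> \<longrightarrow> ennreal (arc_length \<gamma> u - e) < curve_length \<gamma> 0 v" by auto
 then show ?thesis using False by (intro exI[of _ \<delta>]) (auto simp: ennreal_less_iff simp flip: *)
qed

text \<open>Upper semicontinuity is lower semicontinuity for the reversed curve, since the two lengths
 add up to a constant.\<close>
lemma arc_length_continuous_on:
 assumes rect: "rectifiable \<gamma>" shows "continuous_on {0..1} (arc_length \<gamma>)"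
proof -
 let ?\<eta> = "\<lambda>s. \<gamma> (1 - s)"
 have sum: "arc_length \<gamma> v + arc_length ?\<eta> (1 - v) = arc_length \<gamma> 1" if "v \<in> {0..1}" for v
 proof -
  have "ennreal (arc_length ?\<eta> (1 - v)) = ennreal (arc_length \<gamma> 1 - arc_length \<gamma> v)"
   using arc_length_diff(1)[OF rectifiable_reverse[OF rect], of 0 "1 - v"] arc_length_0[OF rectifiable_reverse[OF rect], of 0]
    arc_length_diff(1)[OF rect, of v 1] that by (simp add: curve_length_reverse)
  moreover have "arc_length \<gamma> v <= arc_length \<gamma> 1" using arc_length_diff(2)[OF rect, of v 1] that by auto
  ultimately show ?thesis by (simp add: arc_length_def)
 qed
 show ?thesis unfolding continuous_on_iff
 proof (intro ballI allI impI)
  fix u e :: real assume u: "u \<in> {0..1}" and e: "e > 0"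
  obtain \<delta>1 where d1: "\<delta>1 > 0" "\<And>v. v\<in>{0..1} ==> \<bar>v - u\<bar> < \<delta>1 ==> arc_length \<gamma> u - e < arc_length \<gamma> v"
   using arc_length_lower_semicontinuous[OF rect, of u e] u e by auto
  obtain \<delta>2 where d2: "\<delta>2 > 0" "\<And>v. v\<in>{0..1} ==> \<bar>v - (1 - u)\<bar> < \<delta>2 ==> arc_length ?\<eta> (1 - u) - e < arc_length ?\<eta> v"
   using arc_length_lower_semicontinuous[OF rectifiable_reverse[OF rect], of "1 - u" e] u e by auto
  have "\<bar>arc_length \<gamma> v - arc_length \<gamma> u\<bar> < e" if v: "v \<in> {0..1}" "\<bar>v - u\<bar> < min \<delta>1 \<delta>2" for v
  proof -
   have "\<bar>(1 - v) - (1 - u)\<bar> < \<delta>2" "1 - v \<in> {0..1}" "\<bar>v - u\<bar> < \<delta>1" using v by auto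
   then show ?thesis using d1(2)[OF v(1)] d2(2)[of "1 - v"] sum[OF v(1)] sum[OF u] by (simp add: abs_less_iff)
  qed
  then show "\<exists>d>0. \<forall>x'\<in>{0..1}. dist x' u < d \<longrightarrow> dist (arc_length \<gamma> x') (arc_length \<gamma> u) < e"
   using d1(1) d2(1) by (intro exI[of _ "min \<delta>1 \<delta>2"]) (auto simp: dist_real_def)
 qed
qed

lemma arc_length_clamp:
 assumes rect: "rectifiable \<gamma>" shows "arc_length \<gamma> t = arc_length \<gamma> (max 0 (min t 1))"
proof (cases "t <= 0")
 case True then show ?thesis using arc_length_0[OF rect] by (simp add: min_def max_def)
qed (auto simp: arc_length_def max_def)

lemma arc_length_measure_Icc:
 assumes rect: "rectifiable \<gamma>" and "a <= b"
 shows "emeasure (arc_length_measure \<gamma>) {a..b} = ennreal (arc_length \<gamma> b - arc_length \<gamma> a)"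
  and "emeasure (arc_length_measure \<gamma>) {a<..b} = ennreal (arc_length \<gamma> b - arc_length \<gamma> a)"
proof -
 have m: "arc_length_measure \<gamma> = interval_measure (arc_length \<gamma>)"
  unfolding arc_length_measure_def arc_length_def[abs_def] ..
 have mono: "arc_length \<gamma> x <= arc_length \<gamma> y" if "x <= y" for x y
  by (subst (1 2) arc_length_clamp[OF rect]) (rule arc_length_diff(2)[OF rect], use that in auto)
 have "continuous_on UNIV (\<lambda>t. arc_length \<gamma> (max 0 (min t 1)))"
  by (rule continuous_on_compose2[OF arc_length_continuous_on[OF rect], of UNIV]) (auto intro!: continuous_intros)
 then have cont: "continuous_on UNIV (arc_length \<gamma>)" by (simp flip: arc_length_clamp[OF rect])
 show "emeasure (arc_length_measure \<gamma>) {a..b} = ennreal (arc_length \<gamma> b - arc_length \<gamma> a)"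
  unfolding m by (rule emeasure_interval_measure_Icc[OF assms(2) mono cont])
 show "emeasure (arc_length_measure \<gamma>) {a<..b} = ennreal (arc_length \<gamma> b - arc_length \<gamma> a)"
  unfolding m by (rule emeasure_interval_measure_Ioc[OF assms(2) mono])
   (use cont in \<open>auto simp: continuous_on_eq_continuous_within intro: continuous_within_subset\<close>)
qed

context
 fixes \<gamma> :: "real => real^'n" and h :: "real => real"
 assumes rect: "rectifiable \<gamma>" and h: "continuous_on {0..1} h"
begin

lemma curve_set_integrable:
 assumes "A \<subseteq> {0..1}" "A \<in> sets borel" shows "set_integrable (arc_length_measure \<gamma>) A h"
proof -
 have sets: "sets (arc_length_measure \<gamma>) = sets borel" by (simp add: arc_length_measure_def)
 obtain B where B: "\<forall>t\<in>{0..1}. norm (h t) <= B"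
  using compact_imp_bounded[OF compact_continuous_image[OF h compact_Icc]] unfolding bounded_iff by blast
 have "set_integrable (arc_length_measure \<gamma>) {0..1} h" unfolding set_integrable_def
 proof (rule integrableI_bounded_set[where A="{0..1}" and B=B])
  show "(\<lambda>t. indicator {0..1} t *\<^sub>R h t) \<in> borel_measurable (arc_length_measure \<gamma>)"
   unfolding measurable_cong_sets[OF sets refl]
   by (rule borel_measurable_continuous_on_indicator) (use h in auto)
 qed (use B in \<open>auto simp: sets arc_length_measure_Icc[OF rect] indicator_def\<close>)
 then show ?thesis by (rule set_integrable_subset) (use assms sets in auto)
qed

lemma curve_integral_split:
 assumes "0 <= a" "a <= b" "b <= c" "c <= 1"
 shows "(LINT t:{a<..c}|arc_length_measure \<gamma>. h t) =
  (LINT t:{a<..b}|arc_length_measure \<gamma>. h t) + (LINT t:{b<..c}|arc_length_measure \<gamma>. h t)"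
proof -
 have "{a<..c} = {a<..b} \<union> {b<..c}" using assms by auto
 then show ?thesis using assms by (simp, intro set_integral_Un curve_set_integrable) auto
qed

lemma curve_integral_bounds:
 assumes "0 <= a" "a <= b" "b <= 1" and l: "\<And>t. t \<in> {a..b} ==> l <= h t" and u: "\<And>t. t \<in> {a..b} ==> h t <= u"
 shows "l * (arc_length \<gamma> b - arc_length \<gamma> a) <= (LINT t:{a<..b}|arc_length_measure \<gamma>. h t)"
  and "(LINT t:{a<..b}|arc_length_measure \<gamma>. h t) <= u * (arc_length \<gamma> b - arc_length \<gamma> a)"
proof -
 let ?m = "arc_length_measure \<gamma>"
 have sets: "sets ?m = sets borel" by (simp add: arc_length_measure_def)
 have pos: "0 <= arc_length \<gamma> b - arc_length \<gamma> a" using arc_length_diff(2)[OF rect assms(1-3)] by simp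
 have c: "(LINT t:{a<..b}|?m. c) = c * (arc_length \<gamma> b - arc_length \<gamma> a)" and i: "set_integrable ?m {a<..b} (\<lambda>_. c)" for c :: real
  using arc_length_measure_Icc(2)[OF rect assms(2)] pos
  by (auto simp: set_lebesgue_integral_def set_integrable_def measure_def sets)
 have "set_integrable ?m {a<..b} h" by (rule curve_set_integrable) (use assms in auto)
 then show "l * (arc_length \<gamma> b - arc_length \<gamma> a) <= (LINT t:{a<..b}|?m. h t)"
  "(LINT t:{a<..b}|?m. h t) <= u * (arc_length \<gamma> b - arc_length \<gamma> a)"
  unfolding c[symmetric] using i l u by (auto intro!: set_integral_mono)
qed

lemma curve_integral_Ioc: "(LINT t:{0..1}|arc_length_measure \<gamma>. h t) = (LINT t:{0<..1}|arc_length_measure \<gamma>. h t)"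
proof (rule set_integral_cong_set)
 let ?m = "arc_length_measure \<gamma>"
 have sets: "sets ?m = sets borel" by (simp add: arc_length_measure_def)
 show "set_borel_measurable ?m {0<..1} h" "set_borel_measurable ?m {0..1} h"
  using curve_set_integrable[of "{0<..1}", OF greaterThanAtMost_subseteq_atLeastAtMost_iff[THEN iffD2]] curve_set_integrable[of "{0..1}"]
  by (simp_all add: set_integrable_def set_borel_measurable_def borel_measurable_integrable)
 have "{0} \<in> null_sets ?m" using arc_length_measure_Icc(1)[OF rect, of 0 0]
  by (auto simp: null_sets_def sets)
 then have "AE t in ?m. t \<notin> {0}" by (rule AE_not_in)
 then show "AE t in ?m. t \<in> {0<..1} \<longleftrightarrow> t \<in> {0..1}" by eventually_elim auto
qed

text \<open>Riemann--Stieltjes sums converge; every identity between curve integrals below is read off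
 from the sums.\<close>
lemma curve_integral_riemann:
 assumes "e > 0"
 shows "\<exists>N0. \<forall>N\<ge>N0. \<forall>\<xi>. N > 0 \<and> (\<forall>i<N. \<xi> i \<in> {real i / real N..real (Suc i) / real N}) \<longrightarrow>
   \<bar>(LINT t:{0..1}|arc_length_measure \<gamma>. h t) -
    (\<Sum>i<N. h (\<xi> i) * (arc_length \<gamma> (real (Suc i) / real N) - arc_length \<gamma> (real i / real N)))\<bar> <= e"
proof -
 let ?m = "arc_length_measure \<gamma>" and ?s = "arc_length \<gamma>"
 define e' where "e' = e / (?s 1 + 1)"
 have s1: "0 <= ?s 1" by (simp add: arc_length_def)
 then have e': "e' > 0" using assms by (simp add: e'_def)
 have "uniformly_continuous_on {0..1} h" by (rule compact_uniformly_continuous[OF h compact_Icc])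
 then obtain \<delta> where \<delta>: "\<delta> > 0" "\<And>s t. s \<in> {0..1} ==> t \<in> {0..1} ==> \<bar>t - s\<bar> < \<delta> ==> \<bar>h t - h s\<bar> < e'"
  using e' unfolding uniformly_continuous_on_def dist_real_def by metis
 obtain N0 :: nat where N0: "1 / \<delta> < real N0" using reals_Archimedean2 by blast
 show ?thesis
 proof (intro exI[of _ N0] allI impI)
  fix N \<xi> assume N: "N \<ge> N0" and a: "N > 0 \<and> (\<forall>i<N. \<xi> i \<in> {real i / real N..real (Suc i) / real N})"
  then have N0': "N > 0" by blast
  have "1 / \<delta> < real N" using N0 N by (meson le_less_trans not_le of_nat_mono order_trans)
  then have step: "1 / real N < \<delta>" using \<delta>(1) N0' by (simp add: field_simps)
  define I where "I k = (LINT t:{0<..real k / real N}|?m. h t)" for k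
  define R where "R k = (\<Sum>i<k. h (\<xi> i) * (?s (real (Suc i) / real N) - ?s (real i / real N)))" for k
  have "\<bar>I k - R k\<bar> <= e' * ?s (real k / real N)" if "k <= N" for k using that
  proof (induction k)
   case 0 then show ?case by (simp add: I_def R_def arc_length_0[OF rect] set_lebesgue_integral_def)
  next
   case (Suc k)
   let ?a = "real k / real N" and ?b = "real (Suc k) / real N"
   have ab: "0 <= ?a" "?a <= ?b" "?b <= 1" "?b - ?a = 1 / real N"
    using Suc.prems N0' by (auto simp: field_simps)
   have x: "\<xi> k \<in> {?a..?b}" using a Suc.prems by auto
   have hb: "h (\<xi> k) - e' <= h t" "h t <= h (\<xi> k) + e'" if "t \<in> {?a..?b}" for t
   proof -
    have "\<xi> k \<in> {0..1}" "t \<in> {0..1}" "\<bar>t - \<xi> k\<bar> < \<delta>" using that x ab step unfolding atLeastAtMost_iff by linarith+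
    from \<delta>(2)[OF this] show "h (\<xi> k) - e' <= h t" "h t <= h (\<xi> k) + e'" by linarith+
   qed
   have "I (Suc k) = I k + (LINT t:{?a<..?b}|?m. h t)"
    unfolding I_def using curve_integral_split[of 0 ?a ?b] ab by auto
   moreover have "R (Suc k) = R k + h (\<xi> k) * (?s ?b - ?s ?a)" by (simp add: R_def)
   moreover have "\<bar>I k - R k\<bar> <= e' * ?s ?a" using Suc by simp
   ultimately show ?case using curve_integral_bounds[OF ab(1-3) hb]
    by (simp add: algebra_simps abs_le_iff)
  qed
  from this[of N] have "\<bar>I N - R N\<bar> <= e' * ?s 1" using N0' by simp
  also have "... <= e" using s1 assms by (simp add: e'_def field_simps)
  finally show "\<bar>(LINT t:{0..1}|?m. h t) -
    (\<Sum>i<N. h (\<xi> i) * (?s (real (Suc i) / real N) - ?s (real i / real N)))\<bar> <= e"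
   using N0' by (simp add: curve_integral_Ioc I_def R_def)
 qed
qed

lemma curve_integral_ge_sum:
 assumes pos: "\<And>t. t \<in> {0..1} ==> 0 <= h t"
  and t: "0 <= t 0" "t N <= 1" "\<And>k. k < N ==> t k <= u k" "\<And>k. k < N ==> u k <= t (Suc k)"
  and m: "\<And>k s. k < N ==> s \<in> {t k..u k} ==> m k <= h s" "\<And>k. k < N ==> 0 <= m k"
 shows "(\<Sum>k<N. m k * infnorm (\<gamma> (u k) - \<gamma> (t k))) <= (LINT t:{0..1}|arc_length_measure \<gamma>. h t)"
proof -
 let ?I = "\<lambda>a b. LINT t:{a<..b}|arc_length_measure \<gamma>. h t"
 have nonneg: "0 <= ?I a b" if "0 <= a" "b <= 1" for a b
  unfolding set_lebesgue_integral_def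
  by (rule Bochner_Integration.integral_nonneg) (use that in \<open>auto simp: indicator_def intro!: pos\<close>)
 have mono: "t j <= t k" if "j <= k" "k <= N" for j k using that
 proof (induction k)
  case (Suc k) then show ?case using t(3,4)[of k] by (cases "j = Suc k") auto
 qed auto
 have "(\<Sum>k<j. m k * infnorm (\<gamma> (u k) - \<gamma> (t k))) <= ?I 0 (t j)" if "j <= N" for j using that
 proof (induction j)
  case 0 then show ?case using nonneg[of 0 "t 0"] t mono[of 0 N] by auto
 next
  case (Suc j)
  have b: "0 <= t j" "t j <= u j" "u j <= t (Suc j)" "t (Suc j) <= 1"
   using Suc.prems t mono[of 0 j] mono[of "Suc j" N] by auto
  obtain U where "\<forall>s\<in>{0..1}. norm (h s) <= U"
   using compact_imp_bounded[OF compact_continuous_image[OF h compact_Icc]] unfolding bounded_iff by blast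
  then have U: "\<And>s. s \<in> {0..1} ==> h s <= U" by (auto simp: abs_le_iff)
  have "m j * infnorm (\<gamma> (u j) - \<gamma> (t j)) <= m j * (arc_length \<gamma> (u j) - arc_length \<gamma> (t j))"
   using Suc.prems m(2)[of j] arc_length_chord[OF rect, of "t j" "u j"] b by (intro mult_left_mono) auto
  also have "... <= ?I (t j) (u j)"
   by (rule curve_integral_bounds(1)[where u=U]) (use b m Suc.prems U in auto)
  also have "... <= ?I (t j) (u j) + ?I (u j) (t (Suc j))" using nonneg[of "u j" "t (Suc j)"] b by auto
  also have "... = ?I (t j) (t (Suc j))" using curve_integral_split[of "t j" "u j" "t (Suc j)"] b by auto
  finally have "m j * infnorm (\<gamma> (u j) - \<gamma> (t j)) <= ?I (t j) (t (Suc j))" .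
  moreover have "?I 0 (t (Suc j)) = ?I 0 (t j) + ?I (t j) (t (Suc j))"
   using curve_integral_split[of 0 "t j" "t (Suc j)"] b by auto
  ultimately show ?case using Suc by simp
 qed
 from this[of N] have "(\<Sum>k<N. m k * infnorm (\<gamma> (u k) - \<gamma> (t k))) <= ?I 0 (t N)" by simp
 also have "... <= ?I 0 (t N) + ?I (t N) 1" using nonneg[of "t N" 1] t mono[of 0 N] by auto
 also have "... = ?I 0 1" using curve_integral_split[of 0 "t N" 1] t mono[of 0 N] by auto
 finally show ?thesis by (simp add: curve_integral_Ioc)
qed

end

lemma rectifiable_join:
 assumes g: "rectifiable \<gamma>" "rectifiable \<eta>" and e: "pathfinish \<gamma> = pathstart \<eta>"
 shows "rectifiable (\<gamma> +++ \<eta>)"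
  and "0 <= s ==> s <= t ==> t <= 1 ==>
   arc_length (\<gamma> +++ \<eta>) (t / 2) - arc_length (\<gamma> +++ \<eta>) (s / 2) = arc_length \<gamma> t - arc_length \<gamma> s"
  and "0 <= s ==> s <= t ==> t <= 1 ==>
   arc_length (\<gamma> +++ \<eta>) ((1 + t) / 2) - arc_length (\<gamma> +++ \<eta>) ((1 + s) / 2) = arc_length \<eta> t - arc_length \<eta> s"
proof -
 have a: "curve_length (\<gamma> +++ \<eta>) (s / 2) (t / 2) = curve_length \<gamma> s t" if "0 <= s" "s <= t" "t <= 1" for s t
  using curve_length_affine[of 2 "s/2" "t/2" "\<gamma> +++ \<eta>" \<gamma> 0] that by (auto simp: joinpaths_def)
 have b: "curve_length (\<gamma> +++ \<eta>) ((1 + s) / 2) ((1 + t) / 2) = curve_length \<eta> s t" if "0 <= s" "s <= t" "t <= 1" for s t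
 proof -
  have "(\<gamma> +++ \<eta>) u = \<eta> (2 * u + - 1)" if "(1 + s) / 2 <= u" for u
  proof (cases "u = 1/2")
   case True then show ?thesis using e unfolding True by (simp add: joinpaths_def pathfinish_def pathstart_def)
  next
   case False
   then have "\<not> u <= 1/2" using that \<open>0 <= s\<close> by (auto simp: field_simps)
   then show ?thesis by (simp add: joinpaths_def)
  qed
  then show ?thesis using curve_length_affine[of 2 "(1+s)/2" "(1+t)/2" "\<gamma> +++ \<eta>" \<eta> "-1"]
   by (simp add: add_divide_distrib algebra_simps)
 qed
 have "curve_length (\<gamma> +++ \<eta>) 0 1 = curve_length \<gamma> 0 1 + curve_length \<eta> 0 1"
  using curve_length_add[of 0 "1/2" 1 "\<gamma> +++ \<eta>"] a[of 0 1] b[of 0 1] by simp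
 then show r: "rectifiable (\<gamma> +++ \<eta>)" using g e by (simp add: rectifiable_def)
 show "arc_length (\<gamma> +++ \<eta>) (t / 2) - arc_length (\<gamma> +++ \<eta>) (s / 2) = arc_length \<gamma> t - arc_length \<gamma> s"
  if st: "0 <= s" "s <= t" "t <= 1"
 proof -
  have "0 <= s / 2" "s / 2 <= t / 2" "t / 2 <= 1" using st by auto
  from arc_length_diff[OF g(1) st] arc_length_diff[OF r this] a[OF st] show ?thesis
   by (metis diff_ge_0_iff_ge ennreal_inj)
 qed
 show "arc_length (\<gamma> +++ \<eta>) ((1 + t) / 2) - arc_length (\<gamma> +++ \<eta>) ((1 + s) / 2) = arc_length \<eta> t - arc_length \<eta> s"
  if st: "0 <= s" "s <= t" "t <= 1"
 proof -
  have "0 <= (1 + s) / 2" "(1 + s) / 2 <= (1 + t) / 2" "(1 + t) / 2 <= 1" using st by auto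
  from arc_length_diff[OF g(2) st] arc_length_diff[OF r this] b[OF st] show ?thesis
   by (metis diff_ge_0_iff_ge ennreal_inj)
 qed
qed

lemma curve_integral_join:
 assumes g: "rectifiable \<gamma>" "rectifiable \<eta>" and e: "pathfinish \<gamma> = pathstart \<eta>"
  and h: "continuous_on (path_image \<gamma> \<union> path_image \<eta>) h"
 shows "curve_integral (\<gamma> +++ \<eta>) h = curve_integral \<gamma> h + curve_integral \<eta> h"
proof -
 let ?j = "\<gamma> +++ \<eta>"
 have r: "rectifiable ?j" by (rule rectifiable_join[OF g e])
 have c: "continuous_on {0..1} (\<lambda>t. h (p t))" if "rectifiable p" "path_image p \<subseteq> path_image \<gamma> \<union> path_image \<eta>" for p
  by (rule continuous_on_compose2[OF h rectifiable_continuous[OF that(1)]]) (use that in \<open>auto simp: path_image_def\<close>)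
 have cj: "continuous_on {0..1} (\<lambda>t. h (?j t))" "continuous_on {0..1} (\<lambda>t. h (\<gamma> t))" "continuous_on {0..1} (\<lambda>t. h (\<eta> t))"
  using c g r e by (auto simp: path_image_join)
 have "\<bar>curve_integral ?j h - (curve_integral \<gamma> h + curve_integral \<eta> h)\<bar> <= 3 * d" if d: "d > 0" for d
 proof -
  let ?R = "\<lambda>p N. \<Sum>i<N. h (p (real i / real N)) * (arc_length p (real (Suc i) / real N) - arc_length p (real i / real N))"
  obtain N1 where N1: "\<And>N \<xi>. N \<ge> N1 ==> N > 0 ==> (\<forall>i<N. \<xi> i \<in> {real i / real N..real (Suc i) / real N}) ==>
    \<bar>curve_integral (?j) h - (\<Sum>i<N. h ((?j) (\<xi> i)) * (arc_length (?j) (real (Suc i) / real N) - arc_length (?j) (real i / real N)))\<bar> <= d"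
   using curve_integral_riemann[OF r cj(1) d] unfolding curve_integral_def by blast
  obtain N2 where N2: "\<And>N \<xi>. N \<ge> N2 ==> N > 0 ==> (\<forall>i<N. \<xi> i \<in> {real i / real N..real (Suc i) / real N}) ==>
    \<bar>curve_integral (\<gamma>) h - (\<Sum>i<N. h ((\<gamma>) (\<xi> i)) * (arc_length (\<gamma>) (real (Suc i) / real N) - arc_length (\<gamma>) (real i / real N)))\<bar> <= d"
   using curve_integral_riemann[OF g(1) cj(2) d] unfolding curve_integral_def by blast
  obtain N3 where N3: "\<And>N \<xi>. N \<ge> N3 ==> N > 0 ==> (\<forall>i<N. \<xi> i \<in> {real i / real N..real (Suc i) / real N}) ==>
    \<bar>curve_integral (\<eta>) h - (\<Sum>i<N. h ((\<eta>) (\<xi> i)) * (arc_length (\<eta>) (real (Suc i) / real N) - arc_length (\<eta>) (real i / real N)))\<bar> <= d"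
   using curve_integral_riemann[OF g(2) cj(3) d] unfolding curve_integral_def by blast
  define N where "N = Suc (N1 + N2 + N3)"
  have N: "N > 0" by (simp add: N_def)
  have "?R ?j (N + N) = ?R \<gamma> N + ?R \<eta> N"
  proof -
   have split: "(\<Sum>i<N + M. f i) = (\<Sum>i<N. f i) + (\<Sum>i<M. f (N + i))" for f :: "nat => real" and M
    by (induction M) auto
   have 1: "real i / real (N + N) = (real i / real N) / 2" for i using N by (simp add: field_simps)
   have 2: "real (N + i) / real (N + N) = (1 + real i / real N) / 2" for i using N by (simp add: field_simps)
   have 3: "?j ((real i / real N) / 2) = \<gamma> (real i / real N)" if "i < N" for i
    using that by (simp add: joinpaths_def field_simps)
   have 4: "?j ((1 + real i / real N) / 2) = \<eta> (real i / real N)" for i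
   proof (cases "i = 0")
    case True then show ?thesis using e by (simp add: joinpaths_def pathfinish_def pathstart_def)
   next
    case False
    then have "real i / real N > 0" using N by simp
    moreover have "\<not> (1 + v) / 2 <= 1 / 2" if "v > 0" for v :: real using that by simp
    ultimately have "\<not> (1 + real i / real N) / 2 <= 1 / 2" by blast
    moreover have "2 * ((1 + v) / 2) - 1 = v" for v :: real by (simp add: field_simps)
    ultimately show ?thesis unfolding joinpaths_def by presburger
   qed
   show ?thesis unfolding split
   proof (intro arg_cong2[where f="(+)"] sum.cong refl)
    fix i assume "i \<in> {..<N}"
    then have i: "i < N" by simp
    show "h (?j (real i / real (N + N))) * (arc_length ?j (real (Suc i) / real (N + N)) - arc_length ?j (real i / real (N + N)))
     = h (\<gamma> (real i / real N)) * (arc_length \<gamma> (real (Suc i) / real N) - arc_length \<gamma> (real i / real N))"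
     unfolding 1 3[OF i] by (subst rectifiable_join(2)[OF g e]) (use i in \<open>auto simp: field_simps\<close>)
    have 5: "real (Suc (N + i)) / real (N + N) = (1 + real (Suc i) / real N) / 2"
     using 2[of "Suc i"] by simp
    show "h (?j (real (N + i) / real (N + N))) * (arc_length ?j (real (Suc (N + i)) / real (N + N)) - arc_length ?j (real (N + i) / real (N + N)))
     = h (\<eta> (real i / real N)) * (arc_length \<eta> (real (Suc i) / real N) - arc_length \<eta> (real i / real N))"
     unfolding 2 5 4 by (subst rectifiable_join(3)[OF g e]) (use i in \<open>auto simp: field_simps\<close>)
   qed
  qed
  moreover have "\<bar>curve_integral ?j h - ?R ?j (N + N)\<bar> <= d"
   by (rule N1) (use N in \<open>auto simp: N_def field_simps\<close>)
  moreover have "\<bar>curve_integral \<gamma> h - ?R \<gamma> N\<bar> <= d"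
   by (rule N2) (use N in \<open>auto simp: N_def field_simps\<close>)
  moreover have "\<bar>curve_integral \<eta> h - ?R \<eta> N\<bar> <= d"
   by (rule N3) (use N in \<open>auto simp: N_def field_simps\<close>)
  ultimately show ?thesis by linarith
 qed
 from this[of "\<bar>curve_integral ?j h - (curve_integral \<gamma> h + curve_integral \<eta> h)\<bar> / 6"] show ?thesis
  by (cases "curve_integral ?j h = curve_integral \<gamma> h + curve_integral \<eta> h") auto
qed

lemma curve_integral_reverse:
 assumes g: "rectifiable \<gamma>" and h: "continuous_on (path_image \<gamma>) h"
 shows "curve_integral (\<lambda>s. \<gamma> (1 - s)) h = curve_integral \<gamma> h"
proof -
 let ?r = "\<lambda>s. \<gamma> (1 - s)"
 have r: "rectifiable ?r" by (rule rectifiable_reverse[OF g])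
 have cj: "continuous_on {0..1} (\<lambda>t. h (?r t))" "continuous_on {0..1} (\<lambda>t. h (\<gamma> t))"
  by (rule continuous_on_compose2[OF h rectifiable_continuous[OF r]] continuous_on_compose2[OF h rectifiable_continuous[OF g]],
    force simp: path_image_def)+
 have "\<bar>curve_integral ?r h - curve_integral \<gamma> h\<bar> <= 2 * d" if d: "d > 0" for d
 proof -
  let ?a = "arc_length ?r" and ?b = "arc_length \<gamma>"
  obtain N1 where N1: "\<And>N \<xi>. N \<ge> N1 ==> N > 0 ==> (\<forall>i<N. \<xi> i \<in> {real i / real N..real (Suc i) / real N}) ==>
    \<bar>curve_integral ?r h - (\<Sum>i<N. h (?r (\<xi> i)) * (?a (real (Suc i) / real N) - ?a (real i / real N)))\<bar> <= d"
   using curve_integral_riemann[OF r cj(1) d] unfolding curve_integral_def by blast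
  obtain N2 where N2: "\<And>N \<xi>. N \<ge> N2 ==> N > 0 ==> (\<forall>i<N. \<xi> i \<in> {real i / real N..real (Suc i) / real N}) ==>
    \<bar>curve_integral \<gamma> h - (\<Sum>i<N. h (\<gamma> (\<xi> i)) * (?b (real (Suc i) / real N) - ?b (real i / real N)))\<bar> <= d"
   using curve_integral_riemann[OF g cj(2) d] unfolding curve_integral_def by blast
  define N where "N = Suc (N1 + N2)"
  have N: "N > 0" by (simp add: N_def)
  have "(\<Sum>i<N. h (?r (real i / real N)) * (?a (real (Suc i) / real N) - ?a (real i / real N)))
   = (\<Sum>i<N. h (\<gamma> (real (Suc i) / real N)) * (?b (real (Suc i) / real N) - ?b (real i / real N)))"
  proof (rule sum.reindex_bij_witness[where i="\<lambda>i. N - Suc i" and j="\<lambda>i. N - Suc i"])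
   fix i assume "i \<in> {..<N}"
   then have i: "i < N" by simp
   have 1: "real (N - Suc i) / real N = 1 - real (Suc i) / real N" using i N by (simp add: field_simps)
   have 2: "real (Suc (N - Suc i)) / real N = 1 - real i / real N" using i N by (simp add: field_simps Suc_diff_Suc)
   have b: "0 <= real i / real N" "real i / real N <= real (Suc i) / real N" "real (Suc i) / real N <= 1"
    using i by (auto simp: field_simps)
   have "?a (real (Suc i) / real N) - ?a (real i / real N) = ?b (1 - real i / real N) - ?b (1 - real (Suc i) / real N)"
   proof -
    have b': "0 <= 1 - real (Suc i) / real N" "1 - real (Suc i) / real N <= 1 - real i / real N" "1 - real i / real N <= 1"
     using b by auto
    from arc_length_diff[OF r b] arc_length_diff[OF g b'] show ?thesis
     by (metis curve_length_reverse diff_ge_0_iff_ge ennreal_inj)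
   qed
   then show "h (\<gamma> (real (Suc (N - Suc i)) / real N)) * (?b (real (Suc (N - Suc i)) / real N) - ?b (real (N - Suc i) / real N))
     = h (?r (real i / real N)) * (?a (real (Suc i) / real N) - ?a (real i / real N))"
    unfolding 1 2 by simp
  qed auto
  moreover have "\<bar>curve_integral ?r h - (\<Sum>i<N. h (?r (real i / real N)) * (?a (real (Suc i) / real N) - ?a (real i / real N)))\<bar> <= d"
   by (rule N1) (use N in \<open>auto simp: N_def field_simps\<close>)
  moreover have "\<bar>curve_integral \<gamma> h - (\<Sum>i<N. h (\<gamma> (real (Suc i) / real N)) * (?b (real (Suc i) / real N) - ?b (real i / real N)))\<bar> <= d"
   by (rule N2) (use N in \<open>auto simp: N_def field_simps\<close>)
  ultimately show ?thesis by linarith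
 qed
 from this[of "\<bar>curve_integral ?r h - curve_integral \<gamma> h\<bar> / 4"] show ?thesis
  by (cases "curve_integral ?r h = curve_integral \<gamma> h") auto
qed

lemma rectifiable_linepath: "rectifiable (linepath x y)"
 and curve_integral_linepath_le:
  "continuous_on (closed_segment x y) h ==> (\<And>z. z \<in> closed_segment x y ==> h z <= M) ==> 0 <= M ==>
    curve_integral (linepath x y) h <= M * infnorm (y - x)"
proof -
 have "infnorm (linepath x y t - linepath x y s) <= infnorm (y - x) * (t - s)" if "s <= t" for s t
 proof -
  have "linepath x y t - linepath x y s = (t - s) *\<^sub>R (y - x)" by (simp add: linepath_def algebra_simps)
  then show ?thesis using that by (simp add: infnorm_mul)
 qed
 then have L: "curve_length (linepath x y) 0 1 <= ennreal (infnorm (y - x))"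
  using curve_length_lipschitz[of 0 1 "infnorm (y - x)" "linepath x y"] infnorm_pos_le[of "y - x"] by simp
 also have "... < \<infinity>" by simp
 finally show r: "rectifiable (linepath x y)" by (simp add: rectifiable_def)
 assume h: "continuous_on (closed_segment x y) h" "\<And>z. z \<in> closed_segment x y ==> h z <= M" "0 <= M"
 have c: "continuous_on {0..1} (\<lambda>t. h (linepath x y t))"
  by (rule continuous_on_compose2[OF h(1)]) (auto intro!: continuous_intros simp: linepath_in_path)
 obtain l where l: "\<And>t. t \<in> {0..1} ==> l <= h (linepath x y t)"
  using compact_imp_bounded[OF compact_continuous_image[OF c compact_Icc]] bounded_imp_bdd_below
  unfolding bdd_below_def by (metis (no_types, lifting) image_eqI)
 have "curve_integral (linepath x y) h <= M * (arc_length (linepath x y) 1 - arc_length (linepath x y) 0)"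
  unfolding curve_integral_def curve_integral_Ioc[OF r c]
  by (rule curve_integral_bounds(2)[OF r c _ _ _ l]) (use h in \<open>auto simp: linepath_in_path\<close>)
 also have "arc_length (linepath x y) 1 - arc_length (linepath x y) 0 <= infnorm (y - x)"
  using L arc_length_0[OF r] by (simp add: arc_length_def enn2real_leI infnorm_pos_le)
 finally show "curve_integral (linepath x y) h <= M * infnorm (y - x)" using h(3) by (simp add: mult_left_mono)
qed

section \<open>The intrinsic metrics\<close>

context proper_domain
begin

definition joins :: "(real => real^'n) => real^'n => real^'n => bool" where
 "joins \<gamma> x y \<longleftrightarrow> rectifiable \<gamma> \<and> path_image \<gamma> \<subseteq> \<Omega> \<and> pathstart \<gamma> = x \<and> pathfinish \<gamma> = y"

definition weighted_length :: "real => (real => real^'n) => real" where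
 "weighted_length \<sigma> \<gamma> = curve_integral \<gamma> (\<lambda>z. bd z powr (\<sigma> - 1))"

lemma d_met_eq: "dmet \<sigma> x y = Inf {weighted_length \<sigma> \<gamma> |\<gamma>. joins \<gamma> x y}"
 by (simp add: d_met_def weighted_length_def joins_def)

lemma weight_continuous: "S \<subseteq> \<Omega> ==> continuous_on S (\<lambda>z. bd z powr c)"
 using bd_pos by (intro continuous_intros continuous_bd) force+

lemma joinsD:
 assumes "joins \<gamma> x y"
 shows "rectifiable \<gamma>" "\<And>t. t \<in> {0..1} ==> \<gamma> t \<in> \<Omega>" "\<gamma> 0 = x" "\<gamma> 1 = y" "x \<in> \<Omega>" "y \<in> \<Omega>"
  "continuous_on {0..1} (\<lambda>t. bd (\<gamma> t) powr c)"
proof -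
 show r: "rectifiable \<gamma>" and i: "\<And>t. t \<in> {0..1} ==> \<gamma> t \<in> \<Omega>" and e: "\<gamma> 0 = x" "\<gamma> 1 = y"
  using assms by (auto simp: joins_def path_image_def pathstart_def pathfinish_def)
 show "x \<in> \<Omega>" "y \<in> \<Omega>" using i[of 0] i[of 1] e by auto
 show "continuous_on {0..1} (\<lambda>t. bd (\<gamma> t) powr c)"
  by (rule continuous_on_compose2[OF weight_continuous rectifiable_continuous[OF r], of \<Omega>]) (use i in auto)
qed

lemma weighted_length_nonneg: "0 <= weighted_length \<sigma> \<gamma>"
 unfolding weighted_length_def curve_integral_def set_lebesgue_integral_def
 by (rule Bochner_Integration.integral_nonneg) simp

lemma joins_reverse: "joins \<gamma> x y ==> joins (\<lambda>s. \<gamma> (1 - s)) y x"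
 and weighted_length_reverse: "joins \<gamma> x y ==> weighted_length \<sigma> (\<lambda>s. \<gamma> (1 - s)) = weighted_length \<sigma> \<gamma>"
proof -
 assume j: "joins \<gamma> x y"
 show "joins (\<lambda>s. \<gamma> (1 - s)) y x" using j rectifiable_reverse[of \<gamma>] path_image_reversepath[of \<gamma>]
  by (auto simp: joins_def reversepath_def pathstart_def pathfinish_def)
 show "weighted_length \<sigma> (\<lambda>s. \<gamma> (1 - s)) = weighted_length \<sigma> \<gamma>" unfolding weighted_length_def
  using j by (intro curve_integral_reverse weight_continuous) (auto simp: joins_def)
qed

lemma joins_join: "joins \<gamma> x y ==> joins \<eta> y z ==> joins (\<gamma> +++ \<eta>) x z"
 and weighted_length_join: "joins \<gamma> x y ==> joins \<eta> y z ==>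
  weighted_length \<sigma> (\<gamma> +++ \<eta>) = weighted_length \<sigma> \<gamma> + weighted_length \<sigma> \<eta>"
proof -
 assume j: "joins \<gamma> x y" "joins \<eta> y z"
 then have e: "pathfinish \<gamma> = pathstart \<eta>" by (simp add: joins_def)
 show "joins (\<gamma> +++ \<eta>) x z" using j rectifiable_join(1)[of \<gamma> \<eta>] e
  by (auto simp: joins_def path_image_join)
 show "weighted_length \<sigma> (\<gamma> +++ \<eta>) = weighted_length \<sigma> \<gamma> + weighted_length \<sigma> \<eta>" unfolding weighted_length_def
  using j e by (intro curve_integral_join weight_continuous) (auto simp: joins_def)
qed

lemma joins_linepath:
 assumes "closed_segment x y \<subseteq> \<Omega>" shows "joins (linepath x y) x y"
  and "0 < b ==> (\<And>z. z \<in> closed_segment x y ==> b <= bd z) ==> \<sigma> <= 1 ==>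
   weighted_length \<sigma> (linepath x y) <= b powr (\<sigma> - 1) * infnorm (y - x)"
proof -
 show "joins (linepath x y) x y" using assms by (simp add: joins_def rectifiable_linepath)
 assume b: "0 < b" "\<And>z. z \<in> closed_segment x y ==> b <= bd z" "\<sigma> <= 1"
 show "weighted_length \<sigma> (linepath x y) <= b powr (\<sigma> - 1) * infnorm (y - x)"
  unfolding weighted_length_def
  by (rule curve_integral_linepath_le[OF weight_continuous[OF assms]])
   (use b in \<open>auto intro!: powr_mono2'\<close>)
qed

lemma closed_segment_infnorm:
 assumes "z \<in> closed_segment x (y::real^'n)"
 shows "infnorm (z - x) <= infnorm (y - x)"
proof -
 obtain u where u: "0 <= u" "u <= 1" "z = (1 - u) *\<^sub>R x + u *\<^sub>R y" using assms by (auto simp: closed_segment_def)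
 then have "z - x = u *\<^sub>R (y - x)" by (simp add: algebra_simps)
 then show ?thesis using u by (simp add: infnorm_mul infnorm_pos_le mult_left_le_one_le)
qed

lemma joins_exists:
 assumes "x \<in> \<Omega>" "y \<in> \<Omega>" shows "\<exists>\<gamma>. joins \<gamma> x y"
proof (rule connected_equivalence_relation[OF conn assms, of "\<lambda>x y. \<exists>\<gamma>. joins \<gamma> x y"])
 fix a assume a: "a \<in> \<Omega>"
 obtain e where e: "e > 0" "ball a e \<subseteq> \<Omega>" using op a openE by blast
 have "\<exists>\<gamma>. joins \<gamma> a x" if "x \<in> ball a e" for x
 proof -
  have "closed_segment a x \<subseteq> ball a e" using that e(1) by (intro closed_segment_subset) auto
  then show ?thesis using e(2) by (intro exI[of _ "linepath a x"] joins_linepath) auto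
 qed
 then show "\<exists>T. openin (top_of_set \<Omega>) T \<and> a \<in> T \<and> (\<forall>x\<in>T. \<exists>\<gamma>. joins \<gamma> a x)"
  using e op by (intro exI[of _ "ball a e"]) (auto intro: open_subset)
qed (use joins_reverse joins_join in blast)+

lemma d_met_le: "joins \<gamma> x y ==> dmet \<sigma> x y <= weighted_length \<sigma> \<gamma>"
 unfolding d_met_eq by (rule cInf_lower) (auto intro!: bdd_belowI[of _ 0] weighted_length_nonneg)

lemma d_met_approx:
 assumes "x \<in> \<Omega>" "y \<in> \<Omega>" "dmet \<sigma> x y < e"
 obtains \<gamma> where "joins \<gamma> x y" "weighted_length \<sigma> \<gamma> < e"
proof -
 have "{weighted_length \<sigma> \<gamma> |\<gamma>. joins \<gamma> x y} \<noteq> {}" using joins_exists[OF assms(1,2)] by auto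
 from cInf_lessD[OF this] assms(3) that show thesis unfolding d_met_eq by blast
qed

lemma d_met_nonneg: "x \<in> \<Omega> ==> y \<in> \<Omega> ==> 0 <= dmet \<sigma> x y"
 unfolding d_met_eq by (rule cInf_greatest) (use joins_exists in \<open>auto intro: weighted_length_nonneg\<close>)

lemma d_met_sym_le:
 assumes "x \<in> \<Omega>" "y \<in> \<Omega>" shows "dmet \<sigma> y x <= dmet \<sigma> x y"
proof (rule field_le_epsilon)
 fix e :: real assume "e > 0"
 then obtain \<gamma> where "joins \<gamma> x y" "weighted_length \<sigma> \<gamma> < dmet \<sigma> x y + e"
  using d_met_approx[OF assms, of \<sigma> "dmet \<sigma> x y + e"] by auto
 then show "dmet \<sigma> y x <= dmet \<sigma> x y + e"
  using d_met_le[OF joins_reverse, of \<gamma> x y \<sigma>] weighted_length_reverse[of \<gamma> x y \<sigma>] by simp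
qed

lemma d_met_sym: "x \<in> \<Omega> ==> y \<in> \<Omega> ==> dmet \<sigma> y x = dmet \<sigma> x y"
 using d_met_sym_le by (simp add: antisym)

lemma d_met_triangle:
 assumes "x \<in> \<Omega>" "y \<in> \<Omega>" "z \<in> \<Omega>" shows "dmet \<sigma> x z <= dmet \<sigma> x y + dmet \<sigma> y z"
proof (rule field_le_epsilon)
 fix e :: real assume e: "e > 0"
 obtain \<gamma> where 1: "joins \<gamma> x y" "weighted_length \<sigma> \<gamma> < dmet \<sigma> x y + e/2"
  using d_met_approx[OF assms(1,2), of \<sigma> "dmet \<sigma> x y + e/2"] e by auto
 obtain \<eta> where 2: "joins \<eta> y z" "weighted_length \<sigma> \<eta> < dmet \<sigma> y z + e/2"
  using d_met_approx[OF assms(2,3), of \<sigma> "dmet \<sigma> y z + e/2"] e by auto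
 show "dmet \<sigma> x z <= dmet \<sigma> x y + dmet \<sigma> y z + e"
  using d_met_le[OF joins_join[OF 1(1) 2(1)], of \<sigma>] weighted_length_join[OF 1(1) 2(1), of \<sigma>] 1 2 by simp
qed

lemma d_met_segment:
 assumes "closed_segment x y \<subseteq> \<Omega>" "0 < b" "\<And>z. z \<in> closed_segment x y ==> b <= bd z" "\<sigma> <= 1"
 shows "dmet \<sigma> x y <= b powr (\<sigma> - 1) * infnorm (y - x)"
 using d_met_le[OF joins_linepath(1)[OF assms(1)], of \<sigma>] joins_linepath(2)[OF assms] by linarith

text \<open>Within half its distance to the boundary the weight is comparable to a constant, so a straight segment
 is an efficient curve.\<close>
lemma d_met_local:
 assumes "x \<in> \<Omega>" "infnorm (y - x) <= bd x / 2" "0 < \<sigma>" "\<sigma> <= 1"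
 shows "dmet \<sigma> x y <= (bd x / 2) powr (\<sigma> - 1) * infnorm (y - x)"
  and "dmet \<sigma> x y <= bd x powr \<sigma>"
proof -
 have *: "z \<in> \<Omega>" "bd x / 2 <= bd z" if "z \<in> closed_segment x y" for z
  using bd_half[of x z "1/2"] closed_segment_infnorm[OF that] assms by auto
 show 1: "dmet \<sigma> x y <= (bd x / 2) powr (\<sigma> - 1) * infnorm (y - x)"
  by (rule d_met_segment) (use * assms bd_pos[OF assms(1)] in auto)
 also have "... <= (bd x / 2) powr (\<sigma> - 1) * (bd x / 2)" using assms by (intro mult_left_mono) auto
 also have "... = (bd x / 2) powr \<sigma>" using bd_pos[OF assms(1)] by (simp add: powr_diff)
 also have "... <= bd x powr \<sigma>" using bd_pos[OF assms(1)] assms by (intro powr_mono2) auto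
 finally show "dmet \<sigma> x y <= bd x powr \<sigma>" .
qed

lemma d_met_refl: "x \<in> \<Omega> ==> dmet \<sigma> x x = 0"
proof -
 assume x: "x \<in> \<Omega>"
 have "weighted_length \<sigma> (linepath x x) <= bd x powr (\<sigma> - 1) * infnorm (x - x)" unfolding weighted_length_def
  using x by (intro curve_integral_linepath_le weight_continuous) auto
 then show ?thesis using d_met_le[OF joins_linepath(1), of x x \<sigma>] d_met_nonneg[of x x \<sigma>] x by (simp add: infnorm_0)
qed

text \<open>If the largest distance to the boundary along a curve is \<open>m\<close>, then the weighted length is at least
 \<open>m\<^bsup>\<sigma>-1\<^esup>\<close> times the diameter of the curve, while \<open>m\<close> exceeds the distance at an end point by at most
 that diameter.  So the weighted length controls \<open>m\<close>, hence the size of the curve, and hence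
 the weighted length for a larger exponent.\<close>
lemma curve_scale:
 assumes j: "joins \<gamma> x y" and \<sigma>: "0 < \<sigma>" "\<sigma> <= 1" and r: "0 < r" "weighted_length \<sigma> \<gamma> <= r powr \<sigma>"
  and b: "bd x <= b \<or> bd y <= b" and M: "M = max (2 * b) (2 powr (1/\<sigma>) * r)"
 shows "t \<in> {0..1} ==> bd (\<gamma> t) <= M"
  and "s \<in> {0..1} ==> t \<in> {0..1} ==> infnorm (\<gamma> t - \<gamma> s) <= M"
  and "\<sigma> <= \<tau> ==> weighted_length \<tau> \<gamma> <= M powr (\<tau> - \<sigma>) * weighted_length \<sigma> \<gamma>"
proof -
 note jD = joinsD[OF j]
 have "continuous_on {0..1} (\<lambda>t. bd (\<gamma> t))"
  by (rule continuous_on_compose2[OF continuous_bd rectifiable_continuous[OF jD(1)], of UNIV]) auto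
 then obtain t0 where t0: "t0 \<in> {0..1}" "\<And>t. t \<in> {0..1} ==> bd (\<gamma> t) <= bd (\<gamma> t0)"
  using continuous_attains_sup[of "{0..1::real}" "\<lambda>t. bd (\<gamma> t)"] by (metis atLeastAtMost_iff compact_Icc empty_iff order_refl zero_le_one)
 define m where "m = bd (\<gamma> t0)"
 have m: "m > 0" using bd_pos jD(2) t0(1) by (simp add: m_def)
 have diam: "m powr (\<sigma> - 1) * infnorm (\<gamma> t - \<gamma> s) <= r powr \<sigma>" if st: "s \<in> {0..1}" "t \<in> {0..1}" for s t
 proof -
  have "m powr (\<sigma> - 1) * infnorm (\<gamma> (max s t) - \<gamma> (min s t)) <= weighted_length \<sigma> \<gamma>"
   unfolding weighted_length_def curve_integral_def
  proof -
   have "(\<Sum>k<(1::nat). m powr (\<sigma> - 1) * infnorm (\<gamma> (max s t) - \<gamma> (if k = 0 then min s t else max s t)))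
    <= (LINT t:{0..1}|arc_length_measure \<gamma>. bd (\<gamma> t) powr (\<sigma> - 1))"
   proof (rule curve_integral_ge_sum[OF jD(1), where t="\<lambda>k. if k = 0 then min s t else max s t"
      and u="\<lambda>_. max s t" and m="\<lambda>_. m powr (\<sigma> - 1)" and h="\<lambda>t. bd (\<gamma> t) powr (\<sigma> - 1)"])
    show "continuous_on {0..1} (\<lambda>t. bd (\<gamma> t) powr (\<sigma> - 1))" by (rule jD(7))
   next
    fix k :: nat and u assume "k < 1" "u \<in> {if k = 0 then min s t else max s t..max s t}"
    then have "u \<in> {0..1}" using st by (auto split: if_splits)
    then show "m powr (\<sigma> - 1) <= bd (\<gamma> u) powr (\<sigma> - 1)"
     using t0(2)[of u] bd_pos[OF jD(2), of u] \<sigma> by (intro powr_mono2') (auto simp: m_def)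
   qed (use st in auto)
   then show "m powr (\<sigma> - 1) * infnorm (\<gamma> (max s t) - \<gamma> (min s t))
    <= (LINT t:{0..1}|arc_length_measure \<gamma>. bd (\<gamma> t) powr (\<sigma> - 1))" by simp
  qed
  moreover have "infnorm (\<gamma> (max s t) - \<gamma> (min s t)) = infnorm (\<gamma> t - \<gamma> s)"
   by (auto simp: max_def min_def infnorm_sub)
  ultimately show ?thesis using r by simp
 qed
 have mM: "m <= M"
 proof (cases "m <= 2 * b")
  case False
  obtain e where e: "e \<in> {0..1}" "bd (\<gamma> e) <= b" using b jD(3,4) by (metis atLeastAtMost_iff order_refl zero_le_one)
  have "m <= bd (\<gamma> e) + infnorm (\<gamma> t0 - \<gamma> e)" unfolding m_def by (rule bd_lipschitz)
  then have "m / 2 <= infnorm (\<gamma> t0 - \<gamma> e)" using e False by linarith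
  then have "m powr (\<sigma> - 1) * (m / 2) <= m powr (\<sigma> - 1) * infnorm (\<gamma> t0 - \<gamma> e)" by (intro mult_left_mono) auto
  also have "... <= r powr \<sigma>" by (rule diam[OF e(1) t0(1)])
  finally have "m powr \<sigma> <= 2 * r powr \<sigma>" using m by (simp add: powr_diff)
  also have "... = (2 powr (1/\<sigma>) * r) powr \<sigma>" using \<sigma> r by (simp add: powr_mult powr_powr)
  finally have "m <= 2 powr (1/\<sigma>) * r" using \<sigma> r m by (metis mult_pos_pos not_le powr_gt_zero powr_less_mono2 less_imp_le zero_less_numeral)
  then show ?thesis by (simp add: M)
 qed (simp add: M)
 have M0: "0 < M" using m mM by linarith
 show bdM: "bd (\<gamma> t) <= M" if "t \<in> {0..1}" for t using t0(2)[OF that] mM by (simp add: m_def)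
 have rM: "r <= M"
 proof -
  have "1 <= 2 powr (1/\<sigma>)" using \<sigma> by (simp add: ge_one_powr_ge_zero)
  then have "r <= 2 powr (1/\<sigma>) * r" using r by simp
  then show ?thesis by (simp add: M)
 qed
 show "infnorm (\<gamma> t - \<gamma> s) <= M" if st: "s \<in> {0..1}" "t \<in> {0..1}"
 proof -
  have "M powr (\<sigma> - 1) * infnorm (\<gamma> t - \<gamma> s) <= m powr (\<sigma> - 1) * infnorm (\<gamma> t - \<gamma> s)"
   using m mM \<sigma> by (intro mult_right_mono powr_mono2') (auto simp: infnorm_pos_le)
  also have "... <= r powr \<sigma>" by (rule diam[OF st])
  also have "... <= M powr \<sigma>" using r rM \<sigma> by (intro powr_mono2) auto
  also have "... = M powr (\<sigma> - 1) * M" using M0 by (simp add: powr_diff)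
  finally show ?thesis using M0 by simp
 qed
 assume "\<sigma> <= \<tau>"
 show "weighted_length \<tau> \<gamma> <= M powr (\<tau> - \<sigma>) * weighted_length \<sigma> \<gamma>"
  unfolding weighted_length_def curve_integral_def set_integral_mult_right[symmetric]
 proof (rule set_integral_mono)
  show "set_integrable (arc_length_measure \<gamma>) {0..1} (\<lambda>t. bd (\<gamma> t) powr (\<tau> - 1))"
   "set_integrable (arc_length_measure \<gamma>) {0..1} (\<lambda>t. M powr (\<tau> - \<sigma>) * bd (\<gamma> t) powr (\<sigma> - 1))"
   by (intro set_integrable_mult_right curve_set_integrable jD; simp)+
  fix t :: real assume t: "t \<in> {0..1}"
  have "bd (\<gamma> t) powr (\<tau> - 1) = bd (\<gamma> t) powr (\<tau> - \<sigma>) * bd (\<gamma> t) powr (\<sigma> - 1)"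
   by (simp flip: powr_add)
  also have "... <= M powr (\<tau> - \<sigma>) * bd (\<gamma> t) powr (\<sigma> - 1)"
   using bdM[OF t] \<open>\<sigma> <= \<tau>\<close> by (intro mult_right_mono powr_mono2 bd_nonneg) auto
  finally show "bd (\<gamma> t) powr (\<tau> - 1) <= M powr (\<tau> - \<sigma>) * bd (\<gamma> t) powr (\<sigma> - 1)" .
 qed
qed

lemma d_met_exponent:
 assumes x: "x \<in> \<Omega>" "y \<in> \<Omega>" and \<sigma>: "0 < \<sigma>" "\<sigma> <= 1" "\<sigma> <= \<tau>" and r: "0 < r" "dmet \<sigma> x y < r powr \<sigma>"
  and b: "bd x <= b \<or> bd y <= b"
 shows "dmet \<tau> x y <= max (2 * b) (2 powr (1/\<sigma>) * r) powr (\<tau> - \<sigma>) * r powr \<sigma>"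
proof -
 obtain \<gamma> where g: "joins \<gamma> x y" "weighted_length \<sigma> \<gamma> < r powr \<sigma>" using d_met_approx[OF x r(2)] by blast
 have "dmet \<tau> x y <= weighted_length \<tau> \<gamma>" by (rule d_met_le[OF g(1)])
 also have "... <= max (2 * b) (2 powr (1/\<sigma>) * r) powr (\<tau> - \<sigma>) * weighted_length \<sigma> \<gamma>"
  by (rule curve_scale(3)[OF g(1) \<sigma>(1,2) r(1) _ b refl \<sigma>(3)]) (use g in simp)
 also have "... <= max (2 * b) (2 powr (1/\<sigma>) * r) powr (\<tau> - \<sigma>) * r powr \<sigma>"
  using g by (intro mult_left_mono) auto
 finally show ?thesis .
qed

text \<open>Summation over the dyadic pieces of a segment that runs straight into the boundary.\<close>
lemma d_met_radial:
 assumes seg: "\<And>t. 0 < t ==> t <= 1 ==> a + t *\<^sub>R (x - a) \<in> \<Omega> \<and> t * R <= bd (a + t *\<^sub>R (x - a))"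
  and R: "R = infnorm (x - a)" "0 < R" and \<sigma>: "0 < \<sigma>" "\<sigma> <= 1" and st: "0 < s" "s <= t" "t <= 1"
 shows "dmet \<sigma> (a + t *\<^sub>R (x - a)) (a + s *\<^sub>R (x - a)) <= (t * R) powr \<sigma> / (1 - (1/2) powr \<sigma>)"
proof -
 define p where "p t = a + t *\<^sub>R (x - a)" for t
 have p: "p t \<in> \<Omega>" if "0 < t" "t <= 1" for t using seg[OF that] by (simp add: p_def)
 have h1: "(1/2::real) powr \<sigma> < 1" using \<sigma> powr_less_mono2[of \<sigma> "1/2" 1] by simp
 have short: "dmet \<sigma> (p t) (p s) <= (t * R) powr \<sigma>" if "0 < t" "t/2 <= s" "s <= t" "t <= 1" for s t
 proof -
  have *: "z \<in> \<Omega> \<and> t * R / 2 <= bd z" if zs: "z \<in> closed_segment (p t) (p s)" for z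
  proof -
   obtain u where u: "0 <= u" "u <= 1" "z = (1 - u) *\<^sub>R p t + u *\<^sub>R p s" using zs by (auto simp: closed_segment_def)
   define w where "w = (1 - u) * t + u * s"
   have "z = p w" unfolding u(3) p_def w_def by (simp add: algebra_simps)
   moreover have w: "t / 2 <= w" "w <= t"
   proof -
    have "u * s <= u * t" "u * (t/2) <= u * s" using u \<open>s <= t\<close> \<open>t/2 <= s\<close> by (intro mult_left_mono; simp)+
    moreover have "u * t <= t" using u \<open>0 < t\<close> by (simp add: mult_left_le_one_le)
    ultimately show "t/2 <= w" "w <= t" by (auto simp: w_def algebra_simps)
   qed
   moreover have "t * R / 2 <= w * R" using w R(2) by (simp add: mult_right_mono[of "t/2" w R, simplified])
   ultimately show ?thesis using seg[of w] \<open>0 < t\<close> \<open>t <= 1\<close> by (auto simp: p_def)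
  qed
  have "dmet \<sigma> (p t) (p s) <= (t * R / 2) powr (\<sigma> - 1) * infnorm (p s - p t)"
   by (rule d_met_segment) (use * R(2) that \<sigma> in auto)
  also have "p s - p t = (s - t) *\<^sub>R (x - a)" by (simp add: p_def algebra_simps)
  then have "infnorm (p s - p t) = (t - s) * R" using that by (simp add: infnorm_mul R)
  also have "(t * R / 2) powr (\<sigma> - 1) * ((t - s) * R) <= (t * R / 2) powr (\<sigma> - 1) * (t * R / 2)"
   using that R(2) mult_right_mono[of "t - s" "t/2" R] by (intro mult_left_mono) auto
  also have "... = (t * R / 2) powr \<sigma>" using that R(2) by (simp add: powr_diff)
  also have "... <= (t * R) powr \<sigma>" using that R(2) \<sigma> by (intro powr_mono2) auto
  finally show ?thesis .
 qed
 define C where "C = 1 / (1 - (1/2::real) powr \<sigma>)"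
 have C: "C * (1/2) powr \<sigma> + 1 = C"
 proof -
  have "C * (1 - (1/2) powr \<sigma>) = 1" using h1 \<sigma> by (simp add: C_def)
  then show ?thesis by (simp add: right_diff_distrib)
 qed
 have C1: "1 <= C" using h1 by (simp add: C_def field_simps)
 have main: "\<forall>s t. 0 < t \<and> t <= 1 \<and> t / 2 ^ k <= s \<and> s <= t \<longrightarrow> dmet \<sigma> (p t) (p s) <= C * (t * R) powr \<sigma>" for k :: nat
 proof (induction k)
  case 0
  show ?case
  proof (intro allI impI)
   fix s t :: real assume a: "0 < t \<and> t <= 1 \<and> t / 2 ^ 0 <= s \<and> s <= t"
   then have "s = t" by simp
   then show "dmet \<sigma> (p t) (p s) <= C * (t * R) powr \<sigma>" using d_met_refl[OF p] a C1 by simp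
  qed
 next
  case (Suc k)
  show ?case
  proof (intro allI impI)
   fix s t :: real assume a: "0 < t \<and> t <= 1 \<and> t / 2 ^ Suc k <= s \<and> s <= t"
   show "dmet \<sigma> (p t) (p s) <= C * (t * R) powr \<sigma>"
   proof (cases "t / 2 <= s")
    case True
    have "1 * (t * R) powr \<sigma> <= C * (t * R) powr \<sigma>" using C1 by (intro mult_right_mono) auto
    then show ?thesis using short[of t s] a True by simp
   next
    case False
    have s0: "0 < s" using a by (meson divide_pos_pos less_le_trans zero_less_numeral zero_less_power)
    have "dmet \<sigma> (p t) (p s) <= dmet \<sigma> (p t) (p (t/2)) + dmet \<sigma> (p (t/2)) (p s)"
     using a s0 by (intro d_met_triangle p) auto
    also have "... <= (t * R) powr \<sigma> + C * ((t/2) * R) powr \<sigma>"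
    proof (rule add_mono)
     show "dmet \<sigma> (p t) (p (t/2)) <= (t * R) powr \<sigma>" using short[of t "t/2"] a by auto
     show "dmet \<sigma> (p (t/2)) (p s) <= C * ((t/2) * R) powr \<sigma>"
      using Suc.IH[rule_format, of "t/2" s] a False by (auto simp: field_simps)
    qed
    also have "((t/2) * R) powr \<sigma> = (1/2) powr \<sigma> * (t * R) powr \<sigma>"
     using a R(2) by (simp flip: powr_mult)
    also have "(t * R) powr \<sigma> + C * ((1/2) powr \<sigma> * (t * R) powr \<sigma>) = (C * (1/2) powr \<sigma> + 1) * (t * R) powr \<sigma>"
     by (simp add: algebra_simps)
    finally show ?thesis unfolding C .
   qed
  qed
 qed
 obtain k :: nat where k: "t / s < 2 ^ k" using real_arch_pow[of 2 "t/s"] by auto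
 then have "t / 2 ^ k <= s" using st(1) by (simp add: field_simps)
 then show ?thesis using main[of k] st by (auto simp: p_def C_def)
qed

section \<open>The completion\<close>

lemma rho_tendsto_0_iff:
 assumes "\<And>i. x i \<in> \<Omega>" "\<And>i. y i \<in> \<Omega>" "0 < \<sigma>"
 shows "(\<lambda>i. rho_met \<sigma> \<Omega> (x i) (y i)) \<longlonglongrightarrow> 0 \<longleftrightarrow>
  (\<lambda>i. dmet \<sigma> (x i) (y i)) \<longlonglongrightarrow> 0 \<and> (\<lambda>i. infnorm (x i - y i)) \<longlonglongrightarrow> 0"
proof safe
 assume r: "(\<lambda>i. rho_met \<sigma> \<Omega> (x i) (y i)) \<longlonglongrightarrow> 0"
 have n: "0 <= dmet \<sigma> (x i) (y i)" for i using assms by (intro d_met_nonneg)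
 show "(\<lambda>i. dmet \<sigma> (x i) (y i)) \<longlonglongrightarrow> 0"
  by (rule tendsto_sandwich[OF _ _ tendsto_const r]) (use n in \<open>auto simp: rho_met_def\<close>)
 have "(\<lambda>i. infnorm (x i - y i) powr \<sigma>) \<longlonglongrightarrow> 0"
  by (rule tendsto_sandwich[OF _ _ tendsto_const r]) (use n in \<open>auto simp: rho_met_def\<close>)
 then have "(\<lambda>i. (infnorm (x i - y i) powr \<sigma>) powr (1/\<sigma>)) \<longlonglongrightarrow> 0"
  by (rule tendsto_zero_powrI[OF _ tendsto_const]) (use assms in auto)
 then show "(\<lambda>i. infnorm (x i - y i)) \<longlonglongrightarrow> 0" using assms by (simp add: powr_powr infnorm_pos_le)
next
 assume r: "(\<lambda>i. dmet \<sigma> (x i) (y i)) \<longlonglongrightarrow> 0" "(\<lambda>i. infnorm (x i - y i)) \<longlonglongrightarrow> 0"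
 have "(\<lambda>i. infnorm (x i - y i) powr \<sigma>) \<longlonglongrightarrow> 0"
  using assms r by (intro tendsto_zero_powrI[OF _ tendsto_const]) (auto simp: infnorm_pos_le)
 from tendsto_add[OF r(1) this] show "(\<lambda>i. rho_met \<sigma> \<Omega> (x i) (y i)) \<longlonglongrightarrow> 0" by (simp add: rho_met_def)
qed

lemma rho_Cauchy_iff:
 assumes "0 < \<sigma>"
 shows "rho_Cauchy \<sigma> \<Omega> x \<longleftrightarrow> range x \<subseteq> \<Omega> \<and> (\<forall>e>0. \<exists>N. \<forall>i\<ge>N. \<forall>j\<ge>N. dmet \<sigma> (x i) (x j) < e)
   \<and> (\<forall>e>0. \<exists>N. \<forall>i\<ge>N. \<forall>j\<ge>N. infnorm (x i - x j) < e)" (is "?L \<longleftrightarrow> ?R")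
proof
 assume L: ?L
 then have r: "range x \<subseteq> \<Omega>" by (simp add: rho_Cauchy_def)
 have n: "0 <= dmet \<sigma> (x i) (x j)" for i j using r by (intro d_met_nonneg) auto
 have 1: "\<exists>N. \<forall>i\<ge>N. \<forall>j\<ge>N. dmet \<sigma> (x i) (x j) < e" if e: "e > 0" for e
 proof -
  obtain N where "\<forall>i\<ge>N. \<forall>j\<ge>N. rho_met \<sigma> \<Omega> (x i) (x j) < e" using L e unfolding rho_Cauchy_def by blast
  then show ?thesis unfolding rho_met_def by (smt (verit) powr_ge_zero)
 qed
 have 2: "\<exists>N. \<forall>i\<ge>N. \<forall>j\<ge>N. infnorm (x i - x j) < e" if "e > 0" for e
 proof -
  have "e powr \<sigma> > 0" using that by simp
  then obtain N where N: "\<And>i j. i \<ge> N ==> j \<ge> N ==> rho_met \<sigma> \<Omega> (x i) (x j) < e powr \<sigma>" using L unfolding rho_Cauchy_def by metis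
  have "infnorm (x i - x j) < e" if "i \<ge> N" "j \<ge> N" for i j
  proof -
   have "infnorm (x i - x j) powr \<sigma> < e powr \<sigma>" using N[OF that] n[of i j] unfolding rho_met_def by linarith
   then show ?thesis using assms \<open>e > 0\<close> by (metis infnorm_pos_le less_imp_le not_le powr_mono2)
  qed
  then show ?thesis by blast
 qed
 show ?R using r 1 2 by blast
next
 assume R: ?R
 show ?L unfolding rho_Cauchy_def
 proof (intro conjI allI impI)
  fix e :: real assume e: "e > 0"
  then have "e / 2 > 0" "(e/2) powr (1/\<sigma>) > 0" by auto
  then obtain N1 N2 where N: "\<And>i j. i \<ge> N1 ==> j \<ge> N1 ==> dmet \<sigma> (x i) (x j) < e / 2"
   "\<And>i j. i \<ge> N2 ==> j \<ge> N2 ==> infnorm (x i - x j) < (e / 2) powr (1/\<sigma>)" using R by metis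
  have "rho_met \<sigma> \<Omega> (x i) (x j) < e" if "i \<ge> max N1 N2" "j \<ge> max N1 N2" for i j
  proof -
   have "infnorm (x i - x j) powr \<sigma> < ((e / 2) powr (1/\<sigma>)) powr \<sigma>"
    using N(2)[of i j] that assms by (intro powr_less_mono2) (auto simp: infnorm_pos_le)
   then have "infnorm (x i - x j) powr \<sigma> < e / 2" using assms e by (simp add: powr_powr)
   then show ?thesis using N(1)[of i j] that unfolding rho_met_def by simp
  qed
  then show "\<exists>N. \<forall>i\<ge>N. \<forall>j\<ge>N. rho_met \<sigma> \<Omega> (x i) (x j) < e" by blast
 qed (use R in blast)
qed

lemma rho_CauchyD: "rho_Cauchy \<sigma> \<Omega> x ==> x i \<in> \<Omega>"
 by (auto simp: rho_Cauchy_def)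

lemma cauchy_equiv_iff:
 assumes "0 < \<sigma>"
 shows "(x, y) \<in> cauchy_equiv \<sigma> \<Omega> \<longleftrightarrow> rho_Cauchy \<sigma> \<Omega> x \<and> rho_Cauchy \<sigma> \<Omega> y \<and>
  (\<lambda>i. dmet \<sigma> (x i) (y i)) \<longlonglongrightarrow> 0 \<and> (\<lambda>i. infnorm (x i - y i)) \<longlonglongrightarrow> 0"
 using rho_tendsto_0_iff[of x y \<sigma>] assms rho_CauchyD unfolding cauchy_equiv_def by blast

lemma equiv_cauchy:
 assumes "0 < \<sigma>" shows "equiv {x. rho_Cauchy \<sigma> \<Omega> x} (cauchy_equiv \<sigma> \<Omega>)"
proof (rule equivI)
 show "cauchy_equiv \<sigma> \<Omega> \<subseteq> {x. rho_Cauchy \<sigma> \<Omega> x} \<times> {x. rho_Cauchy \<sigma> \<Omega> x}" by (auto simp: cauchy_equiv_def)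
 show "refl_on {x. rho_Cauchy \<sigma> \<Omega> x} (cauchy_equiv \<sigma> \<Omega>)"
  by (auto simp: refl_on_def cauchy_equiv_iff[OF assms] d_met_refl rho_CauchyD infnorm_0)
 show "sym (cauchy_equiv \<sigma> \<Omega>)"
 proof (rule symI)
  fix x y assume "(x, y) \<in> cauchy_equiv \<sigma> \<Omega>"
  then show "(y, x) \<in> cauchy_equiv \<sigma> \<Omega>"
   using d_met_sym rho_CauchyD by (auto simp: cauchy_equiv_iff[OF assms] infnorm_sub)
 qed
 show "trans (cauchy_equiv \<sigma> \<Omega>)"
 proof (rule transI)
  fix x y z assume "(x, y) \<in> cauchy_equiv \<sigma> \<Omega>" "(y, z) \<in> cauchy_equiv \<sigma> \<Omega>"
  then have h: "rho_Cauchy \<sigma> \<Omega> x" "rho_Cauchy \<sigma> \<Omega> y" "rho_Cauchy \<sigma> \<Omega> z"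
   "(\<lambda>i. dmet \<sigma> (x i) (y i) + dmet \<sigma> (y i) (z i)) \<longlonglongrightarrow> 0 + 0"
   "(\<lambda>i. infnorm (x i - y i) + infnorm (y i - z i)) \<longlonglongrightarrow> 0 + 0"
   by (auto simp only: cauchy_equiv_iff[OF assms] intro!: tendsto_add)
  have "(\<lambda>i. dmet \<sigma> (x i) (z i)) \<longlonglongrightarrow> 0"
   by (rule tendsto_sandwich[OF _ _ tendsto_const h(4)[simplified]])
    (use h(1-3) rho_CauchyD in \<open>auto intro!: always_eventually d_met_nonneg d_met_triangle\<close>)
  moreover have "(\<lambda>i. infnorm (x i - z i)) \<longlonglongrightarrow> 0"
   by (rule tendsto_sandwich[OF _ _ tendsto_const h(5)[simplified]])
    (auto intro!: always_eventually infnorm_triangle_diff simp: infnorm_pos_le)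
  ultimately show "(x, z) \<in> cauchy_equiv \<sigma> \<Omega>" using h by (simp add: cauchy_equiv_iff[OF assms])
 qed
qed

context
 fixes \<sigma> :: real assumes \<sigma>: "0 < \<sigma>" "\<sigma> <= 1"
begin

lemma mem_cclass_iff: "y \<in> cclass \<sigma> \<Omega> x \<longleftrightarrow> (x, y) \<in> cauchy_equiv \<sigma> \<Omega>"
 by (simp add: cclass_def)

lemma completed_cclass: "rho_Cauchy \<sigma> \<Omega> x ==> cclass \<sigma> \<Omega> x \<in> completed \<sigma> \<Omega>"
 and cclass_self: "rho_Cauchy \<sigma> \<Omega> x ==> x \<in> cclass \<sigma> \<Omega> x"
 using equiv_class_self[OF equiv_cauchy[OF \<sigma>(1)], of x] by (auto simp: completed_def cclass_def quotient_def)

lemma completed_eq_cclass: "\<omega> \<in> completed \<sigma> \<Omega> ==> x \<in> \<omega> ==> \<omega> = cclass \<sigma> \<Omega> x"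
 unfolding completed_def cclass_def
 by (metis equiv_cauchy[OF \<sigma>(1)] Image_singleton_iff equiv_class_eq quotientE)

lemma completed_nonempty: "\<omega> \<in> completed \<sigma> \<Omega> ==> \<exists>x. x \<in> \<omega>"
 unfolding completed_def using in_quotient_imp_non_empty[OF equiv_cauchy[OF \<sigma>(1)]] by blast

lemma completed_equiv: "\<omega> \<in> completed \<sigma> \<Omega> ==> x \<in> \<omega> ==> y \<in> \<omega> ==> (x, y) \<in> cauchy_equiv \<sigma> \<Omega>"
 using completed_eq_cclass mem_cclass_iff by blast

lemma completed_Cauchy: "\<omega> \<in> completed \<sigma> \<Omega> ==> x \<in> \<omega> ==> rho_Cauchy \<sigma> \<Omega> x"
 using completed_equiv[of \<omega> x x] by (simp add: cauchy_equiv_def)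

lemma cclass_eqI: "(x, y) \<in> cauchy_equiv \<sigma> \<Omega> ==> cclass \<sigma> \<Omega> x = cclass \<sigma> \<Omega> y"
 unfolding cclass_def by (rule equiv_class_eq[OF equiv_cauchy[OF \<sigma>(1)]])

lemma const_Cauchy: "x \<in> \<Omega> ==> rho_Cauchy \<sigma> \<Omega> (\<lambda>_. x)"
 using \<sigma> by (auto simp: rho_Cauchy_iff d_met_refl infnorm_0)

lemma embed_completed: "x \<in> \<Omega> ==> embed \<sigma> \<Omega> x \<in> completed \<sigma> \<Omega>" "x \<in> \<Omega> ==> (\<lambda>_. x) \<in> embed \<sigma> \<Omega> x"
 unfolding embed_def by (auto intro: completed_cclass cclass_self const_Cauchy)

text \<open>The distances between the terms of two Cauchy sequences form a Cauchy sequence of reals whose limit is the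
 same for equivalent sequences; so the description of \<^const>\<open>d_bar\<close> determines exactly one number.\<close>
lemma d_bar_tendsto:
 assumes w: "\<omega>1 \<in> completed \<sigma> \<Omega>" "\<omega>2 \<in> completed \<sigma> \<Omega>" and xy: "x \<in> \<omega>1" "y \<in> \<omega>2"
 shows "(\<lambda>i. dmet \<sigma> (x i) (y i)) \<longlonglongrightarrow> dbar \<sigma> \<omega>1 \<omega>2"
proof -
 note C = completed_Cauchy[OF w(1)] completed_Cauchy[OF w(2)]
 note in\<Omega> = rho_CauchyD[OF C(1)] rho_CauchyD[OF C(2)]
 have tri: "\<bar>dmet \<sigma> a b - dmet \<sigma> a' b'\<bar> <= dmet \<sigma> a a' + dmet \<sigma> b b'"
  if "a \<in> \<Omega>" "b \<in> \<Omega>" "a' \<in> \<Omega>" "b' \<in> \<Omega>" for a b a' b'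
  using that d_met_triangle[of a a' b \<sigma>] d_met_triangle[of a' b' b \<sigma>] d_met_triangle[of a' a b' \<sigma>]
   d_met_triangle[of a b b' \<sigma>] d_met_sym[of a a' \<sigma>] d_met_sym[of b b' \<sigma>] by (auto simp: abs_le_iff)
 have "Cauchy (\<lambda>i. dmet \<sigma> (x i) (y i))"
 proof (rule metric_CauchyI)
  fix e :: real assume "e > 0"
  then have "e / 2 > 0" by simp
  then obtain N1 N2 where N: "\<And>i j. i \<ge> N1 ==> j \<ge> N1 ==> dmet \<sigma> (x i) (x j) < e / 2"
   "\<And>i j. i \<ge> N2 ==> j \<ge> N2 ==> dmet \<sigma> (y i) (y j) < e / 2"
   using C(1)[OF xy(1)] C(2)[OF xy(2)] unfolding rho_Cauchy_iff[OF \<sigma>(1)] by metis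
  have "dist (dmet \<sigma> (x i) (y i)) (dmet \<sigma> (x j) (y j)) < e" if "i \<ge> max N1 N2" "j \<ge> max N1 N2" for i j
   using tri[of "x i" "y i" "x j" "y j"] in\<Omega>(1)[OF xy(1)] in\<Omega>(2)[OF xy(2)] N(1)[of i j] N(2)[of i j] that
   by (simp add: dist_real_def)
  then show "\<exists>M. \<forall>m\<ge>M. \<forall>n\<ge>M. dist (dmet \<sigma> (x m) (y m)) (dmet \<sigma> (x n) (y n)) < e" by blast
 qed
 then obtain l where l: "(\<lambda>i. dmet \<sigma> (x i) (y i)) \<longlonglongrightarrow> l" using Cauchy_convergent_iff convergent_def by blast
 have all: "(\<lambda>i. dmet \<sigma> (x' i) (y' i)) \<longlonglongrightarrow> l" if "x' \<in> \<omega>1" "y' \<in> \<omega>2" for x' y'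
 proof -
  have "(\<lambda>i. dmet \<sigma> (x' i) (x i) + dmet \<sigma> (y' i) (y i)) \<longlonglongrightarrow> 0 + 0"
   using completed_equiv[OF w(1) that(1) xy(1)] completed_equiv[OF w(2) that(2) xy(2)]
   by (intro tendsto_add) (auto simp: cauchy_equiv_iff[OF \<sigma>(1)])
  then have "(\<lambda>i. dmet \<sigma> (x' i) (y' i) - dmet \<sigma> (x i) (y i)) \<longlonglongrightarrow> 0"
   by (rule Lim_null_comparison[rotated, OF tendsto_eq_rhs])
    (simp, intro always_eventually allI, simp only: real_norm_def,
     intro tri in\<Omega>(1)[OF that(1)] in\<Omega>(2)[OF that(2)] in\<Omega>(1)[OF xy(1)] in\<Omega>(2)[OF xy(2)])
  from tendsto_add[OF this l] show ?thesis by simp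
 qed
 have "dbar \<sigma> \<omega>1 \<omega>2 = l" unfolding d_bar_def
 proof (rule the_equality)
  fix l' assume "\<forall>x\<in>\<omega>1. \<forall>y\<in>\<omega>2. (\<lambda>i. dmet \<sigma> (x i) (y i)) \<longlonglongrightarrow> l'"
  then show "l' = l" using xy l LIMSEQ_unique by blast
 qed (use all in blast)
 with l show ?thesis by simp
qed

lemma d_bar_embed_tendsto:
 "x \<in> \<Omega> ==> \<omega> \<in> completed \<sigma> \<Omega> ==> y \<in> \<omega> ==>
  (\<lambda>i. dmet \<sigma> x (y i)) \<longlonglongrightarrow> d_to \<sigma> x \<omega>"
 using d_bar_tendsto[OF embed_completed(1) _ embed_completed(2)] by blast

lemma d_bar_nonneg:
 assumes "\<omega>1 \<in> completed \<sigma> \<Omega>" "\<omega>2 \<in> completed \<sigma> \<Omega>" shows "0 <= dbar \<sigma> \<omega>1 \<omega>2"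
proof -
 obtain x y where xy: "x \<in> \<omega>1" "y \<in> \<omega>2" using completed_nonempty assms by blast
 show ?thesis
  by (rule LIMSEQ_le_const[OF d_bar_tendsto[OF assms xy]])
   (use d_met_nonneg[OF rho_CauchyD[OF completed_Cauchy[OF assms(1) xy(1)]] rho_CauchyD[OF completed_Cauchy[OF assms(2) xy(2)]]] in auto)
qed

lemma d_bar_triangle:
 assumes "\<omega>1 \<in> completed \<sigma> \<Omega>" "\<omega>2 \<in> completed \<sigma> \<Omega>" "\<omega>3 \<in> completed \<sigma> \<Omega>"
 shows "dbar \<sigma> \<omega>1 \<omega>3 <= dbar \<sigma> \<omega>1 \<omega>2 + dbar \<sigma> \<omega>2 \<omega>3"
proof -
 obtain x y z where xyz: "x \<in> \<omega>1" "y \<in> \<omega>2" "z \<in> \<omega>3" using completed_nonempty assms by metis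
 show ?thesis
  by (rule LIMSEQ_le[OF d_bar_tendsto[OF assms(1,3) xyz(1,3)]
     tendsto_add[OF d_bar_tendsto[OF assms(1,2) xyz(1,2)] d_bar_tendsto[OF assms(2,3) xyz(2,3)]]])
   (use d_met_triangle rho_CauchyD completed_Cauchy assms xyz in blast)
qed

lemma d_bar_embed_le:
 assumes "x \<in> \<Omega>" "x' \<in> \<Omega>" "\<omega> \<in> completed \<sigma> \<Omega>"
 shows "d_to \<sigma> x \<omega> <= dmet \<sigma> x x' + d_to \<sigma> x' \<omega>"
proof -
 have "d_to \<sigma> x (embed \<sigma> \<Omega> x') = dmet \<sigma> x x'"
  using d_bar_tendsto[OF embed_completed(1)[OF assms(1)] embed_completed(1)[OF assms(2)] embed_completed(2)[OF assms(1)] embed_completed(2)[OF assms(2)]]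
   LIMSEQ_unique tendsto_const by blast
 then show ?thesis using d_bar_triangle[OF embed_completed(1)[OF assms(1)] embed_completed(1)[OF assms(2)] assms(3)] by simp
qed

lemma bdry_completed: "\<omega> \<in> bdry \<sigma> ==> \<omega> \<in> completed \<sigma> \<Omega>"
 by (simp add: alpha_bdry_def)

lemma rho_Cauchy_convergent:
 assumes "rho_Cauchy \<sigma> \<Omega> y" obtains z where "y \<longlonglongrightarrow> z" "(\<lambda>i. infnorm (y i - z)) \<longlonglongrightarrow> 0"
proof -
 have c: "\<exists>N. \<forall>i\<ge>N. \<forall>j\<ge>N. infnorm (y i - y j) < e" if "e > 0" for e
  using assms that unfolding rho_Cauchy_iff[OF \<sigma>(1)] by blast
 have "Cauchy y"
 proof (rule metric_CauchyI)
  fix e :: real assume e: "e > 0"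
  define c where "c = sqrt (real DIM(real^'n))"
  have c0: "c > 0" by (simp add: c_def)
  obtain N where N: "\<And>i j. i \<ge> N ==> j \<ge> N ==> infnorm (y i - y j) < e / c" using c[of "e / c"] e c0 by auto
  have "dist (y i) (y j) < e" if "i \<ge> N" "j \<ge> N" for i j
  proof -
   have "dist (y i) (y j) <= c * infnorm (y i - y j)" using norm_le_infnorm[of "y i - y j"] by (simp add: dist_norm c_def)
   also have "... < c * (e / c)" using N[OF that] c0 by (intro mult_strict_left_mono) auto
   finally show ?thesis using c0 by simp
  qed
  then show "\<exists>M. \<forall>m\<ge>M. \<forall>n\<ge>M. dist (y m) (y n) < e" by blast
 qed
 then obtain z where z: "y \<longlonglongrightarrow> z" using Cauchy_convergent_iff convergent_def by blast
 then have "(\<lambda>i. y i - z) \<longlonglongrightarrow> 0" by (simp add: LIM_zero)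
 from tendsto_infnorm[OF this] have "(\<lambda>i. infnorm (y i - z)) \<longlonglongrightarrow> 0" by (simp add: infnorm_0)
 with z that show thesis by blast
qed

text \<open>A limit point inside \<open>\<Omega>\<close> would identify the class with that point, because the intrinsic metric
 is locally bounded by the uniform norm.\<close>
lemma bdry_bd_tendsto_0:
 assumes w: "\<omega> \<in> bdry \<sigma>" and y: "y \<in> \<omega>" shows "(\<lambda>i. bd (y i)) \<longlonglongrightarrow> 0"
proof -
 have C: "rho_Cauchy \<sigma> \<Omega> y" using completed_Cauchy[OF bdry_completed[OF w] y] .
 obtain z where z: "y \<longlonglongrightarrow> z" "(\<lambda>i. infnorm (y i - z)) \<longlonglongrightarrow> 0" by (rule rho_Cauchy_convergent[OF C])
 have "z \<notin> \<Omega>"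
 proof
  assume zO: "z \<in> \<Omega>"
  have "\<forall>\<^sub>F i in sequentially. infnorm (y i - z) < bd z / 2"
   using z(2) bd_pos[OF zO] by (intro order_tendstoD(2)) auto
  then have "\<forall>\<^sub>F i in sequentially. norm (dmet \<sigma> (y i) z) <= (bd z / 2) powr (\<sigma> - 1) * infnorm (y i - z)"
  proof eventually_elim
   case (elim i)
   then show ?case using d_met_local(1)[OF zO, of "y i" \<sigma>] \<sigma> d_met_sym[OF zO rho_CauchyD[OF C], of \<sigma> i]
     d_met_nonneg[OF zO rho_CauchyD[OF C], of \<sigma> i] by simp
  qed
  moreover have "(\<lambda>i. (bd z / 2) powr (\<sigma> - 1) * infnorm (y i - z)) \<longlonglongrightarrow> 0"
   using tendsto_mult_right_zero[OF z(2)] .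
  ultimately have "(\<lambda>i. dmet \<sigma> (y i) z) \<longlonglongrightarrow> 0" by (rule Lim_null_comparison)
  then have "(y, \<lambda>_. z) \<in> cauchy_equiv \<sigma> \<Omega>" using C z(2) const_Cauchy[OF zO] by (simp add: cauchy_equiv_iff[OF \<sigma>(1)])
  then have "\<omega> = embed \<sigma> \<Omega> z" using completed_eq_cclass[OF bdry_completed[OF w] y] cclass_eqI by (simp add: embed_def)
  then show False using w zO by (auto simp: alpha_bdry_def)
 qed
 moreover have "z \<in> closure \<Omega>" using z(1) rho_CauchyD[OF C] closure_sequential by blast
 ultimately have zf: "z \<in> frontier \<Omega>" using op by (simp add: frontier_def interior_open)
 show ?thesis
  by (rule tendsto_sandwich[OF _ _ tendsto_const z(2)])
   (auto intro!: always_eventually udist_le[OF zf] bd_nonneg)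
qed

lemma mem_bdryI:
 assumes "rho_Cauchy \<sigma> \<Omega> y" "(\<lambda>i. bd (y i)) \<longlonglongrightarrow> 0" shows "cclass \<sigma> \<Omega> y \<in> bdry \<sigma>"
proof -
 have False if x: "x \<in> \<Omega>" and e: "cclass \<sigma> \<Omega> y = embed \<sigma> \<Omega> x" for x
 proof -
  have "(\<lambda>_. x) \<in> cclass \<sigma> \<Omega> y" using e embed_completed(2)[OF x] by simp
  then have "(\<lambda>i. infnorm (y i - x)) \<longlonglongrightarrow> 0" by (simp add: mem_cclass_iff cauchy_equiv_iff[OF \<sigma>(1)])
  from tendsto_add[OF assms(2) this] have "(\<lambda>i. bd (y i) + infnorm (y i - x)) \<longlonglongrightarrow> 0" by simp
  then have "bd x <= 0" by (rule LIMSEQ_le_const) (use bd_lipschitz[of x] infnorm_sub in metis)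
  then show False using bd_pos[OF x] by simp
 qed
 then show ?thesis using completed_cclass[OF assms(1)] by (auto simp: alpha_bdry_def)
qed

end

text \<open>A segment that stays at a proportional distance from the boundary while it runs towards \<open>a\<close> is a Cauchy
 sequence, since its dyadic pieces have geometrically decreasing weighted length.  Its class is a boundary
 point because the distance to the boundary tends to zero.\<close>
lemma radial_boundary_point:
 assumes seg: "\<And>t. 0 < t ==> t <= 1 ==> a + t *\<^sub>R (x - a) \<in> \<Omega> \<and> t * R <= bd (a + t *\<^sub>R (x - a))"
  and a: "a \<in> frontier \<Omega>" and R: "R = infnorm (x - a)" "0 < R" and \<sigma>: "0 < \<sigma>" "\<sigma> <= 1"
  and y: "y = (\<lambda>i. a + (1 / real (Suc i)) *\<^sub>R (x - a))"
 shows "rho_Cauchy \<sigma> \<Omega> y" "cclass \<sigma> \<Omega> y \<in> bdry \<sigma>"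
  "d_to \<sigma> x (cclass \<sigma> \<Omega> y) <= R powr \<sigma> / (1 - (1/2) powr \<sigma>)"
proof -
 define c where "c = 1 / (1 - (1/2::real) powr \<sigma>)"
 have yO: "y i \<in> \<Omega>" for i using seg[of "1 / real (Suc i)"] by (auto simp: y)
 have dle: "dmet \<sigma> (y i) (y j) <= c * (R / real (Suc i)) powr \<sigma>" if "i <= j" for i j
  using d_met_radial[OF seg R \<sigma>, of "1 / real (Suc j)" "1 / real (Suc i)"] that
  by (simp add: y c_def frac_le)
 have lim: "(\<lambda>i. R / real (Suc i)) \<longlonglongrightarrow> 0"
  using LIMSEQ_Suc[OF lim_const_over_n[of R]] by simp
 then have lim2: "(\<lambda>i. c * (R / real (Suc i)) powr \<sigma>) \<longlonglongrightarrow> 0"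
  using \<sigma> R by (intro tendsto_mult_right_zero tendsto_zero_powrI[OF _ tendsto_const]) auto
 have na: "infnorm (y i - a) = R / real (Suc i)" for i by (simp add: y infnorm_mul R)
 show C: "rho_Cauchy \<sigma> \<Omega> y" unfolding rho_Cauchy_iff[OF \<sigma>(1)]
 proof (intro conjI allI impI)
  show "range y \<subseteq> \<Omega>" using yO by auto
  fix e :: real assume e: "e > 0"
  obtain N where N: "\<And>i. i \<ge> N ==> c * (R / real (Suc i)) powr \<sigma> < e"
   using order_tendstoD(2)[OF lim2 e] unfolding eventually_sequentially by blast
  have "dmet \<sigma> (y i) (y j) < e" if "i \<ge> N" "j \<ge> N" for i j
   using dle[of i j] dle[of j i] N[OF that(1)] N[OF that(2)] d_met_sym[OF yO yO, of \<sigma> i j]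
   by (cases "i <= j") auto
  then show "\<exists>N. \<forall>i\<ge>N. \<forall>j\<ge>N. dmet \<sigma> (y i) (y j) < e" by blast
  obtain N where N: "\<And>i. i \<ge> N ==> R / real (Suc i) < e / 2"
   using order_tendstoD(2)[OF lim, of "e/2"] e unfolding eventually_sequentially by auto
  have "infnorm (y i - y j) < e" if "i \<ge> N" "j \<ge> N" for i j
   using infnorm_triangle_diff[of "y i" "y j" a] na[of i] na[of j] N[OF that(1)] N[OF that(2)] infnorm_sub[of a "y j"] by linarith
  then show "\<exists>N. \<forall>i\<ge>N. \<forall>j\<ge>N. infnorm (y i - y j) < e" by blast
 qed
 show w: "cclass \<sigma> \<Omega> y \<in> bdry \<sigma>"
 proof (rule mem_bdryI[OF \<sigma> C])
  show "(\<lambda>i. bd (y i)) \<longlonglongrightarrow> 0"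
   by (rule tendsto_sandwich[OF _ _ tendsto_const lim])
    (use udist_le[OF a, of "y _"] in \<open>auto intro!: always_eventually bd_nonneg simp only: na\<close>)
 qed
 have x: "x \<in> \<Omega>" "y 0 = x" using yO[of 0] by (auto simp: y)
 have "d_to \<sigma> x (cclass \<sigma> \<Omega> y) <= c * R powr \<sigma>"
  by (rule LIMSEQ_le_const2[OF d_bar_embed_tendsto[OF \<sigma> x(1) bdry_completed[OF \<sigma> w] cclass_self[OF \<sigma> C]]])
   (use dle[of 0] x in auto)
 then show "d_to \<sigma> x (cclass \<sigma> \<Omega> y) <= R powr \<sigma> / (1 - (1/2) powr \<sigma>)" by (simp add: c_def)
qed

text \<open>The segment from a point to a nearest boundary point stays inside the cubes around that point.\<close>
lemma nearest_radial:
 assumes x: "x \<in> \<Omega>" and "a \<in> frontier \<Omega>" and R: "infnorm (x - a) = R" "R <= bd x" and t: "0 < t" "t <= 1"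
 shows "a + t *\<^sub>R (x - a) \<in> \<Omega> \<and> t * R <= bd (a + t *\<^sub>R (x - a))"
proof -
 let ?z = "a + t *\<^sub>R (x - a)"
 have "?z - x = (1 - t) *\<^sub>R (a - x)" by (simp add: algebra_simps)
 then have "infnorm (?z - x) = (1 - t) * R" using t R by (simp add: infnorm_mul infnorm_sub)
 moreover have "0 < bd x" by (rule bd_pos[OF x])
 moreover have "(1 - t) * R <= (1 - t) * bd x" using t R(2) by (intro mult_left_mono) auto
 moreover have "R - (1 - t) * R = t * R" by (simp add: algebra_simps)
 ultimately show ?thesis using bd_half(1)[OF x, of ?z "1 - t"] bd_lipschitz[of x ?z] t R infnorm_sub[of x ?z] by auto
qed

context
 fixes \<beta> \<alpha> :: real assumes \<beta>: "0 < \<beta>" "\<beta> <= \<alpha>" and \<alpha>: "\<alpha> <= 1"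
begin

text \<open>A bound that is linear in the metric with the smaller exponent transports Cauchy sequences and their
 equivalence to the larger exponent, so that \<^const>\<open>change_exponent\<close> does not depend on representatives.\<close>
lemma d_met_exponent_linear:
 assumes x: "x \<in> \<Omega>" "y \<in> \<Omega>" and b: "bd x <= b" and d: "dmet \<beta> x y < 1"
 shows "dmet \<alpha> x y <= max (2 * b) (2 powr (1/\<beta>)) powr (\<alpha> - \<beta>) * dmet \<beta> x y"
proof -
 let ?d = "dmet \<beta> x y" and ?C = "max (2 * b) (2 powr (1/\<beta>)) powr (\<alpha> - \<beta>)"
 have d0: "0 <= ?d" by (rule d_met_nonneg[OF x])
 have "dmet \<alpha> x y <= ?C * ?d + ?C * e" if e: "0 < e" "e <= 1 - ?d" for e
 proof -
  define r where "r = (?d + e) powr (1/\<beta>)"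
  have r: "r powr \<beta> = ?d + e" "0 < r" using \<beta> d0 e by (auto simp: r_def powr_powr)
  have r1: "r <= 1" unfolding r_def using e d0 \<beta> by (intro powr_le1) auto
  have "dmet \<alpha> x y <= max (2 * b) (2 powr (1/\<beta>) * r) powr (\<alpha> - \<beta>) * r powr \<beta>"
   by (rule d_met_exponent[OF x \<beta>(1) _ \<beta>(2) r(2)]) (use \<beta> \<alpha> r e b in auto)
  also have "... <= ?C * r powr \<beta>"
   using \<beta> r1 r d0 e bd_nonneg[of x] b by (intro mult_right_mono powr_mono2 max.mono) (auto simp: mult_left_le le_max_iff_disj)
  finally show ?thesis by (simp add: r algebra_simps)
 qed
 moreover have "((\<lambda>e. ?C * ?d + ?C * e) \<longlongrightarrow> ?C * ?d + ?C * 0) (at_right 0)" by (intro tendsto_intros)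
 ultimately show ?thesis
  by (intro tendsto_lowerbound[of "\<lambda>e. ?C * ?d + ?C * e" "?C * ?d" "at_right 0"])
   (use d in \<open>auto intro!: eventually_at_rightI[of 0 "1 - ?d"]\<close>)
qed

lemma rho_Cauchy_exponent:
 assumes C: "rho_Cauchy \<beta> \<Omega> x" shows "rho_Cauchy \<alpha> \<Omega> x"
proof -
 have p: "0 < \<alpha>" using \<beta> by simp
 have r: "range x \<subseteq> \<Omega>" and d: "\<And>e. e > 0 ==> \<exists>N. \<forall>i\<ge>N. \<forall>j\<ge>N. dmet \<beta> (x i) (x j) < e"
  and i: "\<And>e. e > 0 ==> \<exists>N. \<forall>i\<ge>N. \<forall>j\<ge>N. infnorm (x i - x j) < e"
  using C unfolding rho_Cauchy_iff[OF \<beta>(1)] by auto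
 obtain N0 where N0: "\<And>i j. i \<ge> N0 ==> j \<ge> N0 ==> infnorm (x i - x j) < 1" using i[of 1] by auto
 define b where "b = bd (x N0) + 1"
 have b: "bd (x i) <= b" if "i \<ge> N0" for i
  using bd_lipschitz[of "x i" "x N0"] N0[OF that order_refl] by (simp add: b_def)
 define K where "K = max (2 * b) (2 powr (1/\<beta>)) powr (\<alpha> - \<beta>)"
 have K: "K > 0" unfolding K_def by (metis less_max_iff_disj powr_gt_zero less_irrefl zero_less_numeral)
 have "\<exists>N. \<forall>i\<ge>N. \<forall>j\<ge>N. dmet \<alpha> (x i) (x j) < e" if e: "e > 0" for e
 proof -
  obtain N where N: "\<And>i j. i \<ge> N ==> j \<ge> N ==> dmet \<beta> (x i) (x j) < min 1 (e / K)"
   using d[of "min 1 (e / K)"] K e by auto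
  have "dmet \<alpha> (x i) (x j) < e" if "i \<ge> max N0 N" "j \<ge> max N0 N" for i j
  proof -
   have "dmet \<beta> (x i) (x j) < 1" "dmet \<beta> (x i) (x j) < e / K" using N[of i j] that by auto
   then have "dmet \<alpha> (x i) (x j) <= K * dmet \<beta> (x i) (x j)" "K * dmet \<beta> (x i) (x j) < e"
    using d_met_exponent_linear[of "x i" "x j" b] r b[of i] that K by (auto simp: K_def field_simps)
   then show ?thesis by simp
  qed
  then show ?thesis by blast
 qed
 then show ?thesis using r i unfolding rho_Cauchy_iff[OF p] by blast
qed

lemma cauchy_equiv_exponent:
 assumes C: "(x, y) \<in> cauchy_equiv \<beta> \<Omega>" shows "(x, y) \<in> cauchy_equiv \<alpha> \<Omega>"
proof -
 have p: "0 < \<alpha>" using \<beta> by simp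
 have h: "rho_Cauchy \<beta> \<Omega> x" "rho_Cauchy \<beta> \<Omega> y" "(\<lambda>i. dmet \<beta> (x i) (y i)) \<longlonglongrightarrow> 0" "(\<lambda>i. infnorm (x i - y i)) \<longlonglongrightarrow> 0"
  using C by (auto simp: cauchy_equiv_iff[OF \<beta>(1)])
 obtain z where z: "(\<lambda>i. infnorm (x i - z)) \<longlonglongrightarrow> 0" using rho_Cauchy_convergent[OF \<beta>(1) _ h(1)] \<beta> \<alpha> by auto
 define b where "b = bd z + 1"
 define K where "K = max (2 * b) (2 powr (1/\<beta>)) powr (\<alpha> - \<beta>)"
 have "\<forall>\<^sub>F i in sequentially. infnorm (x i - z) < 1" "\<forall>\<^sub>F i in sequentially. dmet \<beta> (x i) (y i) < 1"
  using order_tendstoD(2)[OF z] order_tendstoD(2)[OF h(3)] by auto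
 then have "\<forall>\<^sub>F i in sequentially. norm (dmet \<alpha> (x i) (y i)) <= K * dmet \<beta> (x i) (y i)"
 proof eventually_elim
  case (elim i)
  have "bd (x i) <= b" using bd_lipschitz[of "x i" z] elim by (simp add: b_def)
  then show ?case using d_met_exponent_linear[of "x i" "y i" b] elim h rho_CauchyD d_met_nonneg
   by (simp add: K_def)
 qed
 moreover have "(\<lambda>i. K * dmet \<beta> (x i) (y i)) \<longlonglongrightarrow> 0" using tendsto_mult_right_zero[OF h(3)] .
 ultimately have "(\<lambda>i. dmet \<alpha> (x i) (y i)) \<longlonglongrightarrow> 0" by (rule Lim_null_comparison)
 then show ?thesis using h rho_Cauchy_exponent by (simp add: cauchy_equiv_iff[OF p])
qed

lemma change_exponent_eq:
 assumes w: "\<omega> \<in> completed \<beta> \<Omega>" and y: "y \<in> \<omega>"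
 shows "change_exponent \<alpha> \<Omega> \<omega> = cclass \<alpha> \<Omega> y" "y \<in> change_exponent \<alpha> \<Omega> \<omega>" "rho_Cauchy \<alpha> \<Omega> y"
proof -
 have p: "0 < \<alpha>" "\<beta> <= 1" using \<beta> \<alpha> by auto
 have s: "(SOME x. x \<in> \<omega>) \<in> \<omega>" using y by (metis someI)
 show "change_exponent \<alpha> \<Omega> \<omega> = cclass \<alpha> \<Omega> y" unfolding change_exponent_def
  by (rule cclass_eqI[OF p(1) \<alpha>]) (rule cauchy_equiv_exponent[OF completed_equiv[OF \<beta>(1) p(2) w s y]])
 moreover show C: "rho_Cauchy \<alpha> \<Omega> y" by (rule rho_Cauchy_exponent[OF completed_Cauchy[OF \<beta>(1) p(2) w y]])
 ultimately show "y \<in> change_exponent \<alpha> \<Omega> \<omega>" using cclass_self[OF p(1) \<alpha>] by simp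
qed

lemma change_exponent_bdry:
 assumes w: "\<omega> \<in> bdry \<beta>" shows "change_exponent \<alpha> \<Omega> \<omega> \<in> bdry \<alpha>"
proof -
 have p: "0 < \<alpha>" "\<beta> <= 1" using \<beta> \<alpha> by auto
 obtain y where y: "y \<in> \<omega>" using completed_nonempty[OF \<beta>(1) p(2) bdry_completed[OF \<beta>(1) p(2) w]] by blast
 show ?thesis unfolding change_exponent_eq(1)[OF bdry_completed[OF \<beta>(1) p(2) w] y]
  by (rule mem_bdryI[OF p(1) \<alpha> change_exponent_eq(3)[OF bdry_completed[OF \<beta>(1) p(2) w] y] bdry_bd_tendsto_0[OF \<beta>(1) p(2) w y]])
qed

end
end

section \<open>The sharp maximal function\<close>

context proper_domain
begin

context
 fixes \<beta> \<alpha> :: real assumes \<beta>: "0 < \<beta>" "\<beta> <= \<alpha>" and \<alpha>: "\<alpha> <= 1"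
begin

lemma \<beta>1: "\<beta> <= 1" using \<beta> \<alpha> by simp

lemma delta_ball_bdry_iff:
 assumes "x \<in> \<Omega>" "0 < r"
 shows "\<omega> \<in> delta_ball \<beta> \<Omega> x r \<inter> bdry \<beta> \<longleftrightarrow>
  \<omega> \<in> bdry \<beta> \<and> d_to \<beta> x \<omega> <= r powr \<beta>"
proof -
 have "delta_bar \<beta> \<Omega> (embed \<beta> \<Omega> x) \<omega> <= r \<longleftrightarrow> d_to \<beta> x \<omega> <= r powr \<beta>"
  if w: "\<omega> \<in> bdry \<beta>"
 proof -
  have "0 <= d_to \<beta> x \<omega>"
   using d_bar_nonneg[OF \<beta>(1) \<beta>1 embed_completed(1)[OF \<beta>(1) \<beta>1 assms(1)] bdry_completed[OF \<beta>(1) \<beta>1 w]] .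
  then show ?thesis unfolding delta_bar_def
   using assms(2) \<beta>(1) powr_mono2[of \<beta> "d_to \<beta> x \<omega> powr (1/\<beta>)" r]
    powr_mono2[of "1/\<beta>" "d_to \<beta> x \<omega>" "r powr \<beta>"]
   by (auto simp: powr_powr)
 qed
 then show ?thesis using bdry_completed[OF \<beta>(1) \<beta>1] by (auto simp: delta_ball_def)
qed

lemma fsharp_upper:
 assumes "x \<in> \<Omega>" "0 < r" "\<omega>1 \<in> bdry \<beta>" "\<omega>2 \<in> bdry \<beta>"
  "d_to \<beta> x \<omega>1 <= r powr \<beta>" "d_to \<beta> x \<omega>2 <= r powr \<beta>"
 shows "ennreal (\<bar>f (change_exponent \<alpha> \<Omega> \<omega>1) - f (change_exponent \<alpha> \<Omega> \<omega>2)\<bar> / r) <= fsharp \<alpha> \<beta> \<Omega> f x"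
 unfolding fsharp_def using delta_ball_bdry_iff[OF assms(1,2)] assms by (intro Sup_upper) blast

lemma fsharp_least:
 assumes "x \<in> \<Omega>"
  "\<And>r \<omega>1 \<omega>2. 0 < r ==> \<omega>1 \<in> bdry \<beta> ==> \<omega>2 \<in> bdry \<beta> ==>
   d_to \<beta> x \<omega>1 <= r powr \<beta> ==> d_to \<beta> x \<omega>2 <= r powr \<beta> ==>
   ennreal (\<bar>f (change_exponent \<alpha> \<Omega> \<omega>1) - f (change_exponent \<alpha> \<Omega> \<omega>2)\<bar> / r) <= c"
 shows "fsharp \<alpha> \<beta> \<Omega> f x <= c"
 unfolding fsharp_def using delta_ball_bdry_iff[OF assms(1)] assms(2) by (intro Sup_least) blast

lemma fsharp_diff_le:
 assumes "x \<in> \<Omega>" "0 < r" "\<omega>1 \<in> bdry \<beta>" "\<omega>2 \<in> bdry \<beta>"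
  "d_to \<beta> x \<omega>1 <= r powr \<beta>" "d_to \<beta> x \<omega>2 <= r powr \<beta>"
  and fin: "fsharp \<alpha> \<beta> \<Omega> f x < \<infinity>"
 shows "\<bar>f (change_exponent \<alpha> \<Omega> \<omega>1) - f (change_exponent \<alpha> \<Omega> \<omega>2)\<bar> <= r * enn2real (fsharp \<alpha> \<beta> \<Omega> f x)"
proof -
 obtain c where c: "fsharp \<alpha> \<beta> \<Omega> f x = ennreal c" "0 <= c" using fin by (auto simp: less_top_ennreal)
 have "\<bar>f (change_exponent \<alpha> \<Omega> \<omega>1) - f (change_exponent \<alpha> \<Omega> \<omega>2)\<bar> / r <= c"
  using fsharp_upper[OF assms(1-6), of f] c by simp
 then show ?thesis using assms(2) c by (simp add: field_simps)
qed

text \<open>A boundary point at intrinsic distance \<open>r\<close> is reached by curves which stay in a cube of size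
 comparable to \<open>r\<close>; in particular \<open>x\<close> itself is at distance at most a multiple of \<open>r\<close> from the boundary.\<close>
lemma curves_to_boundary:
 assumes x: "x \<in> \<Omega>" and r: "0 < r" and w: "\<omega> \<in> bdry \<beta>" "y \<in> \<omega>"
  and d: "d_to \<beta> x \<omega> <= r powr \<beta>"
 shows "\<forall>\<^sub>F i in sequentially. \<exists>\<gamma>. joins \<gamma> x (y i) \<and> weighted_length \<beta> \<gamma> <= 2 * r powr \<beta> \<and>
   (\<forall>t\<in>{0..1}. bd (\<gamma> t) <= 4 powr (1/\<beta>) * r \<and> infnorm (\<gamma> t - x) <= 4 powr (1/\<beta>) * r)"
proof -
 have r': "r powr \<beta> < 2 * r powr \<beta>" using r by simp
 have wc: "\<omega> \<in> completed \<beta> \<Omega>" by (rule bdry_completed[OF \<beta>(1) \<beta>1 w(1)])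
 have "\<forall>\<^sub>F i in sequentially. dmet \<beta> x (y i) < 2 * r powr \<beta>"
  using order_tendstoD(2)[OF d_bar_embed_tendsto[OF \<beta>(1) \<beta>1 x wc w(2)]] d r' by (meson le_less_trans)
 moreover have "\<forall>\<^sub>F i in sequentially. bd (y i) < r"
  using order_tendstoD(2)[OF bdry_bd_tendsto_0[OF \<beta>(1) \<beta>1 w] r] .
 ultimately show ?thesis
 proof eventually_elim
  case (elim i)
  have yO: "y i \<in> \<Omega>" using rho_CauchyD[OF completed_Cauchy[OF \<beta>(1) \<beta>1 wc w(2)]] .
  obtain \<gamma> where g: "joins \<gamma> x (y i)" "weighted_length \<beta> \<gamma> < 2 * r powr \<beta>" using d_met_approx[OF x yO elim(1)] .
  define R where "R = 2 powr (1/\<beta>) * r"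
  have R: "R powr \<beta> = 2 * r powr \<beta>" "0 < R" using \<beta> r by (auto simp: R_def powr_mult powr_powr)
  have four: "2 powr (1/\<beta>) * R = 4 powr (1/\<beta>) * r"
   by (simp add: R_def mult.assoc[symmetric] powr_mult[symmetric])
  have "2 powr 1 <= (4::real) powr (1/\<beta>)"
  proof -
   have "(2::real) powr 1 <= 4 powr 1" by simp
   also have "... <= 4 powr (1/\<beta>)" using \<beta> \<beta>1 by (intro powr_mono) auto
   finally show ?thesis .
  qed
  then have M: "4 powr (1/\<beta>) * r = max (2 * r) (2 powr (1/\<beta>) * R)" using r unfolding four by (simp add: max_def)
  note cs = curve_scale[OF g(1) \<beta>(1) \<beta>1 R(2) _ _ M]
  show ?case
   using g cs(1,2) R elim(2) joinsD(3)[OF g(1)] by (intro exI[of _ \<gamma>]) force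
 qed
qed

lemma bd_le_of_d_bar:
 assumes "x \<in> \<Omega>" "0 < r" "\<omega> \<in> bdry \<beta>" "d_to \<beta> x \<omega> <= r powr \<beta>"
 shows "bd x <= 4 powr (1/\<beta>) * r"
proof -
 obtain y where "y \<in> \<omega>" using completed_nonempty[OF \<beta>(1) \<beta>1 bdry_completed[OF \<beta>(1) \<beta>1 assms(3)]] by blast
 from eventually_happens[OF curves_to_boundary[OF assms(1-3) this assms(4)]]
 obtain \<gamma> i where g: "joins \<gamma> x (y i)" "\<forall>t\<in>{0..1}. bd (\<gamma> t) <= 4 powr (1/\<beta>) * r" by auto
 from g(2)[rule_format, of 0] show ?thesis using joinsD(3)[OF g(1)] by simp
qed

text \<open>If a ball around \<open>x\<close> contains a boundary point, then its radius is at least a multiple of \<open>bd x\<close>, so it lies in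
 a ball of comparable radius around the nearby point \<open>y\<close>.\<close>
lemma fsharp_harnack:
 assumes x: "x \<in> \<Omega>" and y: "infnorm (y - x) <= bd x / 2"
 shows "fsharp \<alpha> \<beta> \<Omega> f x <= ennreal (5 powr (1/\<beta>)) * fsharp \<alpha> \<beta> \<Omega> f y"
proof (rule fsharp_least[OF x])
 have yO: "y \<in> \<Omega>" using bd_half[of x y "1/2"] x y by auto
 fix r \<omega>1 \<omega>2 assume r: "0 < r" and w: "\<omega>1 \<in> bdry \<beta>" "\<omega>2 \<in> bdry \<beta>"
  and d: "d_to \<beta> x \<omega>1 <= r powr \<beta>" "d_to \<beta> x \<omega>2 <= r powr \<beta>"
 define C where "C = 5 powr (1/\<beta>)"
 have C: "C > 0" "C powr \<beta> = 5" using \<beta> by (auto simp: C_def powr_powr)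
 have "d_to \<beta> y \<omega> <= (C * r) powr \<beta>" if "\<omega> \<in> bdry \<beta>" "d_to \<beta> x \<omega> <= r powr \<beta>" for \<omega>
 proof -
  have "dmet \<beta> y x <= bd x powr \<beta>" using d_met_local(2)[OF x y \<beta>(1) \<beta>1] d_met_sym[OF x yO] by simp
  also have "... <= (4 powr (1/\<beta>) * r) powr \<beta>"
   using bd_le_of_d_bar[OF x r that] \<beta> by (intro powr_mono2 bd_nonneg) auto
  also have "... = 4 * r powr \<beta>" using \<beta> r by (simp add: powr_mult powr_powr)
  finally show ?thesis
   using d_bar_embed_le[OF \<beta>(1) \<beta>1 yO x bdry_completed[OF \<beta>(1) \<beta>1 that(1)]] that(2) C r by (simp add: powr_mult)
 qed
 then have "ennreal (\<bar>f (change_exponent \<alpha> \<Omega> \<omega>1) - f (change_exponent \<alpha> \<Omega> \<omega>2)\<bar> / (C * r)) <= fsharp \<alpha> \<beta> \<Omega> f y"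
  using C r w d by (intro fsharp_upper[OF yO]) auto
 then have "ennreal C * ennreal (\<bar>f (change_exponent \<alpha> \<Omega> \<omega>1) - f (change_exponent \<alpha> \<Omega> \<omega>2)\<bar> / (C * r)) <= ennreal C * fsharp \<alpha> \<beta> \<Omega> f y"
  by (rule mult_left_mono) simp
 then show "ennreal (\<bar>f (change_exponent \<alpha> \<Omega> \<omega>1) - f (change_exponent \<alpha> \<Omega> \<omega>2)\<bar> / r) <= ennreal (5 powr (1/\<beta>)) * fsharp \<alpha> \<beta> \<Omega> f y"
  using C by (simp add: C_def[symmetric] flip: ennreal_mult')
qed

lemma d_bar_embed_nbhd:
 assumes x: "x \<in> \<Omega>" and e: "0 < e" and \<sigma>: "0 < \<sigma>" "\<sigma> <= 1"
 obtains \<delta> where "0 < \<delta>" "ball x \<delta> \<subseteq> \<Omega>"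
  "\<And>x' \<omega>. x' \<in> ball x \<delta> ==> \<omega> \<in> completed \<sigma> \<Omega> ==>
    d_to \<sigma> x' \<omega> < d_to \<sigma> x \<omega> + e"
proof -
 define K where "K = (bd x / 2) powr (\<sigma> - 1)"
 define \<delta> where "\<delta> = min (bd x / 2) (e / K)"
 have K: "K > 0" using bd_pos[OF x] by (simp add: K_def)
 have near: "infnorm (x' - x) < \<delta>" if "x' \<in> ball x \<delta>" for x'
  using that infnorm_le_norm[of "x' - x"] by (auto simp: dist_norm norm_minus_commute)
 have O: "x' \<in> \<Omega>" if "x' \<in> ball x \<delta>" for x'
  using bd_half(1)[OF x, of x' "1/2"] near[OF that] by (auto simp: \<delta>_def)
 show thesis
 proof
  show "0 < \<delta>" using K e bd_pos[OF x] by (simp add: \<delta>_def)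
  show "ball x \<delta> \<subseteq> \<Omega>" using O by auto
  fix x' \<omega> assume x': "x' \<in> ball x \<delta>" and w: "\<omega> \<in> completed \<sigma> \<Omega>"
  have "dmet \<sigma> x' x <= K * infnorm (x' - x)"
   using d_met_local(1)[OF x _ \<sigma>, of x'] near[OF x'] d_met_sym[OF x O[OF x']] by (auto simp: \<delta>_def K_def)
  also have "... < K * (e / K)" using near[OF x'] K by (intro mult_strict_left_mono) (auto simp: \<delta>_def)
  finally show "d_to \<sigma> x' \<omega> < d_to \<sigma> x \<omega> + e"
   using d_bar_embed_le[OF \<sigma> O[OF x'] x w] K by simp
 qed
qed

text \<open>Two boundary points that compete at \<open>x\<close> with radius \<open>r\<close> compete at all nearby points with any radius
 slightly larger than \<open>r\<close>.\<close>
lemma fsharp_lower_semicontinuous: "open {x \<in> \<Omega>. c < fsharp \<alpha> \<beta> \<Omega> f x}"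
proof (rule openI)
 fix x assume "x \<in> {x \<in> \<Omega>. c < fsharp \<alpha> \<beta> \<Omega> f x}"
 then have x: "x \<in> \<Omega>" and c: "c < fsharp \<alpha> \<beta> \<Omega> f x" by auto
 from c obtain r \<omega>1 \<omega>2 where r: "0 < r" and
  w': "\<omega>1 \<in> delta_ball \<beta> \<Omega> x r \<inter> bdry \<beta>" "\<omega>2 \<in> delta_ball \<beta> \<Omega> x r \<inter> bdry \<beta>"
  and lt: "c < ennreal (\<bar>f (change_exponent \<alpha> \<Omega> \<omega>1) - f (change_exponent \<alpha> \<Omega> \<omega>2)\<bar> / r)"
  unfolding fsharp_def less_Sup_iff by blast
 define v where "v = \<bar>f (change_exponent \<alpha> \<Omega> \<omega>1) - f (change_exponent \<alpha> \<Omega> \<omega>2)\<bar>"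
 have w: "\<omega>1 \<in> bdry \<beta>" "\<omega>2 \<in> bdry \<beta>" "d_to \<beta> x \<omega>1 <= r powr \<beta>"
  "d_to \<beta> x \<omega>2 <= r powr \<beta>"
  using w' unfolding delta_ball_bdry_iff[OF x r] by auto
 obtain c' where c': "c = ennreal c'" "0 <= c'" using lt by (cases c) (auto simp: top_unique)
 have "c' < v / r" using lt c' by (simp add: v_def ennreal_less_iff)
 then have "c' * r < v" using r by (simp add: field_simps)
 define r' where "r' = (r + v / c') / 2"
 have "\<exists>r'>r. c' * r' < v"
 proof (cases "c' = 0")
  case True then show ?thesis using \<open>c' * r < v\<close> by (intro exI[of _ "r+1"]) auto
 next
  case False
  then have "r < v / c'" using \<open>c' * r < v\<close> c' by (simp add: field_simps)
  then obtain r' where "r < r'" "r' < v / c'" using dense by blast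
  then show ?thesis using False c' by (intro exI[of _ r']) (auto simp: field_simps)
 qed
 then obtain r' where r': "r < r'" "c' * r' < v" by blast
 have "0 < r' powr \<beta> - r powr \<beta>" using r r' \<beta> by (simp add: powr_less_mono2)
 then obtain \<delta> where \<delta>: "0 < \<delta>" "ball x \<delta> \<subseteq> \<Omega>"
  "\<And>x' \<omega>. x' \<in> ball x \<delta> ==> \<omega> \<in> completed \<beta> \<Omega> ==>
    d_to \<beta> x' \<omega> < d_to \<beta> x \<omega> + (r' powr \<beta> - r powr \<beta>)"
  using d_bar_embed_nbhd[OF x _ \<beta>(1) \<beta>1] by metis
 have "c < fsharp \<alpha> \<beta> \<Omega> f x'" if x': "x' \<in> ball x \<delta>" for x'
 proof -
  have "d_to \<beta> x' \<omega> <= r' powr \<beta>"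
   if "\<omega> \<in> bdry \<beta>" "d_to \<beta> x \<omega> <= r powr \<beta>" for \<omega>
   using \<delta>(3)[OF x' bdry_completed[OF \<beta>(1) \<beta>1 that(1)]] that(2) by simp
  then have "ennreal (v / r') <= fsharp \<alpha> \<beta> \<Omega> f x'" unfolding v_def
   using w r r' x' \<delta>(2) by (intro fsharp_upper) auto
  moreover have "c < ennreal (v / r')" using r r' c' by (simp add: ennreal_less_iff field_simps)
  ultimately show ?thesis by (rule less_le_trans[rotated])
 qed
 then show "\<exists>e>0. ball x e \<subseteq> {x \<in> \<Omega>. c < fsharp \<alpha> \<beta> \<Omega> f x}" using \<delta>(1,2) by (intro exI[of _ \<delta>]) auto
qed

lemma fsharp_measurable:
 assumes "S \<subseteq> \<Omega>" "S \<in> sets lebesgue" shows "fsharp \<alpha> \<beta> \<Omega> f \<in> borel_measurable (lebesgue_on S)"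
proof (rule borel_measurableI_greater)
 fix c
 have "{x \<in> space (lebesgue_on S). c < fsharp \<alpha> \<beta> \<Omega> f x} = S \<inter> {x \<in> \<Omega>. c < fsharp \<alpha> \<beta> \<Omega> f x}"
  using assms by auto
 moreover have "{x \<in> \<Omega>. c < fsharp \<alpha> \<beta> \<Omega> f x} \<in> sets lebesgue"
  using borel_open[OF fsharp_lower_semicontinuous] by (simp add: sets_completionI_sets)
 ultimately show "{x \<in> space (lebesgue_on S). c < fsharp \<alpha> \<beta> \<Omega> f x} \<in> sets (lebesgue_on S)"
  using assms(2) by (auto simp: sets_restrict_space)
qed

end

section \<open>Chains of cubes along a curve\<close>

lemma last_exit:
 fixes \<gamma> :: "real => real^'n"
 assumes g: "continuous_on {0..1} \<gamma>" "\<gamma> ` {0..1} \<subseteq> \<Omega>" and u: "u \<in> {0..1}"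
  and out: "infnorm (\<gamma> 1 - \<gamma> u) > bd (\<gamma> u) / 2"
 shows "\<exists>v. u < v \<and> v < 1 \<and> infnorm (\<gamma> v - \<gamma> u) = bd (\<gamma> u) / 2 \<and>
  (\<forall>s\<in>{v..1}. bd (\<gamma> u) / 2 <= infnorm (\<gamma> s - \<gamma> u))"
proof -
 define \<phi> where "\<phi> s = infnorm (\<gamma> s - \<gamma> u)" for s
 define c where "c = bd (\<gamma> u) / 2"
 have c: "c > 0" using bd_pos g(2) u by (auto simp: c_def image_subset_iff)
 have cont: "continuous_on {0..1} \<phi>" unfolding \<phi>_def by (intro continuous_intros g)
 define T where "T = {s \<in> {u..1}. \<phi> s <= c}"
 have "continuous_on {u..1} \<phi>" by (rule continuous_on_subset[OF cont]) (use u in auto)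
 then have "closed T" unfolding T_def
  by (intro continuous_on_closed_Collect_le continuous_on_const closed_atLeastAtMost)
 then have "compact ({u..1} \<inter> T)" by (rule compact_Int_closed[OF compact_Icc])
 moreover have "{u..1} \<inter> T = T" by (auto simp: T_def)
 ultimately have T: "compact T" "u \<in> T" using u c by (auto simp: T_def \<phi>_def infnorm_0)
 obtain v where v: "v \<in> T" "\<And>s. s \<in> T ==> s <= v" using compact_attains_sup[of T] T by blast
 have vb: "u <= v" "v < 1" "\<phi> v <= c" using v out by (auto simp: T_def \<phi>_def c_def less_le)
 have after: "c < \<phi> s" if "v < s" "s <= 1" for s using v(2)[of s] that vb by (force simp: T_def)
 have "\<phi> v = c"
 proof (rule ccontr)
  assume "\<phi> v \<noteq> c"
  then have "c - \<phi> v > 0" using vb by simp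
  then obtain d where d: "d > 0" "\<And>s. s \<in> {0..1} ==> dist s v < d ==> dist (\<phi> s) (\<phi> v) < c - \<phi> v"
   using cont[unfolded continuous_on_iff, rule_format, of v "c - \<phi> v"] u vb by auto
  define s where "s = min 1 (v + d/2)"
  have "v < s" "s <= 1" "s \<in> {0..1}" "dist s v < d" using d vb u by (auto simp: s_def dist_real_def)
  then show False using d(2)[of s] after[of s] by (simp add: dist_real_def)
 qed
 moreover have "u < v" using vb \<open>\<phi> v = c\<close> c by (cases "u = v") (auto simp: \<phi>_def infnorm_0)
 ultimately show ?thesis using vb after by (intro exI[of _ v]) (force simp: \<phi>_def c_def less_le)
qed

text \<open>Each next centre is the last point of the curve in the cube around the previous one.  All later
 centres lie outside this cube, which makes small cubes around the centres disjoint.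
 The chain ends because otherwise its centres would converge to a point of \<open>\<Omega>\<close>, where the
 step length cannot tend to zero.\<close>
lemma last_exit_chain:
 fixes \<gamma> :: "real => real^'n"
 assumes g: "continuous_on {0..1} \<gamma>" "\<gamma> ` {0..1} \<subseteq> \<Omega>"
 obtains N t where "t 0 = 0" "\<And>k. k <= N ==> t k \<in> {0..1}" "\<And>k. k < N ==> t k < t (Suc k)"
  "\<And>k. k < N ==> infnorm (\<gamma> (t (Suc k)) - \<gamma> (t k)) = bd (\<gamma> (t k)) / 2"
  "infnorm (\<gamma> 1 - \<gamma> (t N)) <= bd (\<gamma> (t N)) / 2"
  "\<And>j k. k < j ==> j <= N ==> bd (\<gamma> (t k)) / 2 <= infnorm (\<gamma> (t j) - \<gamma> (t k))"
proof -
 define out where "out u \<longleftrightarrow> infnorm (\<gamma> 1 - \<gamma> u) > bd (\<gamma> u) / 2" for u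
 obtain nx where nx: "\<And>u. u \<in> {0..1} ==> out u ==> u < nx u \<and> nx u < 1 \<and> infnorm (\<gamma> (nx u) - \<gamma> u) = bd (\<gamma> u) / 2 \<and>
  (\<forall>s\<in>{nx u..1}. bd (\<gamma> u) / 2 <= infnorm (\<gamma> s - \<gamma> u))"
  using last_exit[OF g] unfolding out_def by metis
 define t where "t k = (nx ^^ k) 0" for k
 have tS: "t (Suc k) = nx (t k)" for k by (simp add: t_def)
 have bnd: "t k \<in> {0..1}" if "\<And>j. j < k ==> out (t j)" for k using that
 proof (induction k)
  case (Suc k)
  then have "t k \<in> {0..1}" "out (t k)" by auto
  then show ?case using nx[of "t k"] by (auto simp: tS)
 qed (simp add: t_def)
 have "\<exists>k. \<not> out (t k)"
 proof (rule ccontr)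
  assume "\<not> (\<exists>k. \<not> out (t k))"
  then have o: "out (t k)" for k by blast
  then have b: "t k \<in> {0..1}" for k using bnd by blast
  have "incseq t" using nx[OF b o] by (intro incseq_SucI) (simp add: tS less_imp_le)
  then obtain l where l: "t \<longlonglongrightarrow> l" using incseq_convergent[OF \<open>incseq t\<close>, of 1] b by (metis atLeastAtMost_iff)
  then have lb: "l \<in> {0..1}" using b closed_sequentially[of "{0..1::real}" t l] by auto
  have gl: "(\<lambda>k. \<gamma> (t k)) \<longlonglongrightarrow> \<gamma> l"
   using continuous_on_tendsto_compose[OF g(1) l lb] b by (simp add: always_eventually)
  have "(\<lambda>k. infnorm (\<gamma> (t (Suc k)) - \<gamma> (t k))) \<longlonglongrightarrow> infnorm (\<gamma> l - \<gamma> l)"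
   by (intro tendsto_infnorm tendsto_diff gl LIMSEQ_Suc[OF gl])
  moreover have "(\<lambda>k. bd (\<gamma> (t k)) / 2) \<longlonglongrightarrow> bd (\<gamma> l) / 2"
   using continuous_on_tendsto_compose[OF continuous_bd[of UNIV] gl] by (intro tendsto_intros) auto
  moreover have "infnorm (\<gamma> (t (Suc k)) - \<gamma> (t k)) = bd (\<gamma> (t k)) / 2" for k using nx[OF b o] by (simp add: tS)
  ultimately have "infnorm (\<gamma> l - \<gamma> l) = bd (\<gamma> l) / 2" using LIMSEQ_unique by (simp only:)
  then have "bd (\<gamma> l) / 2 = 0" by (simp add: infnorm_0)
  moreover have "bd (\<gamma> l) > 0" using bd_pos g(2) lb by (auto simp: image_subset_iff)
  ultimately show False by simp
 qed
 define N where "N = (LEAST k. \<not> out (t k))"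
 have N: "\<not> out (t N)" "\<And>k. k < N ==> out (t k)"
  using LeastI_ex[OF \<open>\<exists>k. \<not> out (t k)\<close>] not_less_Least by (auto simp: N_def)
 have b: "t k \<in> {0..1}" if "k <= N" for k using bnd[of k] N(2) that by auto
 note nxt = nx[OF b N(2)]
 have mono: "t j <= t k" if "j <= k" "k <= N" for j k using that
 proof (induction k)
  case (Suc k) then show ?case using nxt[of k] by (cases "j = Suc k") (auto simp: tS)
 qed auto
 show thesis
 proof (rule that[of t N])
  fix j k assume "k < j" "j <= N"
  then have "t j \<in> {nx (t k)..1}" using mono[of "Suc k" j] b[of j] by (simp add: tS)
  then show "bd (\<gamma> (t k)) / 2 <= infnorm (\<gamma> (t j) - \<gamma> (t k))" using nxt[of k] \<open>k < j\<close> \<open>j <= N\<close> by auto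
 qed (use N b nxt in \<open>auto simp: t_def out_def\<close>)
qed

lemma first_hit:
 fixes \<phi> :: "real => real"
 assumes g: "continuous_on {a..b} \<phi>" and ab: "a <= b" "\<phi> b = (c::real)" "\<phi> a <= c"
 shows "\<exists>u\<in>{a..b}. \<phi> u = c \<and> (\<forall>s\<in>{a..u}. \<phi> s <= c)"
proof -
 define T where "T = {s \<in> {a..b}. \<phi> s = c}"
 have "compact T" unfolding T_def
 proof -
  have "closed {s \<in> {a..b}. \<phi> s = c}" by (rule continuous_closed_preimage_constant[OF g]) simp
  then have "compact ({a..b} \<inter> {s \<in> {a..b}. \<phi> s = c})" by (rule compact_Int_closed[OF compact_Icc])
  moreover have "{a..b} \<inter> {s \<in> {a..b}. \<phi> s = c} = {s \<in> {a..b}. \<phi> s = c}" by auto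
  ultimately show "compact {s \<in> {a..b}. \<phi> s = c}" by simp
 qed
 moreover have "b \<in> T" using ab by (simp add: T_def)
 ultimately obtain u where u: "u \<in> T" "\<And>s. s \<in> T ==> u <= s" using compact_attains_inf[of T] by blast
 have "\<phi> s <= c" if s: "s \<in> {a..u}" for s
 proof (rule ccontr)
  assume "\<not> \<phi> s <= c"
  moreover have "continuous_on {a..s} \<phi>" by (rule continuous_on_subset[OF g]) (use s u in \<open>auto simp: T_def\<close>)
  ultimately obtain w where "a <= w" "w <= s" "\<phi> w = c" using IVT'[of \<phi> a c s] ab s by auto
  moreover from this have "w \<in> T" using s u by (auto simp: T_def)
  ultimately have "w = u" "s = u" using u s by (auto intro: antisym order_trans)
  then show False using \<open>\<phi> w = c\<close> \<open>\<not> \<phi> s <= c\<close> by simp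
 qed
 then show ?thesis using u by (auto simp: T_def)
qed

lemma chain_exists:
 assumes j: "joins \<gamma> x y" and \<sigma>: "0 < \<sigma>" "\<sigma> <= 1"
 obtains N p where "p 0 = x" "\<And>k. k <= N ==> p k \<in> \<gamma> ` {0..1}"
  "\<And>k. k < N ==> infnorm (p (Suc k) - p k) <= bd (p k) / 2" "infnorm (y - p N) <= bd (p N) / 2"
  "\<And>i k. k < i ==> i <= N ==> {z. infnorm (z - p k) <= bd (p k) / 8} \<inter> {z. infnorm (z - p i) <= bd (p i) / 8} = {}"
  "(\<Sum>k\<le>N. bd (p k) powr \<sigma>) <= 8 * weighted_length \<sigma> \<gamma> + bd x powr \<sigma>"
proof -
 note result = that
 note jD = joinsD[OF j]
 note gc = rectifiable_continuous[OF jD(1)]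
 have im: "\<gamma> ` {0..1} \<subseteq> \<Omega>" using jD(2) by auto
 show thesis
 proof (rule last_exit_chain[OF gc im])
 fix N t assume t: "t 0 = 0" "\<And>k. k <= N ==> t k \<in> {0..1}" "\<And>k. k < N ==> t k < t (Suc k)"
  "\<And>k. k < N ==> infnorm (\<gamma> (t (Suc k)) - \<gamma> (t k)) = bd (\<gamma> (t k)) / 2"
  "infnorm (\<gamma> 1 - \<gamma> (t N)) <= bd (\<gamma> (t N)) / 2"
  "\<And>j k. k < j ==> j <= N ==> bd (\<gamma> (t k)) / 2 <= infnorm (\<gamma> (t j) - \<gamma> (t k))"
 define p where "p k = \<gamma> (t k)" for k
 have pO: "p k \<in> \<Omega>" if "k <= N" for k using jD(2)[OF t(2)[OF that]] by (simp add: p_def)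
 have bp: "0 < bd (p k)" if "k <= N" for k using bd_pos[OF pO[OF that]] .
 have "\<exists>u. t k <= u \<and> u <= t (Suc k) \<and> infnorm (\<gamma> u - p k) = bd (p k) / 2 \<and> (\<forall>s\<in>{t k..u}. infnorm (\<gamma> s - p k) <= bd (p k) / 2)"
  if k: "k < N" for k
 proof -
  have c: "continuous_on {t k..t (Suc k)} (\<lambda>s. infnorm (\<gamma> s - p k))"
   by (intro continuous_intros continuous_on_subset[OF gc]) (use t(2)[of k] t(2)[of "Suc k"] k in auto)
  have "infnorm (\<gamma> (t (Suc k)) - p k) = bd (p k) / 2" "infnorm (\<gamma> (t k) - p k) <= bd (p k) / 2"
   using t(4)[OF k] bp[of k] k by (auto simp: p_def infnorm_0)
  from first_hit[OF c less_imp_le[OF t(3)[OF k]] this] show ?thesis by (meson atLeastAtMost_iff)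
 qed
 then obtain u where u: "\<And>k. k < N ==> t k <= u k" "\<And>k. k < N ==> u k <= t (Suc k)"
   "\<And>k. k < N ==> infnorm (\<gamma> (u k) - p k) = bd (p k) / 2"
   "\<And>k s. k < N ==> s \<in> {t k..u k} ==> infnorm (\<gamma> s - p k) <= bd (p k) / 2" by metis
 have S: "(\<Sum>k<N. bd (p k) powr \<sigma>) <= 3 * weighted_length \<sigma> \<gamma>"
 proof -
  have "(\<Sum>k<N. (3/2 * bd (p k)) powr (\<sigma> - 1) * infnorm (\<gamma> (u k) - \<gamma> (t k))) <= weighted_length \<sigma> \<gamma>"
   unfolding weighted_length_def curve_integral_def
  proof (rule curve_integral_ge_sum[OF jD(1), where h="\<lambda>t. bd (\<gamma> t) powr (\<sigma> - 1)"])
   show "continuous_on {0..1} (\<lambda>t. bd (\<gamma> t) powr (\<sigma> - 1))" by (rule jD(7))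
  next
   fix k s assume k: "k < N" and s: "s \<in> {t k..u k}"
   then have "s \<in> {0..1}" using t(2)[of k] t(2)[of "Suc k"] u(2)[OF k] by auto
   then have sO: "\<gamma> s \<in> \<Omega>" by (rule jD(2))
   have "bd (\<gamma> s) <= 3/2 * bd (p k)" using bd_half(3)[OF pO, of k "\<gamma> s" "1/2"] u(4)[OF k s] k by auto
   then show "(3/2 * bd (p k)) powr (\<sigma> - 1) <= bd (\<gamma> s) powr (\<sigma> - 1)"
    using bd_pos[OF sO] \<sigma> by (intro powr_mono2') auto
  qed (use t(1) t(2)[of N] u in auto)
  moreover have "bd (p k) powr \<sigma> / 3 <= (3/2 * bd (p k)) powr (\<sigma> - 1) * infnorm (\<gamma> (u k) - \<gamma> (t k))" if k: "k < N" for k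
  proof -
   have b: "0 < bd (p k)" using bp k by simp
   have "1 <= (3/2::real) powr \<sigma>" using \<sigma> by (intro ge_one_powr_ge_zero) auto
   then have "bd (p k) powr \<sigma> / 3 <= (3/2) powr \<sigma> * bd (p k) powr \<sigma> / 3" by (simp add: mult_le_cancel_right1)
   also have "... = (3/2 * bd (p k)) powr \<sigma> / 3" by (simp only: powr_mult)
   also have "... = (3/2 * bd (p k)) powr (\<sigma> - 1) * (bd (p k) / 2)" using b by (simp add: powr_diff)
   also have "bd (p k) / 2 = infnorm (\<gamma> (u k) - \<gamma> (t k))" using u(3)[OF k] by (simp only: p_def)
   finally show ?thesis .
  qed
  then have "(\<Sum>k<N. bd (p k) powr \<sigma> / 3) <= (\<Sum>k<N. (3/2 * bd (p k)) powr (\<sigma> - 1) * infnorm (\<gamma> (u k) - \<gamma> (t k)))"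
   by (intro sum_mono) auto
  ultimately have "(\<Sum>k<N. bd (p k) powr \<sigma>) / 3 <= weighted_length \<sigma> \<gamma>" by (simp add: sum_divide_distrib)
  then show ?thesis by simp
 qed
 have last: "bd (p N) powr \<sigma> <= 3/2 * (\<Sum>k<N. bd (p k) powr \<sigma>) + bd x powr \<sigma>"
 proof (cases N)
  case 0 then show ?thesis using t(1) jD(3) by (simp add: p_def)
 next
  case (Suc M)
  have "bd (p N) <= 3/2 * bd (p M)" using bd_half(3)[OF pO, of M "p N" "1/2"] t(4)[of M] Suc by (auto simp: p_def)
  then have "bd (p N) powr \<sigma> <= (3/2 * bd (p M)) powr \<sigma>" using \<sigma> bd_nonneg by (intro powr_mono2) auto
  also have "... = (3/2) powr \<sigma> * bd (p M) powr \<sigma>" by (simp only: powr_mult)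
  also have "... <= 3/2 * bd (p M) powr \<sigma>" using \<sigma> powr_mono[of \<sigma> 1 "3/2::real"] by (intro mult_right_mono) auto
  also have "... <= 3/2 * (\<Sum>k<N. bd (p k) powr \<sigma>)" using Suc by (auto simp: sum_nonneg)
  finally show ?thesis by (meson add_increasing2 powr_ge_zero)
 qed
 show thesis
 proof (rule result)
  show "p 0 = x" using t(1) jD(3) by (simp add: p_def)
  show "p k \<in> \<gamma> ` {0..1}" if "k <= N" for k using t(2)[OF that] by (auto simp: p_def)
  show "infnorm (p (Suc k) - p k) <= bd (p k) / 2" if "k < N" for k using t(4)[OF that] by (simp add: p_def)
  show "infnorm (y - p N) <= bd (p N) / 2" using t(5) jD(4) by (simp add: p_def)
  show "{z. infnorm (z - p k) <= bd (p k) / 8} \<inter> {z. infnorm (z - p i) <= bd (p i) / 8} = {}" if "k < i" "i <= N" for i k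
  proof -
   have far: "bd (p k) / 2 <= infnorm (p i - p k)" using t(6)[OF that] by (simp add: p_def)
   have "bd (p i) <= bd (p k) + infnorm (p i - p k)" by (rule bd_lipschitz)
   then have *: "bd (p k) / 8 + bd (p i) / 8 < infnorm (p i - p k)" using far bp[of k] that by linarith
   have "\<not> (infnorm (z - p k) <= bd (p k) / 8 \<and> infnorm (z - p i) <= bd (p i) / 8)" for z
    using * infnorm_triangle_diff[of "p i" "p k" z] infnorm_sub[of "p i" z] by linarith
   then show ?thesis by blast
  qed
  have "(\<Sum>k\<le>N. bd (p k) powr \<sigma>) = (\<Sum>k<N. bd (p k) powr \<sigma>) + bd (p N) powr \<sigma>"
   by (simp add: lessThan_Suc_atMost[symmetric])
  then show "(\<Sum>k\<le>N. bd (p k) powr \<sigma>) <= 8 * weighted_length \<sigma> \<gamma> + bd x powr \<sigma>"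
   using S last weighted_length_nonneg[of \<sigma> \<gamma>] by linarith
 qed
qed
qed

end

lemma emeasure_infnorm_ball:
 assumes "0 <= r" shows "emeasure lborel {z::real^'n. infnorm (z - c) <= r} = ennreal ((2 * r) ^ CARD('n))"
proof -
 have "cbox (\<chi> i. c $ i - r) (\<chi> i. c $ i + r) \<noteq> ({}::(real^'n) set)"
  using assms by (auto simp: interval_eq_empty_cart not_less)
 then have "measure lborel (cbox (\<chi> i. c $ i - r) (\<chi> i. c $ i + r) :: (real^'n) set) = (2 * r) ^ CARD('n)"
  by (simp add: content_cbox_cart)
 then show ?thesis unfolding infnorm_ball_eq_cbox
  using emeasure_lborel_cbox_finite[of "\<chi> i. c $ i - r" "\<chi> i. c $ i + r"]
  by (simp add: emeasure_eq_ennreal_measure top.not_eq_extremum)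
qed

lemma infnorm_ball_measurable [measurable]: "{z::real^'n. infnorm (z - c) <= r} \<in> sets borel"
 unfolding infnorm_ball_eq_cbox by simp

text \<open>With the parameter \<open>b\<close> optimised after summation, this replaces Hoelder's inequality.\<close>
lemma young_split:
 assumes "0 <= (a::real)" "0 < b" "1 < s" shows "a <= b + a powr s * b powr (1 - s)"
proof (cases "a <= b")
 case False
 then have "a = a powr s * a powr (1 - s)" using assms by (simp flip: powr_add)
 also have "... <= a powr s * b powr (1 - s)" using False assms by (intro mult_left_mono powr_mono2') auto
 finally show ?thesis using assms by simp
qed (use assms in \<open>auto intro: add_increasing2\<close>)

lemma young_optimise:
 fixes X T J s :: real
 assumes X: "\<And>b. 0 < b ==> X <= b * T + b powr (1 - s) * J" and T: "0 < T" and J: "0 <= J" and s: "1 < s"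
 shows "X <= 2 * T powr (1 - 1/s) * J powr (1/s)"
proof (cases "J = 0")
 case True
 have "X <= 0 + e" if "e > 0" for e
 proof -
  have "0 < e / T" using T that by simp
  from X[OF this] show ?thesis using T True by simp
 qed
 then have "X <= 0" by (rule field_le_epsilon)
 then show ?thesis using True s by simp
next
 case False
 define b where "b = (J / T) powr (1/s)"
 have b: "b > 0" "b = J powr (1/s) * T powr (-(1/s))" using False J T by (auto simp: b_def powr_divide powr_minus_divide)
 have J0: "J > 0" using False J by simp
 have "b * T = J powr (1/s) * T powr (1 - 1/s)" using b T by (simp add: powr_diff powr_minus_divide)
 moreover have "b powr (1 - s) * J = J powr (1/s) * T powr (1 - 1/s)"
 proof -
  have "b powr (1 - s) = J powr ((1 - s)/s) * T powr (-((1 - s)/s))"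
   unfolding b(2) using J0 T by (simp add: powr_mult powr_powr)
  moreover have "J powr ((1 - s)/s) * J = J powr (1/s)"
  proof -
   have "J powr ((1 - s)/s) * J = J powr ((1 - s)/s + 1)" using J0 by (simp add: powr_add)
   also have "(1 - s)/s + 1 = 1/s" using s by (simp add: field_simps)
   finally show ?thesis .
  qed
  moreover have "-((1 - s)/s) = 1 - 1/s" using s by (simp add: field_simps)
  ultimately show ?thesis by (simp add: mult_ac)
 qed
 ultimately show ?thesis using X[OF b(1)] by (simp add: mult_ac)
qed

context proper_domain
begin

text \<open>The estimate of a function along a curve.  The exponent \<open>(s - n)/(s - 1)\<close> is the one for which
 Hoelder's inequality over the chain turns the steps \<open>bd p\<^sub>k \<cdot> H\<^bsup>1/s\<^esup>\<close> into the weighted length and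
 the integral of \<open>H\<close> over the disjoint small cubes.\<close>
lemma chain_estimate:
 fixes H :: "real^'n => ennreal"
 assumes H: "H \<in> borel_measurable borel" and s: "real CARD('n) < s" and \<sigma>: "\<sigma> = (s - real CARD('n)) / (s - 1)"
  and loc: "\<And>x y z. x \<in> \<Omega> ==> infnorm (y - x) <= bd x / 2 ==> infnorm (z - x) <= bd x / 8 ==>
    ennreal (\<bar>F y - F x\<bar> powr s) <= ennreal (bd x powr s) * H z"
  and j: "joins \<gamma> x y" and S: "\<And>t z. t \<in> {0..1} ==> infnorm (z - \<gamma> t) <= bd (\<gamma> t) / 8 ==> z \<in> S"
  and J: "(\<integral>\<^sup>+z\<in>S. H z \<partial>lborel) <= ennreal J" "0 <= J"
 shows "\<bar>F y - F x\<bar> <= 2 * (8 * weighted_length \<sigma> \<gamma> + bd x powr \<sigma>) powr (1 - 1/s) * (4 ^ CARD('n) * J) powr (1/s)"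
proof -
 let ?n = "CARD('n)"
 have n1: "real ?n \<ge> 1" by (simp add: Suc_leI)
 then have s1: "1 < s" using s by linarith
 have "0 < s - real ?n" "s - real ?n <= s - 1" "0 < s - 1" using s s1 n1 by linarith+
 then have \<sigma>0: "0 < \<sigma>" "\<sigma> <= 1" unfolding \<sigma> by (simp, simp only: divide_le_eq_1, simp)
 obtain N p where p: "p 0 = x" "\<And>k. k <= N ==> p k \<in> \<gamma> ` {0..1}"
  "\<And>k. k < N ==> infnorm (p (Suc k) - p k) <= bd (p k) / 2" "infnorm (y - p N) <= bd (p N) / 2"
  "\<And>i k. k < i ==> i <= N ==> {z. infnorm (z - p k) <= bd (p k) / 8} \<inter> {z. infnorm (z - p i) <= bd (p i) / 8} = {}"
  "(\<Sum>k\<le>N. bd (p k) powr \<sigma>) <= 8 * weighted_length \<sigma> \<gamma> + bd x powr \<sigma>"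
  using chain_exists[OF j \<sigma>0] by blast
 define B where "B k = {z. infnorm (z - p k) <= bd (p k) / 8}" for k
 define q where "q k = (if k < N then p (Suc k) else y)" for k
 define a where "a k = \<bar>F (q k) - F (p k)\<bar>" for k
 have pO: "p k \<in> \<Omega>" if "k <= N" for k using p(2)[OF that] joinsD(2)[OF j] by auto
 have bp: "0 < bd (p k)" if "k <= N" for k using bd_pos[OF pO[OF that]] .
 have q: "infnorm (q k - p k) <= bd (p k) / 2" if "k <= N" for k using p(3)[of k] p(4) that by (auto simp: q_def le_less)
 have step: "ennreal (a k powr s * bd (p k) powr (real ?n - s) / 4 ^ ?n) <= (\<integral>\<^sup>+z\<in>B k. H z \<partial>lborel)" if k: "k <= N" for k
 proof -
  have b: "0 < bd (p k)" by (rule bp[OF k])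
  have [measurable]: "B k \<in> sets borel" unfolding B_def by (rule infnorm_ball_measurable)
  have "ennreal (a k powr s) * emeasure lborel (B k) = (\<integral>\<^sup>+z\<in>B k. ennreal (a k powr s) \<partial>lborel)"
   by (simp add: nn_integral_cmult_indicator)
  also have "... <= (\<integral>\<^sup>+z. ennreal (bd (p k) powr s) * (H z * indicator (B k) z) \<partial>lborel)"
   using loc[OF pO[OF k] q[OF k]] by (intro nn_integral_mono) (auto simp: indicator_def a_def B_def)
  also have "... = ennreal (bd (p k) powr s) * (\<integral>\<^sup>+z\<in>B k. H z \<partial>lborel)"
   using H by (subst nn_integral_cmult) auto
  finally have "ennreal (a k powr s) * ennreal ((bd (p k) / 4) ^ ?n) <= ennreal (bd (p k) powr s) * (\<integral>\<^sup>+z\<in>B k. H z \<partial>lborel)"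
   using emeasure_infnorm_ball[of "bd (p k) / 8" "p k"] b by (simp add: B_def)
  then have "ennreal (bd (p k) powr (- s)) * (ennreal (a k powr s) * ennreal ((bd (p k) / 4) ^ ?n))
    <= ennreal (bd (p k) powr (- s)) * (ennreal (bd (p k) powr s) * (\<integral>\<^sup>+z\<in>B k. H z \<partial>lborel))"
   by (rule mult_left_mono) simp
  also have "... = (\<integral>\<^sup>+z\<in>B k. H z \<partial>lborel)"
   using b by (simp add: mult.assoc[symmetric] ennreal_mult[symmetric] powr_add[symmetric])
  also have "ennreal (bd (p k) powr (- s)) * (ennreal (a k powr s) * ennreal ((bd (p k) / 4) ^ ?n))
    = ennreal (a k powr s * bd (p k) powr (real ?n - s) / 4 ^ ?n)"
   using b by (simp add: ennreal_mult[symmetric] powr_diff powr_minus_divide powr_realpow power_divide mult_ac)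
  finally show ?thesis .
 qed
 have total: "(\<Sum>k\<le>N. a k powr s * bd (p k) powr (real ?n - s)) <= 4 ^ ?n * J"
 proof -
  have "ennreal (\<Sum>k\<le>N. a k powr s * bd (p k) powr (real ?n - s) / 4 ^ ?n)
   = (\<Sum>k\<le>N. ennreal (a k powr s * bd (p k) powr (real ?n - s) / 4 ^ ?n))" by (rule sum_ennreal[symmetric]) simp
  also have "... <= (\<Sum>k\<le>N. \<integral>\<^sup>+z\<in>B k. H z \<partial>lborel)" by (rule sum_mono) (use step in auto)
  also have "... = (\<integral>\<^sup>+z. (\<Sum>k\<le>N. H z * indicator (B k) z) \<partial>lborel)"
  proof -
   have [measurable]: "B k \<in> sets borel" for k unfolding B_def by (rule infnorm_ball_measurable)
   show ?thesis using H by (subst nn_integral_sum) auto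
  qed
  also have "... <= (\<integral>\<^sup>+z\<in>S. H z \<partial>lborel)"
  proof (rule nn_integral_mono)
   fix z
   show "(\<Sum>k\<le>N. H z * indicator (B k) z) <= H z * indicator S z"
   proof (cases "\<exists>k\<le>N. z \<in> B k")
    case True
    then obtain k where k: "k <= N" "z \<in> B k" by blast
    have "z \<notin> B i" if "i <= N" "i \<noteq> k" for i
     using p(5)[of i k] p(5)[of k i] k that by (cases "i < k") (auto simp: B_def)
    then have "(\<Sum>i\<le>N. H z * indicator (B i) z) = (\<Sum>i\<le>N. if i = k then H z else 0)"
     using k by (intro sum.cong) auto
    also have "... = H z" using k by simp
    also have "z \<in> S" using k p(2)[OF k(1)] S by (auto simp: B_def)
    then have "H z = H z * indicator S z" by simp
    finally show ?thesis by simp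
   next
    case False
    then have "(\<Sum>i\<le>N. H z * indicator (B i) z) = 0" by (intro sum.neutral) (auto simp: indicator_def)
    then show ?thesis by (simp only: zero_le)
   qed
  qed
  also have "... <= ennreal J" by (rule J)
  finally have "(\<Sum>k\<le>N. a k powr s * bd (p k) powr (real ?n - s) / 4 ^ ?n) <= J" using J(2) by (simp add: ennreal_le_iff)
  then show ?thesis by (simp add: sum_divide_distrib[symmetric] field_simps)
 qed
 have tele: "\<bar>F (p k) - F x\<bar> <= (\<Sum>i<k. a i)" if "k <= N" for k using that
 proof (induction k)
  case 0 then show ?case using p(1) by simp
 next
  case (Suc k)
  then have "\<bar>F (p (Suc k)) - F (p k)\<bar> = a k" by (simp add: a_def q_def)
  then show ?case using Suc by auto
 qed
 have "\<bar>F y - F x\<bar> <= (\<Sum>k\<le>N. a k)" using tele[of N] by (simp add: lessThan_Suc_atMost[symmetric] a_def q_def)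
 moreover have "(\<Sum>k\<le>N. a k) <= b * (\<Sum>k\<le>N. bd (p k) powr \<sigma>) + b powr (1 - s) * (\<Sum>k\<le>N. a k powr s * bd (p k) powr (real ?n - s))" if b: "b > 0" for b
 proof -
  have "a k <= b * bd (p k) powr \<sigma> + b powr (1 - s) * (a k powr s * bd (p k) powr (real ?n - s))" if k: "k <= N" for k
  proof -
   have "(bd (p k) powr \<sigma>) powr (1 - s) = bd (p k) powr (real ?n - s)"
   proof -
    have "\<sigma> * (1 - s) = real ?n - s" using s1 by (simp add: \<sigma> divide_simps) (simp add: algebra_simps)
    then show ?thesis by (simp add: powr_powr)
   qed
   then have "(b * bd (p k) powr \<sigma>) powr (1 - s) = b powr (1 - s) * bd (p k) powr (real ?n - s)"
    using b by (simp add: powr_mult)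
   then show ?thesis using young_split[of "a k" "b * bd (p k) powr \<sigma>" s] b bp[OF k] s1 by (simp add: a_def mult_ac)
  qed
  then show ?thesis unfolding sum_distrib_left sum.distrib[symmetric] by (intro sum_mono) auto
 qed
 moreover have "b * (\<Sum>k\<le>N. bd (p k) powr \<sigma>) + b powr (1 - s) * (\<Sum>k\<le>N. a k powr s * bd (p k) powr (real ?n - s))
   <= b * (8 * weighted_length \<sigma> \<gamma> + bd x powr \<sigma>) + b powr (1 - s) * (4 ^ ?n * J)" if b: "b > 0" for b
  using b total p(6) by (intro add_mono mult_left_mono) auto
 ultimately have X: "\<bar>F y - F x\<bar> <= b * (8 * weighted_length \<sigma> \<gamma> + bd x powr \<sigma>) + b powr (1 - s) * (4 ^ ?n * J)" if "b > 0" for b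
  using that by (meson order_trans)
 have "0 < bd x powr \<sigma>" using bd_pos[OF joinsD(5)[OF j]] by simp
 then have "0 < 8 * weighted_length \<sigma> \<gamma> + bd x powr \<sigma>" using weighted_length_nonneg[of \<sigma> \<gamma>] by linarith
 from young_optimise[OF X this _ s1] J(2) show ?thesis by simp
qed

end

section \<open>Test functions\<close>

text \<open>The functions \<open>P(1/s) e\<^bsup>-1/s\<^esup>\<close>, extended by zero, form a family that is closed under differentiation.\<close>
definition flat :: "real poly => real => real" where
 "flat P s = (if s > 0 then poly P (1 / s) * exp (- (1 / s)) else 0)"

lemma poly_exp_tendsto_0: "((\<lambda>y. poly P y * exp (- y)) \<longlongrightarrow> (0::real)) at_top"
proof -
 have "((\<lambda>y. \<Sum>i\<le>degree P. coeff P i * (y ^ i / exp y)) \<longlongrightarrow> (\<Sum>i\<le>degree P. coeff P i * 0)) at_top"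
  by (intro tendsto_intros tendsto_power_div_exp_0)
 then show ?thesis by (simp add: poly_altdef sum_distrib_right sum_distrib_left exp_minus divide_inverse mult_ac)
qed

lemma flat_has_derivative:
 "(flat P has_real_derivative flat ([:0, 0, 1:] * (P - pderiv P)) s) (at s)"
proof -
 consider "s > 0" | "s < 0" | "s = 0" by linarith
 then show ?thesis
 proof cases
  case 1
  have "((\<lambda>s. poly P (1 / s) * exp (- (1 / s))) has_real_derivative
    (poly (pderiv P) (1 / s) * (- 1 / s\<^sup>2)) * exp (- (1 / s)) + poly P (1 / s) * (exp (- (1 / s)) * (1 / s\<^sup>2))) (at s)"
   using 1 by (auto intro!: derivative_eq_intros simp: power2_eq_square divide_simps)
  moreover have "(poly (pderiv P) (1 / s) * (- 1 / s\<^sup>2)) * exp (- (1 / s)) + poly P (1 / s) * (exp (- (1 / s)) * (1 / s\<^sup>2))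
    = flat ([:0, 0, 1:] * (P - pderiv P)) s"
   using 1 by (simp add: flat_def power2_eq_square algebra_simps)
  ultimately have "((\<lambda>s. poly P (1 / s) * exp (- (1 / s))) has_real_derivative flat ([:0, 0, 1:] * (P - pderiv P)) s) (at s)"
   by (simp only:)
  then show ?thesis
   by (rule has_field_derivative_transform_within_open[where S="{0<..}"]) (use 1 in \<open>auto simp: flat_def\<close>)
 next
  case 2
  have "((\<lambda>s. 0) has_real_derivative flat ([:0, 0, 1:] * (P - pderiv P)) s) (at s)" using 2 by (simp add: flat_def)
  then show ?thesis
   by (rule has_field_derivative_transform_within_open[where S="{..<0}"]) (use 2 in \<open>auto simp: flat_def\<close>)
 next
  case 3
  have "((\<lambda>y. poly ([:0, 1:] * P) y * exp (- y)) \<longlongrightarrow> 0) at_top" by (rule poly_exp_tendsto_0)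
  then have "((\<lambda>h. poly ([:0, 1:] * P) (inverse h) * exp (- inverse h)) \<longlongrightarrow> 0) (at_right (0::real))"
   by (rule filterlim_compose[OF _ filterlim_inverse_at_top_right])
  then have "((\<lambda>h. (flat P (0 + h) - flat P 0) / h) \<longlongrightarrow> 0) (at_right 0)"
   by (rule Lim_transform_eventually) (auto simp: flat_def divide_inverse eventually_at_filter mult_ac)
  moreover have "((\<lambda>h. (flat P (0 + h) - flat P 0) / h) \<longlongrightarrow> 0) (at_left 0)"
   by (rule tendsto_eventually) (auto simp: flat_def eventually_at_filter)
  ultimately have "((\<lambda>h. (flat P (0 + h) - flat P 0) / h) \<longlongrightarrow> 0) (at 0)"
   by (simp add: filterlim_split_at)
  then show ?thesis using 3 by (simp add: DERIV_def flat_def)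
 qed
qed

lemma partial_deriv_eq: "(f has_derivative f') (at x) ==> partial_deriv i f x = f' (axis i 1)"
 unfolding partial_deriv_def by (drule frechet_derivative_at) simp

lemma k_smooth_differentiable: "k_smooth (Suc k) f ==> (f has_derivative frechet_derivative f (at x)) (at x)"
 by (simp add: frechet_derivative_works)

lemma k_smooth_Suc_imp: "k_smooth (Suc k) f ==> k_smooth k f"
proof (induction k arbitrary: f)
 case 0
 then show ?case by (auto intro!: differentiable_imp_continuous_on simp: differentiable_on_def differentiable_at_withinI)
qed auto

lemma k_smooth_const: "k_smooth k (\<lambda>_. c)"
 by (induction k arbitrary: c) (auto simp: partial_deriv_eq[OF has_derivative_const, abs_def])

lemma k_smooth_add: "k_smooth k f ==> k_smooth k g ==> k_smooth k (\<lambda>x. f x + g x)"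
proof (induction k arbitrary: f g)
 case (Suc k)
 have "partial_deriv i (\<lambda>x. f x + g x) = (\<lambda>x. partial_deriv i f x + partial_deriv i g x)" for i
  using partial_deriv_eq[OF has_derivative_add[OF k_smooth_differentiable[OF Suc.prems(1)] k_smooth_differentiable[OF Suc.prems(2)]]]
  by (auto simp: partial_deriv_def)
 then show ?case using Suc by simp
qed (auto intro: continuous_intros)

lemma partial_deriv_mult:
 assumes "k_smooth (Suc k) f" "k_smooth (Suc k) g"
 shows "partial_deriv i (\<lambda>x. f x * g x) x = f x * partial_deriv i g x + partial_deriv i f x * g x"
 using partial_deriv_eq[OF has_derivative_mult[OF k_smooth_differentiable[OF assms(1)] k_smooth_differentiable[OF assms(2)]]]
 by (simp add: partial_deriv_def)

lemma k_smooth_mult: "k_smooth k f ==> k_smooth k g ==> k_smooth k (\<lambda>x. f x * g x)"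
proof (induction k arbitrary: f g)
 case (Suc k)
 have "partial_deriv i (\<lambda>x. f x * g x) = (\<lambda>x. f x * partial_deriv i g x + partial_deriv i f x * g x)" for i
  using partial_deriv_mult[OF Suc.prems] by auto
 moreover have "k_smooth k f" "k_smooth k g" using Suc.prems k_smooth_Suc_imp by blast+
 ultimately show ?case using Suc by (auto intro!: k_smooth_add differentiable_mult)
qed (auto intro: continuous_intros)

lemma k_smooth_prod: "finite A ==> (\<And>i. i \<in> A ==> k_smooth k (f i)) ==> k_smooth k (\<lambda>x. \<Prod>i\<in>A. f i x)"
 by (induction A rule: finite_induct) (auto intro: k_smooth_const k_smooth_mult)

lemma coordinate_has_derivative: "((\<lambda>z::real^'n. c * z $ i + d) has_derivative (\<lambda>h. c * h $ i)) (at x)"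
proof -
 have "((\<lambda>z::real^'n. z $ i) has_derivative (\<lambda>h. h $ i)) (at x)"
  by (rule bounded_linear_imp_has_derivative[OF bounded_linear_vec_nth])
 from has_derivative_add[OF has_derivative_mult_right[OF this, of c] has_derivative_const[of d]] show ?thesis by simp
qed

lemma k_smooth_flat: "k_smooth k (\<lambda>z::real^'n. flat P (c * z $ i + d))"
proof (induction k arbitrary: P)
 case 0
 have "continuous_on UNIV (flat P)" by (rule DERIV_continuous_on) (use flat_has_derivative has_field_derivative_at_within in blast)
 moreover have "continuous_on UNIV (\<lambda>z::real^'n. c * z $ i + d)"
  by (intro has_derivative_continuous_on[OF has_derivative_at_withinI[OF coordinate_has_derivative]])
 ultimately have "continuous_on UNIV (\<lambda>z::real^'n. flat P (c * z $ i + d))" by (rule continuous_on_compose2) simp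
 then show ?case by simp
next
 case (Suc k)
 have D: "((\<lambda>z. flat P (c * z $ i + d)) has_derivative
   (\<lambda>h. (c * h $ i) * flat ([:0, 0, 1:] * (P - pderiv P)) (c * x $ i + d))) (at x)" for x :: "real^'n"
 proof -
  have "(flat P has_derivative (\<lambda>h. h * flat ([:0, 0, 1:] * (P - pderiv P)) (c * x $ i + d))) (at (c * x $ i + d))"
   using flat_has_derivative[of P "c * x $ i + d"] by (simp only: has_field_derivative_def mult_commute_abs)
  from has_derivative_compose[OF coordinate_has_derivative this] show ?thesis .
 qed
 have "partial_deriv j (\<lambda>z. flat P (c * z $ i + d)) =
   (\<lambda>z. (c * axis j 1 $ i) * flat ([:0, 0, 1:] * (P - pderiv P)) (c * z $ i + d))" for j
  by (rule ext) (rule partial_deriv_eq[OF D])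
 moreover have "(\<lambda>z. flat P (c * z $ i + d)) differentiable at x" for x using D differentiable_def by blast
 ultimately show ?case by (auto intro!: k_smooth_mult k_smooth_const Suc)
qed

lemma k_smooth_coordinate: "k_smooth k (\<lambda>z::real^'n. c * z $ i + d)"
proof (cases k)
 case (Suc k)
 note D = coordinate_has_derivative[of c i d]
 have "partial_deriv j (\<lambda>z. c * z $ i + d) = (\<lambda>z. c * axis j 1 $ i)" for j by (rule ext) (rule partial_deriv_eq[OF D])
 then show ?thesis using Suc D by (auto simp: differentiable_def intro!: k_smooth_const)
qed (auto intro!: continuous_intros)

text \<open>Smooth functions positive exactly on a box; for \<open>k \<rightarrow> \<infinity>\<close> they increase to its indicator.\<close>
definition bump :: "real => real^'n => real^'n => real^'n => real" where
 "bump k a b z = (\<Prod>i\<in>UNIV. flat 1 (k * (z $ i - a $ i)) * flat 1 (k * (b $ i - z $ i)))"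

lemma flat_1: "0 <= flat 1 s" "flat 1 s <= 1" "s <= 0 ==> flat 1 s = 0"
 by (auto simp: flat_def)

lemma bump_smooth: "k_smooth m (bump k a b)"
proof -
 have "bump k a b = (\<lambda>z. \<Prod>i\<in>UNIV. flat 1 (k * z $ i + (- k * a $ i)) * flat 1 ((- k) * z $ i + k * b $ i))"
  by (simp add: bump_def fun_eq_iff algebra_simps)
 then show ?thesis by (simp only:) (intro k_smooth_prod k_smooth_mult k_smooth_flat, simp)
qed

lemma bump_bounds: "0 <= bump k a b z" "bump k a b z <= 1"
 unfolding bump_def by (auto intro!: prod_nonneg prod_le_1 mult_nonneg_nonneg mult_le_one simp: flat_1)

lemma bump_outside: 
 assumes "0 < k" "z \<notin> box a b" shows "bump k a b z = 0"
proof -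
 obtain i where "z $ i <= a $ i \<or> b $ i <= z $ i" using assms(2) by (auto simp: mem_box_cart not_less)
 then have "k * (z $ i - a $ i) <= 0 \<or> k * (b $ i - z $ i) <= 0" using assms(1) by (auto simp: mult_le_0_iff)
 then show ?thesis unfolding bump_def by (intro prod_zero) (auto simp: flat_1(3) intro!: exI[of _ i])
qed

lemma bump_test_function:
 assumes "0 < k" "cbox a b \<subseteq> \<Omega>" shows "test_function \<Omega> (bump k a b)"
 unfolding test_function_def using assms bump_smooth bump_outside box_subset_cbox
 by (intro conjI allI exI[of _ "cbox a b"]) (blast intro: compact_cbox)+

lemma bump_tendsto: 
 fixes z :: "real^'n"
 shows "(\<lambda>k. bump (real (Suc k)) a b z) \<longlonglongrightarrow> indicator (box a b) z"
proof (cases "z \<in> box a b")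
 case True
 have "(\<lambda>k. flat 1 (real (Suc k) * s)) \<longlonglongrightarrow> 1" if "s > 0" for s
 proof -
  have "(\<lambda>k. exp (- (1 / s) * (1 / real (Suc k)))) \<longlonglongrightarrow> exp (- (1 / s) * 0)"
   using LIMSEQ_Suc[OF lim_const_over_n[of 1]] by (intro tendsto_intros)
  then show ?thesis using that by (simp add: flat_def mult.commute)
 qed
 then have "(\<lambda>k. bump (real (Suc k)) a b z) \<longlonglongrightarrow> (\<Prod>i\<in>(UNIV::'n set). 1 * 1)"
  unfolding bump_def using True by (intro tendsto_intros) (auto simp: mem_box_cart)
 then show ?thesis using True by simp
qed (simp add: bump_outside)

section \<open>Uniqueness of the weak gradient\<close>

lemma test_product_integrable:
 fixes G :: "real^'n => 'b::euclidean_space"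
 assumes G: "locally_integrable \<Omega> G" and \<phi>: "continuous_on UNIV \<phi>"
  and K: "compact K" "K \<subseteq> \<Omega>" "\<And>x. x \<notin> K ==> \<phi> x = 0"
 shows "set_integrable lebesgue \<Omega> (\<lambda>x. \<phi> x *\<^sub>R G x)" "(\<lambda>x. \<phi> x *\<^sub>R G x) absolutely_integrable_on K"
  "(LINT x:\<Omega>|lebesgue. \<phi> x *\<^sub>R G x) = integral K (\<lambda>x. \<phi> x *\<^sub>R G x)"
proof -
 show a: "(\<lambda>x. \<phi> x *\<^sub>R G x) absolutely_integrable_on K"
 proof (rule absolutely_integrable_bounded_measurable_product[where h="scaleR"])
  show "bilinear (scaleR :: real => 'b => 'b)" by (simp add: bilinear_conv_bounded_bilinear bounded_bilinear_scaleR)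
  show "\<phi> \<in> borel_measurable (lebesgue_on K)"
   by (rule continuous_imp_measurable_on_sets_lebesgue) (use \<phi> K in \<open>auto intro: continuous_on_subset lmeasurable_compact fmeasurableD\<close>)
  show "K \<in> sets lebesgue" using K by (simp add: lmeasurable_compact fmeasurableD)
  show "bounded (\<phi> ` K)" using K \<phi> by (auto intro!: compact_imp_bounded compact_continuous_image continuous_on_subset[OF \<phi>])
  show "G absolutely_integrable_on K" using G K by (simp add: locally_integrable_def)
 qed
 have eq: "(\<lambda>x. indicator \<Omega> x *\<^sub>R (\<phi> x *\<^sub>R G x)) = (\<lambda>x. indicator K x *\<^sub>R (\<phi> x *\<^sub>R G x))"
  using K by (auto simp: indicator_def fun_eq_iff)
 show "set_integrable lebesgue \<Omega> (\<lambda>x. \<phi> x *\<^sub>R G x)" using a unfolding set_integrable_def eq .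
 show "(LINT x:\<Omega>|lebesgue. \<phi> x *\<^sub>R G x) = integral K (\<lambda>x. \<phi> x *\<^sub>R G x)"
  using set_lebesgue_integral_eq_integral(2)[OF a] unfolding set_lebesgue_integral_def eq .
qed

lemma test_functionE:
 assumes "test_function \<Omega> \<phi>"
 obtains K where "compact K" "K \<subseteq> \<Omega>" "\<And>x. x \<notin> K ==> \<phi> x = 0" "continuous_on UNIV \<phi>"
proof -
 have "k_smooth 0 \<phi>" using assms unfolding test_function_def by blast
 then have "continuous_on UNIV \<phi>" by simp
 with assms that show thesis unfolding test_function_def by blast
qed

text \<open>Averages over small cubes converge to the function almost everywhere, and a function that is
 orthogonal to all test functions has integral zero over every cube.\<close>
lemma orthogonal_test_functions_imp_zero:
 fixes H :: "real^'n => real"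
 assumes \<Omega>: "open \<Omega>" and H: "locally_integrable \<Omega> H"
  and orth: "\<And>\<phi>. test_function \<Omega> \<phi> ==> (LINT x:\<Omega>|lebesgue. \<phi> x * H x) = 0"
 shows "AE x in lebesgue. x \<in> \<Omega> \<longrightarrow> H x = 0"
proof -
 have box0: "integral (cbox a b) H = 0" if ab: "cbox a b \<subseteq> \<Omega>" for a b
 proof -
  have Hi: "H absolutely_integrable_on cbox a b" using H ab by (simp add: locally_integrable_def)
  have cb: "continuous_on UNIV (bump k a b)" for k using bump_smooth[of 0] by simp
  have z: "integral (cbox a b) (\<lambda>x. bump (real (Suc k)) a b x * H x) = 0" for k
   using orth[OF bump_test_function[OF _ ab]] bump_outside[of "real (Suc k)" _ a b] box_subset_cbox[of a b]
   by (subst test_product_integrable(3)[OF H cb compact_cbox ab, simplified, symmetric]) auto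
  have "(\<lambda>k. integral (cbox a b) (\<lambda>x. bump (real (Suc k)) a b x * H x))
    \<longlonglongrightarrow> integral (cbox a b) (\<lambda>x. indicator (box a b) x * H x)"
  proof (rule dominated_convergence(2)[where h="\<lambda>x. norm (H x)"])
   show "(\<lambda>x. bump (real (Suc k)) a b x * H x) integrable_on cbox a b" for k
    using test_product_integrable(2)[OF H cb compact_cbox ab] bump_outside[of "real (Suc k)" _ a b] box_subset_cbox[of a b]
    by (intro set_lebesgue_integral_eq_integral(1)) auto
   show "(\<lambda>x. norm (H x)) integrable_on cbox a b" using Hi absolutely_integrable_on_def by blast
   show "norm (bump (real (Suc k)) a b x * H x) <= norm (H x)" for k x
    using bump_bounds[of "real (Suc k)" a b x] by (simp add: abs_mult mult_left_le_one_le)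
   show "(\<lambda>k. bump (real (Suc k)) a b x * H x) \<longlonglongrightarrow> indicator (box a b) x * H x" for x
    by (intro tendsto_mult bump_tendsto tendsto_const)
  qed
  then have "integral (cbox a b) (\<lambda>x. indicator (box a b) x * H x) = 0"
   unfolding z using LIMSEQ_unique[OF _ tendsto_const] by metis
  moreover have "(\<lambda>x. indicator (box a b) x * H x) = (\<lambda>x. if x \<in> box a b then H x else 0)" by (auto simp: indicator_def)
  ultimately have "integral (cbox a b \<inter> box a b) H = 0" by (simp add: integral_restrict_Int Int_commute)
  moreover have "cbox a b \<inter> box a b = box a b" using box_subset_cbox by blast
  ultimately show ?thesis by (simp add: integral_open_interval)
 qed
 obtain C where C: "\<And>n. compact (C n)" "\<And>n. C n \<subseteq> \<Omega>" "\<And>n. C n \<subseteq> interior (C (Suc n))" "\<Union>(range C) = \<Omega>"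
  "\<And>K. compact K ==> K \<subseteq> \<Omega> ==> \<exists>N. \<forall>n\<ge>N. K \<subseteq> C n"
  using open_Union_compact_subsets[OF \<Omega>] by blast
 define f where "f m x = (if x \<in> C m then H x else 0)" for m x
 have "f m absolutely_integrable_on UNIV" for m
  using H C(1,2)[of m] absolutely_integrable_restrict_UNIV[of "C m" H] unfolding f_def locally_integrable_def by auto
 then have "f m absolutely_integrable_on cbox a b" for m a b
  by (rule set_integrable_subset) auto
 then have "f m integrable_on cbox a b" for m a b by (rule set_lebesgue_integral_eq_integral(1))
 then have "\<exists>N. negligible N \<and> (\<forall>x e. x \<notin> N \<and> 0 < e \<longrightarrow> (\<exists>d>0. \<forall>h. 0 < h \<and> h < d \<longrightarrow>
   norm (integral (cbox x (x + h *\<^sub>R One)) (f m) /\<^sub>R h ^ DIM(real^'n) - f m x) < e))" for m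
  using integrable_ccontinuous_explicit[of "f m"] by metis
 then obtain N where N: "\<And>m. negligible (N m)" "\<And>m x e. x \<notin> N m ==> 0 < e ==> (\<exists>d>0. \<forall>h. 0 < h \<and> h < d \<longrightarrow>
   norm (integral (cbox x (x + h *\<^sub>R One)) (f m) /\<^sub>R h ^ DIM(real^'n) - f m x) < e)" by metis
 have zero: "H x = 0" if x: "x \<in> \<Omega>" "x \<notin> (\<Union>m. N m)" for x
 proof (rule ccontr)
  assume nz: "H x \<noteq> 0"
  obtain r where r: "r > 0" "cball x r \<subseteq> \<Omega>" using \<Omega> x(1) open_contains_cball by blast
  obtain m where m: "cball x r \<subseteq> C m" using C(5)[of "cball x r"] r by auto
  obtain d where d: "d > 0" "\<And>h. 0 < h ==> h < d ==>
   norm (integral (cbox x (x + h *\<^sub>R One)) (f m) /\<^sub>R h ^ DIM(real^'n) - f m x) < norm (H x)"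
   using N(2)[of x m "norm (H x)"] x(2) nz by auto
  define l where "l = norm (One :: real^'n)"
  have l: "l > 0" unfolding l_def by (simp add: One_neq_0[unfolded])
  define h where "h = min (d / 2) (r / l)"
  have h: "0 < h" "h < d" "h * l <= r" using d(1) r(1) l by (auto simp: h_def min_def field_simps)
  have sub: "cbox x (x + h *\<^sub>R One) \<subseteq> cball x r"
  proof
   fix z assume z: "z \<in> cbox x (x + h *\<^sub>R One)"
   have "norm (z - x) <= norm (h *\<^sub>R (One::real^'n))"
    by (rule norm_le_componentwise) (use z h(1) in \<open>auto simp: mem_box algebra_simps\<close>)
   then show "z \<in> cball x r" using h by (simp add: dist_norm norm_minus_commute l_def)
  qed
  have "integral (cbox x (x + h *\<^sub>R One)) (f m) = integral (cbox x (x + h *\<^sub>R One)) H"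
   by (rule integral_cong) (use sub m in \<open>auto simp: f_def\<close>)
  also have "... = 0" by (rule box0) (use sub r in auto)
  finally have "norm (f m x) < norm (H x)" using d(2)[OF h(1,2)] by simp
  moreover have "x \<in> C m" using m r(1) by auto
  ultimately show False by (simp add: f_def)
 qed
 have "negligible (\<Union>m. N m)" using N(1) negligible_Union_nat by (metis)
 then have "AE x in lebesgue. x \<notin> (\<Union>m. N m)" by (intro AE_not_in) (simp add: negligible_iff_null_sets)
 then show ?thesis by eventually_elim (use zero in blast)
qed

lemma weak_gradient_unique:
 fixes \<Omega> :: "(real^'n) set"
 assumes \<Omega>: "open \<Omega>" and G: "weak_gradient \<Omega> F G" "weak_gradient \<Omega> F G'"
 shows "AE x in lebesgue. x \<in> \<Omega> \<longrightarrow> G x = G' x"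
proof -
 have li: "locally_integrable \<Omega> G" "locally_integrable \<Omega> G'" using G by (auto simp: weak_gradient_def)
 have lc: "locally_integrable \<Omega> (\<lambda>x. g x $ i)" if "locally_integrable \<Omega> g" for g :: "real^'n => real^'n" and i
  unfolding locally_integrable_def
 proof (intro allI impI)
  fix K assume "compact K \<and> K \<subseteq> \<Omega>"
  then have "g absolutely_integrable_on K" using that by (simp add: locally_integrable_def)
  then have "(\<lambda>x. g x \<bullet> axis i 1) absolutely_integrable_on K" by (rule absolutely_integrable_component)
  then show "(\<lambda>x. g x $ i) absolutely_integrable_on K" by (simp add: inner_axis)
 qed
 have "AE x in lebesgue. x \<in> \<Omega> \<longrightarrow> G x $ i - G' x $ i = 0" for i
 proof (rule orthogonal_test_functions_imp_zero[OF \<Omega>])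
  show "locally_integrable \<Omega> (\<lambda>x. G x $ i - G' x $ i)"
   using lc[OF li(1), of i] lc[OF li(2), of i] unfolding locally_integrable_def by (auto intro: set_integral_diff)
  fix \<phi> assume t: "test_function \<Omega> \<phi>"
  obtain K where K: "compact K" "K \<subseteq> \<Omega>" "\<And>x. x \<notin> K ==> \<phi> x = 0" "continuous_on UNIV \<phi>"
   by (rule test_functionE[OF t]) (rule that)
  have i: "set_integrable lebesgue \<Omega> (\<lambda>x. G x $ i * \<phi> x)" "set_integrable lebesgue \<Omega> (\<lambda>x. G' x $ i * \<phi> x)"
   using test_product_integrable(1)[OF lc[OF li(1)] K(4,1,2,3)] test_product_integrable(1)[OF lc[OF li(2)] K(4,1,2,3)]
   by (auto simp: mult.commute)
  have "(LINT x:\<Omega>|lebesgue. G x $ i * \<phi> x) = (LINT x:\<Omega>|lebesgue. G' x $ i * \<phi> x)"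
   using G t by (auto simp: weak_gradient_def)
  then show "(LINT x:\<Omega>|lebesgue. \<phi> x * (G x $ i - G' x $ i)) = 0"
   using set_integral_diff(2)[OF i] by (simp add: algebra_simps)
 qed
 then have "AE x in lebesgue. \<forall>i\<in>UNIV. x \<in> \<Omega> \<longrightarrow> G x $ i - G' x $ i = 0" by (intro AE_finite_allI) auto
 then show ?thesis by eventually_elim (auto simp: vec_eq_iff)
qed

section \<open>Morrey's inequality on a cube\<close>

definition unit_bump :: "real^'n => real" where
 "unit_bump = bump 1 (\<chi> i. -1) (\<chi> i. 1)"

definition bump_min :: "'n::finite itself => real" where
 "bump_min _ = (flat 1 (1/2) * flat 1 (1/2)) ^ CARD('n)"

lemma bump_min_pos: "0 < bump_min TYPE('n::finite)"
 by (simp add: bump_min_def flat_def)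

lemma unit_bump_bounds: "0 <= unit_bump z" "unit_bump z <= 1" "1 <= infnorm z ==> unit_bump z = 0"
 for z :: "real^'n"
proof -
 show "0 <= unit_bump z" "unit_bump z <= 1" by (simp_all add: unit_bump_def bump_bounds)
 assume z: "1 <= infnorm z"
 have "z \<notin> box (\<chi> i. -1) (\<chi> i. 1)"
 proof
  assume b: "z \<in> box (\<chi> i. -1) (\<chi> i. 1)"
  have "\<bar>z $ i\<bar> < 1" for i using b by (auto simp: mem_box_cart abs_less_iff)
  then have "Max (range (\<lambda>i. \<bar>z $ i\<bar>)) < 1" by (subst Max_less_iff) auto
  moreover have "infnorm z <= Max (range (\<lambda>i. \<bar>z $ i\<bar>))" unfolding infnorm_le_cart by simp
  ultimately show False using z by linarith
 qed
 then show "unit_bump z = 0" by (simp add: unit_bump_def bump_outside)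
qed

lemma flat_mono: "s <= t ==> flat 1 s <= flat 1 t"
 by (auto simp: flat_def divide_simps)

lemma unit_bump_lower: "infnorm (z::real^'n) <= 1/2 ==> bump_min TYPE('n) <= unit_bump z"
proof -
 assume "infnorm z <= 1/2"
 then have z: "\<bar>z $ i\<bar> <= 1/2" for i unfolding infnorm_le_cart by blast
 have "(\<Prod>i\<in>(UNIV::'n set). flat 1 (1/2) * flat 1 (1/2)) <= unit_bump z" unfolding unit_bump_def bump_def
 proof (intro prod_mono conjI mult_mono flat_mono mult_nonneg_nonneg flat_1)
  fix i show "1/2 <= 1 * (z $ i - (\<chi> i. -1) $ i)" "1/2 <= 1 * ((\<chi> i. 1) $ i - z $ i)"
   using z[of i] by auto
 qed
 then show ?thesis by (simp add: bump_min_def)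
qed

lemma unit_bump_smooth: "k_smooth k (unit_bump :: real^'n => real)"
 by (simp add: unit_bump_def bump_smooth)

lemma unit_bump_continuous: "continuous_on S (unit_bump :: real^'n => real)"
 using unit_bump_smooth[of 0] continuous_on_subset by auto

lemma
 fixes f :: "real^'n => real"
 shows k_smooth_affine: "k_smooth k f ==> k_smooth k (\<lambda>z. f (a *\<^sub>R z + b))"
 and partial_deriv_affine: "k_smooth (Suc m) f ==> partial_deriv i (\<lambda>z. f (a *\<^sub>R z + b)) z = a * partial_deriv i f (a *\<^sub>R z + b)"
proof -
 have D: "((\<lambda>z. f (a *\<^sub>R z + b)) has_derivative (\<lambda>h. a *\<^sub>R frechet_derivative f (at (a *\<^sub>R z + b)) h)) (at z)"
  if "k_smooth (Suc m) f" for m z and f :: "real^'n => real"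
 proof -
  have lin: "((\<lambda>z. a *\<^sub>R z + b) has_derivative (\<lambda>h. a *\<^sub>R h)) (at z)" by (auto intro!: derivative_eq_intros)
  note f' = k_smooth_differentiable[OF that, of "a *\<^sub>R z + b"]
  show ?thesis using has_derivative_compose[OF lin f'] linear_scale[OF has_derivative_linear[OF f']] by simp
 qed
 have pd: "partial_deriv i (\<lambda>z. f (a *\<^sub>R z + b)) z = a * partial_deriv i f (a *\<^sub>R z + b)"
  if "k_smooth (Suc m) f" for m i z and f :: "real^'n => real"
  using partial_deriv_eq[OF D[OF that]] by (simp add: partial_deriv_def)
 show "k_smooth (Suc m) f ==> partial_deriv i (\<lambda>z. f (a *\<^sub>R z + b)) z = a * partial_deriv i f (a *\<^sub>R z + b)"
  by (rule pd)
 show "k_smooth k f ==> k_smooth k (\<lambda>z. f (a *\<^sub>R z + b))"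
 proof (induction k arbitrary: f)
  case 0
  have "continuous_on UNIV (\<lambda>z. a *\<^sub>R z + b)" by (intro continuous_intros)
  then show ?case using continuous_on_compose2[of UNIV f UNIV] 0 by simp
 next
  case (Suc k)
  have "partial_deriv i (\<lambda>z. f (a *\<^sub>R z + b)) = (\<lambda>z. a * partial_deriv i f (a *\<^sub>R z + b))" for i
   using pd[OF Suc.prems] by auto
  moreover have "(\<lambda>z. f (a *\<^sub>R z + b)) differentiable at z" for z using D[OF Suc.prems] differentiable_def by blast
  moreover have "k_smooth k (\<lambda>z. a * partial_deriv i f (a *\<^sub>R z + b))" for i
   using Suc by (intro k_smooth_mult k_smooth_const) auto
  ultimately show ?case by simp
 qed
qed

lemma partial_deriv_zero_outside:
 assumes "closed K" "\<And>x. x \<notin> K ==> f x = 0" "z \<notin> K" shows "partial_deriv i f z = 0"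
proof -
 have "((\<lambda>_. 0) has_derivative (\<lambda>_. 0)) (at z)" by simp
 then have "(f has_derivative (\<lambda>_. 0)) (at z)"
  by (rule has_derivative_transform_within_open[OF _ open_Compl[OF assms(1)]]) (use assms in auto)
 from partial_deriv_eq[OF this] show ?thesis by simp
qed

lemma frechet_sum_partial:
 assumes "(f has_derivative f') (at (x::real^'n))" shows "f' h = (\<Sum>i\<in>UNIV. h $ i * partial_deriv i f x)"
proof -
 note lin = has_derivative_linear[OF assms]
 have "f' h = f' (\<Sum>i\<in>UNIV. h $ i *\<^sub>R axis i 1)"
  using basis_expansion[of h] by (simp only: scalar_mult_eq_scaleR)
 also have "... = (\<Sum>i\<in>UNIV. h $ i *\<^sub>R f' (axis i 1))" by (simp add: linear_sum[OF lin] linear_scale[OF lin])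
 finally show ?thesis by (simp add: partial_deriv_eq[OF assms])
qed

lemma integral_lborel_scale:
 fixes f :: "real^'n => real"
 assumes [measurable]: "f \<in> borel_measurable borel" and r: "0 < r"
 shows "integral\<^sup>L lborel (\<lambda>z. f ((1/r) *\<^sub>R (z - c))) = r ^ CARD('n) * integral\<^sup>L lborel f"
proof -
 have "integral\<^sup>L lborel (\<lambda>z. f ((1/r) *\<^sub>R (z - c)))
  = integral\<^sup>L (density (distr lborel borel (\<lambda>x. c + r *\<^sub>R x)) (\<lambda>_. ennreal (r ^ CARD('n)))) (\<lambda>z. f ((1/r) *\<^sub>R (z - c)))"
  using lborel_affine[of r c] r by (simp add: ennreal_power)
 also have "... = integral\<^sup>L lborel (\<lambda>x. r ^ CARD('n) * f x)"
  using r by (simp add: integral_density integral_distr)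
 finally show ?thesis by simp
qed

lemma continuous_integral_box:
 fixes f :: "real^'n => real"
 assumes "continuous_on UNIV f" "\<And>z. z \<notin> cbox a b ==> f z = 0"
 shows "integral (cbox a b) f = integral\<^sup>L lborel f" "integrable lborel f"
proof -
 have c: "set_integrable lborel (cbox a b) f" unfolding set_integrable_def
  by (rule borel_integrable_compact[OF compact_cbox continuous_on_subset[OF assms(1) subset_UNIV]])
 have e: "(\<lambda>z. indicator (cbox a b) z *\<^sub>R f z) = f" using assms(2) by (auto simp: indicator_def fun_eq_iff)
 show "integral (cbox a b) f = integral\<^sup>L lborel f"
  using set_borel_integral_eq_integral(2)[OF c] unfolding set_lebesgue_integral_def e by simp
 show "integrable lborel f" using c unfolding set_integrable_def e .
qed

definition bump_mass :: "'n::finite itself => real" where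
 "bump_mass _ = integral\<^sup>L lborel (unit_bump :: real^'n => real)"

lemma unit_bump_integrable: "integrable lborel (unit_bump :: real^'n => real)"
proof (rule continuous_integral_box(2)[OF unit_bump_continuous])
 fix z :: "real^'n" assume "z \<notin> cbox (\<chi> i. 0 $ i - 1) (\<chi> i. 0 $ i + 1)"
 then show "unit_bump z = 0" using infnorm_ball_eq_cbox[of "0::real^'n" 1] unit_bump_bounds(3)[of z] by force
qed

lemma bump_mass_pos: "0 < bump_mass TYPE('n::finite)"
proof -
 let ?B = "{z::real^'n. infnorm (z - 0) <= 1/2}"
 have B: "emeasure lborel ?B = 1" by (subst emeasure_infnorm_ball) auto
 have m: "?B \<in> sets borel" by (rule infnorm_ball_measurable)
 have "integral\<^sup>L lborel (\<lambda>z. bump_min TYPE('n) * indicator ?B z) <= bump_mass TYPE('n)" unfolding bump_mass_def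
 proof (rule integral_mono)
  show "integrable lborel (\<lambda>z. bump_min TYPE('n) * indicator ?B z)"
   using B m by (intro integrable_mult_right integrable_real_indicator) auto
 qed (use unit_bump_lower unit_bump_bounds in \<open>auto simp: indicator_def unit_bump_integrable\<close>)
 also have "integral\<^sup>L lborel (\<lambda>z. bump_min TYPE('n) * indicator ?B z) = bump_min TYPE('n) * measure lborel ?B"
  using m by simp
 also have "measure lborel ?B = 1" using B by (simp add: measure_def)
 finally show ?thesis using bump_min_pos[where 'n='n] by simp
qed

text \<open>The bump \<open>K 1\<close> is supported in the cube with centre \<open>x + v\<close> and radius \<open>R\<close>, and \<open>K t\<close> arises from it by
 contraction towards \<open>x\<close>, normalised to keep the integral.  These functions satisfy
 \<open>\<partial>\<^sub>t K t = - div ((z - x)/t \<cdot> K t)\<close>.  So the derivative in \<open>t\<close> of the weighted average of \<open>F\<close> is an integral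
 of the weak gradient against test functions, and no smoothing of \<open>F\<close> is needed.\<close>
locale dilated_bump =
 fixes x v :: "real^'n" and R :: real
 assumes R: "0 < R" and v: "infnorm v <= R"
begin

definition \<Phi> :: "real^'n => real" where "\<Phi> w = unit_bump ((1/R) *\<^sub>R w + (- (1/R) *\<^sub>R v))"
definition K :: "real => real^'n => real" where "K t z = (1/t) ^ CARD('n) * \<Phi> ((1/t) *\<^sub>R z + (- (1/t) *\<^sub>R x))"
definition \<psi> :: "'n => real => real^'n => real" where "\<psi> i t z = ((1/t) * z $ i + (- (1/t) * x $ i)) * K t z"

lemma \<Phi>_smooth: "k_smooth k \<Phi>"
 unfolding \<Phi>_def[abs_def] by (intro k_smooth_affine unit_bump_smooth)

lemma K_smooth: "k_smooth k (K t)"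
 unfolding K_def[abs_def] by (intro k_smooth_mult k_smooth_const k_smooth_affine \<Phi>_smooth)

lemma \<psi>_smooth: "k_smooth k (\<psi> i t)"
 unfolding \<psi>_def[abs_def] by (intro k_smooth_mult k_smooth_coordinate K_smooth)

lemma K_bounds: "0 < t ==> 0 <= K t z" "0 < t ==> K t z <= (1/t) ^ CARD('n)"
 unfolding K_def \<Phi>_def by (intro mult_nonneg_nonneg mult_left_le unit_bump_bounds zero_le_power; simp)+

lemma K_support:
 assumes t: "0 < t" and nz: "K t z \<noteq> 0" shows "infnorm (z - (x + t *\<^sub>R v)) <= t * R"
proof -
 have "(1/R) *\<^sub>R ((1/t) *\<^sub>R z + (- (1/t) *\<^sub>R x)) + (- (1/R) *\<^sub>R v) = (1/(t*R)) *\<^sub>R (z - (x + t *\<^sub>R v))"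
  using t R by (simp add: algebra_simps)
 then have "unit_bump ((1/(t*R)) *\<^sub>R (z - (x + t *\<^sub>R v))) \<noteq> 0"
  using nz unfolding K_def \<Phi>_def by (metis mult_zero_right)
 then have "infnorm ((1/(t*R)) *\<^sub>R (z - (x + t *\<^sub>R v))) < 1" using unit_bump_bounds(3) not_less by blast
 then have "infnorm (z - (x + t *\<^sub>R v)) / (t * R) < 1" using t R by (simp add: infnorm_mul)
 then show ?thesis using t R by (simp add: pos_divide_less_eq less_imp_le)
qed

lemma support_near: "0 < t ==> infnorm (z - (x + t *\<^sub>R v)) <= t * R ==> infnorm (z - x) <= 2 * t * R"
proof -
 assume t: "0 < t" "infnorm (z - (x + t *\<^sub>R v)) <= t * R"
 have "infnorm (z - x) <= infnorm (z - (x + t *\<^sub>R v)) + infnorm (t *\<^sub>R v)"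
  using infnorm_triangle_diff[of z x "x + t *\<^sub>R v"] by simp
 also have "infnorm (t *\<^sub>R v) <= t * R" using t v by (simp add: infnorm_mul mult_left_mono)
 finally show ?thesis using t by simp
qed

lemma support_in_cube:
 "0 < t ==> t <= 1 ==> infnorm (z - (x + t *\<^sub>R v)) <= t * R ==> infnorm (z - (x + v)) <= R"
proof -
 assume t: "0 < t" "t <= 1" "infnorm (z - (x + t *\<^sub>R v)) <= t * R"
 have "infnorm (z - (x + v)) <= infnorm (z - (x + t *\<^sub>R v)) + infnorm ((1 - t) *\<^sub>R (- v))"
  using infnorm_triangle_diff[of z "x + v" "x + t *\<^sub>R v"] by (simp add: algebra_simps)
 also have "infnorm ((1 - t) *\<^sub>R (- v)) <= (1 - t) * R" using t v by (simp add: infnorm_mul infnorm_neg mult_left_mono)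
 finally show ?thesis using t by (simp add: algebra_simps)
qed

lemma partial_\<psi>:
 assumes "t \<noteq> 0" defines "w \<equiv> \<lambda>z. (1/t) *\<^sub>R z + (- (1/t) *\<^sub>R x)"
 shows "partial_deriv i (\<psi> i t) z = (1/t) ^ Suc CARD('n) * (\<Phi> (w z) + w z $ i * partial_deriv i \<Phi> (w z))"
proof -
 have K: "partial_deriv i (K t) z = (1/t) ^ CARD('n) * ((1/t) * partial_deriv i \<Phi> (w z))"
 proof -
  have "partial_deriv i (\<lambda>z. (1/t) ^ CARD('n) * \<Phi> (w z)) z = (1/t) ^ CARD('n) * partial_deriv i (\<lambda>z. \<Phi> (w z)) z
    + partial_deriv i (\<lambda>_. (1/t) ^ CARD('n)) z * \<Phi> (w z)"
   unfolding w_def by (rule partial_deriv_mult[OF k_smooth_const k_smooth_affine[OF \<Phi>_smooth]])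
  also have "partial_deriv i (\<lambda>z. \<Phi> (w z)) z = (1/t) * partial_deriv i \<Phi> (w z)"
   unfolding w_def by (rule partial_deriv_affine[OF \<Phi>_smooth])
  also have "partial_deriv i (\<lambda>_. (1/t) ^ CARD('n)) z = 0" using partial_deriv_eq[OF has_derivative_const] .
  finally show ?thesis by (simp add: K_def[abs_def] w_def)
 qed
 have "partial_deriv i (\<psi> i t) z = ((1/t) * z $ i + (- (1/t) * x $ i)) * partial_deriv i (K t) z
   + partial_deriv i (\<lambda>z. (1/t) * z $ i + (- (1/t) * x $ i)) z * K t z"
  unfolding \<psi>_def[abs_def] by (rule partial_deriv_mult[OF k_smooth_coordinate K_smooth])
 also have "partial_deriv i (\<lambda>z. (1/t) * z $ i + (- (1/t) * x $ i)) z = 1/t"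
  using partial_deriv_eq[OF coordinate_has_derivative, of i "1/t" i "- (1/t) * x $ i" z] by (simp add: axis_def)
 also have "(1/t) * z $ i + (- (1/t) * x $ i) = w z $ i" by (simp add: w_def)
 finally have "partial_deriv i (\<psi> i t) z = w z $ i * ((1/t) ^ CARD('n) * ((1/t) * partial_deriv i \<Phi> (w z))) + (1/t) * K t z"
  unfolding K .
 moreover have "K t z = (1/t) ^ CARD('n) * \<Phi> (w z)" by (simp only: K_def w_def)
 ultimately show ?thesis by (simp add: algebra_simps)
qed

lemma K_time_derivative:
 assumes t: "0 < t"
 shows "((\<lambda>t. K t z) has_real_derivative (- (\<Sum>i\<in>UNIV. partial_deriv i (\<psi> i t) z))) (at t)"
proof -
 define w where "w = (\<lambda>t. (1/t) *\<^sub>R z + (- (1/t) *\<^sub>R x))"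
 note D\<Phi> = k_smooth_differentiable[OF \<Phi>_smooth[of "Suc 0"], of "w t"]
 have inv: "((\<lambda>t. 1/t) has_real_derivative - ((1/t) * (1/t))) (at t)"
  using t by (auto intro!: derivative_eq_intros simp: divide_simps)
 have w: "(w has_derivative (\<lambda>h. h *\<^sub>R (- (1/t) *\<^sub>R w t))) (at t)"
 proof -
  have "((\<lambda>t. (1/t) *\<^sub>R (z - x)) has_derivative (\<lambda>h. (- ((1/t) * (1/t)) * h) *\<^sub>R (z - x))) (at t)"
   using has_derivative_scaleR_left[OF inv[unfolded has_field_derivative_def]] by simp
  moreover have "(\<lambda>t. (1/t) *\<^sub>R (z - x)) = w" by (simp add: w_def fun_eq_iff algebra_simps)
  moreover have "(- ((1/t) * (1/t)) * h) *\<^sub>R (z - x) = h *\<^sub>R (- (1/t) *\<^sub>R w t)" for h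
   by (simp add: w_def algebra_simps)
  ultimately show ?thesis by simp
 qed
 have "((\<lambda>t. \<Phi> (w t)) has_derivative (\<lambda>h. frechet_derivative \<Phi> (at (w t)) (h *\<^sub>R (- (1/t) *\<^sub>R w t)))) (at t)"
  by (rule has_derivative_compose[OF w D\<Phi>])
 moreover have "frechet_derivative \<Phi> (at (w t)) (h *\<^sub>R (- (1/t) *\<^sub>R w t)) = (- (1/t) * (\<Sum>i\<in>UNIV. w t $ i * partial_deriv i \<Phi> (w t))) * h" for h
  by (subst frechet_sum_partial[OF D\<Phi>]) (simp add: sum_distrib_left sum_distrib_right mult_ac sum_negf)
 ultimately have \<Phi>': "((\<lambda>t. \<Phi> (w t)) has_real_derivative (- (1/t) * (\<Sum>i\<in>UNIV. w t $ i * partial_deriv i \<Phi> (w t)))) (at t)"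
  unfolding has_field_derivative_def by (simp only:)
 have pow: "((\<lambda>t. (1/t) ^ CARD('n)) has_real_derivative (real CARD('n) * (1/t) ^ (CARD('n) - 1) * (- ((1/t) * (1/t))))) (at t)"
  by (rule DERIV_cong[OF DERIV_power[OF inv]]) simp
 have n: "(1/t) ^ CARD('n) = (1/t) * (1/t) ^ (CARD('n) - 1)"
  using power_eq_if[of "1/t" "CARD('n)"] by simp
 have "((\<lambda>t. (1/t) ^ CARD('n) * \<Phi> (w t)) has_real_derivative
   (real CARD('n) * (1/t) ^ (CARD('n) - 1) * (- ((1/t) * (1/t)))) * \<Phi> (w t)
    + (- (1/t) * (\<Sum>i\<in>UNIV. w t $ i * partial_deriv i \<Phi> (w t))) * (1/t) ^ CARD('n)) (at t)"
  by (rule DERIV_mult[OF pow \<Phi>'])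
 moreover have "(real CARD('n) * (1/t) ^ (CARD('n) - 1) * (- ((1/t) * (1/t)))) * \<Phi> (w t)
    + (- (1/t) * (\<Sum>i\<in>UNIV. w t $ i * partial_deriv i \<Phi> (w t))) * (1/t) ^ CARD('n)
   = - (\<Sum>i\<in>UNIV. partial_deriv i (\<psi> i t) z)"
 proof -
  have "(\<Sum>i\<in>UNIV. partial_deriv i (\<psi> i t) z)
   = (\<Sum>i\<in>UNIV. (1/t) ^ Suc CARD('n) * (\<Phi> (w t) + w t $ i * partial_deriv i \<Phi> (w t)))"
   by (intro sum.cong refl) (use partial_\<psi>[of t] t in \<open>simp add: w_def\<close>)
  also have "... = (1/t) ^ Suc CARD('n) * (real CARD('n) * \<Phi> (w t) + (\<Sum>i\<in>UNIV. w t $ i * partial_deriv i \<Phi> (w t)))"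
   by (simp add: sum_distrib_left sum.distrib algebra_simps)
  finally show ?thesis unfolding power_Suc n by (simp add: algebra_simps)
 qed
 ultimately show ?thesis by (simp add: K_def[abs_def] w_def)
qed

lemma K_mass:
 assumes t: "0 < t" shows "integral\<^sup>L lborel (K t) = R ^ CARD('n) * bump_mass TYPE('n)"
proof -
 have m1: "unit_bump \<in> borel_measurable borel" "\<Phi> \<in> borel_measurable borel"
  using unit_bump_continuous \<Phi>_smooth[of 0] by (auto intro: borel_measurable_continuous_onI)
 have "integral\<^sup>L lborel (K t) = (1/t) ^ CARD('n) * integral\<^sup>L lborel (\<lambda>z. \<Phi> ((1/t) *\<^sub>R (z - x)))"
  unfolding K_def[abs_def] by (simp add: algebra_simps)
 also have "... = integral\<^sup>L lborel \<Phi>" using t by (simp add: integral_lborel_scale[OF m1(2) t] power_one_over)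
 also have "... = integral\<^sup>L lborel (\<lambda>w. unit_bump ((1/R) *\<^sub>R (w - v)))"
  unfolding \<Phi>_def[abs_def] by (simp add: algebra_simps)
 finally show ?thesis by (simp add: integral_lborel_scale[OF m1(1) R] bump_mass_def)
qed

end

text \<open>Hoelder's inequality, up to a factor 2: the elementary splitting with a free parameter is optimised after
 integration.\<close>
lemma gradient_test_bound:
 fixes G :: "real^'n => real^'n"
 assumes G: "G absolutely_integrable_on Q" and q: "1 < q" and B: "B \<subseteq> Q" "B \<in> sets borel" "emeasure lborel B <= ennreal T" "0 < T"
  and J: "(\<integral>\<^sup>+z\<in>Q. ennreal (infnorm (G z) powr q) \<partial>lebesgue) <= ennreal J" "0 <= J" and L: "0 < L"
  and \<psi>: "\<And>z. \<bar>\<psi> z\<bar> <= L * indicator B z"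
 shows "\<bar>LINT z:\<Omega>|lebesgue. G z $ i * \<psi> z\<bar> <= L * (2 * T powr (1 - 1/q) * J powr (1/q))"
proof -
 let ?I = "\<bar>LINT z:\<Omega>|lebesgue. G z $ i * \<psi> z\<bar>"
 have "?I / L <= b * T + b powr (1 - q) * J" if b: "0 < b" for b
 proof -
  have "(\<lambda>z. indicator Q z *\<^sub>R G z) \<in> borel_measurable lebesgue"
   using G borel_measurable_integrable unfolding set_integrable_def by blast
  then have "(\<lambda>z. infnorm (indicator Q z *\<^sub>R G z)) \<in> borel_measurable lebesgue"
   by (rule measurable_compose[OF _ borel_measurable_continuous_onI[OF continuous_on_infnorm[OF continuous_on_id]]])
  then have [measurable]: "(\<lambda>z. infnorm (indicator Q z *\<^sub>R G z) powr q) \<in> borel_measurable lebesgue" by simp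
  have [measurable]: "B \<in> sets lebesgue" using B(2) by (simp add: sets_completionI_sets)
  have "ennreal ?I <= (\<integral>\<^sup>+z. ennreal (L * b) * indicator B z + ennreal (L * b powr (1 - q)) * ennreal (infnorm (indicator Q z *\<^sub>R G z) powr q) \<partial>lebesgue)"
  proof (cases "integrable lebesgue (\<lambda>z. indicator \<Omega> z *\<^sub>R (G z $ i * \<psi> z))")
   case True
   have "ennreal ?I <= (\<integral>\<^sup>+z. norm (indicator \<Omega> z *\<^sub>R (G z $ i * \<psi> z)) \<partial>lebesgue)"
    unfolding set_lebesgue_integral_def real_norm_def[symmetric] by (rule integral_norm_bound_ennreal[OF True])
   also have "... <= (\<integral>\<^sup>+z. ennreal (L * b) * indicator B z + ennreal (L * b powr (1 - q)) * ennreal (infnorm (indicator Q z *\<^sub>R G z) powr q) \<partial>lebesgue)"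
   proof (rule nn_integral_mono)
    fix z
    have "norm (indicator \<Omega> z *\<^sub>R (G z $ i * \<psi> z)) <= L * b * indicator B z + L * b powr (1 - q) * infnorm (indicator Q z *\<^sub>R G z) powr q"
    proof (cases "z \<in> B")
     case True
     then have zQ: "z \<in> Q" using B by auto
     have "norm (indicator \<Omega> z *\<^sub>R (G z $ i * \<psi> z)) <= infnorm (G z) * L"
      using \<psi>[of z] True component_le_infnorm_cart[of "G z" i] L
      by (auto simp: abs_mult indicator_def infnorm_pos_le intro!: mult_mono)
     also have "... <= (b + infnorm (G z) powr q * b powr (1 - q)) * L"
      using young_split[of "infnorm (G z)" b q] b q L by (intro mult_right_mono) (auto simp: infnorm_pos_le)
     finally show ?thesis using True zQ by (simp add: algebra_simps)
    next
     case False
     then have "\<psi> z = 0" using \<psi>[of z] by simp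
     moreover have "0 <= L * b * indicator B z + L * b powr (1 - q) * infnorm (indicator Q z *\<^sub>R G z) powr q"
      using L b by (intro add_nonneg_nonneg mult_nonneg_nonneg) auto
     ultimately show ?thesis by simp
    qed
    then show "ennreal (norm (indicator \<Omega> z *\<^sub>R (G z $ i * \<psi> z)))
     <= ennreal (L * b) * indicator B z + ennreal (L * b powr (1 - q)) * ennreal (infnorm (indicator Q z *\<^sub>R G z) powr q)"
     using L b by (cases "z \<in> B") (auto simp: ennreal_mult[symmetric] ennreal_plus[symmetric] simp del: ennreal_plus intro!: ennreal_leI)
   qed
   finally show ?thesis .
  next
   case False then show ?thesis by (simp add: set_lebesgue_integral_def not_integrable_integral_eq)
  qed
  also have "... = ennreal (L * b) * emeasure lborel B + ennreal (L * b powr (1 - q)) * (\<integral>\<^sup>+z. ennreal (infnorm (indicator Q z *\<^sub>R G z) powr q) \<partial>lebesgue)"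
   using B(2) by (simp add: nn_integral_add nn_integral_cmult nn_integral_cmult_indicator)
  also have "(\<integral>\<^sup>+z. ennreal (infnorm (indicator Q z *\<^sub>R G z) powr q) \<partial>lebesgue) = (\<integral>\<^sup>+z\<in>Q. ennreal (infnorm (G z) powr q) \<partial>lebesgue)"
   by (intro nn_integral_cong) (use q in \<open>auto simp: indicator_def infnorm_0\<close>)
  also have "ennreal (L * b) * emeasure lborel B + ennreal (L * b powr (1 - q)) * (\<integral>\<^sup>+z\<in>Q. ennreal (infnorm (G z) powr q) \<partial>lebesgue)
    <= ennreal (L * b) * ennreal T + ennreal (L * b powr (1 - q)) * ennreal J"
   using B J by (intro add_mono mult_left_mono) auto
  also have "... = ennreal (L * (b * T + b powr (1 - q) * J))"
   using L b B J by (simp add: ennreal_mult[symmetric] ennreal_plus[symmetric] algebra_simps del: ennreal_plus)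
  finally have "?I <= L * (b * T + b powr (1 - q) * J)"
   using L b B J by (subst (asm) ennreal_le_iff) auto
  then show ?thesis using L by (simp add: field_simps)
 qed
 from young_optimise[OF this B(4) J(2) q] L show ?thesis by (simp add: field_simps)
qed

context dilated_bump
begin

text \<open>The cube \<open>Q\<close> contains \<open>x\<close>, so it contains the supports of all \<open>K t\<close> with \<open>t <= 1\<close>.  The average with
 \<open>K t\<close> tends to a multiple of \<open>F x\<close> as \<open>t \<rightarrow> 0\<close>, and by Hoelder's inequality its derivative in \<open>t\<close> is at most
 \<open>D t\<^bsup>-n/q\<^esup>\<close>, which is integrable because \<open>n < q\<close>.\<close>
lemma morrey_at_point:
 assumes \<Omega>: "open \<Omega>" and wg: "weak_gradient \<Omega> F G" and F: "continuous_on \<Omega> F"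
  and Q: "Q = {z. infnorm (z - (x + v)) <= R}" "Q \<subseteq> \<Omega>" and q: "real CARD('n) < q"
  and J: "(\<integral>\<^sup>+z\<in>Q. ennreal (infnorm (G z) powr q) \<partial>lebesgue) <= ennreal J" "0 <= J"
 defines "D \<equiv> real CARD('n) * (2 * R * (2 * ((2 * R) ^ CARD('n)) powr (1 - 1/q) * J powr (1/q)))"
 shows "\<bar>integral Q (\<lambda>z. F z * K 1 z) - F x * (R ^ CARD('n) * bump_mass TYPE('n))\<bar> <= D / (1 - real CARD('n) / q)"
proof -
 let ?n = "CARD('n)" and ?\<kappa> = "real CARD('n) / q"
 have n1: "real ?n \<ge> 1" by (simp add: Suc_leI)
 have q1: "1 < q" using q n1 by linarith
 have \<kappa>: "0 < ?\<kappa>" "?\<kappa> < 1" using q q1 n1 by (auto simp: divide_less_eq)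
 obtain a b where Qc: "Q = cbox a b" using Q(1) infnorm_ball_eq_cbox by blast
 have cQ: "compact Q" by (simp add: Qc)
 have FQ: "continuous_on Q F" by (rule continuous_on_subset[OF F Q(2)])
 have lF: "locally_integrable \<Omega> F" and lG: "locally_integrable \<Omega> G" using wg by (auto simp: weak_gradient_def)
 have GQ: "G absolutely_integrable_on Q" using lG cQ Q(2) by (simp add: locally_integrable_def)
 have supp: "K t z = 0" if "0 < t" "t <= 1" "z \<notin> Q" for t z
  using support_in_cube[OF that(1,2)] K_support[OF that(1)] that(3) Q(1) by blast
 have \<psi>supp: "\<psi> i t z = 0" if "0 < t" "t <= 1" "z \<notin> Q" for i t z using supp[OF that] by (simp add: \<psi>_def)
 have \<psi>test: "test_function \<Omega> (\<psi> i t)" if "0 < t" "t <= 1" for i t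
  unfolding test_function_def using \<psi>_smooth \<psi>supp[OF that] cQ Q(2) by blast
 define DK where "DK t z = - (\<Sum>i\<in>UNIV. partial_deriv i (\<psi> i t) z)" for t z
 define U where "U t = integral Q (\<lambda>z. F z * K t z)" for t
 have contK: "continuous_on UNIV (K t)" for t using K_smooth[of 0] by simp
 have contP: "continuous_on UNIV (partial_deriv i (\<psi> j t))" for i j t using \<psi>_smooth[of "Suc 0" j t] by simp
 have contDK: "continuous_on ({e..1} \<times> Q) (\<lambda>(t, z). DK t z)" if "0 < e" for e
 proof -
  define W where "W p = (1 / fst p) *\<^sub>R snd p + (- (1 / fst p) *\<^sub>R x)" for p :: "real \<times> (real^'n)"
  have W: "continuous_on ({e..1} \<times> Q) W" unfolding W_def using that by (intro continuous_intros) auto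
  have c\<Phi>: "continuous_on UNIV \<Phi>" "continuous_on UNIV (partial_deriv i \<Phi>)" for i
   using \<Phi>_smooth[of 0] \<Phi>_smooth[of "Suc 0"] by auto
  have "continuous_on ({e..1} \<times> Q) (\<lambda>p. \<Phi> (W p))" "continuous_on ({e..1} \<times> Q) (\<lambda>p. partial_deriv i \<Phi> (W p))" for i
   by (rule continuous_on_compose2[OF c\<Phi>(1) W subset_UNIV] continuous_on_compose2[OF c\<Phi>(2) W subset_UNIV])+
  then have "continuous_on ({e..1} \<times> Q) (\<lambda>p. - (\<Sum>i\<in>UNIV. (1 / fst p) ^ Suc ?n * (\<Phi> (W p) + W p $ i * partial_deriv i \<Phi> (W p))))"
   using that W by (intro continuous_intros) auto
  moreover have "- (\<Sum>i\<in>UNIV. (1 / fst p) ^ Suc ?n * (\<Phi> (W p) + W p $ i * partial_deriv i \<Phi> (W p))) = (\<lambda>(t, z). DK t z) p"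
   if p: "p \<in> {e..1} \<times> Q" for p
  proof -
   obtain t z where tz: "p = (t, z)" by (cases p)
   then have "t \<noteq> 0" using p \<open>0 < e\<close> by auto
   from partial_\<psi>[OF this, of _ z] show ?thesis by (simp add: tz DK_def W_def)
  qed
  ultimately show ?thesis by (rule continuous_on_eq)
 qed
 have U': "(U has_real_derivative integral Q (\<lambda>z. F z * DK t z)) (at t within {e..1})" if e: "0 < e" "t \<in> {e..1}" for e t
  unfolding U_def Qc
 proof (rule leibniz_rule_field_derivative)
  fix s z assume s: "s \<in> {e..1}" "z \<in> cbox a b"
  then have "((\<lambda>t. K t z) has_real_derivative DK s z) (at s within {e..1})"
   unfolding DK_def using K_time_derivative[of s z] e has_field_derivative_at_within by auto
  then show "((\<lambda>s. F z * K s z) has_real_derivative F z * DK s z) (at s within {e..1})" by (rule DERIV_cmult)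
 next
  fix s show "(\<lambda>z. F z * K s z) integrable_on cbox a b"
   using FQ contK[of s] continuous_on_subset[OF contK] by (intro integrable_continuous continuous_on_mult) (auto simp: Qc)
 next
  have "continuous_on ({e..1} \<times> Q) (\<lambda>p. F (snd p))"
   by (rule continuous_on_compose2[OF FQ]) (auto intro!: continuous_intros)
  from continuous_on_mult[OF this contDK[OF e(1)]]
  show "continuous_on ({e..1} \<times> cbox a b) (\<lambda>(t, z). F z * DK t z)" by (simp add: Qc case_prod_beta)
 qed (use e in auto)
 have step: "\<bar>integral Q (\<lambda>z. F z * DK t z)\<bar> <= D * t powr (- ?\<kappa>)" if t: "0 < t" "t <= 1" for t
 proof -
  have eq: "integral Q (\<lambda>z. partial_deriv i (\<psi> i t) z * F z) = - (LINT z:\<Omega>|lebesgue. G z $ i * \<psi> i t z)"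
   and int: "(\<lambda>z. partial_deriv i (\<psi> i t) z * F z) integrable_on Q" for i
  proof -
   have z: "partial_deriv i (\<psi> i t) z = 0" if "z \<notin> Q" for z
    by (rule partial_deriv_zero_outside[OF compact_imp_closed[OF cQ] \<psi>supp[OF t] that])
   note tp = test_product_integrable[OF lF contP cQ Q(2) z]
   have "(LINT z:\<Omega>|lebesgue. partial_deriv i (\<psi> i t) z * F z) = - (LINT z:\<Omega>|lebesgue. G z $ i * \<psi> i t z)"
    using wg \<psi>test[OF t, of i] unfolding weak_gradient_def by (simp add: mult.commute)
   then show "integral Q (\<lambda>z. partial_deriv i (\<psi> i t) z * F z) = - (LINT z:\<Omega>|lebesgue. G z $ i * \<psi> i t z)"
    using tp(3) by simp
   show "(\<lambda>z. partial_deriv i (\<psi> i t) z * F z) integrable_on Q"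
    using set_lebesgue_integral_eq_integral(1)[OF tp(2)] by simp
  qed
  have "integral Q (\<lambda>z. F z * DK t z) = - integral Q (\<lambda>z. \<Sum>i\<in>UNIV. partial_deriv i (\<psi> i t) z * F z)"
   by (simp add: DK_def sum_distrib_left sum_distrib_right mult.commute)
  also have "... = - (\<Sum>i\<in>UNIV. integral Q (\<lambda>z. partial_deriv i (\<psi> i t) z * F z))"
   using int by (subst integral_sum) auto
  also have "... = (\<Sum>i\<in>UNIV. LINT z:\<Omega>|lebesgue. G z $ i * \<psi> i t z)" by (simp add: eq sum_negf)
  finally have "\<bar>integral Q (\<lambda>z. F z * DK t z)\<bar> = \<bar>\<Sum>i\<in>UNIV. LINT z:\<Omega>|lebesgue. G z $ i * \<psi> i t z\<bar>" by (simp only:)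
  also have "... <= (\<Sum>i\<in>(UNIV::'n set). (2 * R * (1/t) ^ ?n) * (2 * ((2 * (t * R)) ^ ?n) powr (1 - 1/q) * J powr (1/q)))"
  proof (rule order_trans[OF sum_abs sum_mono], rule gradient_test_bound[OF GQ q1 _ infnorm_ball_measurable _ _ J])
   let ?B = "{z. infnorm (z - (x + t *\<^sub>R v)) <= t * R}"
   show "?B \<subseteq> Q" using support_in_cube[OF t] Q(1) by auto
   show "emeasure lborel ?B <= ennreal ((2 * (t * R)) ^ ?n)" using emeasure_infnorm_ball[of "t * R" "x + t *\<^sub>R v"] t R by simp
   show "0 < (2 * (t * R)) ^ ?n" "0 < 2 * R * (1/t) ^ ?n" using t R by auto
   fix i z
   show "\<bar>\<psi> i t z\<bar> <= 2 * R * (1/t) ^ ?n * indicator ?B z"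
   proof (cases "z \<in> ?B")
    case True
    have "(1/t) * z $ i + (- (1/t) * x $ i) = (z - x) $ i / t" by (simp add: diff_divide_distrib)
    then have "\<bar>(1/t) * z $ i + (- (1/t) * x $ i)\<bar> = \<bar>(z - x) $ i\<bar> / t" using t by simp
    also have "... <= (2 * t * R) / t"
     using component_le_infnorm_cart[of "z - x" i] support_near[OF t(1), of z] True t by (intro divide_right_mono) auto
    finally have "\<bar>(1/t) * z $ i + (- (1/t) * x $ i)\<bar> <= 2 * R" using t by simp
    then have "\<bar>\<psi> i t z\<bar> <= 2 * R * (1/t) ^ ?n" unfolding \<psi>_def abs_mult
     using K_bounds[OF t(1), of z] R by (intro mult_mono) auto
    then show ?thesis using True by simp
   next
    case False
    then have "K t z = 0" using K_support[OF t(1), of z] by auto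
    then show ?thesis using False by (simp add: \<psi>_def)
   qed
  qed
  also have "... = D * t powr (- ?\<kappa>)"
  proof -
   have "(1/t) ^ ?n * ((2 * (t * R)) ^ ?n) powr (1 - 1/q) = ((2 * R) ^ ?n) powr (1 - 1/q) * t powr (- ?\<kappa>)"
   proof -
    have "(2 * (t * R)) ^ ?n = t powr real ?n * (2 * R) ^ ?n" using t by (simp add: powr_realpow power_mult_distrib mult_ac)
    then have "((2 * (t * R)) ^ ?n) powr (1 - 1/q) = t powr (real ?n - ?\<kappa>) * ((2 * R) ^ ?n) powr (1 - 1/q)"
     by (simp add: powr_mult powr_powr right_diff_distrib)
    moreover have "(1/t) ^ ?n = t powr (- real ?n)" using t by (simp add: powr_minus powr_realpow power_one_over divide_inverse power_inverse)
    ultimately show ?thesis by (simp add: powr_add[symmetric] mult_ac)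
   qed
   then show ?thesis by (simp add: D_def mult_ac)
  qed
  finally show ?thesis .
 qed
 have D0: "0 <= D" using R by (simp add: D_def)
 define V where "V t = D / (1 - ?\<kappa>) * t powr (1 - ?\<kappa>)" for t
 have V': "(V has_real_derivative D * t powr (- ?\<kappa>)) (at t)" if "0 < t" for t
  unfolding V_def using that \<kappa> by (auto intro!: derivative_eq_intros)
 have diff: "\<bar>U 1 - U e\<bar> <= D / (1 - ?\<kappa>)" if e: "0 < e" "e < 1" for e
 proof -
  have cU: "continuous_on {e..1} U" by (rule DERIV_continuous_on[OF U'[OF e(1)]])
  have cV: "continuous_on {e..1} V" using V' e by (intro DERIV_continuous_on[OF has_field_derivative_at_within[OF V']]) auto
  have dU: "(U has_real_derivative integral Q (\<lambda>z. F z * DK t z)) (at t)" if "e < t" "t < 1" for t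
   using U'[OF e(1), of t] that by (simp add: at_within_Icc_at)
  have "U 1 - V 1 <= U e - V e"
  proof (rule DERIV_nonpos_imp_decreasing_open[of e 1 "\<lambda>t. U t - V t"])
   fix t assume t: "e < t" "t < 1"
   show "\<exists>y. ((\<lambda>t. U t - V t) has_real_derivative y) (at t) \<and> y <= 0"
    using DERIV_diff[OF dU[OF t] V'[of t]] step[of t] t e by (intro exI conjI) auto
  qed (use e cU cV in \<open>auto intro: continuous_on_diff\<close>)
  moreover have "- U 1 - V 1 <= - U e - V e"
  proof (rule DERIV_nonpos_imp_decreasing_open[of e 1 "\<lambda>t. - U t - V t"])
   fix t assume t: "e < t" "t < 1"
   show "\<exists>y. ((\<lambda>t. - U t - V t) has_real_derivative y) (at t) \<and> y <= 0"
    using DERIV_diff[OF DERIV_minus[OF dU[OF t]] V'[of t]] step[of t] t e by (intro exI conjI) auto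
  qed (use e cU cV in \<open>auto intro: continuous_on_diff continuous_on_minus\<close>)
  moreover have "0 <= V e" "V 1 = D / (1 - ?\<kappa>)" using D0 \<kappa> by (auto simp: V_def)
  ultimately show ?thesis by linarith
 qed
 let ?M = "R ^ ?n * bump_mass TYPE('n)"
 have M0: "0 < ?M" using R bump_mass_pos[where 'n='n] by simp
 have M: "integral Q (K e) = ?M" if "0 < e" "e <= 1" for e
  using continuous_integral_box(1)[OF contK, of a b e] supp[OF that] K_mass[OF that(1)] by (auto simp: Qc)
 have xQ: "x \<in> Q" using v by (simp add: Q(1) infnorm_neg)
 have "\<bar>U 1 - F x * ?M\<bar> <= D / (1 - ?\<kappa>) + d" if d: "0 < d" for d
 proof -
  obtain r where r: "r > 0" "\<And>z. z \<in> Q ==> dist z x < r ==> dist (F z) (F x) < d / ?M"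
   using FQ[unfolded continuous_on_iff, rule_format, OF xQ, of "d / ?M"] d M0 by auto
  define c where "c = sqrt (real DIM(real^'n))"
  have c0: "c > 0" by (simp add: c_def)
  define e where "e = min (1/2) (r / (4 * R * c))"
  have e: "0 < e" "e < 1" "2 * e * R * c < r" using r(1) R c0 by (auto simp: e_def min_def field_simps)
  have near: "\<bar>F z - F x\<bar> <= d / ?M" if "z \<in> Q" "K e z \<noteq> 0" for z
  proof -
   have "infnorm (z - x) <= 2 * e * R" using support_near[OF e(1) K_support[OF e(1) that(2)]] .
   then have "c * infnorm (z - x) <= c * (2 * e * R)" using c0 by (intro mult_left_mono) auto
   moreover have "c * (2 * e * R) = 2 * e * R * c" by simp
   ultimately have "c * infnorm (z - x) < r" using e(3) by linarith
   then have "dist z x < r" using norm_le_infnorm[of "z - x"] unfolding dist_norm c_def by linarith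
   then show ?thesis using r(2)[OF that(1)] by (simp add: dist_real_def)
  qed
  have "continuous_on Q (K e)" by (rule continuous_on_subset[OF contK subset_UNIV])
  then have cK: "continuous_on (cbox a b) (K e)" by (simp add: Qc)
  have i1: "(\<lambda>z. F z * K e z) integrable_on Q" "K e integrable_on Q" "(\<lambda>z. c * K e z) integrable_on Q" for c
   unfolding Qc by (rule integrable_continuous[OF continuous_on_mult[OF FQ[unfolded Qc] cK]] integrable_continuous[OF cK]
    integrable_continuous[OF continuous_on_mult[OF continuous_on_const cK]])+
  have "U e - F x * ?M = integral Q (\<lambda>z. F z * K e z - F x * K e z)"
   using i1 M[of e] e by (subst integral_diff) (auto simp: U_def)
  then have "\<bar>U e - F x * ?M\<bar> = \<bar>integral Q (\<lambda>z. F z * K e z - F x * K e z)\<bar>" by (simp only:)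
  also have "... <= integral Q (\<lambda>z. d / ?M * K e z)"
   unfolding real_norm_def[symmetric]
  proof (rule integral_norm_bound_integral)
   fix z assume z: "z \<in> Q"
   have "\<bar>F z * K e z - F x * K e z\<bar> = \<bar>F z - F x\<bar> * K e z"
    using K_bounds(1)[OF e(1), of z] by (simp add: left_diff_distrib[symmetric] abs_mult)
   also have "... <= d / ?M * K e z"       proof (cases "K e z = 0")
    case False
    show ?thesis by (rule mult_right_mono[OF near[OF z False] K_bounds(1)[OF e(1)]])
   qed simp
   finally show "norm (F z * K e z - F x * K e z) <= d / ?M * K e z" by simp
  qed (intro integrable_diff i1)+
  also have "... = d / ?M * ?M" using M[of e] e by (simp only: integral_mult_right)
  also have "... = d" using nonzero_eq_divide_eq[of ?M "d / ?M" d] M0 by linarith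
  finally show ?thesis using diff[OF e(1,2)] by linarith
 qed
 then have "\<bar>U 1 - F x * ?M\<bar> <= D / (1 - ?\<kappa>)" by (rule field_le_epsilon)
 then show ?thesis by (simp add: U_def)
qed

end

text \<open>The average at time \<open>1\<close> is the same for all points of the cube, so two points are compared
 through it.\<close>
lemma morrey_cube:
 fixes \<Omega> :: "(real^'n) set"
 assumes \<Omega>: "open \<Omega>" and wg: "weak_gradient \<Omega> F G" and F: "continuous_on \<Omega> F"
  and Q: "Q = {z. infnorm (z - c) <= R}" "Q \<subseteq> \<Omega>" and R: "0 < R" and q: "real CARD('n) < q"
  and J: "(\<integral>\<^sup>+z\<in>Q. ennreal (infnorm (G z) powr q) \<partial>lebesgue) <= ennreal J" "0 <= J"
  and xy: "x \<in> Q" "y \<in> Q"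
 shows "\<bar>F x - F y\<bar> <= 8 * real CARD('n) * 2 ^ CARD('n) / ((1 - real CARD('n) / q) * bump_mass TYPE('n))
   * R powr (1 - real CARD('n) / q) * J powr (1/q)"
proof -
 let ?n = "CARD('n)" and ?\<kappa> = "real CARD('n) / q"
 define D where "D = real ?n * (2 * R * (2 * ((2 * R) ^ ?n) powr (1 - 1/q) * J powr (1/q)))"
 define I where "I = integral Q (\<lambda>z. F z * unit_bump ((1/R) *\<^sub>R (z - c)))"
 let ?M = "R ^ ?n * bump_mass TYPE('n)"
 have n1: "real ?n \<ge> 1" by (simp add: Suc_leI)
 have q1: "1 < q" using q n1 by linarith
 have \<kappa>: "?\<kappa> < 1" using q q1 n1 by (auto simp: divide_less_eq)
 have M0: "0 < ?M" using R bump_mass_pos[where 'n='n] by simp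
 have each: "\<bar>I - F x * ?M\<bar> <= D / (1 - ?\<kappa>)" if x: "x \<in> Q" for x
 proof -
  interpret dilated_bump x "c - x" R
   by unfold_locales (use R x in \<open>auto simp: Q(1) infnorm_sub\<close>)
  have "K 1 z = unit_bump ((1/R) *\<^sub>R (z - c))" for z
   by (simp add: K_def \<Phi>_def scaleR_diff_right)
  then show ?thesis
   using morrey_at_point[OF \<Omega> wg F _ Q(2) q J] by (simp add: Q(1) I_def D_def)
 qed
 have "\<bar>F x - F y\<bar> * ?M = \<bar>F x * ?M - F y * ?M\<bar>"
  by (simp only: left_diff_distrib[symmetric] abs_mult[of "F x - F y"] abs_of_pos[OF M0])
 also have "... <= 2 * (D / (1 - ?\<kappa>))" using each[OF xy(1)] each[OF xy(2)] by linarith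
 finally have "\<bar>F x - F y\<bar> <= 2 * (D / (1 - ?\<kappa>)) / ?M" by (simp only: pos_le_divide_eq[OF M0])
 also have "... = 8 * real ?n * ((2 ^ ?n) powr (1 - 1/q)) / ((1 - ?\<kappa>) * bump_mass TYPE('n)) * (R * (R ^ ?n) powr (1 - 1/q) / R ^ ?n) * J powr (1/q)"
  by (simp add: D_def power_mult_distrib powr_mult mult_ac)
 also have "R * (R ^ ?n) powr (1 - 1/q) / R ^ ?n = R powr (1 - ?\<kappa>)"
 proof -
  have "(R ^ ?n) powr (1 - 1/q) = R powr (real ?n - ?\<kappa>)" using R by (simp add: powr_powr right_diff_distrib flip: powr_realpow)
  then have "R * (R ^ ?n) powr (1 - 1/q) / R ^ ?n = R powr 1 * R powr (real ?n - ?\<kappa>) / R powr real ?n" using R by (simp add: powr_realpow)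
  also have "... = R powr (1 + (real ?n - ?\<kappa>) - real ?n)" by (simp only: powr_add powr_diff)
  finally show ?thesis by simp
 qed
 also have "8 * real ?n * ((2 ^ ?n) powr (1 - 1/q)) / ((1 - ?\<kappa>) * bump_mass TYPE('n)) * R powr (1 - ?\<kappa>) * J powr (1/q)
   <= 8 * real ?n * 2 ^ ?n / ((1 - ?\<kappa>) * bump_mass TYPE('n)) * R powr (1 - ?\<kappa>) * J powr (1/q)"
 proof -
  have "((2::real) ^ ?n) powr (1 - 1/q) <= (2 ^ ?n) powr 1" using q1 by (intro powr_mono) auto
  then show ?thesis using \<kappa> bump_mass_pos[where 'n='n] by (intro mult_right_mono divide_right_mono mult_left_mono) auto
 qed
 finally show ?thesis .
qed

section \<open>Powers of extended nonnegative functions\<close>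

lemma ennreal_powr_ennreal [simp]: "0 <= a ==> ennreal_powr (ennreal a) p = ennreal (a powr p)"
 by (simp add: ennreal_powr_def)

lemma ennreal_powr_top [simp]: "ennreal_powr top p = top"
 by (simp add: ennreal_powr_def)

lemma ennreal_cases': obtains (real) a where "u = ennreal a" "0 <= a" | (top) "u = top"
 by (cases u) auto

lemma ennreal_powr_mono: "u <= v ==> 0 <= p ==> ennreal_powr u p <= ennreal_powr v p"
 by (cases u rule: ennreal_cases'; cases v rule: ennreal_cases') (auto intro: ennreal_leI powr_mono2 simp: top_unique)

lemma ennreal_powr_cmult: "0 < c ==> ennreal_powr (ennreal c * u) p = ennreal (c powr p) * ennreal_powr u p"
 by (cases u rule: ennreal_cases') (auto simp: ennreal_mult[symmetric] powr_mult ennreal_mult_top)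

lemma ennreal_powr_mult_self: "1 < s ==> u * ennreal_powr u (s - 1) = ennreal_powr u s"
 by (cases u rule: ennreal_cases') (auto simp: ennreal_mult[symmetric] powr_mult_base)

lemma ennreal_powr_powr: "ennreal_powr (ennreal_powr u p) q = ennreal_powr u (p * q)"
 by (cases u rule: ennreal_cases') (auto simp: powr_powr)

lemma ennreal_powr_measurable [measurable]: "(\<lambda>u. ennreal_powr u p) \<in> borel_measurable borel"
 unfolding ennreal_powr_def by measurable

lemma ennreal_powr_add_le:
 assumes "0 <= p" shows "ennreal_powr (u + v) p <= ennreal (2 powr p) * (ennreal_powr u p + ennreal_powr v p)"
proof -
 have "u + v <= ennreal 2 * max u v" by (cases "u <= v") (auto simp: max_def mult_2 add_mono add_increasing2)
 then have "ennreal_powr (u + v) p <= ennreal_powr (ennreal 2 * max u v) p" by (rule ennreal_powr_mono[OF _ assms])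
 also have "... = ennreal (2 powr p) * ennreal_powr (max u v) p" by (rule ennreal_powr_cmult) simp
 also have "ennreal_powr (max u v) p <= ennreal_powr u p + ennreal_powr v p" by (auto simp: max_def add_increasing add_increasing2)
 then have "ennreal (2 powr p) * ennreal_powr (max u v) p <= ennreal (2 powr p) * (ennreal_powr u p + ennreal_powr v p)"
  by (rule mult_left_mono) simp
 finally show ?thesis .
qed

lemma layer_cake:
 assumes p: "0 < p"
 shows "(\<integral>\<^sup>+t. ennreal (p * t powr (p - 1)) * indicator {t. 0 < t \<and> ennreal t < v} t \<partial>lborel) = ennreal_powr v p"
proof -
 have fin: "(\<integral>\<^sup>+t. ennreal (p * t powr (p - 1)) * indicator {t. 0 < t \<and> ennreal t < ennreal a} t \<partial>lborel) = ennreal (a powr p)"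
  if a: "0 <= a" for a
 proof -
  have "((\<lambda>t. t powr (p - 1)) has_integral (a powr (p - 1 + 1) / (p - 1 + 1))) {0..a}"
   by (rule has_integral_powr_from_0) (use p a in auto)
  then have "((\<lambda>t. p * t powr (p - 1)) has_integral (p * (a powr p / p))) {0..a}"
   by (intro has_integral_mult_right) simp
  then have "((\<lambda>t. if t \<in> {0..a} then p * t powr (p - 1) else 0) has_integral a powr p) UNIV"
   unfolding has_integral_restrict_UNIV using p by simp
  then have "(\<integral>\<^sup>+t. ennreal (if t \<in> {0..a} then p * t powr (p - 1) else 0) \<partial>lborel) = ennreal (a powr p)"
   using p by (intro nn_integral_has_integral_lborel) auto
  moreover have "AE t in lborel. t \<noteq> 0 \<and> t \<noteq> a" using AE_lborel_singleton[of 0] AE_lborel_singleton[of a] by eventually_elim auto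
  then have "(\<integral>\<^sup>+t. ennreal (p * t powr (p - 1)) * indicator {t. 0 < t \<and> ennreal t < ennreal a} t \<partial>lborel)
   = (\<integral>\<^sup>+t. ennreal (if t \<in> {0..a} then p * t powr (p - 1) else 0) \<partial>lborel)"
  proof (intro nn_integral_cong_AE)
   assume "AE t in lborel. t \<noteq> 0 \<and> t \<noteq> a"
   then show "AE t in lborel. ennreal (p * t powr (p - 1)) * indicator {t. 0 < t \<and> ennreal t < ennreal a} t
     = ennreal (if t \<in> {0..a} then p * t powr (p - 1) else 0)"
    by eventually_elim (auto simp: indicator_def ennreal_less_iff)
  qed
  ultimately show ?thesis by simp
 qed
 show ?thesis
 proof (cases v rule: ennreal_cases')
  case (real a) then show ?thesis using fin[of a] by simp
 next
  case top
  have big: "ennreal K <= (\<integral>\<^sup>+t. ennreal (p * t powr (p - 1)) * indicator {t. 0 < t \<and> ennreal t < top} t \<partial>lborel)" if K: "0 <= K" for K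
  proof -
   have "ennreal K = ennreal ((K powr (1/p)) powr p)" using K p by (simp add: powr_powr)
   also have "... <= (\<integral>\<^sup>+t. ennreal (p * t powr (p - 1)) * indicator {t. 0 < t \<and> ennreal t < top} t \<partial>lborel)"
    unfolding fin[of "K powr (1/p)", symmetric, simplified] by (intro nn_integral_mono) (auto simp: indicator_def)
   finally show ?thesis .
  qed
  then have "(\<integral>\<^sup>+t. ennreal (p * t powr (p - 1)) * indicator {t. 0 < t \<and> ennreal t < top} t \<partial>lborel) = top"
  proof (cases "\<integral>\<^sup>+t. ennreal (p * t powr (p - 1)) * indicator {t. 0 < t \<and> ennreal t < top} t \<partial>lborel" rule: ennreal_cases')
   case (real a)
   then have "ennreal (a + 1) <= ennreal a" using big[of "a + 1"] by simp
   then show ?thesis using real by simp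
  qed
  then show ?thesis by (simp add: top)
 qed
qed

section \<open>The Hardy--Littlewood maximal function\<close>

definition maxfun :: "(real^'n => ennreal) => real^'n => ennreal" where
 "maxfun u x = (SUP r\<in>{0<..}. (\<integral>\<^sup>+z\<in>ball x r. u z \<partial>lborel) / ennreal (r ^ CARD('n)))"

lemma maxfun_upper:
 fixes u :: "real^'n => ennreal"
 assumes "0 < r" shows "(\<integral>\<^sup>+z\<in>ball x r. u z \<partial>lborel) <= ennreal (r ^ CARD('n)) * maxfun u x"
proof -
 have "(\<integral>\<^sup>+z\<in>ball x r. u z \<partial>lborel) / ennreal (r ^ CARD('n)) <= maxfun u x"
  unfolding maxfun_def using assms by (intro SUP_upper) auto
 then have "ennreal (r ^ CARD('n)) * ((\<integral>\<^sup>+z\<in>ball x r. u z \<partial>lborel) / ennreal (r ^ CARD('n))) <= ennreal (r ^ CARD('n)) * maxfun u x"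
  by (rule mult_left_mono) simp
 moreover have "ennreal (r ^ CARD('n)) * ((\<integral>\<^sup>+z\<in>ball x r. u z \<partial>lborel) / ennreal (r ^ CARD('n))) = (\<integral>\<^sup>+z\<in>ball x r. u z \<partial>lborel)"
  using assms by (simp add: ennreal_times_divide) (subst mult.commute, simp add: ennreal_mult_divide_eq)
 ultimately show ?thesis by simp
qed

lemma maxfun_open:
 fixes u :: "real^'n => ennreal"
 shows "open {x. t < maxfun u x}"
proof (rule openI)
 fix x assume "x \<in> {x. t < maxfun u x}"
 then obtain r where r: "0 < r" "t < (\<integral>\<^sup>+z\<in>ball x r. u z \<partial>lborel) / ennreal (r ^ CARD('n))"
  by (auto simp: maxfun_def less_SUP_iff)
 define A where "A = (\<integral>\<^sup>+z\<in>ball x r. u z \<partial>lborel)"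
 have "\<exists>r'>r. t < A / ennreal (r' ^ CARD('n))"
 proof (cases A rule: ennreal_cases')
  case (real a)
  obtain t' where t': "t = ennreal t'" "0 <= t'" using r(2) by (cases t) (auto simp: top_unique)
  have "((\<lambda>r. a / r ^ CARD('n)) \<longlongrightarrow> a / r ^ CARD('n)) (at_right r)" using r(1) by (intro tendsto_intros) auto
  moreover have "t' < a / r ^ CARD('n)" using r t' real by (simp add: A_def[symmetric] divide_ennreal ennreal_less_iff)
  ultimately have "\<forall>\<^sub>F r' in at_right r. t' < a / r' ^ CARD('n)" by (rule order_tendstoD(1))
  moreover have "\<forall>\<^sub>F r' in at_right r. r < r'" by (simp add: eventually_at_filter)
  ultimately have "\<forall>\<^sub>F r' in at_right r. r < r' \<and> t' < a / r' ^ CARD('n)" by eventually_elim auto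
  then obtain r' where "r < r'" "t' < a / r' ^ CARD('n)" using eventually_happens by fastforce
  then show ?thesis using r(1) real t' by (intro exI[of _ r']) (auto simp: divide_ennreal ennreal_less_iff)
 next
  case top
  then show ?thesis using r by (intro exI[of _ "r + 1"]) (auto simp: ennreal_top_divide A_def[symmetric] less_top)
 qed
 then obtain r' where r': "r < r'" "t < A / ennreal (r' ^ CARD('n))" by blast
 have "t < maxfun u y" if y: "y \<in> ball x (r' - r)" for y
 proof -
  have "ball x r \<subseteq> ball y r'"
  proof
   fix z assume "z \<in> ball x r"
   then show "z \<in> ball y r'" using y dist_triangle[of y z x] by (simp add: dist_commute)
  qed
  then have "A <= (\<integral>\<^sup>+z\<in>ball y r'. u z \<partial>lborel)" unfolding A_def by (intro nn_integral_mono) (auto simp: indicator_def)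
  then have "A / ennreal (r' ^ CARD('n)) <= (\<integral>\<^sup>+z\<in>ball y r'. u z \<partial>lborel) / ennreal (r' ^ CARD('n))" by (rule divide_right_mono_ennreal)
  also have "... <= maxfun u y" unfolding maxfun_def using r r' by (intro SUP_upper) auto
  finally show ?thesis using r'(2) by (rule less_le_trans[rotated])
 qed
 then show "\<exists>e>0. ball x e \<subseteq> {x. t < maxfun u x}" using r'(1) by (intro exI[of _ "r' - r"]) auto
qed

lemma maxfun_measurable [measurable]: "maxfun u \<in> borel_measurable borel"
 by (rule borel_measurableI_greater) (use maxfun_open borel_open in auto)

lemma emeasure_cball_le: "0 <= r ==> emeasure lborel (cball (x::real^'n) r) <= ennreal ((2 * r) ^ CARD('n))"
 unfolding emeasure_infnorm_ball[symmetric, of r x]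
 by (rule emeasure_mono) (auto simp: dist_norm norm_minus_commute intro: order_trans[OF infnorm_le_norm] infnorm_ball_measurable)

text \<open>Vitali's covering lemma selects disjoint balls, on each of which the average of \<open>u\<close> exceeds \<open>t\<close> and whose
 fivefold enlargements cover the level set.\<close>
lemma maxfun_weak_type:
 fixes u :: "real^'n => ennreal"
 assumes [measurable]: "u \<in> borel_measurable borel" and t: "0 < t"
 shows "emeasure lborel {x. ennreal t < maxfun u x} <= ennreal (10 ^ CARD('n) / t) * (\<integral>\<^sup>+z. u z \<partial>lborel)"
proof (cases "(\<integral>\<^sup>+z. u z \<partial>lborel)" rule: ennreal_cases')
 case (real I)
 let ?n = "CARD('n)" and ?S = "{x. ennreal t < maxfun u x}"
 have "\<forall>x\<in>?S. \<exists>r>0. ennreal (r ^ ?n) <= ennreal (1 / t) * (\<integral>\<^sup>+z\<in>ball x r. u z \<partial>lborel)"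
 proof
  fix x assume "x \<in> ?S"
  then obtain r where r: "0 < r" "ennreal t < (\<integral>\<^sup>+z\<in>ball x r. u z \<partial>lborel) / ennreal (r ^ ?n)"
   by (auto simp: maxfun_def less_SUP_iff)
  have "(\<integral>\<^sup>+z\<in>ball x r. u z \<partial>lborel) <= (\<integral>\<^sup>+z. u z \<partial>lborel)" by (intro nn_integral_mono) (auto simp: indicator_def)
  then obtain a where a: "(\<integral>\<^sup>+z\<in>ball x r. u z \<partial>lborel) = ennreal a" "0 <= a" using real by (cases "\<integral>\<^sup>+z\<in>ball x r. u z \<partial>lborel") (auto simp: top_unique)
  then have "r ^ ?n <= 1 / t * a" using r t by (simp add: divide_ennreal ennreal_less_iff field_simps)
  then show "\<exists>r>0. ennreal (r ^ ?n) <= ennreal (1 / t) * (\<integral>\<^sup>+z\<in>ball x r. u z \<partial>lborel)"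
   using r(1) a t by (intro exI[of _ r]) (auto simp: ennreal_mult[symmetric] intro: ennreal_leI)
 qed
 then obtain r where r: "\<And>x. x \<in> ?S ==> 0 < r x"
  "\<And>x. x \<in> ?S ==> ennreal (r x ^ ?n) <= ennreal (1 / t) * (\<integral>\<^sup>+z\<in>ball x (r x). u z \<partial>lborel)" by metis
 have bound: "r x <= max 1 (I / t)" if x: "x \<in> ?S" for x
 proof (cases "r x <= 1")
  case False
  have "ennreal (r x ^ ?n) <= ennreal (1 / t) * (\<integral>\<^sup>+z. u z \<partial>lborel)"
   by (rule order_trans[OF r(2)[OF x] mult_left_mono[OF nn_integral_mono]]) (auto simp: indicator_def)
  then have "r x ^ ?n <= I / t" using real t by (simp add: ennreal_mult[symmetric] ennreal_le_iff)
  moreover have "r x ^ 1 <= r x ^ ?n" using False by (intro power_increasing) (auto simp: Suc_leI)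
  ultimately show ?thesis by simp
 qed auto
 obtain C where C: "countable C" "C \<subseteq> ?S" "pairwise (\<lambda>i j. disjnt (cball i (r i)) (cball j (r j))) C"
  "?S \<subseteq> (\<Union>i\<in>C. cball i (5 * r i))"
 proof (rule Vitali_covering_lemma_cballs[where S="?S" and K="?S" and a="\<lambda>x. x" and r=r and B="max 1 (I / t)"])
  show "?S \<subseteq> (\<Union>i\<in>?S. cball i (r i))" using r(1) less_imp_le by force
 qed (use r(1) bound that in blast)+
 obtain g :: "real^'n => nat" where g: "inj_on g C" using C(1) countable_def by blast
 define c where "c m = the_inv_into C g m" for m
 define B where "B m = (if m \<in> g ` C then cball (c m) (r (c m)) else {})" for m
 define B5 where "B5 m = (if m \<in> g ` C then cball (c m) (5 * r (c m)) else {})" for m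
 have cg: "c (g i) = i" if "i \<in> C" for i using that g by (simp add: c_def the_inv_into_f_f)
 have mB: "B5 m \<in> sets borel" for m by (simp add: B5_def)
 have "?S \<subseteq> (\<Union>m. B5 m)"
 proof
  fix x assume "x \<in> ?S"
  then obtain i where "i \<in> C" "x \<in> cball i (5 * r i)" using C(4) by blast
  then have "x \<in> B5 (g i)" by (simp add: B5_def cg)
  then show "x \<in> (\<Union>m. B5 m)" by blast
 qed
 then have "emeasure lborel ?S <= emeasure lborel (\<Union>m. B5 m)" by (rule emeasure_mono) (use mB in auto)
 also have "... <= (\<Sum>m. emeasure lborel (B5 m))" by (rule emeasure_subadditive_countably) (auto simp: B5_def)
 also have "... <= (\<Sum>m. ennreal (10 ^ ?n / t) * emeasure (density lborel u) (B m))"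
 proof (rule suminf_le)
  fix m
  show "emeasure lborel (B5 m) <= ennreal (10 ^ ?n / t) * emeasure (density lborel u) (B m)"
  proof (cases "m \<in> g ` C")
   case True
   then have cm: "c m \<in> ?S" using C(2) cg by auto
   have "emeasure lborel (B5 m) <= ennreal ((2 * (5 * r (c m))) ^ ?n)"
    using True emeasure_cball_le[of "5 * r (c m)" "c m"] r(1)[OF cm] by (simp add: B5_def)
   also have "2 * (5 * r (c m)) = 10 * r (c m)" by simp
   then have "ennreal ((2 * (5 * r (c m))) ^ ?n) = ennreal (10 ^ ?n) * ennreal (r (c m) ^ ?n)"
    using r(1)[OF cm] by (simp only: power_mult_distrib) (simp add: ennreal_mult)
   also have "... <= ennreal (10 ^ ?n) * (ennreal (1 / t) * (\<integral>\<^sup>+z\<in>ball (c m) (r (c m)). u z \<partial>lborel))"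
    by (rule mult_left_mono[OF r(2)[OF cm]]) simp
   also have "... <= ennreal (10 ^ ?n) * (ennreal (1 / t) * (\<integral>\<^sup>+z\<in>cball (c m) (r (c m)). u z \<partial>lborel))"
    by (intro mult_left_mono nn_integral_mono) (auto simp: indicator_def)
   also have "(\<integral>\<^sup>+z\<in>cball (c m) (r (c m)). u z \<partial>lborel) = emeasure (density lborel u) (B m)"
    using True by (simp add: B_def emeasure_density)
   finally show ?thesis using t by (simp add: ennreal_mult[symmetric] mult.assoc[symmetric])
  qed (simp add: B5_def)
 qed auto
 also have "... = ennreal (10 ^ ?n / t) * (\<Sum>m. emeasure (density lborel u) (B m))" by simp
 also have "(\<Sum>m. emeasure (density lborel u) (B m)) = emeasure (density lborel u) (\<Union>m. B m)"
 proof (rule suminf_emeasure)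
  show "disjoint_family B" unfolding disjoint_family_on_def
  proof (intro ballI impI)
   fix m k :: nat assume "m \<noteq> k"
   show "B m \<inter> B k = {}"
   proof (cases "m \<in> g ` C \<and> k \<in> g ` C")
    case True
    then have "c m \<in> C" "c k \<in> C" "c m \<noteq> c k" using cg \<open>m \<noteq> k\<close> by auto
    then show ?thesis using C(3) True by (auto simp: B_def pairwise_def disjnt_def)
   qed (auto simp: B_def)
  qed
 qed (auto simp: B_def)
 also have "... <= emeasure (density lborel u) UNIV" by (rule emeasure_mono) auto
 also have "emeasure (density lborel u) UNIV = (\<integral>\<^sup>+z. u z \<partial>lborel)" by (simp add: emeasure_density)
 finally show ?thesis by (simp add: mult_left_mono)
qed (use t in \<open>simp add: ennreal_mult_top\<close>)

definition max_const :: "'n::finite itself => real => real" where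
 "max_const _ s = 2 * 10 ^ CARD('n) * s / (s - 1) * (2 ^ Suc CARD('n)) powr (s - 1)"

text \<open>Only the part of \<open>u\<close> above a multiple of \<open>t\<close> contributes to the level set at height \<open>t\<close>.\<close>
lemma maxfun_level_set:
 fixes u :: "real^'n => ennreal"
 assumes [measurable]: "u \<in> borel_measurable borel" and t: "0 < t"
 shows "emeasure lborel {x. ennreal t < maxfun u x} \<le>
  ennreal (2 * 10 ^ CARD('n) / t) * (\<integral>\<^sup>+z. u z * indicator {z. ennreal t < ennreal (2 ^ Suc CARD('n)) * u z} z \<partial>lborel)"
proof -
 let ?n = "CARD('n)"
 define w where "w z = u z * indicator {z. ennreal t < ennreal (2 ^ Suc ?n) * u z} z" for z
 have mw [measurable]: "w \<in> borel_measurable borel" unfolding w_def by measurable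
 define \<tau> where "\<tau> = t / 2 ^ Suc ?n"
 have \<tau>: "0 <= \<tau>" using t by (simp add: \<tau>_def)
 have u: "u z <= w z + ennreal \<tau>" for z
 proof (cases "ennreal t < ennreal (2 ^ Suc ?n) * u z")
  case False
  then have "ennreal (2 ^ Suc ?n) * u z <= ennreal t" by simp
  then have "u z <= ennreal \<tau>" using t
   by (cases "u z" rule: ennreal_cases') (auto simp: \<tau>_def ennreal_mult[symmetric] ennreal_mult_top top_unique field_simps intro!: ennreal_leI)
  then show ?thesis by (simp add: add_increasing)
 qed (simp add: w_def add_increasing2)
 have "maxfun u x <= maxfun w x + ennreal (t / 2)" for x
  unfolding maxfun_def[of u]
 proof (rule SUP_least)
  fix r :: real assume "r \<in> {0<..}"
  then have r: "0 < r" by simp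
  have "(\<integral>\<^sup>+z\<in>ball x r. u z \<partial>lborel) <= (\<integral>\<^sup>+z. w z * indicator (ball x r) z + ennreal \<tau> * indicator (ball x r) z \<partial>lborel)"
   by (intro nn_integral_mono) (auto simp: indicator_def u)
  also have "... = (\<integral>\<^sup>+z\<in>ball x r. w z \<partial>lborel) + ennreal \<tau> * emeasure lborel (ball x r)"
  proof -
   have m: "(\<lambda>z. w z * indicator (ball x r) z) \<in> borel_measurable lborel"
    "(\<lambda>z. ennreal \<tau> * indicator (ball x r) z) \<in> borel_measurable lborel" unfolding measurable_lborel2
    by (intro borel_measurable_times_ennreal mw borel_measurable_const borel_measurable_indicator borel_open open_ball)+
   show ?thesis by (simp add: nn_integral_add[OF m] nn_integral_cmult_indicator)
  qed
  also have "... <= ennreal (r ^ ?n) * maxfun w x + ennreal \<tau> * ennreal ((2 * r) ^ ?n)"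
   using r by (intro add_mono mult_left_mono maxfun_upper order_trans[OF emeasure_mono[OF ball_subset_cball] emeasure_cball_le]) auto
  also have "... = ennreal (r ^ ?n) * (maxfun w x + ennreal (t / 2))"
  proof -
   have "ennreal \<tau> * ennreal ((2 * r) ^ ?n) = ennreal (r ^ ?n) * ennreal (t / 2)"
    using r t by (simp add: \<tau>_def ennreal_mult[symmetric] power_mult_distrib)
   then show ?thesis by (simp add: distrib_left)
  qed
  finally have "(\<integral>\<^sup>+z\<in>ball x r. u z \<partial>lborel) / ennreal (r ^ ?n) <= ennreal (r ^ ?n) * (maxfun w x + ennreal (t / 2)) / ennreal (r ^ ?n)"
   by (rule divide_right_mono_ennreal)
  also have "... = maxfun w x + ennreal (t / 2)" using r by (subst mult.commute) (simp add: ennreal_mult_divide_eq)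
  finally show "(\<integral>\<^sup>+z\<in>ball x r. u z \<partial>lborel) / ennreal (r ^ ?n) <= maxfun w x + ennreal (t / 2)" .
 qed
 then have sub: "{x. ennreal t < maxfun u x} \<subseteq> {x. ennreal (t / 2) < maxfun w x}"
 proof safe
  fix x assume le: "\<And>x. maxfun u x <= maxfun w x + ennreal (t / 2)" and lt: "ennreal t < maxfun u x"
  have "ennreal t < maxfun w x + ennreal (t / 2)" using less_le_trans[OF lt le] .
  then show "ennreal (t / 2) < maxfun w x" using t
   by (cases "maxfun w x" rule: ennreal_cases') (auto simp: ennreal_plus[symmetric] ennreal_less_iff simp del: ennreal_plus)
 qed
 have "emeasure lborel {x. ennreal t < maxfun u x} <= emeasure lborel {x. ennreal (t / 2) < maxfun w x}"
  by (rule emeasure_mono[OF sub]) measurable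
 also have "... <= ennreal (10 ^ ?n / (t / 2)) * (\<integral>\<^sup>+z. w z \<partial>lborel)" using t by (intro maxfun_weak_type) auto
 finally show ?thesis using t by (simp add: w_def mult.commute)
qed

text \<open>The integral of the level-set bound against \<open>t\<^bsup>s-1\<^esup>\<close>, with the two integrations exchanged.\<close>
lemma maxfun_strong_type:
 fixes u :: "real^'n => ennreal"
 assumes [measurable]: "u \<in> borel_measurable borel" and s: "1 < s"
 shows "(\<integral>\<^sup>+x. ennreal_powr (maxfun u x) s \<partial>lborel) <= ennreal (max_const TYPE('n) s) * (\<integral>\<^sup>+x. ennreal_powr (u x) s \<partial>lborel)"
proof -
 let ?n = "CARD('n)"
 define L where "L = (2::real) ^ Suc ?n"
 define K where "K = 2 * 10 ^ ?n * s / (s - 1)"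
 have L: "0 < L" and K: "0 <= K" using s by (auto simp: L_def K_def)
 have "(\<integral>\<^sup>+x. ennreal_powr (maxfun u x) s \<partial>lborel)
  = (\<integral>\<^sup>+x. (\<integral>\<^sup>+t. ennreal (s * t powr (s - 1)) * indicator {t. 0 < t \<and> ennreal t < maxfun u x} t \<partial>lborel) \<partial>lborel)"
  using s by (simp add: layer_cake)
 also have "... = (\<integral>\<^sup>+t. (\<integral>\<^sup>+x. ennreal (s * t powr (s - 1)) * indicator {t. 0 < t \<and> ennreal t < maxfun u x} t \<partial>lborel) \<partial>lborel)"
  by (rule lborel_pair.Fubini') measurable
 also have "... <= (\<integral>\<^sup>+t. (\<integral>\<^sup>+x. ennreal K * u x * (ennreal ((s - 1) * t powr (s - 1 - 1)) * indicator {t. 0 < t \<and> ennreal t < ennreal L * u x} t) \<partial>lborel) \<partial>lborel)"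
 proof (rule nn_integral_mono)
  fix t :: real
  show "(\<integral>\<^sup>+x. ennreal (s * t powr (s - 1)) * indicator {t. 0 < t \<and> ennreal t < maxfun u x} t \<partial>lborel)
   <= (\<integral>\<^sup>+x. ennreal K * u x * (ennreal ((s - 1) * t powr (s - 1 - 1)) * indicator {t. 0 < t \<and> ennreal t < ennreal L * u x} t) \<partial>lborel)"
  proof (cases "0 < t")
   case t: True
   have "(\<integral>\<^sup>+x. ennreal (s * t powr (s - 1)) * indicator {t. 0 < t \<and> ennreal t < maxfun u x} t \<partial>lborel)
    = (\<integral>\<^sup>+x. ennreal (s * t powr (s - 1)) * indicator {x. ennreal t < maxfun u x} x \<partial>lborel)"
    by (intro nn_integral_cong) (use t in \<open>auto simp: indicator_def\<close>)
   also have "... = ennreal (s * t powr (s - 1)) * emeasure lborel {x. ennreal t < maxfun u x}"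
    by (rule nn_integral_cmult_indicator) measurable
   also have "... <= ennreal (s * t powr (s - 1)) * (ennreal (2 * 10 ^ ?n / t) * (\<integral>\<^sup>+z. u z * indicator {z. ennreal t < ennreal L * u z} z \<partial>lborel))"
    unfolding L_def by (rule mult_left_mono[OF maxfun_level_set[OF assms(1) t]]) simp
   also have "ennreal (s * t powr (s - 1)) * (ennreal (2 * 10 ^ ?n / t) * I) = ennreal (K * ((s - 1) * t powr (s - 1 - 1))) * I" for I
   proof -
    have "t powr (s - 1 - 1) = t powr (s - 1) / t" using t powr_diff[of t "s - 1" 1] by simp
    then have "s * t powr (s - 1) * (2 * 10 ^ ?n / t) = K * ((s - 1) * t powr (s - 1 - 1))"
     using t s by (simp add: K_def)
    then show ?thesis using t s by (simp add: mult.assoc[symmetric] ennreal_mult[symmetric])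
   qed
   also have "ennreal (K * ((s - 1) * t powr (s - 1 - 1))) * (\<integral>\<^sup>+z. u z * indicator {z. ennreal t < ennreal L * u z} z \<partial>lborel)
    = (\<integral>\<^sup>+z. ennreal (K * ((s - 1) * t powr (s - 1 - 1))) * (u z * indicator {z. ennreal t < ennreal L * u z} z) \<partial>lborel)"
    by (rule nn_integral_cmult[symmetric]) measurable
   also have "... = (\<integral>\<^sup>+x. ennreal K * u x * (ennreal ((s - 1) * t powr (s - 1 - 1)) * indicator {t. 0 < t \<and> ennreal t < ennreal L * u x} t) \<partial>lborel)"
    by (intro nn_integral_cong) (use t s K in \<open>auto simp: indicator_def ennreal_mult mult_ac\<close>)
   finally show ?thesis .
  qed simp
 qed
 also have "... = (\<integral>\<^sup>+x. (\<integral>\<^sup>+t. ennreal K * u x * (ennreal ((s - 1) * t powr (s - 1 - 1)) * indicator {t. 0 < t \<and> ennreal t < ennreal L * u x} t) \<partial>lborel) \<partial>lborel)"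
  by (rule lborel_pair.Fubini'[symmetric]) measurable
 also have "... = (\<integral>\<^sup>+x. ennreal (K * L powr (s - 1)) * ennreal_powr (u x) s \<partial>lborel)"
 proof (rule nn_integral_cong)
  fix x
  have "(\<integral>\<^sup>+t. ennreal K * u x * (ennreal ((s - 1) * t powr (s - 1 - 1)) * indicator {t. 0 < t \<and> ennreal t < ennreal L * u x} t) \<partial>lborel)
   = ennreal K * u x * ennreal_powr (ennreal L * u x) (s - 1)"
   using layer_cake[of "s - 1" "ennreal L * u x"] s by (subst nn_integral_cmult) auto
  also have "... = ennreal (K * L powr (s - 1)) * (u x * ennreal_powr (u x) (s - 1))"
   using L K by (simp add: ennreal_powr_cmult ennreal_mult mult_ac)
  finally show "(\<integral>\<^sup>+t. ennreal K * u x * (ennreal ((s - 1) * t powr (s - 1 - 1)) * indicator {t. 0 < t \<and> ennreal t < ennreal L * u x} t) \<partial>lborel)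
   = ennreal (K * L powr (s - 1)) * ennreal_powr (u x) s" using s by (simp add: ennreal_powr_mult_self)
 qed
 also have "... = ennreal (K * L powr (s - 1)) * (\<integral>\<^sup>+x. ennreal_powr (u x) s \<partial>lborel)"
  by (rule nn_integral_cmult) measurable
 finally show ?thesis by (simp add: max_const_def K_def L_def)
qed

section \<open>Necessity: the trace of a Sobolev function\<close>

locale trace_setting = proper_domain \<Omega> for \<Omega> :: "(real^'n::finite) set" +
 fixes p q \<alpha> \<beta> :: real
 assumes q: "real CARD('n) < q" and qp: "q < p"
  and \<beta>_eq: "\<beta> = (q - real CARD('n)) / (q - 1)" and \<alpha>_eq: "\<alpha> = (p - real CARD('n)) / (p - 1)"
begin

lemma n1: "1 <= real CARD('n)" by (simp add: Suc_leI)

lemma exponents: "1 < q" "1 < p" "0 < \<beta>" "\<beta> <= \<alpha>" "\<alpha> <= 1" "\<beta> <= 1" "0 < \<alpha>" "1 < p / q"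
proof -
 show 1: "1 < q" "1 < p" using n1 q qp by linarith+
 have \<beta>': "\<beta> = 1 - (real CARD('n) - 1) / (q - 1)" and \<alpha>': "\<alpha> = 1 - (real CARD('n) - 1) / (p - 1)"
  using 1 by (auto simp: \<beta>_eq \<alpha>_eq field_simps)
 show 2: "0 < \<beta>" using q 1 by (simp add: \<beta>_eq)
 show 3: "\<beta> <= \<alpha>" unfolding \<alpha>' \<beta>' using n1 1 qp by (intro diff_left_mono divide_left_mono) auto
 show 4: "\<alpha> <= 1" unfolding \<alpha>' using n1 1 by simp
 show "\<beta> <= 1" "0 < \<alpha>" using 2 3 4 by linarith+
 show "1 < p / q" using 1 qp by simp
qed

lemmas fs = exponents(3,4,5)

abbreviation sharp :: "('n cpoint => real) => real^'n => ennreal" where "sharp \<equiv> fsharp \<alpha> \<beta> \<Omega>"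
definition fv :: "('n cpoint => real) => 'n cpoint => real" where "fv f \<omega> = f (change_exponent \<alpha> \<Omega> \<omega>)"

lemma near_boundary_point:
 assumes x: "x \<in> \<Omega>"
 shows "\<exists>\<omega>\<in>bdry \<beta>. d_to \<beta> x \<omega> <= bd x powr \<beta> / (1 - (1/2) powr \<beta>)"
proof -
 obtain a where a: "a \<in> frontier \<Omega>" "bd x = infnorm (x - a)"
  using udist_attained[OF frontier_closed frontier_ne, of x] by blast
 have "a + t *\<^sub>R (x - a) \<in> \<Omega> \<and> t * bd x <= bd (a + t *\<^sub>R (x - a))" if "0 < t" "t <= 1" for t
  by (rule nearest_radial[OF x a(1) a(2)[symmetric] order_refl that])
 from radial_boundary_point(2,3)[OF this a bd_pos[OF x] exponents(3,6) refl] show ?thesis by blast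
qed

lemma udiam_cube:
 assumes "0 < r" shows "2 * r <= udiam (cube_set (c::real^'n, r))"
proof -
 let ?v = "(\<chi> i. r) :: real^'n"
 have v: "infnorm ?v <= r" using assms by (simp add: infnorm_le_cart)
 have "r <= infnorm ?v" using component_le_infnorm_cart[of ?v undefined] assms by simp
 moreover have "infnorm ((c + ?v) - (c - ?v)) = 2 * infnorm ?v"
 proof -
  have "(c + ?v) - (c - ?v) = 2 *\<^sub>R ?v" by (simp only: scaleR_2) simp
  from arg_cong[OF this, of infnorm] show ?thesis unfolding infnorm_mul by simp
 qed
 moreover have "infnorm ((c + ?v) - (c - ?v)) <= udiam (cube_set (c, r))" unfolding udiam_def
 proof (rule cSup_upper)
  show "infnorm ((c + ?v) - (c - ?v)) \<in> {infnorm (a - b) |a b. a \<in> cube_set (c, r) \<and> b \<in> cube_set (c, r)}"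
  proof -
   have "c + ?v \<in> cube_set (c, r)" "c - ?v \<in> cube_set (c, r)" using v by (auto simp: cube_set_def infnorm_neg)
   then show ?thesis by blast
  qed
  show "bdd_above {infnorm (a - b) |a b. a \<in> cube_set (c, r) \<and> b \<in> cube_set (c, r)}"
  proof (rule bdd_aboveI[of _ "2 * r"], clarify)
   fix a b assume "a \<in> cube_set (c, r)" "b \<in> cube_set (c, r)"
   then show "infnorm (a - b) <= 2 * r"
    using infnorm_triangle_diff[of a b c] infnorm_sub[of c b] by (auto simp: cube_set_def)
  qed
 qed
 ultimately show ?thesis by simp
qed

text \<open>In the uniform norm the centre of a cube is at distance \<open>r + dist(Q, \<partial>\<Omega>)\<close> from the boundary, so a
 boundary point nearest to the cube is also nearest to its centre.\<close>
lemma cube_nearest_centre: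
 assumes Q: "is_cube_in \<Omega> (c, r)" and a: "a \<in> frontier \<Omega>" "udist a (cube_set (c, r)) = udist_set (cube_set (c, r)) (frontier \<Omega>)"
 shows "c \<in> \<Omega>" "infnorm (c - a) <= bd c" "\<And>x. x \<in> cube_set (c, r) ==> udist_set (cube_set (c, r)) (frontier \<Omega>) <= bd x"
proof -
 let ?Q = "cube_set (c, r)" and ?D = "udist_set (cube_set (c, r)) (frontier \<Omega>)"
 have r: "0 < r" "?Q \<subseteq> \<Omega>" using Q by (auto simp: is_cube_in_def)
 have cQ: "c \<in> ?Q" using r by (simp add: cube_set_def infnorm_0)
 then show "c \<in> \<Omega>" using r by auto
 have D: "?D <= infnorm (z - b)" if "z \<in> ?Q" "b \<in> frontier \<Omega>" for z b
  unfolding udist_set_def by (rule cInf_lower[OF _ udist_bdd_below]) (use that in auto)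
 show "?D <= bd x" if "x \<in> ?Q" for x by (rule udist_greatest[OF frontier_ne D[OF that]])
 have "r + ?D <= bd c"
 proof (rule udist_greatest[OF frontier_ne])
  fix b assume b: "b \<in> frontier \<Omega>"
  then have "b \<notin> ?Q" using r(2) op by (auto simp: frontier_def interior_open)
  then have R: "r < infnorm (b - c)" by (simp add: cube_set_def)
  define z where "z = c + (r / infnorm (b - c)) *\<^sub>R (b - c)"
  have "z \<in> ?Q" using R r(1) by (simp add: z_def cube_set_def infnorm_mul)
  moreover have "z - b = (1 - r / infnorm (b - c)) *\<^sub>R (c - b)" by (simp add: z_def algebra_simps)
  then have "infnorm (z - b) = (1 - r / infnorm (b - c)) * infnorm (b - c)"
   using R r(1) by (simp add: infnorm_mul infnorm_sub)
  then have "infnorm (z - b) = infnorm (b - c) - r" using R r(1) by (simp add: left_diff_distrib)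
  ultimately show "r + ?D <= infnorm (c - b)" using D[of z b] b by (simp add: infnorm_sub)
 qed
 moreover have "infnorm (c - a) <= r + ?D"
 proof -
  have "infnorm (a - c) - r <= udist a ?Q"
  proof (rule udist_greatest)
   fix z assume "z \<in> ?Q"
   then show "infnorm (a - c) - r <= infnorm (a - z)" using infnorm_triangle_diff[of a c z] by (simp add: cube_set_def)
  qed (use cQ in auto)
  then show ?thesis using a(2) by (simp add: infnorm_sub)
 qed
 ultimately show "infnorm (c - a) <= bd c" by linarith
qed

definition cube_const :: "real => real" where
 "cube_const \<theta> = (\<theta> * \<theta> + (1 + \<theta>) / (1 - (1/2) powr \<beta>)) powr (1 / \<beta>)"

lemma cube_const_pos: "1 < \<theta> ==> 0 < cube_const \<theta>"
proof -
 assume \<theta>: "1 < \<theta>"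
 have "(1/2::real) powr \<beta> < 1" using exponents(3) powr_less_mono2[of \<beta> "1/2" 1] by simp
 then have "0 <= (1 + \<theta>) / (1 - (1/2) powr \<beta>)" using \<theta> by simp
 moreover have "0 < \<theta> * \<theta>" using \<theta> by simp
 ultimately show ?thesis by (simp add: cube_const_def)
qed

text \<open>The class \<^const>\<open>omega_cube\<close> is given by a segment that runs radially to a nearest boundary point, and a
 point of the cube is joined to the centre inside the cube, where the distance to the boundary is comparable
 to the diameter.\<close>
lemma omega_cube_props:
 assumes Q: "is_cube_in \<Omega> (c, r)" and a: "nearest_choice \<Omega> a" and \<theta>: "1 < \<theta>"
  and W: "udiam (cube_set (c, r)) / \<theta> <= udist_set (cube_set (c, r)) (frontier \<Omega>)" and x: "x \<in> cube_set (c, r)"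
 shows "omega_cube \<beta> \<Omega> a (c, r) \<in> bdry \<beta>"
  "omega_cube \<alpha> \<Omega> a (c, r) = change_exponent \<alpha> \<Omega> (omega_cube \<beta> \<Omega> a (c, r))"
  "d_to \<beta> x (omega_cube \<beta> \<Omega> a (c, r)) <= (cube_const \<theta> * bd x) powr \<beta>"
proof -
 let ?a = "a (c, r)" and ?D = "udist_set (cube_set (c, r)) (frontier \<Omega>)" and ?g = "1 - (1/2::real) powr \<beta>"
 have aQ: "?a \<in> frontier \<Omega>" "udist ?a (cube_set (c, r)) = ?D" using a Q by (auto simp: nearest_choice_def)
 note cn = cube_nearest_centre[OF Q aQ]
 have r: "0 < r" "cube_set (c, r) \<subseteq> \<Omega>" using Q by (auto simp: is_cube_in_def)
 have g: "0 < ?g" using exponents(3) powr_less_mono2[of \<beta> "1/2" 1] by simp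
 have R: "infnorm (c - ?a) = bd c" using udist_le[OF aQ(1), of c] cn(2) by simp
 note radial = radial_boundary_point[OF nearest_radial[OF cn(1) aQ(1) R order_refl] aQ(1) R[symmetric] bd_pos[OF cn(1)] _ _ refl]
 show w: "omega_cube \<beta> \<Omega> a (c, r) \<in> bdry \<beta>"
  using radial(2)[OF _ _ exponents(3,6)] by (simp add: omega_cube_def)
 have "rho_Cauchy \<beta> \<Omega> (\<lambda>i. ?a + (1 / real (Suc i)) *\<^sub>R (c - ?a))" using radial(1)[OF _ _ exponents(3,6)] by simp
 from cclass_self[OF exponents(3,6) this]
 have "(\<lambda>i. ?a + (1 / real (Suc i)) *\<^sub>R (c - ?a)) \<in> omega_cube \<beta> \<Omega> a (c, r)" by (simp add: omega_cube_def)
 from change_exponent_eq(1)[OF fs bdry_completed[OF exponents(3,6) w] this]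
 show "omega_cube \<alpha> \<Omega> a (c, r) = change_exponent \<alpha> \<Omega> (omega_cube \<beta> \<Omega> a (c, r))" by (simp add: omega_cube_def)
 have dc: "d_to \<beta> c (omega_cube \<beta> \<Omega> a (c, r)) <= bd c powr \<beta> / ?g"
  using radial(3)[OF _ _ exponents(3,6)] by (simp add: omega_cube_def)
 have xO: "x \<in> \<Omega>" using x r by auto
 have b: "0 < bd x" by (rule bd_pos[OF xO])
 have xc: "infnorm (x - c) <= r" using x by (simp add: cube_set_def)
 have rD: "2 * r / \<theta> <= ?D" using udiam_cube[OF r(1), of c] W \<theta> by (meson divide_right_mono less_imp_le order_trans zero_less_one less_trans)
 have Dx: "?D <= bd x" by (rule cn(3)[OF x])
 have rx: "2 * r <= \<theta> * bd x"
 proof -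
  have "2 * r <= \<theta> * ?D" using rD \<theta> by (simp add: field_simps)
  also have "... <= \<theta> * bd x" using Dx \<theta> by (intro mult_left_mono) auto
  finally show ?thesis .
 qed
 have conv: "closed_segment x c \<subseteq> cube_set (c, r)"
 proof
  fix z assume "z \<in> closed_segment x c"
  then have "infnorm (z - c) <= infnorm (x - c)" using closed_segment_infnorm[of z c x] by (simp add: closed_segment_commute)
  then show "z \<in> cube_set (c, r)" using xc by (simp add: cube_set_def)
 qed
 have "dmet \<beta> x c <= (2 * r / \<theta>) powr (\<beta> - 1) * infnorm (c - x)"
 proof (rule d_met_segment)
  show "2 * r / \<theta> <= bd z" if "z \<in> closed_segment x c" for z using cn(3)[of z] that conv rD by auto
 qed (use conv r \<theta> exponents in auto)
 also have "... <= (2 * r / \<theta>) powr (\<beta> - 1) * r" using xc by (intro mult_left_mono) (auto simp: infnorm_sub)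
 also have "... = (2 * r / \<theta>) powr \<beta> * (\<theta> / 2)" using r \<theta> by (simp add: powr_diff)
 also have "... <= (bd x) powr \<beta> * (\<theta> * \<theta>)"
  using rx r \<theta> exponents(3) by (intro mult_mono powr_mono2) (auto simp: field_simps)
 finally have d1: "dmet \<beta> x c <= bd x powr \<beta> * (\<theta> * \<theta>)" .
 have "bd c <= bd x + infnorm (c - x)" by (rule bd_lipschitz)
 then have "bd c <= (1 + \<theta>) * bd x" using xc rx r(1) by (simp add: infnorm_sub algebra_simps)
 then have "bd c powr \<beta> <= ((1 + \<theta>) * bd x) powr \<beta>" using exponents by (intro powr_mono2 bd_nonneg) auto
 also have "... = (1 + \<theta>) powr \<beta> * bd x powr \<beta>" by (simp add: powr_mult)
 also have "... <= (1 + \<theta>) * bd x powr \<beta>"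
  using \<theta> exponents powr_mono[of \<beta> 1 "1 + \<theta>"] by (intro mult_right_mono) auto
 finally have "bd c powr \<beta> / ?g <= (1 + \<theta>) * bd x powr \<beta> / ?g" using g by (intro divide_right_mono) auto
 then have "d_to \<beta> x (omega_cube \<beta> \<Omega> a (c, r)) <= bd x powr \<beta> * (\<theta> * \<theta>) + (1 + \<theta>) * bd x powr \<beta> / ?g"
  using d_bar_embed_le[OF exponents(3,6) xO cn(1) bdry_completed[OF exponents(3,6) w]] d1 dc by linarith
 also have "... = (\<theta> * \<theta> + (1 + \<theta>) / ?g) * bd x powr \<beta>" by (simp add: algebra_simps)
 also have "... = (cube_const \<theta> * bd x) powr \<beta>"
 proof -
  have "0 <= \<theta> * \<theta> + (1 + \<theta>) / ?g" using \<theta> g by simp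
  then show ?thesis using exponents(3) by (simp add: powr_mult cube_const_def powr_powr)
 qed
 finally show "d_to \<beta> x (omega_cube \<beta> \<Omega> a (c, r)) <= (cube_const \<theta> * bd x) powr \<beta>" .
qed

definition morrey_const :: real where
 "morrey_const = 8 * real CARD('n) * 2 ^ CARD('n) / ((1 - real CARD('n) / q) * bump_mass TYPE('n))"
definition hajlasz_const :: real where
 "hajlasz_const = morrey_const powr q * sqrt (real CARD('n)) ^ CARD('n)"
definition approach_const :: real where
 "approach_const = 40 * (4 ^ CARD('n) * (2 * 4 powr (1/\<beta>) * sqrt (real CARD('n))) ^ CARD('n)) powr (1/q)"
definition trace_const :: real where
 "trace_const = 2 * approach_const * (max_const TYPE('n) (p/q) * hajlasz_const powr (p/q) * max_const TYPE('n) (p/q)) powr (1/p)"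

lemma consts_pos: "0 < morrey_const" "0 < hajlasz_const" "0 < approach_const" "0 < max_const TYPE('n) (p/q)" "0 < trace_const"
proof -
 have "real CARD('n) / q < 1" using q exponents(1) by simp
 then show 1: "0 < morrey_const" using bump_mass_pos[where 'n='n] by (simp add: morrey_const_def)
 then show 2: "0 < hajlasz_const" by (simp add: hajlasz_const_def)
 show 3: "0 < approach_const" by (simp add: approach_const_def)
 show 4: "0 < max_const TYPE('n) (p/q)" using exponents by (simp add: max_const_def)
 show "0 < trace_const" using 2 3 4 by (simp add: trace_const_def)
qed

lemma infnorm_ball_subset_ball:
 assumes "0 < \<rho>" "\<And>w. w \<in> B ==> infnorm (w - z) < \<rho>" shows "B \<subseteq> ball (z::real^'n) (sqrt (real CARD('n)) * \<rho>)"
proof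
 fix w assume "w \<in> B"
 then have "sqrt (real CARD('n)) * infnorm (w - z) < sqrt (real CARD('n)) * \<rho>" using assms(2) by (intro mult_strict_left_mono) auto
 moreover have "norm (w - z) <= sqrt (real CARD('n)) * infnorm (w - z)" using norm_le_infnorm[of "w - z"] by simp
 ultimately have "norm (w - z) < sqrt (real CARD('n)) * \<rho>" by linarith
 then show "w \<in> ball z (sqrt (real CARD('n)) * \<rho>)" by (simp only: mem_ball dist_norm norm_minus_commute[of z w])
qed

lemma power_integral:
 assumes "AE z in lebesgue. u z = ennreal (infnorm (G z :: real^'n) powr q) * indicator \<Omega> z"
 shows "(\<integral>\<^sup>+x. ennreal_powr (ennreal (infnorm (G x))) p \<partial>lebesgue_on \<Omega>) = (\<integral>\<^sup>+x. ennreal_powr (u x) (p/q) \<partial>lborel)"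
proof -
 have "(\<integral>\<^sup>+x. ennreal_powr (ennreal (infnorm (G x))) p \<partial>lebesgue_on \<Omega>) = (\<integral>\<^sup>+x\<in>\<Omega>. ennreal_powr (ennreal (infnorm (G x))) p \<partial>lebesgue)"
  using op by (intro nn_integral_restrict_space) auto
 also have "... = (\<integral>\<^sup>+x. ennreal_powr (u x) (p/q) \<partial>lebesgue)"
  by (rule nn_integral_cong_AE, use assms in eventually_elim)
   (use exponents in \<open>auto simp: indicator_def powr_powr infnorm_pos_le ennreal_powr_def\<close>)
 finally show ?thesis by (simp add: nn_integral_completion)
qed

end

text \<open>A continuous Sobolev function \<open>F\<close> with trace \<open>f\<close>.  The Borel function \<open>u\<close> represents
 \<open>\<bar>\<nabla>F\<bar>\<^sup>q\<close>, extended by zero.\<close>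
locale sobolev_trace = trace_setting \<Omega> p q \<alpha> \<beta> for \<Omega> :: "(real^'n::finite) set" and p q \<alpha> \<beta> +
 fixes F :: "real^'n => real" and G :: "real^'n => real^'n" and f :: "'n cpoint => real" and u :: "real^'n => ennreal"
 assumes wg: "weak_gradient \<Omega> F G" and F: "continuous_on \<Omega> F" and tr: "is_trace \<alpha> \<Omega> F f"
  and u [measurable]: "u \<in> borel_measurable borel"
  and uG: "AE z in lebesgue. u z = ennreal (infnorm (G z) powr q) * indicator \<Omega> z"
  and fin: "(\<integral>\<^sup>+z. ennreal_powr (u z) (p/q) \<partial>lborel) < \<infinity>"
begin

definition H :: "real^'n => ennreal" where "H z = ennreal hajlasz_const * maxfun u z"

lemma H_measurable [measurable]: "H \<in> borel_measurable borel"
 unfolding H_def[abs_def] by measurable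

text \<open>Morrey's inequality on the cube of radius \<open>bd x / 2\<close>; the integral of \<open>u\<close> over this cube is controlled by the
 maximal function at each point \<open>z\<close> of the smaller cube, which gives the freedom to integrate over \<open>z\<close> in a chain
 estimate.\<close>
lemma hajlasz:
 assumes x: "x \<in> \<Omega>" and y: "infnorm (y - x) <= bd x / 2" and z: "infnorm (z - x) <= bd x / 8"
 shows "ennreal (\<bar>F y - F x\<bar> powr q) <= ennreal (bd x powr q) * H z"
proof (cases "maxfun u z" rule: ennreal_cases')
 case top
 then show ?thesis using consts_pos(2) bd_pos[OF x] by (simp add: H_def ennreal_mult_top)
next
 case (real m)
 let ?n = "CARD('n)"
 have b: "0 < bd x" by (rule bd_pos[OF x])
 define Q where "Q = {w. infnorm (w - x) <= bd x / 2}"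
 have QO: "Q \<subseteq> \<Omega>" using bd_half(1)[OF x, of _ "1/2"] by (auto simp: Q_def)
 define r where "r = sqrt (real ?n) * bd x"
 have r: "0 < r" using b by (simp add: r_def)
 have Qb: "Q \<subseteq> ball z r" unfolding r_def
 proof (rule infnorm_ball_subset_ball[OF b])
  fix w assume "w \<in> Q"
  then show "infnorm (w - z) < bd x" using infnorm_triangle_diff[of w z x] z b infnorm_sub[of x z] by (simp add: Q_def)
 qed
 have "(\<integral>\<^sup>+w\<in>Q. ennreal (infnorm (G w) powr q) \<partial>lebesgue) <= (\<integral>\<^sup>+w\<in>ball z r. u w \<partial>lebesgue)"
  by (rule nn_integral_mono_AE, use uG in eventually_elim) (use QO Qb in \<open>auto simp: indicator_def\<close>)
 also have "... <= ennreal (r ^ ?n) * maxfun u z" unfolding nn_integral_completion by (rule maxfun_upper[OF r])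
 also have "... = ennreal (r ^ ?n * m)" using real r by (simp add: ennreal_mult)
 finally have J: "(\<integral>\<^sup>+w\<in>Q. ennreal (infnorm (G w) powr q) \<partial>lebesgue) <= ennreal (r ^ ?n * m)" .
 have xyQ: "y \<in> Q" "x \<in> Q" using y b by (auto simp: Q_def infnorm_0)
 have "\<bar>F y - F x\<bar> <= morrey_const * (bd x / 2) powr (1 - real ?n / q) * (r ^ ?n * m) powr (1/q)"
  using morrey_cube[OF op wg F Q_def QO _ q J _ xyQ] b r real by (simp add: morrey_const_def)
 then have "\<bar>F y - F x\<bar> powr q <= (morrey_const * (bd x / 2) powr (1 - real ?n / q) * (r ^ ?n * m) powr (1/q)) powr q"
  using exponents(1) by (intro powr_mono2) auto
 also have "... = morrey_const powr q * (bd x / 2) powr (q - real ?n) * (r ^ ?n * m)"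
  using exponents(1) r real by (simp add: powr_mult powr_powr left_diff_distrib)
 also have "... <= morrey_const powr q * bd x powr (q - real ?n) * (r ^ ?n * m)"
  using b q r real by (intro mult_right_mono mult_left_mono powr_mono2) auto
 also have "... = hajlasz_const * (bd x powr (q - real ?n) * bd x ^ ?n) * m"
  by (simp add: hajlasz_const_def r_def power_mult_distrib mult_ac)
 also have "bd x powr (q - real ?n) * bd x ^ ?n = bd x powr q" using b by (simp add: powr_diff powr_realpow)
 finally have "ennreal (\<bar>F y - F x\<bar> powr q) <= ennreal (hajlasz_const * bd x powr q * m)" by (rule ennreal_leI)
 also have "... = ennreal (bd x powr q) * H z"
  using consts_pos(2) real by (simp add: H_def ennreal_mult[symmetric] mult_ac)
 finally show ?thesis .
qed

text \<open>The chain of cubes along a curve from \<open>x\<close> to the boundary point stays in a ball of radius comparable to \<open>r\<close>, so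
 the integral of \<open>H\<close> over it is bounded by the maximal function of \<open>H\<close> at \<open>x\<close>.  The powers of \<open>r\<close> add up
 to one, since \<open>\<beta> (1 - 1/q) + n/q = 1\<close>.\<close>
lemma trace_approach:
 assumes x: "x \<in> \<Omega>" and r: "0 < r" and w: "\<omega> \<in> bdry \<beta>" and d: "d_to \<beta> x \<omega> <= r powr \<beta>"
 shows "ennreal \<bar>fv f \<omega> - F x\<bar> <= ennreal (approach_const * r) * ennreal_powr (maxfun H x) (1/q)"
proof (cases "maxfun H x" rule: ennreal_cases')
 case top
 then show ?thesis using consts_pos(3) r by (simp add: ennreal_mult_top)
next
 case (real m)
 let ?n = "CARD('n)" and ?K = "4 powr (1/\<beta>)"
 have wc: "\<omega> \<in> completed \<beta> \<Omega>" by (rule bdry_completed[OF exponents(3,6) w])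
 obtain y where y: "y \<in> \<omega>" using completed_nonempty[OF exponents(3,6) wc] by blast
 have lim: "(\<lambda>i. F (y i)) \<longlonglongrightarrow> fv f \<omega>"
  using tr change_exponent_bdry[OF fs w] change_exponent_eq(2)[OF fs wc y] by (auto simp: is_trace_def fv_def)
 define R where "R = sqrt (real ?n) * (2 * ?K * r)"
 have R: "0 < R" using r by (simp add: R_def)
 have J: "(\<integral>\<^sup>+z\<in>ball x R. H z \<partial>lborel) <= ennreal (R ^ ?n * m)"
  using maxfun_upper[OF R, where x=x and u=H] real R by (simp add: ennreal_mult)
 have "\<forall>\<^sub>F i in sequentially. \<bar>F (y i) - F x\<bar> <= approach_const * r * m powr (1/q)"
  using curves_to_boundary[OF fs x r w y d]
 proof eventually_elim
  case (elim i)
  then obtain \<gamma> where g: "joins \<gamma> x (y i)" "weighted_length \<beta> \<gamma> <= 2 * r powr \<beta>"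
   "\<And>t. t \<in> {0..1} ==> bd (\<gamma> t) <= ?K * r \<and> infnorm (\<gamma> t - x) <= ?K * r" by blast
  have Kr: "0 < ?K * r" using r by simp
  have S: "z \<in> ball x R" if t: "t \<in> {0..1}" and z: "infnorm (z - \<gamma> t) <= bd (\<gamma> t) / 8" for t z
  proof -
   have "infnorm (z - x) < 2 * ?K * r"
    using infnorm_triangle_diff[of z x "\<gamma> t"] z g(3)[OF t] Kr by linarith
   moreover have "0 < 2 * ?K * r" using r by simp
   ultimately show ?thesis using infnorm_ball_subset_ball[of "2 * ?K * r" "{z}" x] by (simp add: R_def)
  qed
  have "\<bar>F (y i) - F x\<bar> <= 2 * (8 * weighted_length \<beta> \<gamma> + bd x powr \<beta>) powr (1 - 1/q) * (4 ^ ?n * (R ^ ?n * m)) powr (1/q)"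
   using chain_estimate[OF H_measurable q \<beta>_eq hajlasz g(1) S J] R real by simp
  also have "... <= 2 * (20 * r powr \<beta>) powr (1 - 1/q) * (4 ^ ?n * (R ^ ?n * m)) powr (1/q)"
  proof -
   have "bd x powr \<beta> <= (?K * r) powr \<beta>" using g(3)[of 0] joinsD(3)[OF g(1)] exponents by (intro powr_mono2 bd_nonneg) auto
   also have "... = 4 * r powr \<beta>" using exponents by (simp add: powr_mult powr_powr)
   finally have "8 * weighted_length \<beta> \<gamma> + bd x powr \<beta> <= 20 * r powr \<beta>" using g(2) by simp
   then show ?thesis using exponents weighted_length_nonneg[of \<beta> \<gamma>]
    by (intro mult_right_mono mult_left_mono powr_mono2) auto
  qed
  also have "... = 2 * 20 powr (1 - 1/q) * (4 ^ ?n * (2 * ?K * sqrt (real ?n)) ^ ?n) powr (1/q)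
    * ((r powr \<beta>) powr (1 - 1/q) * (r ^ ?n) powr (1/q)) * m powr (1/q)"
   by (simp add: R_def powr_mult power_mult_distrib mult_ac)
  also have "(r powr \<beta>) powr (1 - 1/q) * (r ^ ?n) powr (1/q) = r"
  proof -
   have "\<beta> * (1 - 1/q) = 1 - real ?n / q" using exponents(1) by (simp add: \<beta>_eq divide_simps)
   then have "(r powr \<beta>) powr (1 - 1/q) * (r ^ ?n) powr (1/q) = r powr (1 - real ?n / q) * r powr (real ?n / q)"
    using r by (simp add: powr_powr flip: powr_realpow)
   also have "... = r powr 1" by (simp only: powr_add[symmetric]) simp
   finally show ?thesis using r by simp
  qed
  also have "2 * 20 powr (1 - 1/q) * (4 ^ ?n * (2 * ?K * sqrt (real ?n)) ^ ?n) powr (1/q) * r * m powr (1/q) <= approach_const * r * m powr (1/q)"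
  proof -
   have "(20::real) powr (1 - 1/q) <= 20 powr 1" using exponents(1) by (intro powr_mono) auto
   then show ?thesis unfolding approach_const_def using r by (intro mult_right_mono) auto
  qed
  finally show ?case .
 qed
 then have "\<forall>\<^sub>F i in sequentially. norm (F (y i) - F x) <= approach_const * r * m powr (1/q)" by simp
 then have "norm (fv f \<omega> - F x) <= approach_const * r * m powr (1/q)"
  by (rule Lim_norm_ubound[OF sequentially_bot tendsto_diff[OF lim tendsto_const]])
 then show ?thesis using real consts_pos(3) r by (simp add: ennreal_mult[symmetric] ennreal_leI)
qed

lemma fsharp_le_maxfun:
 assumes x: "x \<in> \<Omega>" shows "sharp f x <= ennreal (2 * approach_const) * ennreal_powr (maxfun H x) (1/q)"
proof (rule fsharp_least[OF fs x])
 fix r \<omega>1 \<omega>2 assume r: "0 < r" and w: "\<omega>1 \<in> bdry \<beta>" "\<omega>2 \<in> bdry \<beta>"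
  and d: "d_to \<beta> x \<omega>1 <= r powr \<beta>" "d_to \<beta> x \<omega>2 <= r powr \<beta>"
 let ?V = "ennreal_powr (maxfun H x) (1/q)"
 have "ennreal (\<bar>fv f \<omega>1 - fv f \<omega>2\<bar> / r) <= ennreal ((\<bar>fv f \<omega>1 - F x\<bar> + \<bar>fv f \<omega>2 - F x\<bar>) / r)"
  using r by (intro ennreal_leI divide_right_mono) auto
 also have "... = ennreal (1/r) * (ennreal \<bar>fv f \<omega>1 - F x\<bar> + ennreal \<bar>fv f \<omega>2 - F x\<bar>)"
  using r by (simp add: ennreal_mult[symmetric] ennreal_plus[symmetric] del: ennreal_plus)
 also have "... <= ennreal (1/r) * (ennreal (approach_const * r) * ?V + ennreal (approach_const * r) * ?V)"
  by (intro mult_left_mono add_mono trace_approach x r w d) simp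
 also have "... = (ennreal (1/r) * ennreal (2 * (approach_const * r))) * ?V"
  by (simp add: mult_2[symmetric] mult.assoc ennreal_mult' )
 also have "ennreal (1/r) * ennreal (2 * (approach_const * r)) = ennreal (2 * approach_const)"
  using r consts_pos(3) by (simp add: ennreal_mult[symmetric])
 finally show "ennreal (\<bar>f (change_exponent \<alpha> \<Omega> \<omega>1) - f (change_exponent \<alpha> \<Omega> \<omega>2)\<bar> / r) <= ennreal (2 * approach_const) * ?V"
  by (simp add: fv_def)
qed

text \<open>The maximal theorem is applied twice, each time with the exponent \<open>p/q > 1\<close>.  This is where \<open>q < p\<close> enters.\<close>
lemma maxfun_H_bound:
 "(\<integral>\<^sup>+x. ennreal_powr (H x) (p/q) \<partial>lborel) <= ennreal (hajlasz_const powr (p/q) * max_const TYPE('n) (p/q)) * (\<integral>\<^sup>+x. ennreal_powr (u x) (p/q) \<partial>lborel)"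
 "(\<integral>\<^sup>+x. ennreal_powr (maxfun H x) (p/q) \<partial>lborel)
  <= ennreal (max_const TYPE('n) (p/q) * hajlasz_const powr (p/q) * max_const TYPE('n) (p/q)) * (\<integral>\<^sup>+x. ennreal_powr (u x) (p/q) \<partial>lborel)"
proof -
 let ?I = "\<integral>\<^sup>+x. ennreal_powr (u x) (p/q) \<partial>lborel" and ?M = "max_const TYPE('n) (p/q)"
 have "(\<integral>\<^sup>+x. ennreal_powr (H x) (p/q) \<partial>lborel) = ennreal (hajlasz_const powr (p/q)) * (\<integral>\<^sup>+x. ennreal_powr (maxfun u x) (p/q) \<partial>lborel)"
  unfolding H_def using consts_pos(2) by (simp add: ennreal_powr_cmult nn_integral_cmult)
 also have "... <= ennreal (hajlasz_const powr (p/q)) * (ennreal ?M * ?I)"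
  by (intro mult_left_mono maxfun_strong_type u exponents) simp
 finally show 1: "(\<integral>\<^sup>+x. ennreal_powr (H x) (p/q) \<partial>lborel) <= ennreal (hajlasz_const powr (p/q) * ?M) * ?I"
  using consts_pos by (simp add: ennreal_mult mult.assoc)
 have "(\<integral>\<^sup>+x. ennreal_powr (maxfun H x) (p/q) \<partial>lborel) <= ennreal ?M * (\<integral>\<^sup>+x. ennreal_powr (H x) (p/q) \<partial>lborel)"
  by (intro maxfun_strong_type H_measurable exponents)
 also have "... <= ennreal ?M * (ennreal (hajlasz_const powr (p/q) * ?M) * ?I)" by (rule mult_left_mono[OF 1]) simp
 finally show "(\<integral>\<^sup>+x. ennreal_powr (maxfun H x) (p/q) \<partial>lborel) <= ennreal (?M * hajlasz_const powr (p/q) * ?M) * ?I"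
  using consts_pos by (simp add: ennreal_mult mult.assoc)
qed

lemma u_norm: "Lp_norm p \<Omega> G = ennreal_powr (\<integral>\<^sup>+x. ennreal_powr (u x) (p/q) \<partial>lborel) (1/p)"
 by (simp add: Lp_norm_def enn_Lp_norm_def power_integral[OF uG])

lemma Lp_norm_maxfun:
 assumes h: "\<And>x. x \<in> S ==> h x <= ennreal c * ennreal_powr (maxfun H x) (1/q)" and c: "0 < c" and S: "S \<in> sets lebesgue"
 shows "enn_Lp_norm p S h <= ennreal (c * (trace_const / (2 * approach_const))) * Lp_norm p \<Omega> G"
proof -
 let ?I = "\<integral>\<^sup>+x. ennreal_powr (u x) (p/q) \<partial>lborel" and ?M = "max_const TYPE('n) (p/q)"
 let ?B = "?M * hajlasz_const powr (p/q) * ?M"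
 have B: "0 < ?B" using consts_pos by simp
 have "(\<integral>\<^sup>+x. ennreal_powr (h x) p \<partial>lebesgue_on S) = (\<integral>\<^sup>+x\<in>S. ennreal_powr (h x) p \<partial>lebesgue)"
  using S by (intro nn_integral_restrict_space) auto
 also have "... <= (\<integral>\<^sup>+x. ennreal (c powr p) * ennreal_powr (maxfun H x) (p/q) \<partial>lebesgue)"
 proof (rule nn_integral_mono)
  fix x
  show "ennreal_powr (h x) p * indicator S x <= ennreal (c powr p) * ennreal_powr (maxfun H x) (p/q)"
  proof (cases "x \<in> S")
   case True
   then have "ennreal_powr (h x) p <= ennreal_powr (ennreal c * ennreal_powr (maxfun H x) (1/q)) p"
    using h exponents by (intro ennreal_powr_mono) auto
   then show ?thesis using True c by (simp add: ennreal_powr_cmult ennreal_powr_powr)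
  qed simp
 qed
 also have "... = ennreal (c powr p) * (\<integral>\<^sup>+x. ennreal_powr (maxfun H x) (p/q) \<partial>lborel)"
  unfolding nn_integral_completion by (rule nn_integral_cmult) measurable
 also have "... <= ennreal (c powr p) * (ennreal ?B * ?I)" by (rule mult_left_mono[OF maxfun_H_bound(2)]) simp
 also have "... = ennreal (c powr p * ?B) * ?I" using B by (simp add: ennreal_mult mult.assoc)
 finally have "enn_Lp_norm p S h <= ennreal_powr (ennreal (c powr p * ?B) * ?I) (1/p)"
  unfolding enn_Lp_norm_def using exponents by (intro ennreal_powr_mono) auto
 also have "... = ennreal ((c powr p * ?B) powr (1/p)) * Lp_norm p \<Omega> G"
  unfolding u_norm using c B by (intro ennreal_powr_cmult) auto
 also have "(c powr p * ?B) powr (1/p) = c * ?B powr (1/p)" using c exponents by (simp add: powr_mult powr_powr)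
 also have "?B powr (1/p) = trace_const / (2 * approach_const)" using consts_pos(3) by (simp add: trace_const_def)
 finally show ?thesis .
qed

text \<open>The chain estimate with the exponent \<open>p\<close> and the total integral of \<open>H\<^bsup>p/q\<^esup>\<close> bounds the increments of \<open>F\<close> by
 a power of \<open>d_met \<alpha>\<close>, up to an error that vanishes at the boundary.\<close>
lemma trace_d_continuous: "d_continuous \<alpha> \<Omega> f"
proof -
 let ?n = "CARD('n)"
 note e\<alpha> = exponents(7,5)
 define H2 where "H2 z = ennreal_powr (H z) (p/q)" for z
 have H2m: "H2 \<in> borel_measurable borel" unfolding H2_def by measurable
 have "(\<integral>\<^sup>+z. H2 z \<partial>lborel) < \<infinity>" unfolding H2_def
  by (rule le_less_trans[OF maxfun_H_bound(1)]) (use fin in \<open>simp add: ennreal_mult_less_top\<close>)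
 then obtain J where J: "(\<integral>\<^sup>+z. H2 z \<partial>lborel) = ennreal J" "0 <= J" by (cases "\<integral>\<^sup>+z. H2 z \<partial>lborel") auto
 have loc: "ennreal (\<bar>F y - F x\<bar> powr p) <= ennreal (bd x powr p) * H2 z"
  if "x \<in> \<Omega>" "infnorm (y - x) <= bd x / 2" "infnorm (z - x) <= bd x / 8" for x y z
 proof -
  have "ennreal_powr (ennreal (\<bar>F y - F x\<bar> powr q)) (p/q) <= ennreal_powr (ennreal (bd x powr q) * H z) (p/q)"
   using exponents by (intro ennreal_powr_mono hajlasz that) auto
  then show ?thesis using exponents bd_pos[OF that(1)] by (simp add: ennreal_powr_cmult powr_powr H2_def)
 qed
 define K where "K = 2 * (4 ^ ?n * J) powr (1/p) + 1"
 have K: "0 < K" by (simp add: K_def add_nonneg_pos)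
 have curve: "\<bar>F y - F x\<bar> <= K * (8 * e + bd x powr \<alpha>) powr (1 - 1/p)" if xy: "x \<in> \<Omega>" "y \<in> \<Omega>" "dmet \<alpha> x y < e" for x y e
 proof -
  obtain \<gamma> where g: "joins \<gamma> x y" "weighted_length \<alpha> \<gamma> < e" by (rule d_met_approx[OF xy])
  have pn: "real ?n < p" using q qp by simp
  have "\<bar>F y - F x\<bar> <= 2 * (8 * weighted_length \<alpha> \<gamma> + bd x powr \<alpha>) powr (1 - 1/p) * (4 ^ ?n * J) powr (1/p)"
   using chain_estimate[OF H2m pn \<alpha>_eq loc g(1), of UNIV J] J by simp
  also have "... <= K * (8 * weighted_length \<alpha> \<gamma> + bd x powr \<alpha>) powr (1 - 1/p)" by (simp add: K_def algebra_simps)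
  also have "... <= K * (8 * e + bd x powr \<alpha>) powr (1 - 1/p)"
   using K g(2) exponents weighted_length_nonneg[of \<alpha> \<gamma>] by (intro mult_left_mono powr_mono2) auto
  finally show ?thesis .
 qed
 show ?thesis unfolding d_continuous_def
 proof (intro ballI allI impI)
  fix \<omega> e assume w: "\<omega> \<in> bdry \<alpha>" and e: "0 < (e::real)"
  define \<delta> where "\<delta> = (e / (2 * K)) powr (1 / (1 - 1/p)) / 9"
  have \<delta>: "0 < \<delta>" using e K by (simp add: \<delta>_def)
  have p': "0 < 1 - 1/p" using exponents by simp
  have "K * (9 * \<delta>) powr (1 - 1/p) = e / 2" using e K exponents(2) by (simp add: \<delta>_def powr_powr)
  moreover have "\<bar>f \<omega>' - f \<omega>\<bar> <= K * (9 * \<delta>) powr (1 - 1/p)" if w': "\<omega>' \<in> bdry \<alpha>" and d: "dbar \<alpha> \<omega> \<omega>' < \<delta>" for \<omega>'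
  proof -
   note wc = bdry_completed[OF e\<alpha> w] bdry_completed[OF e\<alpha> w']
   obtain y y' where y: "y \<in> \<omega>" "y' \<in> \<omega>'" using completed_nonempty[OF e\<alpha>] wc by blast
   have yO: "y i \<in> \<Omega>" "y' i \<in> \<Omega>" for i
    using rho_CauchyD[OF completed_Cauchy[OF e\<alpha> wc(1) y(1)]] rho_CauchyD[OF completed_Cauchy[OF e\<alpha> wc(2) y(2)]] by auto
   have lim: "(\<lambda>i. F (y' i) - F (y i)) \<longlonglongrightarrow> f \<omega>' - f \<omega>"
    using tr w w' y by (intro tendsto_diff) (auto simp: is_trace_def)
   have "(\<lambda>i. bd (y i) powr \<alpha>) \<longlonglongrightarrow> 0"
    using bdry_bd_tendsto_0[OF e\<alpha> w y(1)] by (rule tendsto_zero_powrI[OF _ tendsto_const]) (use e\<alpha> bd_nonneg in auto)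
   then have "\<forall>\<^sub>F i in sequentially. bd (y i) powr \<alpha> < \<delta>" using \<delta> by (rule order_tendstoD)
   moreover have "\<forall>\<^sub>F i in sequentially. dmet \<alpha> (y i) (y' i) < \<delta>"
    using d_bar_tendsto[OF e\<alpha> wc y] d by (rule order_tendstoD)
   ultimately have "\<forall>\<^sub>F i in sequentially. norm (F (y' i) - F (y i)) <= K * (9 * \<delta>) powr (1 - 1/p)"
   proof eventually_elim
    case (elim i)
    have "\<bar>F (y' i) - F (y i)\<bar> <= K * (8 * \<delta> + bd (y i) powr \<alpha>) powr (1 - 1/p)" by (rule curve[OF yO elim(2)])
    also have "... <= K * (9 * \<delta>) powr (1 - 1/p)" using K elim(1) \<delta> p' by (intro mult_left_mono powr_mono2) auto
    finally show ?case by simp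
   qed
   then have "norm (f \<omega>' - f \<omega>) <= K * (9 * \<delta>) powr (1 - 1/p)" by (rule Lim_norm_ubound[OF sequentially_bot lim])
   then show ?thesis by simp
  qed
  ultimately show "\<exists>\<delta>>0. \<forall>\<omega>'\<in>bdry \<alpha>. dbar \<alpha> \<omega> \<omega>' < \<delta> \<longrightarrow> \<bar>f \<omega>' - f \<omega>\<bar> < e"
   using \<delta> e by (intro exI[of _ \<delta>]) force
 qed
qed

end

section \<open>Weak gradients from difference quotients\<close>

lemma norm_axis_1: "norm (axis i (1::real) :: real^'n) = 1" "infnorm (axis i (1::real) :: real^'n) = 1"
proof -
 show "norm (axis i (1::real) :: real^'n) = 1" by simp
 then have "infnorm (axis i (1::real) :: real^'n) <= 1" using infnorm_le_norm by metis
 moreover have "1 <= infnorm (axis i (1::real) :: real^'n)" using component_le_infnorm_cart[of "axis i (1::real)" i] by simp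
 ultimately show "infnorm (axis i (1::real) :: real^'n) = 1" by simp
qed

lemma smooth_line_derivative:
 fixes \<phi> :: "real^'n => real"
 assumes "k_smooth (Suc m) \<phi>"
 shows "((\<lambda>t. \<phi> (x + t *\<^sub>R v)) has_real_derivative (\<Sum>i\<in>UNIV. v $ i * partial_deriv i \<phi> (x + t *\<^sub>R v))) (at t)"
proof -
 note D = k_smooth_differentiable[OF assms, of "x + t *\<^sub>R v"]
 have "((\<lambda>t. x + t *\<^sub>R v) has_derivative (\<lambda>h. h *\<^sub>R v)) (at t)" by (auto intro!: derivative_eq_intros)
 from has_derivative_compose[OF this D]
 have "((\<lambda>t. \<phi> (x + t *\<^sub>R v)) has_derivative (\<lambda>h. frechet_derivative \<phi> (at (x + t *\<^sub>R v)) (h *\<^sub>R v))) (at t)" .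
 moreover have "frechet_derivative \<phi> (at (x + t *\<^sub>R v)) (h *\<^sub>R v) = (\<Sum>i\<in>UNIV. v $ i * partial_deriv i \<phi> (x + t *\<^sub>R v)) * h" for h
  by (subst frechet_sum_partial[OF D]) (simp add: sum_distrib_left sum_distrib_right mult_ac)
 ultimately show ?thesis unfolding has_field_derivative_def by (simp only:)
qed

lemma smooth_compact_lipschitz:
 fixes \<phi> :: "real^'n => real"
 assumes "k_smooth (Suc m) \<phi>" "compact K" "\<And>x. x \<notin> K ==> \<phi> x = 0"
 shows "\<exists>L>0. \<forall>x y. \<bar>\<phi> x - \<phi> y\<bar> <= L * infnorm (x - y)"
proof -
 have "\<exists>M. \<forall>x. \<bar>partial_deriv i \<phi> x\<bar> <= M" for i
 proof -
  have "k_smooth k h ==> k_smooth 0 h" for k and h :: "real^'n => real" by (induction k) (use k_smooth_Suc_imp in blast)+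
  moreover have "k_smooth m (partial_deriv i \<phi>)" using assms(1) by simp
  ultimately have "k_smooth 0 (partial_deriv i \<phi>)" by blast
  then have "continuous_on K (partial_deriv i \<phi>)" using continuous_on_subset by auto
  then have "bounded (partial_deriv i \<phi> ` K)" by (intro compact_imp_bounded compact_continuous_image assms(2))
  then obtain M where "\<forall>x\<in>K. \<bar>partial_deriv i \<phi> x\<bar> <= M" unfolding bounded_iff by auto
  then have "\<bar>partial_deriv i \<phi> x\<bar> <= max M 0" for x
   using partial_deriv_zero_outside[OF compact_imp_closed[OF assms(2)] assms(3), where z=x and i=i] by (cases "x \<in> K") (auto simp: le_max_iff_disj)
  then show ?thesis by blast
 qed
 then obtain M where M: "\<And>i x. \<bar>partial_deriv i \<phi> x\<bar> <= M i" by metis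
 have M0: "0 <= M i" for i using M[of i undefined] by linarith
 define L where "L = (\<Sum>i\<in>UNIV. M i) + 1"
 have "\<bar>\<phi> x - \<phi> y\<bar> <= L * infnorm (x - y)" for x y
 proof -
  obtain t where "\<phi> (y + 1 *\<^sub>R (x - y)) - \<phi> (y + 0 *\<^sub>R (x - y)) = (1 - 0) * (\<Sum>i\<in>UNIV. (x - y) $ i * partial_deriv i \<phi> (y + t *\<^sub>R (x - y)))"
   using MVT2[of 0 1 "\<lambda>t. \<phi> (y + t *\<^sub>R (x - y))", OF _ smooth_line_derivative[OF assms(1)]] by auto
  then have "\<bar>\<phi> x - \<phi> y\<bar> = \<bar>\<Sum>i\<in>UNIV. (x - y) $ i * partial_deriv i \<phi> (y + t *\<^sub>R (x - y))\<bar>" by simp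
  also have "... <= (\<Sum>i\<in>UNIV. infnorm (x - y) * M i)"
   by (rule order_trans[OF sum_abs sum_mono], unfold abs_mult, rule mult_mono[OF component_le_infnorm_cart M infnorm_pos_le]) simp
  also have "... <= L * infnorm (x - y)" unfolding sum_distrib_left[symmetric] L_def
   using infnorm_pos_le[of "x - y"] by (simp add: distrib_right distrib_left mult.commute)
  finally show ?thesis .
 qed
 moreover have "0 < L" unfolding L_def using sum_nonneg[of UNIV M] M0 by (simp add: add_nonneg_pos)
 ultimately show ?thesis by blast
qed

lemma integral_lborel_translate:
 fixes f :: "real^'n => real"
 assumes "f \<in> borel_measurable borel" shows "integral\<^sup>L lborel (\<lambda>x. f (x + c)) = integral\<^sup>L lborel f"
 using integral_distr[of "(+) c" lborel borel f] lborel_distr_plus[of c] assms by (simp add: add.commute[of c])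

text \<open>A counterexample sequence would accumulate at a point of \<open>K\<close>, around which \<open>F\<close> is Lipschitz.\<close>
lemma compact_uniformly_lipschitz:
 fixes F :: "real^'n => real"
 assumes loc: "\<And>x. x \<in> \<Omega> ==> \<exists>\<delta>>0. \<exists>L. ball x \<delta> \<subseteq> \<Omega> \<and> (\<forall>y\<in>ball x \<delta>. \<forall>y'\<in>ball x \<delta>. \<bar>F y - F y'\<bar> <= L * norm (y - y'))"
  and K: "compact K" "K \<subseteq> \<Omega>"
 shows "\<exists>\<delta>>0. \<exists>L\<ge>0. \<forall>x\<in>K. \<forall>y. norm (y - x) < \<delta> \<longrightarrow> y \<in> \<Omega> \<and> \<bar>F y - F x\<bar> <= L * norm (y - x)"
proof (rule ccontr)
 assume no: "\<not> ?thesis"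
 have "\<exists>x\<in>K. \<exists>y. norm (y - x) < 1 / real (Suc k) \<and> \<not> (y \<in> \<Omega> \<and> \<bar>F y - F x\<bar> <= real k * norm (y - x))" for k
 proof (rule ccontr)
  assume "\<not> ?thesis"
  then have "\<forall>x\<in>K. \<forall>y. norm (y - x) < 1 / real (Suc k) \<longrightarrow> y \<in> \<Omega> \<and> \<bar>F y - F x\<bar> <= real k * norm (y - x)" by blast
  moreover have "0 < 1 / real (Suc k)" "0 <= real k" by auto
  ultimately show False using no by blast
 qed
 then obtain x y where xy: "\<And>k. x k \<in> K" "\<And>k. norm (y k - x k) < 1 / real (Suc k)"
  "\<And>k. \<not> (y k \<in> \<Omega> \<and> \<bar>F (y k) - F (x k)\<bar> <= real k * norm (y k - x k))" by metis
 obtain l \<sigma> where l: "l \<in> K" "strict_mono (\<sigma> :: nat => nat)" "(x \<circ> \<sigma>) \<longlonglongrightarrow> l"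
  using K(1) xy(1) unfolding compact_def by metis
 then obtain \<delta> L where d: "\<delta> > 0" "ball l \<delta> \<subseteq> \<Omega>" "\<And>y y'. y \<in> ball l \<delta> ==> y' \<in> ball l \<delta> ==> \<bar>F y - F y'\<bar> <= L * norm (y - y')"
  using loc[of l] K(2) by blast
 have "(\<lambda>k. y (\<sigma> k) - x (\<sigma> k)) \<longlonglongrightarrow> 0"
 proof (rule Lim_null_comparison)
  show "\<forall>\<^sub>F k in sequentially. norm (y (\<sigma> k) - x (\<sigma> k)) <= 1 / real (Suc k)"
  proof (intro always_eventually allI)
   fix k
   have "norm (y (\<sigma> k) - x (\<sigma> k)) <= 1 / real (Suc (\<sigma> k))" using xy(2) less_imp_le by blast
   also have "... <= 1 / real (Suc k)" using seq_suble[OF l(2), of k] by (simp add: frac_le)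
   finally show "norm (y (\<sigma> k) - x (\<sigma> k)) <= 1 / real (Suc k)" .
  qed
  show "(\<lambda>k. 1 / real (Suc k)) \<longlonglongrightarrow> 0" using LIMSEQ_Suc[OF lim_const_over_n[of 1]] by simp
 qed
 from tendsto_add[OF this l(3)[unfolded o_def]] have "(\<lambda>k. y (\<sigma> k)) \<longlonglongrightarrow> l" by simp
 then have "\<forall>\<^sub>F k in sequentially. y (\<sigma> k) \<in> ball l \<delta>" "\<forall>\<^sub>F k in sequentially. x (\<sigma> k) \<in> ball l \<delta>"
  using topological_tendstoD[OF _ open_ball, of _ l _ l \<delta>] l(3) d(1) unfolding o_def by auto
 moreover obtain k0 :: nat where k0: "L < real k0" using reals_Archimedean2 by blast
 then have "\<forall>\<^sub>F k in sequentially. L <= real (\<sigma> k)"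
  using seq_suble[OF l(2)] by (intro eventually_sequentiallyI[of k0]) (meson less_imp_le of_nat_le_iff order_trans)
 ultimately have "\<forall>\<^sub>F k in sequentially. False"
 proof eventually_elim
  case (elim k)
  have "\<bar>F (y (\<sigma> k)) - F (x (\<sigma> k))\<bar> <= L * norm (y (\<sigma> k) - x (\<sigma> k))" by (rule d(3)[OF elim(1,2)])
  also have "... <= real (\<sigma> k) * norm (y (\<sigma> k) - x (\<sigma> k))" using elim(3) by (intro mult_right_mono) auto
  finally show ?case using xy(3)[of "\<sigma> k"] d(2) elim(1) by blast
 qed
 then show False by simp
qed

text \<open>For a locally Lipschitz function both sides of the discrete integration by parts
 \<open>\<integral> F D\<^sup>-\<phi> = - \<integral> D\<^sup>+F \<phi>\<close> converge by dominated convergence, as soon as the difference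
 quotients of \<open>F\<close> converge along one sequence of steps.\<close>
lemma weak_gradient_of_difference_quotients:
 fixes F :: "real^'n => real"
 assumes \<Omega>: "open \<Omega>"
  and loc: "\<And>x. x \<in> \<Omega> ==> \<exists>\<delta>>0. \<exists>L. ball x \<delta> \<subseteq> \<Omega> \<and> (\<forall>y\<in>ball x \<delta>. \<forall>y'\<in>ball x \<delta>. \<bar>F y - F y'\<bar> <= L * norm (y - y'))"
  and G: "\<And>x i. x \<in> \<Omega> ==> (\<lambda>k. real (Suc k) * (F (x + (1 / real (Suc k)) *\<^sub>R axis i 1) - F x)) \<longlonglongrightarrow> G x $ i"
 shows "continuous_on \<Omega> F" "weak_gradient \<Omega> F G"
proof -
 have unif: "\<exists>\<delta>>0. \<exists>L\<ge>0. \<forall>x\<in>K. \<forall>y. norm (y - x) < \<delta> \<longrightarrow> y \<in> \<Omega> \<and> \<bar>F y - F x\<bar> <= L * norm (y - x)"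
  if "compact K" "K \<subseteq> \<Omega>" for K by (rule compact_uniformly_lipschitz[OF loc that])
 show Fc: "continuous_on \<Omega> F"
 proof (rule continuous_at_imp_continuous_on, rule ballI)
  fix x assume "x \<in> \<Omega>"
  then obtain \<delta> L where d: "\<delta> > 0" "\<And>y. norm (y - x) < \<delta> ==> \<bar>F y - F x\<bar> <= L * norm (y - x)"
   using unif[of "{x}"] by auto
  have "((\<lambda>y. F y - F x) \<longlongrightarrow> 0) (at x)"
  proof (rule Lim_null_comparison)
   show "\<forall>\<^sub>F y in at x. norm (F y - F x) <= L * norm (y - x)"
    using d unfolding eventually_at by (intro exI[of _ \<delta>]) (auto simp: dist_norm)
   have "((\<lambda>y. L * norm (y - x)) \<longlongrightarrow> L * norm (x - x)) (at x)" by (intro tendsto_intros)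
   then show "((\<lambda>y. L * norm (y - x)) \<longlongrightarrow> 0) (at x)" by simp
  qed
  then show "isCont F x" by (simp add: isCont_def LIM_zero_iff)
 qed
 define F0 where "F0 x = indicator \<Omega> x *\<^sub>R F x" for x
 have F0m [measurable]: "F0 \<in> borel_measurable borel" unfolding F0_def[abs_def]
  by (rule borel_measurable_continuous_on_indicator) (use \<Omega> Fc in auto)
 define G0 where "G0 i x = indicator \<Omega> x * G x $ i" for i x
 have G0m [measurable]: "G0 i \<in> borel_measurable borel" for i
 proof (rule borel_measurable_LIMSEQ_real)
  show "(\<lambda>x. indicator \<Omega> x * (real (Suc k) * (F0 (x + (1 / real (Suc k)) *\<^sub>R axis i 1) - F0 x))) \<in> borel_measurable borel" for k
  proof -
   have [measurable]: "\<Omega> \<in> sets borel" using \<Omega> by (rule borel_open)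
   show ?thesis by measurable
  qed
  show "(\<lambda>k. indicator \<Omega> x * (real (Suc k) * (F0 (x + (1 / real (Suc k)) *\<^sub>R axis i 1) - F0 x))) \<longlonglongrightarrow> G0 i x" for x
  proof (cases "x \<in> \<Omega>")
   case True
   obtain \<delta> where d: "\<delta> > 0" "\<And>y. norm (y - x) < \<delta> ==> y \<in> \<Omega>" using unif[of "{x}"] True by auto
   have "\<forall>\<^sub>F k in sequentially. 1 / real (Suc k) < \<delta>"
    using order_tendstoD(2)[OF LIMSEQ_Suc[OF lim_const_over_n[of 1]] d(1)] by simp
   then have "\<forall>\<^sub>F k in sequentially. real (Suc k) * (F (x + (1 / real (Suc k)) *\<^sub>R axis i 1) - F x)
     = indicator \<Omega> x * (real (Suc k) * (F0 (x + (1 / real (Suc k)) *\<^sub>R axis i 1) - F0 x))"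
   proof eventually_elim
    case (elim k)
    then have "x + (1 / real (Suc k)) *\<^sub>R axis i 1 \<in> \<Omega>" by (intro d(2)) simp
    then show ?case using True by (simp add: F0_def)
   qed
   from Lim_transform_eventually[OF G[OF True] this] show ?thesis using True by (simp add: G0_def)
  qed (simp add: G0_def)
 qed
 have Gbound: "\<exists>L\<ge>0. \<forall>x\<in>K. \<forall>i. \<bar>G x $ i\<bar> <= L" if K: "compact K" "K \<subseteq> \<Omega>" for K
 proof -
  obtain \<delta> L where d: "\<delta> > 0" "L \<ge> 0" "\<And>x y. x \<in> K ==> norm (y - x) < \<delta> ==> \<bar>F y - F x\<bar> <= L * norm (y - x)"
   using unif[OF K] by blast
  have "\<bar>G x $ i\<bar> <= L" if x: "x \<in> K" for x i
  proof -
   have "\<forall>\<^sub>F k in sequentially. 1 / real (Suc k) < \<delta>"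
    using order_tendstoD(2)[OF LIMSEQ_Suc[OF lim_const_over_n[of 1]] d(1)] by simp
   then have "\<forall>\<^sub>F k in sequentially. norm (real (Suc k) * (F (x + (1 / real (Suc k)) *\<^sub>R axis i 1) - F x)) <= L"
   proof eventually_elim
    case (elim k)
    then have "\<bar>F (x + (1 / real (Suc k)) *\<^sub>R axis i 1) - F x\<bar> <= L * (1 / real (Suc k))"
     using d(3)[OF x, of "x + (1 / real (Suc k)) *\<^sub>R axis i 1"] by simp
    from mult_left_mono[OF this, of "real (Suc k)"] show ?case by (simp add: abs_mult del: of_nat_Suc)
   qed
   then have "norm (G x $ i) <= L" using x K G by (intro Lim_norm_ubound[OF sequentially_bot]) auto
   then show ?thesis by simp
  qed
  then show ?thesis using d(2) by blast
 qed
 have bdd_int: "h absolutely_integrable_on K"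
  if K: "compact K" and h: "(\<lambda>x. indicator \<Omega> x * h x) \<in> borel_measurable borel" "K \<subseteq> \<Omega>" "\<And>x. x \<in> K ==> \<bar>h x\<bar> <= B" for K B and h :: "real^'n => real"
 proof -
  have "integrable lborel (\<lambda>x. indicator K x *\<^sub>R (indicator \<Omega> x * h x))"
  proof (rule integrableI_bounded_set[where A=K and B=B])
   have [measurable]: "K \<in> sets borel" using K by (rule borel_compact)
   note h(1)[measurable]
   show "(\<lambda>x. indicator K x *\<^sub>R (indicator \<Omega> x * h x)) \<in> borel_measurable lborel" by measurable
   show "emeasure lborel K < \<infinity>" using emeasure_bounded_finite[OF compact_imp_bounded[OF K]] .
  qed (use K h borel_compact in \<open>auto simp: indicator_def\<close>)
  moreover have "(\<lambda>x. indicator K x *\<^sub>R (indicator \<Omega> x * h x)) = (\<lambda>x. indicator K x *\<^sub>R h x)" using h(2) by (auto simp: indicator_def fun_eq_iff)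
  ultimately show ?thesis unfolding set_integrable_def using integrable_completion by (metis borel_measurable_integrable)
 qed
 have Fint: "locally_integrable \<Omega> F" unfolding locally_integrable_def
 proof (intro allI impI)
  fix K assume K: "compact K \<and> K \<subseteq> \<Omega>"
  then have "bounded (F ` K)" using Fc by (intro compact_imp_bounded compact_continuous_image) (auto intro: continuous_on_subset)
  then obtain B where "\<forall>x\<in>K. \<bar>F x\<bar> <= B" unfolding bounded_iff by auto
  then show "F absolutely_integrable_on K" using K F0m unfolding F0_def[abs_def] by (intro bdd_int[where B=B]) auto
 qed
 have Gint: "locally_integrable \<Omega> G" unfolding locally_integrable_def
 proof (intro allI impI)
  fix K assume K: "compact K \<and> K \<subseteq> \<Omega>"
  then obtain L where L: "\<forall>x\<in>K. \<forall>i. \<bar>G x $ i\<bar> <= L" using Gbound by blast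
  have "(\<lambda>x. G x $ i) absolutely_integrable_on K" for i
   using K L G0m[of i] unfolding G0_def[abs_def] by (intro bdd_int[where B=L]) auto
  then show "G absolutely_integrable_on K"
   by (subst absolutely_integrable_componentwise_iff) (auto simp: Basis_vec_def inner_axis)
 qed
 have parts: "(LINT x:\<Omega>|lebesgue. F x * partial_deriv i \<phi> x) = - (LINT x:\<Omega>|lebesgue. G x $ i * \<phi> x)"
  if t: "test_function \<Omega> \<phi>" for \<phi> i
 proof -
  let ?e = "axis i (1::real) :: real^'n"
  obtain K where K: "compact K" "K \<subseteq> \<Omega>" "\<And>x. x \<notin> K ==> \<phi> x = 0" "continuous_on UNIV \<phi>"
   by (rule test_functionE[OF t]) (rule that)
  have sm: "k_smooth (Suc 0) \<phi>" using t by (simp only: test_function_def)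
  obtain M where M: "\<And>x y. \<bar>\<phi> x - \<phi> y\<bar> <= M * infnorm (x - y)" using smooth_compact_lipschitz[OF sm K(1,3)] by blast
  have \<phi>m [measurable]: "\<phi> \<in> borel_measurable borel" using K(4) by (rule borel_measurable_continuous_onI)
  have d\<phi>m [measurable]: "partial_deriv i \<phi> \<in> borel_measurable borel"
   using sm by (intro borel_measurable_continuous_onI) simp
  obtain \<delta> L where d: "\<delta> > 0" "L \<ge> 0" "\<And>x y. x \<in> K ==> norm (y - x) < \<delta> ==> y \<in> \<Omega> \<and> \<bar>F y - F x\<bar> <= L * norm (y - x)"
   using unif[OF K(1,2)] by blast
  obtain k0 :: nat where k0: "1 / real (Suc k0) < \<delta>" using d(1) nat_approx_posE by blast
  define s where "s k = real (Suc (k + k0))" for k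
  define e where "e k = (1 / s k) *\<^sub>R (axis i 1 :: real^'n)" for k
  have s: "0 < s k" "1 / s k <= 1 / real (Suc k0)" for k by (auto simp: s_def frac_le)
  define K1 where "K1 = (\<lambda>(x, t). x + t *\<^sub>R ?e) ` (K \<times> {0..1 / real (Suc k0)})"
  have cK1: "compact K1" unfolding K1_def case_prod_beta
   by (intro compact_continuous_image compact_Times K compact_Icc continuous_intros)
  have K1O: "K1 \<subseteq> \<Omega>"
  proof
   fix z assume "z \<in> K1"
   then obtain x t where "x \<in> K" "0 <= t" "t <= 1 / real (Suc k0)" "z = x + t *\<^sub>R ?e" by (auto simp: K1_def)
   then show "z \<in> \<Omega>" using d(3)[of x z] k0 by auto
  qed
  have KK1: "K \<subseteq> K1" unfolding K1_def by (force intro: image_eqI[of _ _ "(_, 0)"])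
  have K1: "\<phi> (x - e k) = 0" if "x \<notin> K1" for x k
  proof (rule K(3), rule notI)
   assume "x - e k \<in> K"
   then have "(\<lambda>(x, t). x + t *\<^sub>R ?e) (x - e k, 1 / s k) \<in> K1"
    unfolding K1_def using s by (intro imageI) (auto simp: less_imp_le)
   then show False using that by (simp add: e_def)
  qed
  have "bounded (F ` K1)" using Fc cK1 K1O by (intro compact_imp_bounded compact_continuous_image) (auto intro: continuous_on_subset)
  then obtain B where B: "\<forall>x\<in>K1. \<bar>F x\<bar> <= B" unfolding bounded_iff by auto
  have B0: "\<bar>F0 x * c\<bar> <= B * C * indicator K1 x" if "x \<notin> K1 ==> c = 0" "\<bar>c\<bar> <= C" for x c C
   using that B K1O by (cases "x \<in> K1") (auto simp: F0_def abs_mult intro!: mult_mono)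
  have iK1: "integrable lborel (\<lambda>x. C * indicator K1 x :: real)" for C
   using emeasure_bounded_finite[OF compact_imp_bounded[OF cK1]] cK1
   by (intro integrable_mult_right integrable_real_indicator) (auto simp: borel_compact)
  define A where "A k = integral\<^sup>L lborel (\<lambda>x. F0 x * (s k * (\<phi> x - \<phi> (x - e k))))" for k
  define C where "C k = integral\<^sup>L lborel (\<lambda>x. (s k * (F0 (x + e k) - F0 x)) * \<phi> x)" for k
  have lim_s: "(\<lambda>k. X (k + k0)) \<longlonglongrightarrow> l" if "X \<longlonglongrightarrow> l" for X and l :: real using LIMSEQ_ignore_initial_segment[OF that] .
  have "A \<longlonglongrightarrow> integral\<^sup>L lborel (\<lambda>x. F0 x * partial_deriv i \<phi> x)" unfolding A_def
  proof (rule integral_dominated_convergence[where w="\<lambda>x. B * M * indicator K1 x"])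
   show "AE x in lborel. (\<lambda>k. F0 x * (s k * (\<phi> x - \<phi> (x - e k)))) \<longlonglongrightarrow> F0 x * partial_deriv i \<phi> x"
   proof (rule AE_I2, rule tendsto_mult[OF tendsto_const])
    fix x
    have "((\<lambda>t. \<phi> (x + t *\<^sub>R ?e)) has_real_derivative partial_deriv i \<phi> x) (at 0)"
    proof -
     have "(\<Sum>j\<in>UNIV. ?e $ j * partial_deriv j \<phi> (x + 0 *\<^sub>R ?e)) = (\<Sum>j\<in>UNIV. if j = i then partial_deriv j \<phi> x else 0)"
      by (intro sum.cong) (auto simp: axis_def)
     then show ?thesis using smooth_line_derivative[OF sm, of x ?e 0] by simp
    qed
    then have "((\<lambda>h. (\<phi> (x + h *\<^sub>R ?e) - \<phi> x) / h) \<longlongrightarrow> partial_deriv i \<phi> x) (at 0)" by (simp add: DERIV_def)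
    moreover have "(\<lambda>k. - (1 / s k)) \<longlonglongrightarrow> 0"
     using tendsto_minus[OF lim_s[OF LIMSEQ_Suc[OF lim_const_over_n[of 1]]]] by (simp add: s_def)
    then have "filterlim (\<lambda>k. - (1 / s k)) (at 0) sequentially" using s(1) by (auto simp: filterlim_at less_imp_neq[symmetric] intro!: always_eventually)
    ultimately have "(\<lambda>k. (\<phi> (x + (- (1 / s k)) *\<^sub>R ?e) - \<phi> x) / (- (1 / s k))) \<longlonglongrightarrow> partial_deriv i \<phi> x"
     by (rule filterlim_compose)
    then show "(\<lambda>k. s k * (\<phi> x - \<phi> (x - e k))) \<longlonglongrightarrow> partial_deriv i \<phi> x"
     using s(1) by (simp add: e_def field_simps)
   qed
   fix k
   show "AE x in lborel. norm (F0 x * (s k * (\<phi> x - \<phi> (x - e k)))) <= B * M * indicator K1 x"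
   proof (rule AE_I2, unfold real_norm_def, rule B0)
    fix x assume "x \<notin> K1" then show "s k * (\<phi> x - \<phi> (x - e k)) = 0" using K1[of x k] K(3) KK1 by auto
   next
    fix x
    have "\<bar>s k * (\<phi> x - \<phi> (x - e k))\<bar> <= s k * (M * infnorm (x - (x - e k)))"
     using M[of x "x - e k"] s(1)[of k] by (simp add: abs_mult)
    then show "\<bar>s k * (\<phi> x - \<phi> (x - e k))\<bar> <= M" using s(1)[of k] by (simp add: e_def infnorm_mul norm_axis_1)
   qed
  qed (use iK1[of "B * M"] in \<open>simp_all only: measurable_lborel2, measurable\<close>)
  moreover have limC: "C \<longlonglongrightarrow> integral\<^sup>L lborel (\<lambda>x. G0 i x * \<phi> x)" unfolding C_def
  proof (rule integral_dominated_convergence[where w="\<lambda>x. L * \<bar>\<phi> x\<bar>"])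
   have near: "x + e k \<in> \<Omega> \<and> \<bar>F (x + e k) - F x\<bar> <= L * (1 / s k)" if "x \<in> K" for x k
    using d(3)[OF that, of "x + e k"] s[of k] k0 by (auto simp: e_def)
   have eq: "(s k * (F0 (x + e k) - F0 x)) * \<phi> x = (s k * (F (x + e k) - F x)) * \<phi> x" for x k
    using near[of x k] K(2,3) by (cases "x \<in> K") (auto simp: F0_def)
   show "AE x in lborel. (\<lambda>k. (s k * (F0 (x + e k) - F0 x)) * \<phi> x) \<longlonglongrightarrow> G0 i x * \<phi> x"
   proof (rule AE_I2)
    fix x
    show "(\<lambda>k. (s k * (F0 (x + e k) - F0 x)) * \<phi> x) \<longlonglongrightarrow> G0 i x * \<phi> x"
    proof (cases "x \<in> K")
     case True
     then show ?thesis unfolding eq using lim_s[OF G[of x i]] K(2) by (intro tendsto_mult tendsto_const) (auto simp: s_def e_def G0_def)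
    qed (simp add: K(3))
   qed
   show "AE x in lborel. norm ((s k * (F0 (x + e k) - F0 x)) * \<phi> x) <= L * \<bar>\<phi> x\<bar>" for k
   proof (rule AE_I2)
    fix x
    show "norm ((s k * (F0 (x + e k) - F0 x)) * \<phi> x) <= L * \<bar>\<phi> x\<bar>"
    proof (cases "x \<in> K")
     case True
     have "\<bar>s k * (F (x + e k) - F x)\<bar> <= L"
      using mult_left_mono[OF conjunct2[OF near[OF True, of k]], of "s k"] s(1)[of k] by (simp add: abs_mult)
     then show ?thesis unfolding eq by (simp add: abs_mult mult_right_mono)
    qed (simp add: K(3))
   qed
   have "integrable lborel (\<lambda>x. indicator K x *\<^sub>R \<phi> x)" by (rule borel_integrable_compact[OF K(1) continuous_on_subset[OF K(4) subset_UNIV]])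
   moreover have "(\<lambda>x. indicator K x *\<^sub>R \<phi> x) = \<phi>" using K(3) by (auto simp: indicator_def fun_eq_iff)
   ultimately have "integrable lborel \<phi>" by simp
   then show "integrable lborel (\<lambda>x. L * \<bar>\<phi> x\<bar>)" by (intro integrable_mult_right integrable_abs)
  qed auto
  moreover have AC: "A k = - C k" for k
  proof -
   have b\<phi>: "\<exists>c. \<forall>x. \<bar>\<phi> x\<bar> <= c"
    using compact_imp_bounded[OF compact_continuous_image[OF continuous_on_subset[OF K(4) subset_UNIV] K(1)]] K(3)
    unfolding bounded_iff by (metis abs_ge_zero abs_zero image_eqI order_trans real_norm_def)
   then obtain c where c: "\<And>x. \<bar>\<phi> x\<bar> <= c" by blast
   have i1: "integrable lborel (\<lambda>x. F0 x * \<phi> x)"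
    by (rule Bochner_Integration.integrable_bound[OF iK1[of "B * c"]], simp, rule AE_I2, unfold real_norm_def,
      rule order_trans[OF B0 abs_ge_self]) (use c K(3) KK1 in auto)
   have i2: "integrable lborel (\<lambda>x. F0 x * \<phi> (x - e k))"
    by (rule Bochner_Integration.integrable_bound[OF iK1[of "B * c"]], simp, rule AE_I2, unfold real_norm_def,
      rule order_trans[OF B0 abs_ge_self]) (use c K1 in auto)
   have m2: "(\<lambda>x. F0 x * \<phi> (x - e k)) \<in> borel_measurable borel" by measurable
   have tr: "integral\<^sup>L lborel (\<lambda>x. F0 (x + e k) * \<phi> x) = integral\<^sup>L lborel (\<lambda>x. F0 x * \<phi> (x - e k))"
    using integral_lborel_translate[OF m2, of "e k"] by simp
   have i3: "integrable lborel (\<lambda>x. F0 (x + e k) * \<phi> x)"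
   proof -
    have "integrable (distr lborel borel ((+) (e k))) (\<lambda>x. F0 x * \<phi> (x - e k))"
     using i2 by (simp only: lborel_distr_plus)
    from integrable_distr[OF _ this] show ?thesis by (simp add: add.commute)
   qed
   have "A k = s k * (integral\<^sup>L lborel (\<lambda>x. F0 x * \<phi> x) - integral\<^sup>L lborel (\<lambda>x. F0 x * \<phi> (x - e k)))"
    unfolding A_def using i1 i2 by (simp add: right_diff_distrib mult.left_commute[of _ "s k"])
   moreover have "C k = s k * (integral\<^sup>L lborel (\<lambda>x. F0 (x + e k) * \<phi> x) - integral\<^sup>L lborel (\<lambda>x. F0 x * \<phi> x))"
    unfolding C_def using i1 i3 by (simp add: right_diff_distrib left_diff_distrib mult.assoc)
   ultimately show ?thesis unfolding tr by (simp add: algebra_simps)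
  qed
  ultimately have "integral\<^sup>L lborel (\<lambda>x. F0 x * partial_deriv i \<phi> x) = - integral\<^sup>L lborel (\<lambda>x. G0 i x * \<phi> x)"
   using LIMSEQ_unique[OF _ tendsto_minus[OF limC]] AC[abs_def] by (metis (no_types, lifting) ext)
  moreover have "(LINT x:\<Omega>|lebesgue. F x * partial_deriv i \<phi> x) = integral\<^sup>L lborel (\<lambda>x. F0 x * partial_deriv i \<phi> x)"
  proof -
   have "(LINT x:\<Omega>|lebesgue. F x * partial_deriv i \<phi> x) = integral\<^sup>L lebesgue (\<lambda>x. F0 x * partial_deriv i \<phi> x)"
    by (simp add: set_lebesgue_integral_def F0_def mult.assoc)
   also have "... = integral\<^sup>L lborel (\<lambda>x. F0 x * partial_deriv i \<phi> x)" by (rule integral_completion) measurable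
   finally show ?thesis .
  qed
  moreover have "(LINT x:\<Omega>|lebesgue. G x $ i * \<phi> x) = integral\<^sup>L lborel (\<lambda>x. G0 i x * \<phi> x)"
  proof -
   have "(LINT x:\<Omega>|lebesgue. G x $ i * \<phi> x) = integral\<^sup>L lebesgue (\<lambda>x. G0 i x * \<phi> x)"
    by (simp add: set_lebesgue_integral_def G0_def mult.assoc)
   also have "... = integral\<^sup>L lborel (\<lambda>x. G0 i x * \<phi> x)" by (rule integral_completion) measurable
   finally show ?thesis .
  qed
  ultimately show ?thesis by simp
 qed
 show "weak_gradient \<Omega> F G" unfolding weak_gradient_def using Fint Gint parts by blast
qed

section \<open>Averaging at the scale of the distance to the boundary\<close>

definition bump_lip :: "'n::finite itself => real" where
 "bump_lip _ = (SOME L. 0 < L \<and> (\<forall>v w::real^'n. \<bar>unit_bump v - unit_bump w\<bar> <= L * infnorm (v - w)))"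

lemma bump_lip: "0 < bump_lip TYPE('n::finite)" "\<bar>unit_bump v - unit_bump (w::real^'n)\<bar> <= bump_lip TYPE('n) * infnorm (v - w)"
proof -
 have "compact {z::real^'n. infnorm (z - 0) <= 1}" unfolding infnorm_ball_eq_cbox by (rule compact_cbox)
 moreover have "unit_bump z = 0" if "z \<notin> {z::real^'n. infnorm (z - 0) <= 1}" for z :: "real^'n"
  using that unit_bump_bounds(3)[of z] by simp
 ultimately have "\<exists>L>0. \<forall>v w::real^'n. \<bar>unit_bump v - unit_bump w\<bar> <= L * infnorm (v - w)"
  using smooth_compact_lipschitz[OF unit_bump_smooth] by metis
 from someI_ex[OF this]
 show "0 < bump_lip TYPE('n)" "\<bar>unit_bump v - unit_bump w\<bar> <= bump_lip TYPE('n) * infnorm (v - w)"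
  by (auto simp: bump_lip_def)
qed

definition mollify_const :: "'n::finite itself => real" where
 "mollify_const _ = 32 * bump_lip TYPE('n) * 32 ^ CARD('n) / bump_min TYPE('n)"

lemma mollify_const_pos: "0 < mollify_const TYPE('n::finite)"
 using bump_lip(1)[where 'n='n] bump_min_pos[where 'n='n] by (simp add: mollify_const_def)

context proper_domain
begin

text \<open>The radius of the bump is proportional to the distance at the point \<open>z\<close> of integration and not at
 \<open>x\<close>.  So the kernel is a smooth function of \<open>x\<close>, although \<^const>\<open>udist\<close> is only Lipschitz.\<close>
definition ker :: "real^'n => real^'n => real" where
 "ker x z = indicator \<Omega> z * unit_bump ((8 / bd z) *\<^sub>R (x - z))"

definition mollify :: "(real^'n => real) => real^'n => real" where
 "mollify g x = integral\<^sup>L lborel (\<lambda>z. g z * ker x z) / integral\<^sup>L lborel (ker x)"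

lemma ker_measurable [measurable]: "ker x \<in> borel_measurable borel"
proof -
 have [measurable]: "bd \<in> borel_measurable borel" by (rule borel_measurable_continuous_onI[OF continuous_bd])
 have [measurable]: "unit_bump \<in> borel_measurable borel" by (rule borel_measurable_continuous_onI[OF unit_bump_continuous])
 have [measurable]: "\<Omega> \<in> sets borel" using op by (rule borel_open)
 show ?thesis unfolding ker_def[abs_def] by measurable
qed

context
 fixes x :: "real^'n" assumes x: "x \<in> \<Omega>"
begin

abbreviation "B \<equiv> {z. infnorm (z - x) <= bd x / 2}"
abbreviation "near \<equiv> {x'. infnorm (x' - x) <= bd x / 8}"

lemma near_bd: "x' \<in> near ==> x' \<in> \<Omega>" "x' \<in> near ==> 7/8 * bd x <= bd x'" "x' \<in> near ==> bd x' <= 9/8 * bd x"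
 using bd_half[OF x, of x' "1/8"] by auto

lemma ker_support: "x' \<in> near ==> ker x' z \<noteq> 0 ==> z \<in> B \<and> z \<in> \<Omega> \<and> bd x / 2 <= bd z"
proof -
 assume x': "x' \<in> near" and nz: "ker x' z \<noteq> 0"
 then have z: "z \<in> \<Omega>" "unit_bump ((8 / bd z) *\<^sub>R (x' - z)) \<noteq> 0" by (auto simp: ker_def indicator_def split: if_splits)
 then have "infnorm ((8 / bd z) *\<^sub>R (x' - z)) < 1" using unit_bump_bounds(3) not_less by blast
 then have "8 / bd z * infnorm (x' - z) < 1" using bd_pos[OF z(1)] unfolding infnorm_mul by simp
 then have d: "8 * infnorm (x' - z) < bd z" using bd_pos[OF z(1)] by (simp add: field_simps)
 have "bd z <= bd x' + infnorm (x' - z)" using bd_lipschitz[of z x'] infnorm_sub[of z x'] by simp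
 moreover have "infnorm (z - x) <= infnorm (x' - z) + infnorm (x' - x)"
  using infnorm_triangle_diff[of z x x'] infnorm_sub[of z x'] by simp
 moreover have "bd x <= bd z + infnorm (z - x)" using bd_lipschitz[of x z] infnorm_sub[of x z] by simp
 ultimately show ?thesis using z(1) d x' near_bd(3)[OF x'] bd_pos[OF x] by auto
qed

lemma ker_bounds: "0 <= ker y z" "x' \<in> near ==> ker x' z <= indicator B z"
proof -
 show "0 <= ker y z" by (simp add: ker_def unit_bump_bounds indicator_def)
 show "ker x' z <= indicator B z" if "x' \<in> near"
 proof (cases "ker x' z = 0")
  case False
  then have "z \<in> B" using ker_support[OF that] by blast
  moreover have "ker x' z <= 1" by (simp add: ker_def unit_bump_bounds indicator_def)
  ultimately show ?thesis by simp
 qed simp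
qed

lemma ker_lipschitz:
 assumes "x' \<in> near" "x'' \<in> near"
 shows "\<bar>ker x' z - ker x'' z\<bar> <= (16 * bump_lip TYPE('n) / bd x * infnorm (x' - x'')) * indicator B z"
proof (cases "ker x' z = 0 \<and> ker x'' z = 0")
 case False
 then have z: "z \<in> B" "z \<in> \<Omega>" "bd x / 2 <= bd z" using ker_support assms by blast+
 have "(8 / bd z) *\<^sub>R (x' - z) - (8 / bd z) *\<^sub>R (x'' - z) = (8 / bd z) *\<^sub>R (x' - x'')"
  by (simp add: algebra_simps)
 then have "\<bar>ker x' z - ker x'' z\<bar> <= bump_lip TYPE('n) * infnorm ((8 / bd z) *\<^sub>R (x' - x''))"
  using bump_lip(2)[of "(8 / bd z) *\<^sub>R (x' - z)" "(8 / bd z) *\<^sub>R (x'' - z)"] z(2) by (simp add: ker_def)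
 also have "... = bump_lip TYPE('n) * ((8 / bd z) * infnorm (x' - x''))" using bd_pos[OF z(2)] by (simp add: infnorm_mul)
 also have "... <= bump_lip TYPE('n) * ((16 / bd x) * infnorm (x' - x''))"
  using z(3) bd_pos[OF x] bd_pos[OF z(2)] bump_lip(1)[where 'n='n]
  by (intro mult_left_mono mult_right_mono infnorm_pos_le) (auto simp: field_simps)
 finally show ?thesis using z(1) by (simp add: mult_ac)
qed (use bd_pos[OF x] bump_lip(1)[where 'n='n] in \<open>auto intro!: mult_nonneg_nonneg divide_nonneg_nonneg simp: infnorm_pos_le\<close>)

lemma integral_B:
 fixes h :: "real^'n => real"
 assumes h: "h \<in> borel_measurable borel" "\<And>z. \<bar>h z\<bar> <= c * indicator B z" and c: "0 <= c"
 shows "integrable lborel h" "\<bar>integral\<^sup>L lborel h\<bar> <= c * bd x ^ CARD('n)" "integrable lborel (\<lambda>z. c * indicator B z :: real)"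
proof -
 have e: "emeasure lborel B = ennreal (bd x ^ CARD('n))" using emeasure_infnorm_ball[of "bd x / 2" x] bd_pos[OF x] by simp
 have mB: "B \<in> sets borel" by (rule infnorm_ball_measurable)
 show i: "integrable lborel (\<lambda>z. c * indicator B z :: real)" using e mB by (intro integrable_mult_right integrable_real_indicator) auto
 show ih: "integrable lborel h"
  by (rule Bochner_Integration.integrable_bound[OF i]) (use h c in \<open>auto intro!: AE_I2 order_trans[OF h(2)]\<close>)
 have "\<bar>integral\<^sup>L lborel h\<bar> <= integral\<^sup>L lborel (\<lambda>z. \<bar>h z\<bar>)" by (rule integral_abs_bound)
 also have "... <= integral\<^sup>L lborel (\<lambda>z. c * indicator B z)"
  by (rule Bochner_Integration.integral_mono) (use ih i h(2) in auto)
 also have "... = c * bd x ^ CARD('n)" using mB e bd_pos[OF x] by (simp add: measure_def)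
 finally show "\<bar>integral\<^sup>L lborel h\<bar> <= c * bd x ^ CARD('n)" .
qed

lemma ker_mass:
 assumes x': "x' \<in> near"
 shows "bump_min TYPE('n) * (bd x / 32) ^ CARD('n) <= integral\<^sup>L lborel (ker x')" "0 < integral\<^sup>L lborel (ker x')" "integrable lborel (ker x')"
proof -
 let ?S = "{z. infnorm (z - x') <= bd x' / 32}"
 note nb = near_bd[OF x']
 have b: "0 < bd x" "0 < bd x'" using bd_pos[OF x] bd_pos[OF nb(1)] by auto
 show ik: "integrable lborel (ker x')" using ker_bounds(1) ker_bounds(2)[OF x'] by (intro integral_B(1)[where c=1]) auto
 have e: "emeasure lborel ?S = ennreal ((bd x' / 16) ^ CARD('n))" using emeasure_infnorm_ball[of "bd x' / 32" x'] b by simp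
 have mS: "?S \<in> sets borel" by (rule infnorm_ball_measurable)
 have "bump_min TYPE('n) * (bd x / 32) ^ CARD('n) <= bump_min TYPE('n) * (bd x' / 16) ^ CARD('n)"
  using nb(2) b bump_min_pos[where 'n='n] by (intro mult_left_mono power_mono) auto
 also have "... = integral\<^sup>L lborel (\<lambda>z. bump_min TYPE('n) * indicator ?S z)" using mS e b by (simp add: measure_def)
 also have "... <= integral\<^sup>L lborel (ker x')"
 proof (rule Bochner_Integration.integral_mono[OF _ ik])
  show "integrable lborel (\<lambda>z. bump_min TYPE('n) * indicator ?S z)" using mS e by (intro integrable_mult_right integrable_real_indicator) auto
  fix z
  show "bump_min TYPE('n) * indicator ?S z <= ker x' z"
  proof (cases "z \<in> ?S")
   case True
   then have z: "infnorm (z - x') <= 1/32 * bd x'" by simp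
   note bz = bd_half[OF nb(1) z]
   have "infnorm ((8 / bd z) *\<^sub>R (x' - z)) = 8 / bd z * infnorm (z - x')"
    using bd_pos[OF bz(1)] by (simp add: infnorm_mul infnorm_sub)
   also have "... <= 8 / bd z * (bd x' / 32)" using z bd_pos[OF bz(1)] by (intro mult_left_mono) auto
   also have "... <= 1/2" using bz(2) bd_pos[OF bz(1)] b by (simp add: field_simps)
   finally have "bump_min TYPE('n) <= unit_bump ((8 / bd z) *\<^sub>R (x' - z))" by (rule unit_bump_lower)
   then show ?thesis using True bz(1) by (simp add: ker_def)
  qed (simp add: ker_bounds)
 qed
 finally show 1: "bump_min TYPE('n) * (bd x / 32) ^ CARD('n) <= integral\<^sup>L lborel (ker x')" .
 show "0 < integral\<^sup>L lborel (ker x')" by (rule less_le_trans[OF _ 1]) (use b bump_min_pos[where 'n='n] in simp)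
qed

context
 fixes g :: "real^'n => real" and c K :: real
 assumes g [measurable]: "g \<in> borel_measurable borel"
  and osc: "\<And>z. infnorm (z - x) <= bd x / 2 ==> \<bar>g z - c\<bar> <= K"
begin

lemma K_nonneg: "0 <= K"
 using osc[of x] bd_pos[OF x] abs_ge_zero[of "g x - c"] by (auto simp: infnorm_0)

lemma deviation_bound: "x' \<in> near ==> \<bar>(g z - c) * ker x' z\<bar> <= K * ker x' z"
proof (cases "ker x' z = 0")
 case False
 assume x': "x' \<in> near"
 then have "\<bar>g z - c\<bar> <= K" using ker_support[OF x' False] osc by auto
 then show ?thesis using ker_bounds(1)[of x' z] by (simp add: abs_mult mult_right_mono)
qed simp

definition dev :: "real^'n => real" where "dev x' = integral\<^sup>L lborel (\<lambda>z. (g z - c) * ker x' z)"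

lemma dev_props:
 assumes x': "x' \<in> near"
 shows "integrable lborel (\<lambda>z. (g z - c) * ker x' z)" "\<bar>dev x'\<bar> <= K * integral\<^sup>L lborel (ker x')"
  "mollify g x' = c + dev x' / integral\<^sup>L lborel (ker x')"
proof -
 note km = ker_mass[OF x']
 show i: "integrable lborel (\<lambda>z. (g z - c) * ker x' z)"
 proof (rule integral_B(1)[OF _ _ K_nonneg])
  show "\<bar>(g z - c) * ker x' z\<bar> <= K * indicator B z" for z
   by (rule order_trans[OF deviation_bound[OF x'] mult_left_mono[OF ker_bounds(2)[OF x'] K_nonneg]])
 qed measurable
 have "\<bar>dev x'\<bar> <= integral\<^sup>L lborel (\<lambda>z. \<bar>(g z - c) * ker x' z\<bar>)" unfolding dev_def by (rule integral_abs_bound)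
 also have "... <= integral\<^sup>L lborel (\<lambda>z. K * ker x' z)"
  by (rule Bochner_Integration.integral_mono) (use i km(3) deviation_bound[OF x'] in auto)
 finally show "\<bar>dev x'\<bar> <= K * integral\<^sup>L lborel (ker x')" by simp
 have "(\<lambda>z. g z * ker x' z) = (\<lambda>z. (g z - c) * ker x' z + c * ker x' z)" by (simp add: algebra_simps)
 then have "integral\<^sup>L lborel (\<lambda>z. g z * ker x' z) = dev x' + c * integral\<^sup>L lborel (ker x')"
  using i km(3) by (simp add: dev_def)
 then show "mollify g x' = c + dev x' / integral\<^sup>L lborel (ker x')" using km(2) by (simp add: mollify_def field_simps)
qed

text \<open>Averages of a function with small oscillation stay close to its values.\<close>
lemma mollify_close: "\<bar>mollify g x - c\<bar> <= K"
proof -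
 have x0: "x \<in> near" using bd_pos[OF x] by (simp add: infnorm_0)
 show ?thesis using dev_props(2,3)[OF x0] ker_mass(2)[OF x0] by (simp add: abs_divide divide_le_eq)
qed

text \<open>Subtracting the constant \<open>c\<close> does not change the increments of the normalised average, so only the
 oscillation \<open>K\<close> of \<open>g\<close> appears in the bound.\<close>
lemma mollify_lipschitz:
 assumes n: "x' \<in> near" "x'' \<in> near"
 shows "\<bar>mollify g x' - mollify g x''\<bar> <= mollify_const TYPE('n) * K / bd x * infnorm (x' - x'')"
proof -
 let ?W = "\<lambda>y. integral\<^sup>L lborel (ker y)" and ?n = "CARD('n)"
 define L where "L = 16 * bump_lip TYPE('n) / bd x * infnorm (x' - x'')"
 have b: "0 < bd x" by (rule bd_pos[OF x])
 have L: "0 <= L" using b bump_lip(1)[where 'n='n] by (simp add: L_def infnorm_pos_le)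
 note W = ker_mass[OF n(1)] ker_mass[OF n(2)] and kl = ker_lipschitz[OF n]
 have "\<bar>integral\<^sup>L lborel (\<lambda>z. ker x' z - ker x'' z)\<bar> <= L * bd x ^ ?n"
  by (rule integral_B(2)) (use kl L in \<open>auto simp: L_def\<close>)
 then have dW: "\<bar>?W x' - ?W x''\<bar> <= L * bd x ^ ?n" using W by simp
 have "\<bar>integral\<^sup>L lborel (\<lambda>z. (g z - c) * (ker x' z - ker x'' z))\<bar> <= K * L * bd x ^ ?n"
 proof (rule integral_B(2))
  show "\<bar>(g z - c) * (ker x' z - ker x'' z)\<bar> <= K * L * indicator B z" for z
  proof (cases "z \<in> B")
   case True
   then have "\<bar>ker x' z - ker x'' z\<bar> <= L" using kl[of z] by (simp add: L_def)
   moreover have "\<bar>g z - c\<bar> <= K" using True by (intro osc) simp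
   ultimately have "\<bar>g z - c\<bar> * \<bar>ker x' z - ker x'' z\<bar> <= K * L" using K_nonneg by (intro mult_mono) auto
   then show ?thesis using True by (simp add: abs_mult)
  next
   case False
   then show ?thesis using kl[of z] by simp
  qed
 qed (use K_nonneg L in auto)
 moreover have "integral\<^sup>L lborel (\<lambda>z. (g z - c) * (ker x' z - ker x'' z)) = dev x' - dev x''"
  using dev_props(1)[OF n(1)] dev_props(1)[OF n(2)] by (simp add: dev_def right_diff_distrib)
 ultimately have dA: "\<bar>dev x' - dev x''\<bar> <= K * L * bd x ^ ?n" by simp
 have "mollify g x' - mollify g x'' = (dev x' - dev x'') / ?W x' + (dev x'' / ?W x'') * ((?W x'' - ?W x') / ?W x')"
  using W(2,5) by (simp add: dev_props(3)[OF n(1)] dev_props(3)[OF n(2)] field_simps)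
 then have "\<bar>mollify g x' - mollify g x''\<bar> <= \<bar>(dev x' - dev x'') / ?W x'\<bar> + \<bar>(dev x'' / ?W x'') * ((?W x'' - ?W x') / ?W x')\<bar>"
  by (simp only: abs_triangle_ineq)
 also have "... = \<bar>dev x' - dev x''\<bar> / ?W x' + \<bar>dev x''\<bar> / ?W x'' * (\<bar>?W x'' - ?W x'\<bar> / ?W x')"
  using W(2,5) by (simp add: abs_mult abs_divide)
 also have "... <= K * L * bd x ^ ?n / ?W x' + K * (L * bd x ^ ?n / ?W x')"
 proof (intro add_mono mult_mono divide_right_mono dA)
  show "\<bar>dev x''\<bar> / ?W x'' <= K" using dev_props(2)[OF n(2)] W(5) by (simp add: divide_le_eq)
  show "\<bar>?W x'' - ?W x'\<bar> <= L * bd x ^ ?n" using dW by (simp add: abs_minus_commute)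
 qed (use W(2) K_nonneg in auto)
 also have "... = 2 * K * L * bd x ^ ?n / ?W x'" by simp
 also have "... <= 2 * K * L * bd x ^ ?n / (bump_min TYPE('n) * (bd x / 32) ^ ?n)"
  using W(1,2) b bump_min_pos[where 'n='n] K_nonneg L by (intro divide_left_mono) auto
 also have "... = mollify_const TYPE('n) * K / bd x * infnorm (x' - x'')"
  using b by (simp add: mollify_const_def L_def power_divide field_simps)
 finally show ?thesis .
qed

lemma mollify_difference_quotient:
 "convergent (\<lambda>k. real (Suc k) * (mollify g (x + (1 / real (Suc k)) *\<^sub>R axis i 1) - mollify g x))"
proof -
 let ?W = "\<lambda>y. integral\<^sup>L lborel (ker y)" and ?e = "axis i (1::real) :: real^'n"
 have b: "0 < bd x" by (rule bd_pos[OF x])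
 have x0: "x \<in> near" using b by (simp add: infnorm_0)
 obtain k0 :: nat where k0: "1 / real (Suc k0) < bd x / 8" using b nat_approx_posE[of "bd x / 8"] by auto
 define s where "s k = real (Suc (k + k0))" for k
 define y where "y k = x + (1 / s k) *\<^sub>R ?e" for k
 have s: "0 < s k" for k by (simp add: s_def)
 have inf_y: "infnorm (y k - x) = 1 / s k" for k using s[of k] by (simp add: y_def infnorm_mul norm_axis_1)
 have yn: "y k \<in> near" for k
 proof -
  have "1 / s k <= 1 / real (Suc k0)" by (simp add: s_def frac_le)
  then show ?thesis using k0 inf_y[of k] by simp
 qed
 have sinv: "(\<lambda>k. 1 / s k) \<longlonglongrightarrow> 0"
  using LIMSEQ_ignore_initial_segment[OF LIMSEQ_Suc[OF lim_const_over_n[of 1]], of k0] by (simp add: s_def)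
 have "\<exists>d. (\<lambda>k. s k * (ker (y k) z - ker x z)) \<longlonglongrightarrow> d" for z
 proof -
  define v where "v = (8 / bd z) *\<^sub>R ?e"
  obtain d where d: "((\<lambda>t. unit_bump ((8 / bd z) *\<^sub>R (x - z) + t *\<^sub>R v)) has_real_derivative d) (at 0)"
   using smooth_line_derivative[OF unit_bump_smooth] by blast
  have "((\<lambda>h. (unit_bump ((8 / bd z) *\<^sub>R (x - z) + h *\<^sub>R v) - unit_bump ((8 / bd z) *\<^sub>R (x - z))) / h) \<longlongrightarrow> d) (at 0)"
   using d by (simp add: DERIV_def)
  moreover have "filterlim (\<lambda>k. 1 / s k) (at 0) sequentially"
   using sinv s by (auto simp: filterlim_at less_imp_neq[symmetric] intro!: always_eventually)
  ultimately have "(\<lambda>k. (unit_bump ((8 / bd z) *\<^sub>R (x - z) + (1 / s k) *\<^sub>R v) - unit_bump ((8 / bd z) *\<^sub>R (x - z))) / (1 / s k)) \<longlonglongrightarrow> d"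
   by (rule filterlim_compose)
  moreover have "(8 / bd z) *\<^sub>R (x - z) + (1 / s k) *\<^sub>R v = (8 / bd z) *\<^sub>R (y k - z)" for k
   by (simp add: v_def y_def algebra_simps)
  ultimately have "(\<lambda>k. s k * (unit_bump ((8 / bd z) *\<^sub>R (y k - z)) - unit_bump ((8 / bd z) *\<^sub>R (x - z)))) \<longlonglongrightarrow> d"
   by (simp add: mult.commute)
  from tendsto_mult[OF tendsto_const[of "indicator \<Omega> z"] this] show ?thesis
   by (auto simp: ker_def algebra_simps)
 qed
 then obtain D where D: "\<And>z. (\<lambda>k. s k * (ker (y k) z - ker x z)) \<longlonglongrightarrow> D z" by metis
 have Dm [measurable]: "D \<in> borel_measurable borel"
  by (rule borel_measurable_LIMSEQ_real[OF D]) measurable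
 have kb: "\<bar>s k * (ker (y k) z - ker x z)\<bar> <= (16 * bump_lip TYPE('n) / bd x) * indicator B z" for k z
  using mult_left_mono[OF ker_lipschitz[OF yn[of k] x0, of z], of "s k"] s[of k] by (simp add: abs_mult inf_y)
 have lim: "(\<lambda>k. s k * (integral\<^sup>L lborel (\<lambda>z. h z * ker (y k) z) - integral\<^sup>L lborel (\<lambda>z. h z * ker x z))) \<longlonglongrightarrow> integral\<^sup>L lborel (\<lambda>z. h z * D z)"
  if h [measurable]: "h \<in> borel_measurable borel" and hb: "\<And>z. z \<in> B ==> \<bar>h z\<bar> <= C" and C: "0 <= C"
   and hi: "\<And>x'. x' \<in> near ==> integrable lborel (\<lambda>z. h z * ker x' z)" for h C
 proof -
  let ?c = "C * (16 * bump_lip TYPE('n) / bd x)"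
  have c0: "0 <= ?c" using C b bump_lip(1)[where 'n='n] by simp
  have "(\<lambda>k. integral\<^sup>L lborel (\<lambda>z. h z * (s k * (ker (y k) z - ker x z)))) \<longlonglongrightarrow> integral\<^sup>L lborel (\<lambda>z. h z * D z)"
  proof (rule integral_dominated_convergence[where w="\<lambda>z. ?c * indicator B z"])
   show "integrable lborel (\<lambda>z. ?c * indicator B z :: real)" proof (rule integral_B(3)[OF _ _ c0, of "\<lambda>_. 0"])
    show "\<bar>0::real\<bar> <= ?c * indicator B z" for z using mult_nonneg_nonneg[OF c0, of "indicator B z"] by simp
   qed simp
   show "AE z in lborel. (\<lambda>k. h z * (s k * (ker (y k) z - ker x z))) \<longlonglongrightarrow> h z * D z"
    by (intro AE_I2 tendsto_mult tendsto_const D)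
   show "AE z in lborel. norm (h z * (s k * (ker (y k) z - ker x z))) <= ?c * indicator B z" for k
   proof (rule AE_I2)
    fix z
    show "norm (h z * (s k * (ker (y k) z - ker x z))) <= ?c * indicator B z"
    proof (cases "z \<in> B")
     case True
     have "\<bar>h z\<bar> * \<bar>s k * (ker (y k) z - ker x z)\<bar> <= C * (16 * bump_lip TYPE('n) / bd x)"
      using kb[of k z] True hb[OF True] C by (intro mult_mono) auto
     then show ?thesis using True by (simp add: abs_mult)
    next
     case False
     then have "s k * (ker (y k) z - ker x z) = 0" using kb[of k z] by simp
     then show ?thesis using False by simp
    qed
   qed
  qed measurable
  moreover have "integral\<^sup>L lborel (\<lambda>z. h z * (s k * (ker (y k) z - ker x z)))
    = s k * (integral\<^sup>L lborel (\<lambda>z. h z * ker (y k) z) - integral\<^sup>L lborel (\<lambda>z. h z * ker x z))" for k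
  proof -
   have "(\<lambda>z. h z * (s k * (ker (y k) z - ker x z))) = (\<lambda>z. s k * (h z * ker (y k) z - h z * ker x z))"
    by (simp add: fun_eq_iff algebra_simps)
   then show ?thesis using hi[OF yn[of k]] hi[OF x0] by simp
  qed
  ultimately show ?thesis by simp
 qed
 have limA: "(\<lambda>k. s k * (dev (y k) - dev x)) \<longlonglongrightarrow> integral\<^sup>L lborel (\<lambda>z. (g z - c) * D z)"
  unfolding dev_def by (rule lim[where C=K]) (use osc K_nonneg dev_props(1) in auto)
 have limW: "(\<lambda>k. s k * (?W (y k) - ?W x)) \<longlonglongrightarrow> integral\<^sup>L lborel (\<lambda>z. 1 * D z)"
  using lim[of "\<lambda>_. 1" 1] ker_mass(3) by simp
 have "(\<lambda>k. (1 / s k) * (s k * (?W (y k) - ?W x)) + ?W x) \<longlonglongrightarrow> 0 * integral\<^sup>L lborel (\<lambda>z. 1 * D z) + ?W x"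
  by (intro tendsto_intros sinv limW)
 then have W: "(\<lambda>k. ?W (y k)) \<longlonglongrightarrow> ?W x" using s by (simp add: less_imp_neq[symmetric])
 have W0: "?W x \<noteq> 0" "?W (y k) \<noteq> 0" for k using ker_mass(2)[OF x0] ker_mass(2)[OF yn[of k]] by auto
 have "(\<lambda>k. (s k * (dev (y k) - dev x) * ?W x - dev x * (s k * (?W (y k) - ?W x))) / (?W (y k) * ?W x))
   \<longlonglongrightarrow> (integral\<^sup>L lborel (\<lambda>z. (g z - c) * D z) * ?W x - dev x * integral\<^sup>L lborel (\<lambda>z. 1 * D z)) / (?W x * ?W x)"
  by (intro tendsto_intros limA limW W) (use W0 in auto)
 moreover have "(s k * (dev (y k) - dev x) * ?W x - dev x * (s k * (?W (y k) - ?W x))) / (?W (y k) * ?W x)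
   = s k * (mollify g (y k) - mollify g x)" for k
  using W0 by (simp add: dev_props(3)[OF yn] dev_props(3)[OF x0] field_simps)
 ultimately have "convergent (\<lambda>k. s k * (mollify g (y k) - mollify g x))" unfolding convergent_def by auto
 then show ?thesis
  using convergent_ignore_initial_segment[of "\<lambda>k. real (Suc k) * (mollify g (x + (1 / real (Suc k)) *\<^sub>R axis i 1) - mollify g x)" k0]
  by (simp add: s_def y_def)
qed

end
end

definition mollify_grad :: "(real^'n => real) => real^'n => real^'n" where
 "mollify_grad g x = (\<chi> i. lim (\<lambda>k. real (Suc k) * (mollify g (x + (1 / real (Suc k)) *\<^sub>R axis i 1) - mollify g x)))"

lemma mollify_grad_bound:
 assumes x: "x \<in> \<Omega>" and g: "g \<in> borel_measurable borel" and osc: "\<And>z. infnorm (z - x) <= bd x / 2 ==> \<bar>g z - c\<bar> <= K"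
 shows "infnorm (mollify_grad g x) <= mollify_const TYPE('n) * K / bd x"
 unfolding infnorm_le_cart
proof
 fix i
 let ?q = "\<lambda>k. real (Suc k) * (mollify g (x + (1 / real (Suc k)) *\<^sub>R axis i 1) - mollify g x)"
 have b: "0 < bd x" by (rule bd_pos[OF x])
 have "?q \<longlonglongrightarrow> mollify_grad g x $ i"
  using convergent_LIMSEQ_iff[THEN iffD1, OF mollify_difference_quotient[OF x g osc]] by (simp add: mollify_grad_def)
 moreover have "\<forall>\<^sub>F k in sequentially. 1 / real (Suc k) < bd x / 8"
  using order_tendstoD(2)[OF LIMSEQ_Suc[OF lim_const_over_n[of 1]], of "bd x / 8"] b by simp
 then have "\<forall>\<^sub>F k in sequentially. norm (?q k) <= mollify_const TYPE('n) * K / bd x"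
 proof eventually_elim
  case (elim k)
  have "\<bar>mollify g (x + (1 / real (Suc k)) *\<^sub>R axis i 1) - mollify g x\<bar> <= mollify_const TYPE('n) * K / bd x * (1 / real (Suc k))"
   using mollify_lipschitz[OF x g osc, of "x + (1 / real (Suc k)) *\<^sub>R axis i 1" x] elim b by (simp add: infnorm_mul norm_axis_1 infnorm_0)
  from mult_left_mono[OF this, of "real (Suc k)"] show ?case by (simp add: abs_mult del: of_nat_Suc)
 qed
 ultimately have "norm (mollify_grad g x $ i) <= mollify_const TYPE('n) * K / bd x"
  by (intro Lim_norm_ubound[OF sequentially_bot])
 then show "\<bar>mollify_grad g x $ i\<bar> <= mollify_const TYPE('n) * K / bd x" by simp
qed

lemma mollify_weak_gradient:
 assumes g: "g \<in> borel_measurable borel"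
  and osc: "\<And>x. x \<in> \<Omega> ==> \<exists>c K. \<forall>z. infnorm (z - x) <= bd x / 2 \<longrightarrow> \<bar>g z - c\<bar> <= K"
 shows "continuous_on \<Omega> (mollify g)" "weak_gradient \<Omega> (mollify g) (mollify_grad g)"
proof -
 have loc: "\<exists>\<delta>>0. \<exists>L. ball x \<delta> \<subseteq> \<Omega> \<and> (\<forall>y\<in>ball x \<delta>. \<forall>y'\<in>ball x \<delta>. \<bar>mollify g y - mollify g y'\<bar> <= L * norm (y - y'))"
  if x: "x \<in> \<Omega>" for x
 proof -
  obtain c K where cK: "\<And>z. infnorm (z - x) <= bd x / 2 ==> \<bar>g z - c\<bar> <= K" using osc[OF x] by blast
  have b: "0 < bd x" by (rule bd_pos[OF x])
  define L where "L = mollify_const TYPE('n) * K / bd x"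
  have L: "0 <= L" using K_nonneg[OF x g cK] b mollify_const_pos[where 'n='n] by (simp add: L_def)
  have near: "infnorm (y - x) <= bd x / 8" if "y \<in> ball x (bd x / 8)" for y
   using that infnorm_le_norm[of "y - x"] by (simp add: dist_norm norm_minus_commute)
  have "\<bar>mollify g y - mollify g y'\<bar> <= L * norm (y - y')" if "y \<in> ball x (bd x / 8)" "y' \<in> ball x (bd x / 8)" for y y'
  proof -
   have "\<bar>mollify g y - mollify g y'\<bar> <= L * infnorm (y - y')"
    unfolding L_def by (rule mollify_lipschitz[OF x g cK]) (use near that in auto)
   also have "... <= L * norm (y - y')" using L infnorm_le_norm by (intro mult_left_mono) auto
   finally show ?thesis .
  qed
  moreover have "ball x (bd x / 8) \<subseteq> \<Omega>" using near ball_bd_subset[OF x] b by force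
  ultimately have "0 < bd x / 8 \<and> (\<exists>L. ball x (bd x / 8) \<subseteq> \<Omega> \<and> (\<forall>y\<in>ball x (bd x / 8). \<forall>y'\<in>ball x (bd x / 8). \<bar>mollify g y - mollify g y'\<bar> <= L * norm (y - y')))"
   using b by (intro conjI exI[of _ L] ballI) simp_all
  then show ?thesis by (rule exI)
 qed
 have lim: "(\<lambda>k. real (Suc k) * (mollify g (x + (1 / real (Suc k)) *\<^sub>R axis i 1) - mollify g x)) \<longlonglongrightarrow> mollify_grad g x $ i"
  if x: "x \<in> \<Omega>" for x i
 proof -
  obtain c K where cK: "\<And>z. infnorm (z - x) <= bd x / 2 ==> \<bar>g z - c\<bar> <= K" using osc[OF x] by blast
  from convergent_LIMSEQ_iff[THEN iffD1, OF mollify_difference_quotient[OF x g cK, of i]]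
  show ?thesis by (simp add: mollify_grad_def)
 qed
 show "continuous_on \<Omega> (mollify g)" "weak_gradient \<Omega> (mollify g) (mollify_grad g)"
  using weak_gradient_of_difference_quotients[OF op loc lim] by blast+
qed

end

section \<open>Sufficiency: extending a boundary function\<close>

context trace_setting
begin

definition near_const :: real where
 "near_const = (1 + (1 + 1 / (1 - (1/2) powr \<beta>)) * 2 powr \<beta>) powr (1 / \<beta>)"

lemma near_const: "0 < near_const" "near_const powr \<beta> = 1 + (1 + 1 / (1 - (1/2) powr \<beta>)) * 2 powr \<beta>" "0 < 1 - (1/2::real) powr \<beta>"
proof -
 show g: "0 < 1 - (1/2::real) powr \<beta>" using exponents(3) powr_less_mono2[of \<beta> "1/2" 1] by simp
 have "0 < 1 + (1 + 1 / (1 - (1/2) powr \<beta>)) * 2 powr \<beta>" using g by (intro add_pos_nonneg) auto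
 then show "0 < near_const" "near_const powr \<beta> = 1 + (1 + 1 / (1 - (1/2) powr \<beta>)) * 2 powr \<beta>"
  using exponents(3) by (auto simp: near_const_def powr_powr)
qed

text \<open>A measurable choice of boundary points near the points of \<open>\<Omega>\<close>: the choice is constant on the cells of a countable
 partition, each cell lying in a small cube around a point of a countable dense set.\<close>
lemma near_point_selection:
 obtains near where "\<And>z. z \<in> \<Omega> ==> near z \<in> bdry \<beta>"
  and "\<And>x z. x \<in> \<Omega> ==> infnorm (z - x) <= bd x / 2 ==> d_to \<beta> x (near z) <= (near_const * bd x) powr \<beta>"
  and "\<And>h :: 'n cpoint => real. (\<lambda>z. indicator \<Omega> z * h (near z)) \<in> borel_measurable borel"
proof -
 let ?g = "1 - (1/2::real) powr \<beta>"
 obtain D :: "(real^'n) set" where D: "countable D" "\<And>X. open X ==> X \<noteq> {} ==> \<exists>d\<in>D. d \<in> X"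
  using countable_dense_exists by blast
 have Dne: "D \<noteq> {}" using D(2)[OF open_UNIV] by auto
 define c where "c = from_nat_into D"
 obtain \<psi> where \<psi>: "\<And>x. x \<in> \<Omega> ==> \<psi> x \<in> bdry \<beta> \<and> d_to \<beta> x (\<psi> x) <= bd x powr \<beta> / ?g"
  using near_boundary_point by metis
 \<comment> \<open>The cell of \<open>z\<close> is the first admissible index, which makes the choice measurable.\<close>
 define P where "P k z \<longleftrightarrow> c k \<in> \<Omega> \<and> infnorm (z - c k) < bd (c k) / 4" for k z
 define idx where "idx z = (LEAST k. P k z)" for z
 define near where "near z = \<psi> (c (idx z))" for z
 have P: "P (idx z) z" if z: "z \<in> \<Omega>" for z
 proof -
  have "\<exists>d\<in>D. d \<in> ball z (bd z / 8)" using bd_pos[OF z] by (intro D(2)) auto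
  then obtain d where d: "d \<in> D" "d \<in> ball z (bd z / 8)" by blast
  obtain k where k: "c k = d" using from_nat_into_surj[OF D(1) d(1)] by (auto simp: c_def)
  have n: "infnorm (d - z) < bd z / 8" using d(2) infnorm_le_norm[of "d - z"] by (simp add: dist_norm norm_minus_commute)
  have "d \<in> \<Omega>" "7/8 * bd z <= bd d" using bd_half[OF z, of d "1/8"] n by auto
  then have "P k z" unfolding P_def k using n bd_pos[OF z] infnorm_sub[of z d] by auto
  then show ?thesis unfolding idx_def by (rule LeastI)
 qed
 have nb: "near z \<in> bdry \<beta>" if "z \<in> \<Omega>" for z using P[OF that] \<psi> by (simp add: near_def P_def)
 have bnd: "d_to \<beta> x (near z) <= (near_const * bd x) powr \<beta>"
  if x: "x \<in> \<Omega>" and zx: "infnorm (z - x) <= bd x / 2" for x z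
 proof -
  let ?c = "c (idx z)"
  have z: "z \<in> \<Omega>" and bz: "bd z <= 3/2 * bd x" using bd_half[OF x, of z "1/2"] zx by auto
  have c: "?c \<in> \<Omega>" and zc: "infnorm (z - ?c) < bd ?c / 4" using P[OF z] by (auto simp: P_def)
  have bc: "bd ?c <= 2 * bd x" using bd_half[OF c, of z "1/4"] zc bz by simp
  note wc = bdry_completed[OF exponents(3,6) nb[OF z]]
  have "d_to \<beta> x (near z) <= dmet \<beta> x z + d_to \<beta> z (near z)"
   by (rule d_bar_embed_le[OF exponents(3,6) x z wc])
  also have "... <= dmet \<beta> x z + (dmet \<beta> z ?c + dbar \<beta> (embed \<beta> \<Omega> ?c) (near z))"
   by (intro add_left_mono d_bar_embed_le[OF exponents(3,6) z c wc])
  also have "... <= bd x powr \<beta> + (bd ?c powr \<beta> + bd ?c powr \<beta> / ?g)"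
  proof (intro add_mono)
   show "dmet \<beta> x z <= bd x powr \<beta>" by (rule d_met_local(2)[OF x zx exponents(3,6)])
   show "dmet \<beta> z ?c <= bd ?c powr \<beta>"
    using d_met_sym_le[OF c z, of \<beta>] d_met_local(2)[OF c _ exponents(3,6), of z] zc bd_pos[OF c] by simp
   show "dbar \<beta> (embed \<beta> \<Omega> ?c) (near z) <= bd ?c powr \<beta> / ?g" using \<psi>[OF c] by (simp add: near_def)
  qed
  also have "... = bd x powr \<beta> + (1 + 1 / ?g) * bd ?c powr \<beta>" by (simp add: algebra_simps)
  also have "... <= bd x powr \<beta> + (1 + 1 / ?g) * (2 * bd x) powr \<beta>"
   using near_const(3) bc exponents(3) bd_pos[OF c] by (intro add_left_mono mult_left_mono powr_mono2) auto
  also have "... = near_const powr \<beta> * bd x powr \<beta>" using bd_pos[OF x] by (simp add: near_const(2) powr_mult algebra_simps)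
  also have "... = (near_const * bd x) powr \<beta>" using bd_pos[OF x] near_const(1) by (simp add: powr_mult)
  finally show ?thesis .
 qed
 have "(\<lambda>z. indicator \<Omega> z * h (near z)) \<in> borel_measurable borel" for h :: "'n cpoint => real"
 proof -
  have [measurable]: "infnorm \<in> borel_measurable (borel :: (real^'n) measure)" by (intro borel_measurable_continuous_onI continuous_intros continuous_on_infnorm)
  have [measurable]: "\<Omega> \<in> sets borel" using op by (rule borel_open)
  have [measurable]: "Measurable.pred borel (P k)" for k unfolding P_def[abs_def] by measurable
  have "idx \<in> measurable borel (count_space UNIV)" unfolding idx_def[abs_def] by measurable
  then have [measurable]: "(\<lambda>z. h (near z)) \<in> borel_measurable borel"
   unfolding near_def by (rule measurable_compose) simp
  show ?thesis by measurable
 qed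
 from that[of near, OF nb bnd this] show thesis by blast
qed

text \<open>Nearness in the metric with exponent \<open>\<beta>\<close> is nearness with exponent \<open>\<alpha>\<close>, as a short curve that starts
 close to the boundary cannot go far from it.\<close>
lemma d_bar_change_exponent:
 assumes x: "x \<in> \<Omega>" and w: "\<omega> \<in> bdry \<beta>" and A: "1 <= A"
  and d: "d_to \<beta> x \<omega> <= (A * bd x) powr \<beta>"
 shows "d_to \<alpha> x (change_exponent \<alpha> \<Omega> \<omega>) <= (2 powr (1/\<beta>) * (2 * A) * bd x) powr \<alpha>"
proof -
 note e\<alpha> = exponents(7,5) and e\<beta> = exponents(3,6)
 let ?C = "2 powr (1/\<beta>) * (2 * A)"
 note wc = bdry_completed[OF e\<beta> w]
 have b: "0 < bd x" by (rule bd_pos[OF x])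
 have two: "1 <= (2::real) powr (1/\<beta>)" using e\<beta> by (simp add: ge_one_powr_ge_zero)
 have C: "2 * A <= ?C" using mult_right_mono[OF two, of "2 * A"] A by simp
 obtain y where y: "y \<in> \<omega>" using completed_nonempty[OF e\<beta> wc] by blast
 have yO: "y i \<in> \<Omega>" for i using rho_CauchyD[OF completed_Cauchy[OF e\<beta> wc y]] .
 have "d_to \<beta> x \<omega> < (2 * A * bd x) powr \<beta>"
  using d powr_less_mono2[of \<beta> "A * bd x" "2 * A * bd x"] A b e\<beta> by simp
 with d_bar_embed_tendsto[OF e\<beta> x wc y] have "\<forall>\<^sub>F i in sequentially. dmet \<beta> x (y i) < (2 * A * bd x) powr \<beta>"
  by (rule order_tendstoD(2))
 then have "\<forall>\<^sub>F i in sequentially. dmet \<alpha> x (y i) <= (?C * bd x) powr \<alpha>"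
 proof eventually_elim
  case (elim i)
  have "dmet \<alpha> x (y i) <= max (2 * bd x) (2 powr (1/\<beta>) * (2 * A * bd x)) powr (\<alpha> - \<beta>) * (2 * A * bd x) powr \<beta>"
   by (rule d_met_exponent[OF x yO e\<beta> exponents(4) _ elim]) (use A b in auto)
  also have "... <= (?C * bd x) powr (\<alpha> - \<beta>) * (?C * bd x) powr \<beta>"
  proof (rule mult_mono)
   have "2 <= ?C" using C A by linarith
   from mult_right_mono[OF this, of "bd x"]
   have m: "max (2 * bd x) (2 powr (1/\<beta>) * (2 * A * bd x)) <= ?C * bd x" using b by (simp add: mult.assoc)
   have m0: "0 <= max (2 * bd x) (2 powr (1/\<beta>) * (2 * A * bd x))" unfolding le_max_iff_disj using b by simp
   show "max (2 * bd x) (2 powr (1/\<beta>) * (2 * A * bd x)) powr (\<alpha> - \<beta>) <= (?C * bd x) powr (\<alpha> - \<beta>)"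
    by (rule powr_mono2[OF _ m0 m]) (use exponents(4) in simp)
   have "2 * A * bd x <= ?C * bd x" using C b by (intro mult_right_mono) auto
   then show "(2 * A * bd x) powr \<beta> <= (?C * bd x) powr \<beta>" using A b e\<beta> by (intro powr_mono2) auto
  qed auto
  also have "... = (?C * bd x) powr \<alpha>" by (simp add: powr_add[symmetric])
  finally show ?case .
 qed
 with d_bar_embed_tendsto[OF e\<alpha> x bdry_completed[OF e\<alpha> change_exponent_bdry[OF fs w]] change_exponent_eq(2)[OF fs wc y]]
 show ?thesis by (rule tendsto_upperbound) simp
qed

text \<open>Let \<open>g x\<close> be the value of \<open>f\<close> at a boundary point near \<open>x\<close>, multiplied by the cutoff \<open>\<kappa>\<close> that vanishes where
 \<open>lam * bd x >= 1\<close>.  Without the cutoff, all values of \<open>g\<close> in the cube of radius \<open>bd x / 2\<close> around \<open>x\<close> are values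
 of \<open>f\<close> at points of one ball of radius comparable to \<open>bd x\<close>, so the oscillation of \<open>g\<close> there is at most a multiple of
 \<open>bd x\<close> times \<^const>\<open>fsharp\<close>.  Averaging turns this into a bound of the gradient.  The trace is \<open>f\<close> since near
 points of a sequence converging to \<open>\<omega>\<close> converge to \<open>\<omega>\<close> and \<open>f\<close> is continuous.\<close>
lemma extension:
 assumes f: "d_continuous \<alpha> \<Omega> f" and lam: "0 <= lam"
  and fin: "\<And>x. x \<in> \<Omega> ==> lam * bd x < 2 ==> sharp f x < \<infinity>"
 obtains F G \<nu> where "continuous_on \<Omega> F" "weak_gradient \<Omega> F G" "is_trace \<alpha> \<Omega> F f"
  "\<And>x. x \<in> \<Omega> ==> \<nu> x \<in> bdry \<beta>"
  "\<And>x. x \<in> \<Omega> ==> d_to \<beta> x (\<nu> x) <= (near_const * bd x) powr \<beta>"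
  "\<And>x. x \<in> \<Omega> ==> lam * bd x < 2 ==>
   \<bar>F x\<bar> <= near_const * bd x * enn2real (sharp f x) + 2 * \<bar>fv f (\<nu> x)\<bar>"
  "\<And>x. x \<in> \<Omega> ==> lam * bd x < 2 ==>
   infnorm (G x) <= mollify_const TYPE('n) * (near_const * enn2real (sharp f x) + lam / 2 * \<bar>fv f (\<nu> x)\<bar>)"
  "\<And>x. x \<in> \<Omega> ==> 2 <= lam * bd x ==> F x = 0 \<and> G x = 0"
proof -
 note e\<alpha> = exponents(7,5) and e\<beta> = exponents(3,6)
 obtain \<nu> where nb: "\<And>z. z \<in> \<Omega> ==> \<nu> z \<in> bdry \<beta>"
  and nd: "\<And>x z. x \<in> \<Omega> ==> infnorm (z - x) <= bd x / 2 ==> d_to \<beta> x (\<nu> z) <= (near_const * bd x) powr \<beta>"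
  and nm: "\<And>h :: 'n cpoint => real. (\<lambda>z. indicator \<Omega> z * h (\<nu> z)) \<in> borel_measurable borel"
  by (rule near_point_selection) blast
 define \<kappa> where "\<kappa> z = max 0 (1 - lam * bd z)" for z
 define g where "g z = \<kappa> z * (indicator \<Omega> z * fv f (\<nu> z))" for z
 let ?\<phi> = "\<lambda>x. enn2real (sharp f x)"
 have [measurable]: "bd \<in> borel_measurable borel" by (rule borel_measurable_continuous_onI[OF continuous_bd])
 have gm: "g \<in> borel_measurable borel" unfolding g_def[abs_def] \<kappa>_def using nm[of "fv f"] by measurable
 \<comment> \<open>A bound of the oscillation of \<open>g\<close> in the cube of radius \<open>bd x / 2\<close>.  If \<open>lam * bd x >= 2\<close>, then \<open>g\<close> vanishes there.\<close>
 define K where "K x = (if lam * bd x < 2 then near_const * bd x * ?\<phi> x + lam * bd x / 2 * \<bar>fv f (\<nu> x)\<bar> else 0)" for x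
 have nc: "1 <= near_const" unfolding near_const_def using near_const(3) e\<beta> by (intro ge_one_powr_ge_zero) auto
 have \<kappa>01: "0 <= \<kappa> z" "z \<in> \<Omega> ==> \<kappa> z <= 1" for z using lam bd_pos[of z] by (auto simp: \<kappa>_def)
 have center: "infnorm (x - x) <= bd x / 2" if "x \<in> \<Omega>" for x using bd_pos[OF that] by (simp add: infnorm_0)
 have osc: "\<bar>g z - g x\<bar> <= K x" if x: "x \<in> \<Omega>" and zx: "infnorm (z - x) <= bd x / 2" for x z
 proof -
  have b: "0 < bd x" by (rule bd_pos[OF x])
  have z: "z \<in> \<Omega>" and bz: "1/2 * bd x <= bd z" using bd_half[OF x, of z "1/2"] zx by auto
  have gz: "g z = \<kappa> z * fv f (\<nu> z)" "g x = \<kappa> x * fv f (\<nu> x)" using x z by (auto simp: g_def)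
  show ?thesis
  proof (cases "lam * bd x < 2")
   case True
   have 1: "\<bar>fv f (\<nu> z) - fv f (\<nu> x)\<bar> <= near_const * bd x * ?\<phi> x"
    unfolding fv_def using near_const(1) b by (intro fsharp_diff_le[OF fs x _ nb[OF z] nb[OF x] nd[OF x zx] nd[OF x center[OF x]] fin[OF x True]]) simp
   have bb: "\<bar>bd z - bd x\<bar> <= bd x / 2" using bd_lipschitz[of z x] bd_lipschitz[of x z] infnorm_sub[of x z] zx by linarith
   have "\<bar>\<kappa> z - \<kappa> x\<bar> <= \<bar>lam * bd z - lam * bd x\<bar>" unfolding \<kappa>_def by linarith
   also have "... = lam * \<bar>bd z - bd x\<bar>" using lam by (simp add: right_diff_distrib[symmetric] abs_mult)
   also have "... <= lam * (bd x / 2)" using bb lam by (rule mult_left_mono)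
   finally have 2: "\<bar>\<kappa> z - \<kappa> x\<bar> <= lam * bd x / 2" by simp
   have "g z - g x = \<kappa> z * (fv f (\<nu> z) - fv f (\<nu> x)) + (\<kappa> z - \<kappa> x) * fv f (\<nu> x)" by (simp add: gz algebra_simps)
   then have "\<bar>g z - g x\<bar> <= \<kappa> z * \<bar>fv f (\<nu> z) - fv f (\<nu> x)\<bar> + \<bar>\<kappa> z - \<kappa> x\<bar> * \<bar>fv f (\<nu> x)\<bar>"
    using abs_triangle_ineq[of "\<kappa> z * (fv f (\<nu> z) - fv f (\<nu> x))" "(\<kappa> z - \<kappa> x) * fv f (\<nu> x)"] \<kappa>01(1)[of z] by (simp add: abs_mult)
   also have "... <= 1 * (near_const * bd x * ?\<phi> x) + lam * bd x / 2 * \<bar>fv f (\<nu> x)\<bar>"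
    using 1 2 \<kappa>01[of z] z lam b by (intro add_mono mult_mono) auto
   finally show ?thesis using True by (simp add: K_def)
  next
   case False
   have "2 <= lam * (2 * bd z)" using mult_left_mono[OF _ lam, of "bd x" "2 * bd z"] bz False by linarith
   then show ?thesis using False by (simp add: gz K_def \<kappa>_def)
  qed
 qed
 define F where "F = mollify g"
 define G where "G = mollify_grad g"
 have wg: "continuous_on \<Omega> F" "weak_gradient \<Omega> F G" unfolding F_def G_def using mollify_weak_gradient[OF gm] osc by blast+
 have close: "\<bar>F x - g x\<bar> <= K x" and gr: "infnorm (G x) <= mollify_const TYPE('n) * K x / bd x" if x: "x \<in> \<Omega>" for x
  using mollify_close[OF x gm osc[OF x]] mollify_grad_bound[OF x gm osc[OF x]] by (auto simp: F_def G_def)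
 have trace: "is_trace \<alpha> \<Omega> F f" unfolding is_trace_def
 proof (intro ballI LIMSEQ_I)
  fix \<omega> y e assume w: "\<omega> \<in> bdry \<alpha>" and y: "y \<in> \<omega>" and e: "0 < (e::real)"
  note wc = bdry_completed[OF e\<alpha> w]
  have yC: "rho_Cauchy \<alpha> \<Omega> y" by (rule completed_Cauchy[OF e\<alpha> wc y])
  have yO: "y i \<in> \<Omega>" for i using rho_CauchyD[OF yC] .
  obtain \<delta> where \<delta>: "0 < \<delta>" "\<And>\<omega>'. \<omega>' \<in> bdry \<alpha> ==> dbar \<alpha> \<omega> \<omega>' < \<delta> ==> \<bar>f \<omega>' - f \<omega>\<bar> < e / 4"
   using f w e unfolding d_continuous_def by (metis divide_pos_pos zero_less_numeral)
  let ?C = "2 powr (1/\<beta>) * (2 * near_const)"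
  have bd0: "(\<lambda>i. bd (y i)) \<longlonglongrightarrow> 0" by (rule bdry_bd_tendsto_0[OF e\<alpha> w y])
  have "(\<lambda>i. (?C * bd (y i)) powr \<alpha>) \<longlonglongrightarrow> 0"
   by (rule tendsto_zero_powrI[OF tendsto_mult_right_zero[OF bd0] tendsto_const]) (use e\<alpha> bd_nonneg near_const(1) in auto)
  then have E1: "\<forall>\<^sub>F i in sequentially. (?C * bd (y i)) powr \<alpha> < \<delta> / 2" using \<delta>(1) by (intro order_tendstoD(2)[of _ 0]) auto
  have "(\<lambda>i. lam * (3/2 * bd (y i)) * \<bar>f \<omega>\<bar>) \<longlonglongrightarrow> 0"
   by (intro tendsto_mult_left_zero tendsto_mult_right_zero bd0)
  then have E2: "\<forall>\<^sub>F i in sequentially. lam * (3/2 * bd (y i)) * \<bar>f \<omega>\<bar> < e / 2" using e by (intro order_tendstoD(2)[of _ 0]) auto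
  have E3: "\<forall>\<^sub>F i in sequentially. dbar \<alpha> \<omega> (embed \<alpha> \<Omega> (y i)) <= \<delta> / 4"
  proof -
   have "0 < \<delta> / 4" using \<delta>(1) by simp
   from yC[unfolded rho_Cauchy_def, THEN conjunct2, THEN spec, THEN mp, OF this] obtain N where N: "\<And>i j. N <= i ==> N <= j ==> rho_met \<alpha> \<Omega> (y i) (y j) < \<delta> / 4"
    by blast
   have "dbar \<alpha> \<omega> (embed \<alpha> \<Omega> (y i)) <= \<delta> / 4" if i: "N <= i" for i
   proof (rule tendsto_upperbound[OF d_bar_tendsto[OF e\<alpha> wc embed_completed(1)[OF e\<alpha> yO] y embed_completed(2)[OF e\<alpha> yO]]])
    show "\<forall>\<^sub>F j in sequentially. dmet \<alpha> (y j) (y i) <= \<delta> / 4"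
     using eventually_ge_at_top[of N]
    proof eventually_elim
     case (elim j)
     then show ?case using N[of j i] i powr_ge_zero[of "infnorm (y j - y i)" \<alpha>] unfolding rho_met_def by linarith
    qed
   qed simp
   then show ?thesis unfolding eventually_sequentially by blast
  qed
  have "\<forall>\<^sub>F i in sequentially. norm (F (y i) - f \<omega>) < e"
   using E1 E2 E3
  proof eventually_elim
   case (elim i)
   let ?x = "y i"
   have "\<bar>g z - f \<omega>\<bar> <= e / 4 + lam * (3/2 * bd ?x) * \<bar>f \<omega>\<bar>" if zx: "infnorm (z - ?x) <= bd ?x / 2" for z
   proof -
    have z: "z \<in> \<Omega>" and bz: "bd z <= 3/2 * bd ?x" using bd_half[OF yO[of i], of z "1/2"] zx by auto
    let ?w = "change_exponent \<alpha> \<Omega> (\<nu> z)"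
    have wb: "?w \<in> bdry \<alpha>" by (rule change_exponent_bdry[OF fs nb[OF z]])
    have "dbar \<alpha> \<omega> ?w <= dbar \<alpha> \<omega> (embed \<alpha> \<Omega> ?x) + dbar \<alpha> (embed \<alpha> \<Omega> ?x) ?w"
     by (rule d_bar_triangle[OF e\<alpha> wc embed_completed(1)[OF e\<alpha> yO] bdry_completed[OF e\<alpha> wb]])
    also have "... < \<delta>" using elim(1,3) d_bar_change_exponent[OF yO nb[OF z] nc nd[OF yO zx]] \<delta>(1) by linarith
    finally have 1: "\<bar>fv f (\<nu> z) - f \<omega>\<bar> < e / 4" unfolding fv_def by (rule \<delta>(2)[OF wb])
    have "\<bar>\<kappa> z - 1\<bar> <= lam * bd z" using mult_nonneg_nonneg[OF lam less_imp_le[OF bd_pos[OF z]]] unfolding \<kappa>_def by linarith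
    also have "... <= lam * (3/2 * bd ?x)" using bz lam by (rule mult_left_mono)
    finally have 2: "\<bar>\<kappa> z - 1\<bar> <= lam * (3/2 * bd ?x)" .
    have "g z - f \<omega> = \<kappa> z * (fv f (\<nu> z) - f \<omega>) + (\<kappa> z - 1) * f \<omega>" using z by (simp add: g_def algebra_simps)
    then have "\<bar>g z - f \<omega>\<bar> <= \<kappa> z * \<bar>fv f (\<nu> z) - f \<omega>\<bar> + \<bar>\<kappa> z - 1\<bar> * \<bar>f \<omega>\<bar>"
     using abs_triangle_ineq[of "\<kappa> z * (fv f (\<nu> z) - f \<omega>)" "(\<kappa> z - 1) * f \<omega>"] \<kappa>01(1)[of z] by (simp add: abs_mult)
    also have "... <= 1 * (e / 4) + lam * (3/2 * bd ?x) * \<bar>f \<omega>\<bar>"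
     using 1 2 \<kappa>01[of z] z lam bd_nonneg[of ?x] by (intro add_mono mult_mono) auto
    finally show ?thesis by simp
   qed
   from mollify_close[OF yO gm this] have "\<bar>F ?x - f \<omega>\<bar> <= e / 4 + lam * (3/2 * bd ?x) * \<bar>f \<omega>\<bar>" by (simp add: F_def)
   then show ?case using elim(2) e unfolding real_norm_def by linarith
  qed
  then show "\<exists>N. \<forall>i\<ge>N. norm (F (y i) - f \<omega>) < e" unfolding eventually_sequentially .
 qed
 have Fb: "\<bar>F x\<bar> <= near_const * bd x * ?\<phi> x + 2 * \<bar>fv f (\<nu> x)\<bar>" if x: "x \<in> \<Omega>" and l: "lam * bd x < 2" for x
 proof -
  have "\<bar>F x\<bar> <= \<bar>g x\<bar> + K x" using close[OF x] by linarith
  moreover have "\<bar>g x\<bar> = \<kappa> x * \<bar>fv f (\<nu> x)\<bar>" using x \<kappa>01(1)[of x] by (simp add: g_def abs_mult)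
  moreover have "(\<kappa> x + lam * bd x / 2) * \<bar>fv f (\<nu> x)\<bar> <= 2 * \<bar>fv f (\<nu> x)\<bar>"
   using \<kappa>01(2)[OF x] l by (intro mult_right_mono) auto
  ultimately show ?thesis using l by (simp add: K_def distrib_right)
 qed
 have Gb: "infnorm (G x) <= mollify_const TYPE('n) * (near_const * ?\<phi> x + lam / 2 * \<bar>fv f (\<nu> x)\<bar>)" if x: "x \<in> \<Omega>" and l: "lam * bd x < 2" for x
 proof -
  have "K x / bd x = near_const * ?\<phi> x + lam / 2 * \<bar>fv f (\<nu> x)\<bar>" using l bd_pos[OF x] by (simp add: K_def add_divide_distrib)
  then show ?thesis using gr[OF x] unfolding times_divide_eq_right[symmetric] by simp
 qed
 have zero: "F x = 0 \<and> G x = 0" if x: "x \<in> \<Omega>" and l: "2 <= lam * bd x" for x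
 proof -
  have "K x = 0" "g x = 0" using l by (auto simp: K_def g_def \<kappa>_def)
  then show ?thesis using close[OF x] gr[OF x] infnorm_pos_le[of "G x"] infnorm_eq_0[of "G x"] by simp
 qed
 show thesis by (rule that[OF wg trace nb nd[OF _ center] Fb Gb zero])
qed

end

section \<open>Comparison of the norms\<close>

lemma whitney_countable:
 assumes "whitney_covering \<theta> \<Omega> (\<Q> :: ('n::finite) cube set)" shows "countable \<Q>"
proof -
 let ?I = "\<lambda>Q. interior (cube_set Q)"
 have ne: "?I Q \<noteq> {}" if Q: "Q \<in> \<Q>" for Q
 proof -
  have "0 < snd Q" using assms Q by (auto simp: whitney_covering_def is_cube_in_def)
  moreover have "ball (fst Q) (snd Q) \<subseteq> cube_set Q"
   by (auto simp: cube_set_def dist_norm norm_minus_commute intro: order_trans[OF infnorm_le_norm])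
  ultimately show ?thesis using interior_maximal[OF _ open_ball] by (metis centre_in_ball empty_iff subset_iff)
 qed
 have dj: "?I Q \<inter> ?I Q' = {}" if "Q \<in> \<Q>" "Q' \<in> \<Q>" "Q \<noteq> Q'" for Q Q'
  using assms that by (auto simp: whitney_covering_def)
 have "inj_on ?I \<Q>"
 proof (rule inj_onI, rule ccontr)
  fix Q Q' assume "Q \<in> \<Q>" "Q' \<in> \<Q>" "?I Q = ?I Q'" "Q \<noteq> Q'"
  with dj[of Q Q'] ne[of Q] show False by simp
 qed
 moreover have "pairwise disjnt (?I ` \<Q>)"
 proof (rule pairwise_imageI)
  fix Q Q' assume "Q \<in> \<Q>" "Q' \<in> \<Q>" "Q \<noteq> Q'"
  from dj[OF this] show "disjnt (?I Q) (?I Q')" by (simp add: disjnt_def)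
 qed
 then have "countable (?I ` \<Q>)"
  by (rule countable_disjoint_nonempty_interior_subsets) auto
 ultimately show ?thesis by (rule countable_image_inj_on[rotated])
qed

text \<open>Off the null set of the boundaries of the cubes the cube that contains a point is unique, so the choice of a
 cube is locally constant there; what happens on the null set does not matter for Lebesgue measurability.\<close>
lemma whitney_piecewise_measurable:
 fixes v :: "('n::finite) cube => real"
 assumes W: "whitney_covering \<theta> \<Omega> \<Q>" and S: "S \<subseteq> \<Omega>" "S \<in> sets lebesgue"
 shows "(\<lambda>x. v (SOME Q. Q \<in> \<Q> \<and> x \<in> cube_set Q)) \<in> borel_measurable (lebesgue_on S)"
proof -
 let ?s = "\<lambda>x. SOME Q. Q \<in> \<Q> \<and> x \<in> cube_set Q"
 define N where "N = (\<Union>Q\<in>\<Q>. cube_set Q - interior (cube_set Q))"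
 have "negligible (cube_set Q - interior (cube_set Q))" for Q :: "'n cube"
  unfolding cube_set_def infnorm_ball_eq_cbox interior_cbox by (rule negligible_frontier_interval)
 then have N: "negligible N" unfolding N_def
  using whitney_countable[OF W] by (intro negligible_countable_Union) auto
 have s: "?s x \<in> \<Q> \<and> x \<in> cube_set (?s x)" if "x \<in> \<Omega>" for x
 proof -
  have "\<exists>Q. Q \<in> \<Q> \<and> x \<in> cube_set Q" using W that unfolding whitney_covering_def by blast
  then show ?thesis by (rule someI_ex)
 qed
 have eq: "?s x = Q \<longleftrightarrow> x \<in> interior (cube_set Q)" if x: "x \<in> \<Omega>" "x \<notin> N" and Q: "Q \<in> \<Q>" for x Q
 proof -
  have "x \<in> interior (cube_set (?s x))" using s[OF x(1)] x(2) unfolding N_def by blast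
  then show ?thesis using W Q s[OF x(1)] unfolding whitney_covering_def by blast
 qed
 show ?thesis
 proof (rule measurableI)
  fix A :: "real set" assume "A \<in> sets borel"
  let ?B = "\<Union>Q\<in>{Q\<in>\<Q>. v Q \<in> A}. interior (cube_set Q)" and ?N = "{x\<in>S. v (?s x) \<in> A} \<inter> N"
  have "(\<lambda>x. v (?s x)) -` A \<inter> space (lebesgue_on S) = (S \<inter> ?B - N) \<union> ?N"
  proof (intro set_eqI)
   fix x
   show "x \<in> (\<lambda>x. v (?s x)) -` A \<inter> space (lebesgue_on S) \<longleftrightarrow> x \<in> (S \<inter> ?B - N) \<union> ?N"
   proof (cases "x \<in> S \<and> x \<notin> N")
    case True
    then have "x \<in> \<Omega>" "x \<notin> N" using S by auto
    note e = eq[OF this] and sx = s[OF this(1)]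
    have "v (?s x) \<in> A \<longleftrightarrow> x \<in> ?B"
    proof
     assume "v (?s x) \<in> A"
     with sx e[of "?s x"] show "x \<in> ?B" by blast
    next
     assume "x \<in> ?B"
     then obtain Q where Q: "Q \<in> \<Q>" "v Q \<in> A" "x \<in> interior (cube_set Q)" by blast
     from e[OF Q(1)] Q(2,3) show "v (?s x) \<in> A" by simp
    qed
    then show ?thesis using True by simp
   next
    case False then show ?thesis by auto
   qed
  qed
  moreover have "?N \<in> sets lebesgue" using negligible_subset[OF N] by (intro negligible_imp_sets) blast
  moreover have "open ?B" by (intro open_UN ballI open_interior)
  then have "?B \<in> sets lebesgue" by (simp only: borel_open sets_lborel sets_completionI_sets)
  then have "S \<inter> ?B - N \<in> sets lebesgue"
   using S(2) negligible_imp_sets[OF N] by (intro sets.Diff sets.Int)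
  ultimately have "(\<lambda>x. v (?s x)) -` A \<inter> space (lebesgue_on S) \<in> sets lebesgue" by simp
  then show "(\<lambda>x. v (?s x)) -` A \<inter> space (lebesgue_on S) \<in> sets (lebesgue_on S)"
   using S(2) by (subst sets_restrict_space_iff) auto
 qed simp
qed

lemma locally_integrable_measurable:
 fixes G :: "real^'n => 'b::euclidean_space"
 assumes \<Omega>: "open \<Omega>" and G: "locally_integrable \<Omega> G"
 shows "G \<in> borel_measurable (lebesgue_on \<Omega>)"
proof -
 obtain C where C: "\<And>n. compact (C n)" "\<And>n. C n \<subseteq> \<Omega>" "\<And>n. C n \<subseteq> interior (C (Suc n))" "\<Union>(range C) = \<Omega>"
  "\<And>K. compact K ==> K \<subseteq> \<Omega> ==> \<exists>N. \<forall>n\<ge>N. K \<subseteq> C n"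
  using open_Union_compact_subsets[OF \<Omega>] by blast
 define g where "g m x = (if x \<in> C m then G x else 0)" for m x
 have "g m absolutely_integrable_on UNIV" for m
  using G C(1,2)[of m] absolutely_integrable_restrict_UNIV[of "C m" G] unfolding g_def locally_integrable_def by auto
 then have gm: "g m \<in> borel_measurable lebesgue" for m unfolding set_integrable_def by (simp add: borel_measurable_integrable)
 have "(\<lambda>m. g m x) \<longlonglongrightarrow> (if x \<in> \<Omega> then G x else 0)" for x
 proof (rule tendsto_eventually)
  show "\<forall>\<^sub>F m in sequentially. g m x = (if x \<in> \<Omega> then G x else 0)"
  proof (cases "x \<in> \<Omega>")
   case True
   then obtain N where "\<forall>n\<ge>N. {x} \<subseteq> C n" using C(5)[of "{x}"] by auto
   then show ?thesis using True unfolding eventually_sequentially g_def by auto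
  next
   case False
   then have "x \<notin> C m" for m using C(2) by blast
   then show ?thesis using False by (simp add: g_def)
  qed
 qed
 then have "(\<lambda>x. if x \<in> \<Omega> then G x else 0) \<in> borel_measurable lebesgue"
  by (rule borel_measurable_LIMSEQ_metric[OF gm])
 then show ?thesis using \<Omega> by (simp add: borel_measurable_if)
qed

lemma grad_of_weak_gradient:
 assumes \<Omega>: "open (\<Omega> :: (real^'n) set)" and G: "weak_gradient \<Omega> F G"
 shows "weak_gradient \<Omega> F (grad \<Omega> F)" "grad \<Omega> F \<in> borel_measurable (lebesgue_on \<Omega>)"
  "AE x in lebesgue. x \<in> \<Omega> \<longrightarrow> grad \<Omega> F x = G x"
proof -
 show w: "weak_gradient \<Omega> F (grad \<Omega> F)" unfolding grad_def by (rule someI[of _ G]) (rule G)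
 show "grad \<Omega> F \<in> borel_measurable (lebesgue_on \<Omega>)"
  using w by (intro locally_integrable_measurable[OF \<Omega>]) (simp add: weak_gradient_def)
 show "AE x in lebesgue. x \<in> \<Omega> \<longrightarrow> grad \<Omega> F x = G x" by (rule weak_gradient_unique[OF \<Omega> w G])
qed

text \<open>A triangle inequality with a factor 4, which follows from the inequality \<open>(a + b)\<^sup>p <= 2\<^sup>p (a\<^sup>p + b\<^sup>p)\<close> alone.\<close>
lemma enn_Lp_norm_add_le:
 assumes p: "1 < p" and c: "0 < c" and S: "S \<in> sets lebesgue" and T: "T \<in> sets lebesgue" "T \<subseteq> S"
  and m: "h1 \<in> borel_measurable (lebesgue_on T)" "h2 \<in> borel_measurable (lebesgue_on T)"
  and le: "AE x in lebesgue. x \<in> S \<longrightarrow> (x \<in> T \<and> h x <= ennreal c * (h1 x + h2 x)) \<or> h x = 0"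
 shows "enn_Lp_norm p S h <= ennreal (4 * c) * (enn_Lp_norm p T h1 + enn_Lp_norm p T h2)"
proof -
 let ?I = "\<lambda>h. \<integral>\<^sup>+x. ennreal_powr (h x) p \<partial>lebesgue_on T"
 have "(\<integral>\<^sup>+x. ennreal_powr (h x) p \<partial>lebesgue_on S) = (\<integral>\<^sup>+x\<in>S. ennreal_powr (h x) p \<partial>lebesgue)"
  using S by (intro nn_integral_restrict_space) auto
 also have "... <= (\<integral>\<^sup>+x\<in>T. ennreal ((2 * c) powr p) * (ennreal_powr (h1 x) p + ennreal_powr (h2 x) p) \<partial>lebesgue)"
 proof (rule nn_integral_mono_AE, use le in eventually_elim)
  case (elim x)
  show "ennreal_powr (h x) p * indicator S x <= ennreal ((2 * c) powr p) * (ennreal_powr (h1 x) p + ennreal_powr (h2 x) p) * indicator T x"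
  proof (cases "x \<in> S \<and> h x \<noteq> 0")
   case True
   then have x: "x \<in> S" "x \<in> T" "h x <= ennreal c * (h1 x + h2 x)" using elim by auto
   have "ennreal_powr (h x) p <= ennreal_powr (ennreal c * (h1 x + h2 x)) p" using x p by (intro ennreal_powr_mono) auto
   also have "... = ennreal (c powr p) * ennreal_powr (h1 x + h2 x) p" by (rule ennreal_powr_cmult[OF c])
   also have "... <= ennreal (c powr p) * (ennreal (2 powr p) * (ennreal_powr (h1 x) p + ennreal_powr (h2 x) p))"
    using p by (intro mult_left_mono ennreal_powr_add_le) auto
   also have "... = ennreal ((2 * c) powr p) * (ennreal_powr (h1 x) p + ennreal_powr (h2 x) p)"
    using c by (simp add: powr_mult ennreal_mult mult_ac)
   finally show ?thesis using x by simp
  next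
   case False
   then show ?thesis by (auto simp: indicator_def ennreal_powr_def)
  qed
 qed
 also have "... = (\<integral>\<^sup>+x. ennreal ((2 * c) powr p) * (ennreal_powr (h1 x) p + ennreal_powr (h2 x) p) \<partial>lebesgue_on T)"
  using T by (intro nn_integral_restrict_space[symmetric]) auto
 also have "... = ennreal ((2 * c) powr p) * (?I h1 + ?I h2)"
  using m by (subst nn_integral_cmult; measurable)+ (simp add: nn_integral_add)
 finally have "enn_Lp_norm p S h <= ennreal_powr (ennreal ((2 * c) powr p) * (?I h1 + ?I h2)) (1/p)"
  unfolding enn_Lp_norm_def using p by (intro ennreal_powr_mono) auto
 also have "... = ennreal (2 * c) * ennreal_powr (?I h1 + ?I h2) (1/p)"
  using c p by (subst ennreal_powr_cmult) (auto simp: powr_powr)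
 also have "... <= ennreal (2 * c) * (ennreal (2 powr (1/p)) * (enn_Lp_norm p T h1 + enn_Lp_norm p T h2))"
  unfolding enn_Lp_norm_def using p by (intro mult_left_mono ennreal_powr_add_le) auto
 also have "... <= ennreal (2 * c) * (ennreal 2 * (enn_Lp_norm p T h1 + enn_Lp_norm p T h2))"
  using p powr_mono[of "1/p" 1 2] by (intro mult_left_mono mult_right_mono ennreal_leI) auto
 also have "... = ennreal (4 * c) * (enn_Lp_norm p T h1 + enn_Lp_norm p T h2)"
 proof -
  have "ennreal (2 * c) * ennreal 2 = ennreal (4 * c)" using c by (subst ennreal_mult[symmetric]) auto
  then show ?thesis by (simp only: mult.assoc[symmetric])
 qed
 finally show ?thesis .
qed

lemma comparable_Inf:
 assumes C: "1 <= C" and le: "\<And>a. a \<in> A ==> Y <= ennreal C * a" and w: "a0 \<in> A" "a0 <= ennreal C * Y"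
 shows "comparable C (Inf A) Y"
 unfolding comparable_def
proof
 have pos: "0 < ennreal C" using C by simp
 show "Inf A / ennreal C <= Y"
  by (rule divide_le_posI_ennreal[OF pos order_trans[OF Inf_lower[OF w(1)] w(2)]])
 have "Y / ennreal C <= Inf A" by (rule Inf_greatest) (rule divide_le_posI_ennreal[OF pos le])
 from mult_left_mono[OF this, of "ennreal C"] show "Y <= ennreal C * Inf A"
  using C by (simp add: ennreal_times_divide ennreal_mult_divide_eq mult.commute)
qed

section \<open>The two characterisations\<close>

lemma infnorm_real [simp]: "infnorm (r::real) = \<bar>r\<bar>"
 by (simp add: infnorm_Max)

context trace_setting
begin

lemma T_map_point:
 assumes W: "whitney_covering \<theta> \<Omega> \<Q>" and a: "nearest_choice \<Omega> a" and \<theta>: "1 < \<theta>" and x: "x \<in> \<Omega>"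
 shows "\<exists>\<omega>\<in>bdry \<beta>. T_map \<alpha> \<Omega> a \<Q> x = change_exponent \<alpha> \<Omega> \<omega> \<and>
  d_to \<beta> x \<omega> <= (cube_const \<theta> * bd x) powr \<beta>"
proof -
 define Q where "Q = (SOME Q. Q \<in> \<Q> \<and> x \<in> cube_set Q)"
 have "\<exists>Q. Q \<in> \<Q> \<and> x \<in> cube_set Q" using W x unfolding whitney_covering_def by blast
 then have Q: "Q \<in> \<Q>" "x \<in> cube_set Q" using someI_ex[of "\<lambda>Q. Q \<in> \<Q> \<and> x \<in> cube_set Q"] by (auto simp: Q_def)
 obtain c r where cr: "Q = (c, r)" by (cases Q)
 have 1: "is_cube_in \<Omega> (c, r)" "udiam (cube_set (c, r)) / \<theta> <= udist_set (cube_set (c, r)) (frontier \<Omega>)" "x \<in> cube_set (c, r)"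
  using W Q unfolding whitney_covering_def cr by blast+
 note o = omega_cube_props[OF 1(1) a \<theta> 1(2,3)]
 have "T_map \<alpha> \<Omega> a \<Q> x = change_exponent \<alpha> \<Omega> (omega_cube \<beta> \<Omega> a (c, r))"
  using o(2) by (simp add: T_map_def Q_def[symmetric] cr)
 with o(1,3) show ?thesis by blast
qed

text \<open>An infinite value at one point would force infinite values on a whole neighbourhood, by the Harnack inequality.\<close>
lemma fsharp_finite:
 assumes S: "open S" "S \<subseteq> \<Omega>" and f: "sharp f \<in> enn_Lp p S" and x: "x \<in> S"
 shows "sharp f x < \<infinity>"
proof (rule ccontr)
 assume "\<not> sharp f x < \<infinity>"
 then have inf: "sharp f x = \<infinity>" by (simp add: less_top[symmetric])
 have xO: "x \<in> \<Omega>" using S x by blast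
 define U where "U = S \<inter> ball x (bd x / 2)"
 have U: "open U" "x \<in> U" using S x bd_pos[OF xO] by (auto simp: U_def)
 have top: "sharp f y = top" if "y \<in> U" for y
 proof (rule ccontr)
  assume "sharp f y \<noteq> top"
  moreover have "infnorm (y - x) <= bd x / 2"
   using that infnorm_le_norm[of "y - x"] by (auto simp: U_def dist_norm norm_minus_commute)
  from fsharp_harnack[OF fs xO this, of f] have "top <= ennreal (5 powr (1/\<beta>)) * sharp f y" by (simp add: inf)
  ultimately show False by (simp add: top_unique ennreal_mult_eq_top_iff)
 qed
 have "emeasure lebesgue U \<noteq> 0"
  using open_not_negligible[OF U(1)] U by (auto simp: negligible_iff_null_sets null_sets_def borel_open)
 then have "top = (\<integral>\<^sup>+y. top * indicator U y \<partial>lebesgue)"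
  using U(1) by (subst nn_integral_cmult_indicator) (auto simp: ennreal_top_mult borel_open)
 also have "... <= (\<integral>\<^sup>+y\<in>S. ennreal_powr (sharp f y) p \<partial>lebesgue)"
  using top by (intro nn_integral_mono) (auto simp: indicator_def U_def)
 also have "... = (\<integral>\<^sup>+y. ennreal_powr (sharp f y) p \<partial>lebesgue_on S)"
  using S(1) by (intro nn_integral_restrict_space[symmetric]) (auto simp: borel_open)
 finally have "enn_Lp_norm p S (sharp f) = top" by (simp add: enn_Lp_norm_def top_unique)
 then show False using f by (simp add: enn_Lp_def)
qed

definition dominating_const :: real where "dominating_const = trace_const / (2 * approach_const)"

text \<open>The function \<open>V\<close> is the \<open>q\<close>-th root of the iterated maximal function of \<open>\<bar>\<nabla>F\<bar>\<^sup>q\<close>.  A Borel representative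
 of \<open>\<bar>\<nabla>F\<bar>\<^sup>q\<close> is needed because the maximal function is formed with Borel measure.\<close>
lemma necessity:
 assumes F: "F \<in> L1p p \<Omega>" "continuous_on \<Omega> F" "is_trace \<alpha> \<Omega> F f"
 obtains V where "V \<in> borel_measurable borel" "d_continuous \<alpha> \<Omega> f"
  "enn_Lp_norm p \<Omega> V <= ennreal dominating_const * L1p_norm p \<Omega> F"
  "\<And>x. x \<in> \<Omega> ==> sharp f x <= ennreal (2 * approach_const) * V x"
  "\<And>x r \<omega>. x \<in> \<Omega> ==> 0 < r ==> \<omega> \<in> bdry \<beta> ==> d_to \<beta> x \<omega> <= r powr \<beta> ==>
   ennreal \<bar>fv f \<omega> - F x\<bar> <= ennreal (approach_const * r) * V x"
proof -
 let ?G = "grad \<Omega> F"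
 have wg: "weak_gradient \<Omega> F ?G" and G: "?G \<in> borel_measurable (lebesgue_on \<Omega>)" "Lp_norm p \<Omega> ?G < \<infinity>"
  using F(1) grad_of_weak_gradient(1)[OF op] by (auto simp: L1p_def Lp_def)
 define w where "w z = ennreal (infnorm (?G z) powr q) * indicator \<Omega> z" for z
 have "infnorm \<in> borel_measurable (borel :: (real^'n) measure)"
  by (intro borel_measurable_continuous_onI continuous_intros continuous_on_infnorm)
 from measurable_compose[OF G(1) this] have "(\<lambda>z. ennreal (infnorm (?G z) powr q)) \<in> borel_measurable (lebesgue_on \<Omega>)"
  by measurable
 then have "w \<in> borel_measurable lebesgue" unfolding w_def[abs_def]
  using op by (subst (asm) borel_measurable_restrict_space_iff_ennreal) auto
 then obtain u where u: "u \<in> borel_measurable lborel" "AE z in lborel. w z = u z"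
  using completion_ex_borel_measurable by blast
 have uG: "AE z in lebesgue. u z = ennreal (infnorm (?G z) powr q) * indicator \<Omega> z"
  using AE_completion[OF u(2)] by eventually_elim (simp add: w_def)
 have "(\<integral>\<^sup>+z. ennreal_powr (u z) (p/q) \<partial>lborel) < \<infinity>"
 proof (rule ccontr)
  assume "\<not> ?thesis"
  then have "(\<integral>\<^sup>+z. ennreal_powr (u z) (p/q) \<partial>lborel) = top" by (simp add: less_top[symmetric])
  then have "Lp_norm p \<Omega> ?G = top" by (simp add: Lp_norm_def enn_Lp_norm_def power_integral[OF uG])
  then show False using G(2) by simp
 qed
 then interpret sobolev_trace \<Omega> p q \<alpha> \<beta> F ?G f u
  by unfold_locales (use wg F u uG in auto)
 let ?V = "\<lambda>x. ennreal_powr (maxfun H x) (1/q)"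
 show thesis
 proof (rule that[of ?V])
  show "enn_Lp_norm p \<Omega> ?V <= ennreal dominating_const * L1p_norm p \<Omega> F"
   using Lp_norm_maxfun[of \<Omega> ?V 1] op by (simp add: dominating_const_def L1p_norm_def borel_open)
 qed (use trace_d_continuous fsharp_le_maxfun trace_approach in auto)
qed

definition extension_const :: real where
 "extension_const = 4 * (mollify_const TYPE('n) * near_const)"

lemma dominating_const_pos: "0 < dominating_const"
 using consts_pos by (simp add: dominating_const_def)

lemma zero_measurable: "(\<lambda>_. 0 :: ennreal) \<in> borel_measurable M" by simp

lemma enn_Lp_norm_zero: "enn_Lp_norm p S (\<lambda>_. 0) = 0"
 using exponents by (simp add: enn_Lp_norm_def ennreal_powr_def)

lemma L1p_of_weak_gradient:
 assumes "weak_gradient \<Omega> F G" and "\<And>h. (AE x in lebesgue. x \<in> \<Omega> \<longrightarrow> h x = ennreal (infnorm (G x))) ==> enn_Lp_norm p \<Omega> h <= M" and "M < \<infinity>"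
 shows "F \<in> L1p p \<Omega>" "L1p_norm p \<Omega> F <= M"
proof -
 note g = grad_of_weak_gradient[OF op assms(1)]
 show 1: "L1p_norm p \<Omega> F <= M" unfolding L1p_norm_def Lp_norm_def
  by (rule assms(2)) (use g(3) in eventually_elim, simp)
 then show "F \<in> L1p p \<Omega>" using g assms by (auto simp: L1p_def Lp_def L1p_norm_def)
qed

text \<open>The extension without cutoff: its gradient is bounded pointwise by \<^const>\<open>fsharp\<close>.\<close>
lemma homogeneous_sufficiency:
 assumes f: "d_continuous \<alpha> \<Omega> f" "sharp f \<in> enn_Lp p \<Omega>"
 shows "\<exists>F\<in>L1p p \<Omega>. continuous_on \<Omega> F \<and> is_trace \<alpha> \<Omega> F f \<and>
  L1p_norm p \<Omega> F <= ennreal extension_const * enn_Lp_norm p \<Omega> (sharp f)"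
proof -
 let ?\<phi> = "sharp f"
 have fin: "?\<phi> x < \<infinity>" if "x \<in> \<Omega>" for x by (rule fsharp_finite[OF op order_refl f(2) that])
 have fin0: "\<And>x. x \<in> \<Omega> ==> 0 * bd x < 2 ==> ?\<phi> x < \<infinity>" using fin by blast
 from extension[OF f(1) order_refl fin0]
 obtain F G where F: "continuous_on \<Omega> F" "is_trace \<alpha> \<Omega> F f" and G: "weak_gradient \<Omega> F G"
  and Gb: "\<And>x. x \<in> \<Omega> ==> infnorm (G x) <= mollify_const TYPE('n) * (near_const * enn2real (?\<phi> x))"
  by (metis (no_types, lifting) add.right_neutral div_0 mult_zero_left zero_less_numeral)
 have c: "0 < mollify_const TYPE('n) * near_const" using near_const(1) mollify_const_pos[where 'n='n] by simp
 let ?B = "ennreal extension_const * enn_Lp_norm p \<Omega> ?\<phi>"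
 have "enn_Lp_norm p \<Omega> h <= ?B" if h: "AE x in lebesgue. x \<in> \<Omega> \<longrightarrow> h x = ennreal (infnorm (G x))" for h
 proof -
  have "enn_Lp_norm p \<Omega> h <= ennreal (4 * (mollify_const TYPE('n) * near_const)) * (enn_Lp_norm p \<Omega> ?\<phi> + enn_Lp_norm p \<Omega> (\<lambda>_. 0))"
  proof (rule enn_Lp_norm_add_le[OF exponents(2) c _ _ order_refl _ zero_measurable])
   show "AE x in lebesgue. x \<in> \<Omega> \<longrightarrow> x \<in> \<Omega> \<and> h x <= ennreal (mollify_const TYPE('n) * near_const) * (?\<phi> x + 0) \<or> h x = 0"
    using h
   proof eventually_elim
    case (elim x)
    show ?case
    proof (intro impI disjI1 conjI)
     assume x: "x \<in> \<Omega>"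
     have "h x <= ennreal (mollify_const TYPE('n) * near_const * enn2real (?\<phi> x))"
      using elim x Gb[OF x] by (simp add: mult.assoc ennreal_leI)
     also have "... = ennreal (mollify_const TYPE('n) * near_const) * ?\<phi> x"
      using fin[OF x] c by (simp add: ennreal_mult')
     finally show "h x <= ennreal (mollify_const TYPE('n) * near_const) * (?\<phi> x + 0)" by simp
    qed
   qed
  qed (use op f in \<open>auto simp: enn_Lp_def borel_open\<close>)
  then show ?thesis by (simp add: enn_Lp_norm_zero extension_const_def)
 qed
 moreover have "?B < \<infinity>" using f(2) by (simp add: enn_Lp_def ennreal_mult_less_top)
 ultimately show ?thesis using L1p_of_weak_gradient[OF G, of ?B] F by blast
qed

lemma homogeneous_necessity:
 assumes F: "F \<in> L1p p \<Omega>" "continuous_on \<Omega> F" "is_trace \<alpha> \<Omega> F f"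
 shows "d_continuous \<alpha> \<Omega> f \<and> sharp f \<in> enn_Lp p \<Omega>"
  "enn_Lp_norm p \<Omega> (sharp f) <= ennreal (8 * approach_const * dominating_const) * L1p_norm p \<Omega> F"
proof -
 let ?\<phi> = "sharp f"
 have \<phi>m: "?\<phi> \<in> borel_measurable (lebesgue_on \<Omega>)" using op by (intro fsharp_measurable[OF fs]) (auto simp: borel_open)
 obtain V where V: "V \<in> borel_measurable borel" "d_continuous \<alpha> \<Omega> f" "enn_Lp_norm p \<Omega> V <= ennreal dominating_const * L1p_norm p \<Omega> F"
  "\<And>x. x \<in> \<Omega> ==> ?\<phi> x <= ennreal (2 * approach_const) * V x" using necessity[OF F] by metis
 have "enn_Lp_norm p \<Omega> ?\<phi> <= ennreal (4 * (2 * approach_const)) * (enn_Lp_norm p \<Omega> V + enn_Lp_norm p \<Omega> (\<lambda>_. 0))"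
  by (rule enn_Lp_norm_add_le[OF exponents(2) _ _ _ order_refl _ zero_measurable])
   (use V op consts_pos in \<open>auto simp: borel_open measurable_restrict_space1 measurable_completion\<close>)
 also have "... <= ennreal (8 * approach_const) * (ennreal dominating_const * L1p_norm p \<Omega> F)"
  using V(3) by (simp add: enn_Lp_norm_zero mult_left_mono)
 also have "... = ennreal (8 * approach_const * dominating_const) * L1p_norm p \<Omega> F"
  using consts_pos(3) by (simp add: ennreal_mult' mult.assoc)
 finally show n: "enn_Lp_norm p \<Omega> ?\<phi> <= ennreal (8 * approach_const * dominating_const) * L1p_norm p \<Omega> F" .
 have "L1p_norm p \<Omega> F < \<infinity>" using F(1) by (simp add: L1p_def Lp_def L1p_norm_def)
 then have "ennreal (8 * approach_const * dominating_const) * L1p_norm p \<Omega> F < \<infinity>" by (simp add: ennreal_mult_less_top)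
 with n have "enn_Lp_norm p \<Omega> ?\<phi> < \<infinity>" by (rule le_less_trans)
 then show "d_continuous \<alpha> \<Omega> f \<and> ?\<phi> \<in> enn_Lp p \<Omega>" using V(2) \<phi>m by (simp add: enn_Lp_def)
qed

end

lemma trace_characterisation:
 assumes nec: "\<And>F. F \<in> X ==> continuous_on \<Omega> F ==> is_trace \<alpha> \<Omega> F f ==> P \<and> Y <= ennreal D * N F"
  and suf: "P ==> \<exists>F\<in>X. continuous_on \<Omega> F \<and> is_trace \<alpha> \<Omega> F f \<and> N F <= ennreal E * Y"
 shows "(f \<in> trace_space \<alpha> \<Omega> X \<longleftrightarrow> P) \<and> (f \<in> trace_space \<alpha> \<Omega> X \<longrightarrow> comparable (max 1 (max E D)) (trace_norm \<alpha> \<Omega> X N f) Y)"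
proof (intro conjI impI)
 show iff: "f \<in> trace_space \<alpha> \<Omega> X \<longleftrightarrow> P" unfolding trace_space_def using nec suf by blast
 assume "f \<in> trace_space \<alpha> \<Omega> X"
 with iff suf obtain F0 where F0: "F0 \<in> X" "continuous_on \<Omega> F0" "is_trace \<alpha> \<Omega> F0 f" "N F0 <= ennreal E * Y" by blast
 let ?C = "max 1 (max E D)"
 show "comparable ?C (trace_norm \<alpha> \<Omega> X N f) Y"
  unfolding trace_norm_def
 proof (rule comparable_Inf[where ?a0.0 = "N F0"])
  fix a assume "a \<in> {N F |F. F \<in> X \<and> continuous_on \<Omega> F \<and> is_trace \<alpha> \<Omega> F f}"
  then obtain F where F: "F \<in> X" "continuous_on \<Omega> F" "is_trace \<alpha> \<Omega> F f" "a = N F" by blast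
  have "ennreal D * a <= ennreal ?C * a" by (intro mult_right_mono ennreal_leI) auto
  with nec[OF F(1-3)] F(4) show "Y <= ennreal ?C * a" by (auto intro: order_trans)
 next
  have "ennreal E * Y <= ennreal ?C * Y" by (intro mult_right_mono ennreal_leI) auto
  with F0(4) show "N F0 <= ennreal ?C * Y" by (rule order_trans)
 qed (use F0 in auto)
qed

lemma enn_Lp_norm_subset:
 assumes "1 < p" "S \<subseteq> T" "S \<in> sets lebesgue" "T \<in> sets lebesgue" shows "enn_Lp_norm p S h <= enn_Lp_norm p T h"
proof -
 have "(\<integral>\<^sup>+x. ennreal_powr (h x) p \<partial>lebesgue_on S) = (\<integral>\<^sup>+x\<in>S. ennreal_powr (h x) p \<partial>lebesgue)"
  using assms by (intro nn_integral_restrict_space) auto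
 also have "... <= (\<integral>\<^sup>+x\<in>T. ennreal_powr (h x) p \<partial>lebesgue)"
  using assms(2) by (intro nn_integral_mono) (auto simp: indicator_def)
 also have "... = (\<integral>\<^sup>+x. ennreal_powr (h x) p \<partial>lebesgue_on T)"
  using assms by (intro nn_integral_restrict_space[symmetric]) auto
 finally show ?thesis unfolding enn_Lp_norm_def using assms(1) by (intro ennreal_powr_mono) auto
qed

lemma (in proper_domain) bdry_nbhd_props: "open (bdry_nbhd \<epsilon> \<Omega>)" "bdry_nbhd \<epsilon> \<Omega> \<subseteq> \<Omega>" "bdry_nbhd \<epsilon> \<Omega> \<in> sets lebesgue"
proof -
 have "bdry_nbhd \<epsilon> \<Omega> = \<Omega> \<inter> {x. bd x < \<epsilon>}" by (auto simp: bdry_nbhd_def)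
 moreover have "open {x. bd x < \<epsilon>}" using continuous_bd by (intro open_Collect_less continuous_on_const)
 ultimately show o: "open (bdry_nbhd \<epsilon> \<Omega>)" using op by auto
 show "bdry_nbhd \<epsilon> \<Omega> \<subseteq> \<Omega>" by (auto simp: bdry_nbhd_def)
 show "bdry_nbhd \<epsilon> \<Omega> \<in> sets lebesgue" using o by (simp only: borel_open sets_lborel sets_completionI_sets)
qed

context trace_setting
begin

definition near_cube_const :: "real => real" where "near_cube_const \<theta> = max near_const (cube_const \<theta>)"

definition extension_value_const :: "real => real => real" where
 "extension_value_const \<epsilon> \<theta> = 2 + 3 * near_cube_const \<theta> * \<epsilon>"

definition extension_gradient_const :: "real => real => real" where
 "extension_gradient_const \<epsilon> \<theta> = mollify_const TYPE('n) * (3 * near_cube_const \<theta> + 2 / \<epsilon>)"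

definition trace_value_const :: "real => real => real" where
 "trace_value_const \<epsilon> \<theta> = 1 + approach_const * cube_const \<theta> * \<epsilon>"

context
 fixes \<epsilon> \<theta> :: real and \<Q> :: "'n cube set" and a :: "'n cube => real^'n"
 assumes \<epsilon>: "0 < \<epsilon>" and \<theta>: "1 < \<theta>" and W: "whitney_covering \<theta> \<Omega> \<Q>" and a: "nearest_choice \<Omega> a"
begin

abbreviation S where "S \<equiv> bdry_nbhd \<epsilon> \<Omega>"
abbreviation t where "t f \<equiv> \<lambda>x. f (T_map \<alpha> \<Omega> a \<Q> x) :: real"

lemma t_measurable: "t f \<in> borel_measurable (lebesgue_on S)"
 unfolding T_map_def
 by (rule whitney_piecewise_measurable[OF W bdry_nbhd_props(2,3), where v="\<lambda>Q. f (omega_cube \<alpha> \<Omega> a Q)"])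

lemma near_cube_const: "0 < near_cube_const \<theta>" "near_const <= near_cube_const \<theta>" "cube_const \<theta> <= near_cube_const \<theta>"
 using near_const(1) by (auto simp: near_cube_const_def)

text \<open>The cutoff at distance \<open>\<epsilon> / 4\<close> costs a gradient of size \<open>1/\<epsilon>\<close> times the near value.  The near value and the value at
 \<open>T x\<close> differ by at most a multiple of \<open>bd x\<close> times \<^const>\<open>fsharp\<close>, and \<open>bd x < \<epsilon>\<close> where the extension does not
 vanish.\<close>
lemma inhomogeneous_sufficiency:
 assumes f: "d_continuous \<alpha> \<Omega> f" and fT: "t f \<in> Lp p S" and f\<phi>: "sharp f \<in> enn_Lp p S"
 shows "\<exists>F\<in>W1p p \<Omega>. continuous_on \<Omega> F \<and> is_trace \<alpha> \<Omega> F f \<and>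
  W1p_norm p \<Omega> F <= ennreal (4 * (extension_value_const \<epsilon> \<theta> + extension_gradient_const \<epsilon> \<theta>)) *
   (Lp_norm p S (t f) + enn_Lp_norm p S (sharp f))"
proof -
 let ?\<phi> = "sharp f" and ?M = "near_cube_const \<theta>" and ?m = "mollify_const TYPE('n)"
 let ?R = "Lp_norm p S (t f) + enn_Lp_norm p S ?\<phi>" and ?c1 = "extension_value_const \<epsilon> \<theta>" and ?c2 = "extension_gradient_const \<epsilon> \<theta>"
 define \<psi> where "\<psi> x = enn2real (?\<phi> x)" for x
 have inS: "x \<in> S" if "x \<in> \<Omega>" "4 / \<epsilon> * bd x < 2" for x
  using that \<epsilon> bd_pos[OF that(1)] by (simp add: bdry_nbhd_def field_simps)
 have fin: "?\<phi> x < \<infinity>" if "x \<in> S" for x by (rule fsharp_finite[OF bdry_nbhd_props(1,2) f\<phi> that])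
 have c: "0 < ?c1" "0 < ?c2" using near_cube_const(1) \<epsilon> mollify_const_pos[where 'n='n]
  by (auto simp: extension_value_const_def extension_gradient_const_def intro!: add_pos_pos mult_pos_pos)
 have lam: "0 <= 4 / \<epsilon>" using \<epsilon> by simp
 obtain F G \<nu> where F: "continuous_on \<Omega> F" and G: "weak_gradient \<Omega> F G" and tr: "is_trace \<alpha> \<Omega> F f"
  and nb: "\<And>x. x \<in> \<Omega> ==> \<nu> x \<in> bdry \<beta>"
  and nd: "\<And>x. x \<in> \<Omega> ==> d_to \<beta> x (\<nu> x) <= (near_const * bd x) powr \<beta>"
  and Fb: "\<And>x. x \<in> \<Omega> ==> 4 / \<epsilon> * bd x < 2 ==> \<bar>F x\<bar> <= near_const * bd x * enn2real (?\<phi> x) + 2 * \<bar>fv f (\<nu> x)\<bar>"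
  and Gb: "\<And>x. x \<in> \<Omega> ==> 4 / \<epsilon> * bd x < 2 ==>
   infnorm (G x) <= ?m * (near_const * enn2real (?\<phi> x) + 4 / \<epsilon> / 2 * \<bar>fv f (\<nu> x)\<bar>)"
  and z: "\<And>x. x \<in> \<Omega> ==> 2 <= 4 / \<epsilon> * bd x ==> F x = 0 \<and> G x = 0"
  by (rule extension[OF f lam fin[OF inS]]) blast+
 have v: "\<bar>fv f (\<nu> x)\<bar> <= \<bar>t f x\<bar> + ?M * \<epsilon> * \<psi> x" if x: "x \<in> S" for x
 proof -
  have xO: "x \<in> \<Omega>" and be: "bd x < \<epsilon>" using x by (auto simp: bdry_nbhd_def)
  have b: "0 < bd x" by (rule bd_pos[OF xO])
  obtain \<omega> where w: "\<omega> \<in> bdry \<beta>" "t f x = fv f \<omega>" "d_to \<beta> x \<omega> <= (cube_const \<theta> * bd x) powr \<beta>"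
   using T_map_point[OF W a \<theta> xO] by (auto simp: fv_def)
  have up: "(c * bd x) powr \<beta> <= (?M * bd x) powr \<beta>" if "0 < c" "c <= ?M" for c
   using that b exponents(3) by (intro powr_mono2 mult_right_mono) auto
  have "\<bar>fv f (\<nu> x) - fv f \<omega>\<bar> <= ?M * bd x * \<psi> x" unfolding fv_def \<psi>_def
  proof (rule fsharp_diff_le[OF fs xO _ nb[OF xO] w(1) _ _ fin[OF x]])
   show "0 < ?M * bd x" using near_cube_const(1) b by simp
   show "d_to \<beta> x (\<nu> x) <= (?M * bd x) powr \<beta>"
    using nd[OF xO] up[OF near_const(1) near_cube_const(2)] by simp
   show "d_to \<beta> x \<omega> <= (?M * bd x) powr \<beta>"
    using w(3) up[OF cube_const_pos[OF \<theta>] near_cube_const(3)] by simp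
  qed
  also have "... <= ?M * \<epsilon> * \<psi> x"
   using be near_cube_const(1) by (intro mult_right_mono mult_left_mono) (auto simp: \<psi>_def)
  finally show ?thesis using w(2) by linarith
 qed
 have bnd: "ennreal \<bar>F x\<bar> <= ennreal ?c1 * (ennreal \<bar>t f x\<bar> + ?\<phi> x)" "ennreal (infnorm (G x)) <= ennreal ?c2 * (ennreal \<bar>t f x\<bar> + ?\<phi> x)"
  if x: "x \<in> \<Omega>" and l: "4 / \<epsilon> * bd x < 2" for x
 proof -
  have xS: "x \<in> S" by (rule inS[OF x l])
  then have be: "bd x <= \<epsilon>" by (simp add: bdry_nbhd_def)
  have \<psi>0: "0 <= \<psi> x" by (simp add: \<psi>_def)
  have up: "ennreal r <= ennreal c * (ennreal \<bar>t f x\<bar> + ?\<phi> x)" if "r <= c * (\<bar>t f x\<bar> + \<psi> x)" "0 < c" for r c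
  proof -
   have "ennreal r <= ennreal (c * (\<bar>t f x\<bar> + \<psi> x))" by (rule ennreal_leI[OF that(1)])
   also have "... = ennreal c * (ennreal \<bar>t f x\<bar> + ennreal (\<psi> x))" using that(2) \<psi>0 by (simp add: ennreal_mult')
   also have "ennreal (\<psi> x) = ?\<phi> x" using fin[OF xS] by (simp add: \<psi>_def)
   finally show ?thesis .
  qed
  have n1: "near_const * bd x * \<psi> x <= ?M * \<epsilon> * \<psi> x"
   using near_cube_const be near_const(1) \<psi>0 bd_nonneg[of x] by (intro mult_right_mono mult_mono) auto
  have n2: "near_const * \<psi> x <= ?M * \<psi> x" using near_cube_const(2) \<psi>0 by (rule mult_right_mono)
  have M\<epsilon>: "0 <= ?M * \<epsilon>" using near_cube_const(1) \<epsilon> by simp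
  have "\<bar>F x\<bar> <= 2 * \<bar>t f x\<bar> + 3 * (?M * \<epsilon> * \<psi> x)" using Fb[OF x l] v[OF xS] n1 by (simp add: \<psi>_def)
  also have "... <= ?c1 * (\<bar>t f x\<bar> + \<psi> x)"
  proof -
   have "?c1 * (\<bar>t f x\<bar> + \<psi> x) = 2 * \<bar>t f x\<bar> + 3 * (?M * \<epsilon> * \<psi> x) + (2 * \<psi> x + 3 * (?M * \<epsilon> * \<bar>t f x\<bar>))"
    by (simp add: extension_value_const_def algebra_simps)
   moreover have "0 <= 2 * \<psi> x + 3 * (?M * \<epsilon> * \<bar>t f x\<bar>)" using \<psi>0 M\<epsilon> by simp
   ultimately show ?thesis by linarith
  qed
  finally show "ennreal \<bar>F x\<bar> <= ennreal ?c1 * (ennreal \<bar>t f x\<bar> + ?\<phi> x)" using c(1) by (rule up)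
  have "infnorm (G x) <= ?m * (near_const * \<psi> x + 2 / \<epsilon> * \<bar>fv f (\<nu> x)\<bar>)" using Gb[OF x l] by (simp add: \<psi>_def)
  also have "... <= ?m * (?M * \<psi> x + 2 / \<epsilon> * (\<bar>t f x\<bar> + ?M * \<epsilon> * \<psi> x))"
   using mollify_const_pos[where 'n='n] \<epsilon> n2 v[OF xS] by (intro mult_left_mono add_mono) auto
  also have "... <= ?c2 * (\<bar>t f x\<bar> + \<psi> x)"
  proof -
   have "2 / \<epsilon> * (\<bar>t f x\<bar> + ?M * \<epsilon> * \<psi> x) = 2 / \<epsilon> * \<bar>t f x\<bar> + 2 * ?M * \<psi> x" using \<epsilon> by (simp add: field_simps)
   moreover have "0 <= 3 * ?M * \<bar>t f x\<bar>" "0 <= 2 / \<epsilon> * \<psi> x" using near_cube_const(1) \<epsilon> \<psi>0 by auto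
   ultimately have "?M * \<psi> x + 2 / \<epsilon> * (\<bar>t f x\<bar> + ?M * \<epsilon> * \<psi> x) <= (3 * ?M + 2 / \<epsilon>) * (\<bar>t f x\<bar> + \<psi> x)"
    by (simp add: distrib_left distrib_right)
   then show ?thesis unfolding extension_gradient_const_def mult.assoc
    using mollify_const_pos[where 'n='n] by (intro mult_left_mono) auto
  qed
  finally show "ennreal (infnorm (G x)) <= ennreal ?c2 * (ennreal \<bar>t f x\<bar> + ?\<phi> x)" using c(2) by (rule up)
 qed
 have tm: "(\<lambda>x. ennreal \<bar>t f x\<bar>) \<in> borel_measurable (lebesgue_on S)" using t_measurable[of f] by measurable
 have \<phi>m: "?\<phi> \<in> borel_measurable (lebesgue_on S)" by (rule fsharp_measurable[OF fs bdry_nbhd_props(2,3)])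
 have tn: "Lp_norm p S (t f) = enn_Lp_norm p S (\<lambda>x. ennreal \<bar>t f x\<bar>)" by (simp add: Lp_norm_def)
 have \<Omega>m: "\<Omega> \<in> sets lebesgue" using op by (simp only: borel_open sets_lborel sets_completionI_sets)
 note norm_le = enn_Lp_norm_add_le[OF exponents(2) _ \<Omega>m bdry_nbhd_props(3,2) tm \<phi>m, folded tn]
 have far: "x \<in> S \<or> (F x = 0 \<and> G x = 0)" "4 / \<epsilon> * bd x < 2 \<or> (F x = 0 \<and> G x = 0)" if "x \<in> \<Omega>" for x
  using z[OF that] inS[OF that] not_less[of "4 / \<epsilon> * bd x" 2] by blast+
 have "enn_Lp_norm p \<Omega> h <= ennreal (4 * ?c2) * ?R" if h: "AE x in lebesgue. x \<in> \<Omega> \<longrightarrow> h x = ennreal (infnorm (G x))" for h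
 proof (rule norm_le[OF c(2)], use h in eventually_elim)
  case (elim x) then show ?case using bnd(2)[of x] far[of x] by (auto simp: infnorm_0)
 qed
 moreover have R: "?R < \<infinity>" using fT f\<phi> by (auto simp: Lp_def enn_Lp_def)
 then have fi: "ennreal c * ?R < \<infinity>" for c by (simp add: ennreal_mult_less_top)
 ultimately have L: "F \<in> L1p p \<Omega>" "L1p_norm p \<Omega> F <= ennreal (4 * ?c2) * ?R"
  using L1p_of_weak_gradient[OF G, of "ennreal (4 * ?c2) * ?R"] by blast+
 have LF: "Lp_norm p \<Omega> F <= ennreal (4 * ?c1) * ?R" unfolding Lp_norm_def[of p \<Omega>]
 proof (rule norm_le[OF c(1)], rule AE_I2)
  fix x show "x \<in> \<Omega> \<longrightarrow> x \<in> S \<and> ennreal (infnorm (F x)) <= ennreal ?c1 * (ennreal \<bar>t f x\<bar> + ?\<phi> x) \<or> ennreal (infnorm (F x)) = 0"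
   using bnd(1)[of x] far[of x] by (auto simp: infnorm_0)
 qed
 have "F \<in> borel_measurable (lebesgue_on \<Omega>)" by (rule continuous_imp_measurable_on_sets_lebesgue[OF F \<Omega>m])
 then have "F \<in> W1p p \<Omega>" using L(1) le_less_trans[OF LF fi] by (simp add: W1p_def Lp_def)
 moreover have "W1p_norm p \<Omega> F <= ennreal (4 * ?c1) * ?R + ennreal (4 * ?c2) * ?R"
  using LF L(2) unfolding W1p_norm_def L1p_norm_def by (rule add_mono)
 then have "W1p_norm p \<Omega> F <= ennreal (4 * (?c1 + ?c2)) * ?R" using c by (simp add: distrib_right[symmetric] ennreal_plus[symmetric] del: ennreal_plus)
 ultimately show ?thesis using F tr by blast
qed

text \<open>The values \<open>f (T x)\<close> and \<open>F x\<close> differ by at most a multiple of \<open>bd x\<close> times the dominating function, and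
 \<open>bd x < \<epsilon>\<close>.\<close>
lemma inhomogeneous_necessity:
 assumes F: "F \<in> W1p p \<Omega>" "continuous_on \<Omega> F" "is_trace \<alpha> \<Omega> F f"
 shows "d_continuous \<alpha> \<Omega> f \<and> t f \<in> Lp p S \<and> sharp f \<in> enn_Lp p S"
  "Lp_norm p S (t f) + enn_Lp_norm p S (sharp f)
   <= ennreal (8 * approach_const * dominating_const + 4 * trace_value_const \<epsilon> \<theta> * (1 + dominating_const)) * W1p_norm p \<Omega> F"
proof -
 let ?\<phi> = "sharp f" and ?c = "trace_value_const \<epsilon> \<theta>" and ?D = dominating_const and ?A = approach_const
 let ?N = "Lp_norm p \<Omega> F" and ?L = "L1p_norm p \<Omega> F"
 have FL: "F \<in> L1p p \<Omega>" using F(1) by (simp add: W1p_def)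
 have c: "1 <= ?c" using consts_pos(3) cube_const_pos[OF \<theta>] \<epsilon> by (simp add: trace_value_const_def)
 have \<Omega>m: "\<Omega> \<in> sets lebesgue" using op by (simp only: borel_open sets_lborel sets_completionI_sets)
 note Sm = bdry_nbhd_props(3)[of \<epsilon>] and SO = bdry_nbhd_props(2)[of \<epsilon>]
 obtain V where V: "V \<in> borel_measurable borel" "d_continuous \<alpha> \<Omega> f" "enn_Lp_norm p \<Omega> V <= ennreal ?D * ?L"
  "\<And>x. x \<in> \<Omega> ==> ?\<phi> x <= ennreal (2 * ?A) * V x"
  "\<And>x r \<omega>. x \<in> \<Omega> ==> 0 < r ==> \<omega> \<in> bdry \<beta> ==> d_to \<beta> x \<omega> <= r powr \<beta> ==>
   ennreal \<bar>fv f \<omega> - F x\<bar> <= ennreal (?A * r) * V x"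
  by (rule necessity[OF FL F(2,3)]) blast
 have Vm: "V \<in> borel_measurable (lebesgue_on S)" using V(1) by (simp add: measurable_restrict_space1 measurable_completion)
 have Fm: "(\<lambda>x. ennreal \<bar>F x\<bar>) \<in> borel_measurable (lebesgue_on S)"
  using continuous_imp_measurable_on_sets_lebesgue[OF continuous_on_subset[OF F(2) SO] Sm] by measurable
 have VS: "enn_Lp_norm p S V <= ennreal ?D * ?L"
  by (rule order_trans[OF enn_Lp_norm_subset[OF exponents(2) SO Sm \<Omega>m] V(3)])
 have FS: "enn_Lp_norm p S (\<lambda>x. ennreal \<bar>F x\<bar>) <= ?N"
  using enn_Lp_norm_subset[OF exponents(2) SO Sm \<Omega>m, of "\<lambda>x. ennreal \<bar>F x\<bar>"] by (simp add: Lp_norm_def)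
 have tb: "ennreal \<bar>t f x\<bar> <= ennreal ?c * (ennreal \<bar>F x\<bar> + V x)" if x: "x \<in> S" for x
 proof -
  have xO: "x \<in> \<Omega>" and be: "bd x < \<epsilon>" using x by (auto simp: bdry_nbhd_def)
  have b: "0 < bd x" by (rule bd_pos[OF xO])
  obtain \<omega> where w: "\<omega> \<in> bdry \<beta>" "t f x = fv f \<omega>" "d_to \<beta> x \<omega> <= (cube_const \<theta> * bd x) powr \<beta>"
   using T_map_point[OF W a \<theta> xO] by (auto simp: fv_def)
  have "ennreal \<bar>t f x\<bar> <= ennreal (\<bar>F x\<bar> + \<bar>fv f \<omega> - F x\<bar>)" unfolding w(2) by (rule ennreal_leI) linarith
  also have "... = ennreal \<bar>F x\<bar> + ennreal \<bar>fv f \<omega> - F x\<bar>" by simp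
  also have "... <= ennreal ?c * ennreal \<bar>F x\<bar> + ennreal ?c * V x"
  proof (rule add_mono)
   show "ennreal \<bar>F x\<bar> <= ennreal ?c * ennreal \<bar>F x\<bar>"
    using c mult_right_mono[of 1 ?c "\<bar>F x\<bar>"] by (simp add: ennreal_mult[symmetric] ennreal_leI)
   have "ennreal \<bar>fv f \<omega> - F x\<bar> <= ennreal (?A * (cube_const \<theta> * bd x)) * V x"
    by (rule V(5)[OF xO _ w(1,3)]) (use cube_const_pos[OF \<theta>] b in simp)
   also have "... <= ennreal ?c * V x"
   proof (intro mult_right_mono ennreal_leI)
    have "?A * (cube_const \<theta> * bd x) <= ?A * (cube_const \<theta> * \<epsilon>)"
     using be consts_pos(3) cube_const_pos[OF \<theta>] by (intro mult_left_mono) auto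
    then show "?A * (cube_const \<theta> * bd x) <= ?c" by (simp add: trace_value_const_def)
   qed simp
   finally show "ennreal \<bar>fv f \<omega> - F x\<bar> <= ennreal ?c * V x" .
  qed
  finally show ?thesis by (simp add: distrib_left)
 qed
 have "Lp_norm p S (t f) <= ennreal (4 * ?c) * (enn_Lp_norm p S (\<lambda>x. ennreal \<bar>F x\<bar>) + enn_Lp_norm p S V)"
  unfolding Lp_norm_def
  by (rule enn_Lp_norm_add_le[OF exponents(2) _ Sm Sm order_refl Fm Vm]) (use c tb in auto)
 also have "... <= ennreal (4 * ?c) * (?N + ennreal ?D * ?L)" using FS VS by (intro mult_left_mono add_mono) auto
 also have "... <= ennreal (4 * ?c) * (ennreal (1 + ?D) * (?N + ?L))"
 proof (rule mult_left_mono)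
  have "?N + ennreal ?D * ?L <= ennreal (1 + ?D) * ?N + ennreal (1 + ?D) * ?L"
   using mult_right_mono[of 1 "ennreal (1 + ?D)" ?N] dominating_const_pos
   by (intro add_mono mult_right_mono ennreal_leI) auto
  then show "?N + ennreal ?D * ?L <= ennreal (1 + ?D) * (?N + ?L)" by (simp add: distrib_left)
 qed simp
 also have "... = ennreal (4 * ?c * (1 + ?D)) * (?N + ?L)" using c dominating_const_pos by (simp add: ennreal_mult mult.assoc)
 finally have 1: "Lp_norm p S (t f) <= ennreal (4 * ?c * (1 + ?D)) * (?N + ?L)" .
 have "enn_Lp_norm p S ?\<phi> <= enn_Lp_norm p \<Omega> ?\<phi>" by (rule enn_Lp_norm_subset[OF exponents(2) SO Sm \<Omega>m])
 also have "... <= ennreal (8 * ?A * ?D) * ?L" by (rule homogeneous_necessity(2)[OF FL F(2,3)])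
 also have "... <= ennreal (8 * ?A * ?D) * (?N + ?L)" by (intro mult_left_mono) auto
 finally have 2: "enn_Lp_norm p S ?\<phi> <= ennreal (8 * ?A * ?D) * (?N + ?L)" .
 have W: "W1p_norm p \<Omega> F = ?N + ?L" by (simp add: W1p_norm_def L1p_norm_def)
 have Wf: "?N + ?L < \<infinity>" using F(1) by (simp add: W1p_def L1p_def Lp_def L1p_norm_def)
 have fi: "Lp_norm p S (t f) < \<infinity>" "enn_Lp_norm p S ?\<phi> < \<infinity>"
  using le_less_trans[OF 1] le_less_trans[OF 2] Wf by (simp_all add: ennreal_mult_less_top)
 then show "d_continuous \<alpha> \<Omega> f \<and> t f \<in> Lp p S \<and> ?\<phi> \<in> enn_Lp p S"
  using V(2) t_measurable[of f] fsharp_measurable[OF fs SO Sm] by (simp add: Lp_def enn_Lp_def)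
 have "Lp_norm p S (t f) + enn_Lp_norm p S ?\<phi> <= ennreal (4 * ?c * (1 + ?D)) * (?N + ?L) + ennreal (8 * ?A * ?D) * (?N + ?L)"
  by (rule add_mono[OF 1 2])
 also have "... = ennreal (8 * ?A * ?D + 4 * ?c * (1 + ?D)) * (?N + ?L)"
  using c dominating_const_pos consts_pos(3) by (subst ennreal_plus) (auto simp: distrib_right add.commute)
 finally show "Lp_norm p S (t f) + enn_Lp_norm p S ?\<phi> <= ennreal (8 * ?A * ?D + 4 * ?c * (1 + ?D)) * W1p_norm p \<Omega> F"
  by (simp only: W)
qed

end

definition homogeneous_const :: real where
 "homogeneous_const = max extension_const (8 * approach_const * dominating_const)"

theorem homogeneous_trace:
 "(f \<in> trace_space \<alpha> \<Omega> (L1p p \<Omega>) \<longleftrightarrow> d_continuous \<alpha> \<Omega> f \<and> sharp f \<in> enn_Lp p \<Omega>) \<and>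
  (f \<in> trace_space \<alpha> \<Omega> (L1p p \<Omega>) \<longrightarrow>
   comparable (max 1 homogeneous_const) (trace_norm \<alpha> \<Omega> (L1p p \<Omega>) (L1p_norm p \<Omega>) f) (enn_Lp_norm p \<Omega> (sharp f)))"
 unfolding homogeneous_const_def
 by (rule trace_characterisation) (use homogeneous_necessity homogeneous_sufficiency in blast)+

definition inhomogeneous_const :: "real => real => real" where
 "inhomogeneous_const \<epsilon> \<theta> = max (4 * (extension_value_const \<epsilon> \<theta> + extension_gradient_const \<epsilon> \<theta>))
   (8 * approach_const * dominating_const + 4 * trace_value_const \<epsilon> \<theta> * (1 + dominating_const))"

theorem inhomogeneous_trace:
 assumes \<epsilon>: "0 < \<epsilon>" and \<theta>: "1 < \<theta>" and W: "whitney_covering \<theta> \<Omega> \<Q>" and a: "nearest_choice \<Omega> a"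
 shows "(f \<in> trace_space \<alpha> \<Omega> (W1p p \<Omega>) \<longleftrightarrow> d_continuous \<alpha> \<Omega> f \<and>
    (\<lambda>x. f (T_map \<alpha> \<Omega> a \<Q> x)) \<in> Lp p (bdry_nbhd \<epsilon> \<Omega>) \<and> sharp f \<in> enn_Lp p (bdry_nbhd \<epsilon> \<Omega>)) \<and>
  (f \<in> trace_space \<alpha> \<Omega> (W1p p \<Omega>) \<longrightarrow>
   comparable (max 1 (inhomogeneous_const \<epsilon> \<theta>)) (trace_norm \<alpha> \<Omega> (W1p p \<Omega>) (W1p_norm p \<Omega>) f)
    (Lp_norm p (bdry_nbhd \<epsilon> \<Omega>) (\<lambda>x. f (T_map \<alpha> \<Omega> a \<Q> x)) + enn_Lp_norm p (bdry_nbhd \<epsilon> \<Omega>) (sharp f)))"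
 unfolding inhomogeneous_const_def
 by (rule trace_characterisation)
  (use inhomogeneous_necessity[OF assms] inhomogeneous_sufficiency[OF assms] in blast)+

end

theorem theorem6p1:
  fixes p q \<alpha> \<beta> :: real
  assumes "real CARD('n::finite) < q" and "q < p"
    and "\<beta> = (q - real CARD('n)) / (q - 1)"
    and "\<alpha> = (p - real CARD('n)) / (p - 1)"
  shows
    "(\<exists>C\<ge>1. \<forall>(\<Omega> :: (real^'n) set) f.
        open \<Omega> \<and> connected \<Omega> \<and> \<Omega> \<noteq> {} \<and> \<Omega> \<noteq> UNIV \<longrightarrow>
        (f \<in> trace_space \<alpha> \<Omega> (L1p p \<Omega>) \<longleftrightarrow>
           d_continuous \<alpha> \<Omega> f \<and> fsharp \<alpha> \<beta> \<Omega> f \<in> enn_Lp p \<Omega>) \<and>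
        (f \<in> trace_space \<alpha> \<Omega> (L1p p \<Omega>) \<longrightarrow>
           comparable C (trace_norm \<alpha> \<Omega> (L1p p \<Omega>) (L1p_norm p \<Omega>) f)
                        (enn_Lp_norm p \<Omega> (fsharp \<alpha> \<beta> \<Omega> f))))
     \<and>
     (\<forall>\<epsilon>>0. \<forall>\<theta>>1. \<exists>C\<ge>1. \<forall>(\<Omega> :: (real^'n) set) \<Q> a f.
        open \<Omega> \<and> connected \<Omega> \<and> \<Omega> \<noteq> {} \<and> \<Omega> \<noteq> UNIV \<and>
        whitney_covering \<theta> \<Omega> \<Q> \<and> nearest_choice \<Omega> a \<longrightarrow>
        (f \<in> trace_space \<alpha> \<Omega> (W1p p \<Omega>) \<longleftrightarrow>
           d_continuous \<alpha> \<Omega> f \<and>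
           (\<lambda>x. f (T_map \<alpha> \<Omega> a \<Q> x)) \<in> Lp p (bdry_nbhd \<epsilon> \<Omega>) \<and>
           fsharp \<alpha> \<beta> \<Omega> f \<in> enn_Lp p (bdry_nbhd \<epsilon> \<Omega>)) \<and>
        (f \<in> trace_space \<alpha> \<Omega> (W1p p \<Omega>) \<longrightarrow>
           comparable C (trace_norm \<alpha> \<Omega> (W1p p \<Omega>) (W1p_norm p \<Omega>) f)
                        (Lp_norm p (bdry_nbhd \<epsilon> \<Omega>) (\<lambda>x. f (T_map \<alpha> \<Omega> a \<Q> x)) +
                         enn_Lp_norm p (bdry_nbhd \<epsilon> \<Omega>) (fsharp \<alpha> \<beta> \<Omega> f))))"
proof -
  have setting: "trace_setting \<Omega> p q \<alpha> \<beta>" if "open \<Omega> \<and> connected \<Omega> \<and> \<Omega> \<noteq> {} \<and> \<Omega> \<noteq> UNIV" for \<Omega> :: "(real^'n) set"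
    using that assms by unfold_locales auto
  \<comment> \<open>The constants of the locale do not mention \<open>\<Omega>\<close>, so they may be chosen before it.\<close>
  show ?thesis
    apply (intro conjI allI impI)
    subgoal
      by (rule exI[of _ "max 1 (trace_setting.homogeneous_const TYPE('n) p q \<beta>)"], rule conjI[OF max.cobounded1],
          intro allI impI, rule trace_setting.homogeneous_trace, erule setting)
    subgoal for \<epsilon> \<theta>
      by (rule exI[of _ "max 1 (trace_setting.inhomogeneous_const TYPE('n) p q \<beta> \<epsilon> \<theta>)"], rule conjI[OF max.cobounded1],
          intro allI impI, rule trace_setting.inhomogeneous_trace[OF setting]) blast+
    done
qed

end
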